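(* The system $\mathsf{RCA}_0^\omega+\mathsf{QF\text{-}AC}^{0,1}$ proves $\mathsf{WKL}\leftrightarrow\mathsf{HBC}_s$, where $\mathsf{HBC}_s$ is the statement: for every closed $C\subseteq[0,1]$ and every sequence $(O_n)_{n\in\mathbb{N}}$ of open sets with $C\subseteq\bigcup_{n\in\mathbb{N}}O_n$, there is $n_0\in\mathbb{N}$ with $C\subseteq\bigcup_{n\le n_0}O_n$.
   Context: Framework: Kohlenbach's higher-order arithmetic. $\mathsf{RCA}_0^\omega$ is the base theory in the language with variables of all finite types over $\mathbb{N}$, consisting of basic arithmetic axioms, combinators for $\lambda$-abstraction, the primitive recursor $\mathbf{R}_0$, extensionality at all types, quantifier-free induction, and $\mathsf{QF\text{-}AC}^{1,0}$. For types $\sigma,\tau$, $\mathsf{QF\text{-}AC}^{\sigma,\tau}$ is the schema $(\forall x^\sigma)(\exists y^\tau)A(x,y)\to(\exists Y^{\sigma\to\tau})(\forall x^\sigma)A(x,Y(x))$ for quantifier-free $A$. $\mathsf{WKL}$ is weak König's lemma. Reals are represented by fast-converging Cauchy sequences of rationals. A set of reals is given by a function $Y:\mathbb{R}\to\mathbb{R}$, where $x\in Y$ means $Y(x)>0$; $Y$ is open if for every $x\in Y$ there is a rational $r>0$ with $B(x,r)\subseteq Y$; $Y$ is closed if its complement is open. A sequence of sets is an object mapping each $n\in\mathbb{N}$ to such a function $O_n$.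
   Formalization: A closed set C is taken to be the complement of an open set given by a function D (x in C means not D(x)>0), rather than itself given by Y with x in C meaning Y(x)>0; with the literal representation of C the equivalence fails in a model of the base system. *)

theory Defs
  imports Main
begin

section \<open>Finite types, terms and formulas\<close>

datatype ty = Num | Fn ty ty (infixr "\<^bold>\<rightarrow>" 70)

abbreviation ty1 :: ty where "ty1 \<equiv> Num \<^bold>\<rightarrow> Num"

datatype const =
    CZero | CSucc | CPlus | CTimes
  | CRec
  | CK ty ty
  | CS ty ty ty

primrec const_ty :: "const \<Rightarrow> ty" where
  "const_ty CZero = Num"
| "const_ty CSucc = Num \<^bold>\<rightarrow> Num"
| "const_ty CPlus = Num \<^bold>\<rightarrow> Num \<^bold>\<rightarrow> Num"
| "const_ty CTimes = Num \<^bold>\<rightarrow> Num \<^bold>\<rightarrow> Num"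
| "const_ty CRec = (Num \<^bold>\<rightarrow> Num \<^bold>\<rightarrow> Num) \<^bold>\<rightarrow> Num \<^bold>\<rightarrow> Num \<^bold>\<rightarrow> Num"
| "const_ty (CK \<sigma> \<tau>) = \<sigma> \<^bold>\<rightarrow> \<tau> \<^bold>\<rightarrow> \<sigma>"
| "const_ty (CS \<rho> \<sigma> \<tau>) = (\<rho> \<^bold>\<rightarrow> \<sigma> \<^bold>\<rightarrow> \<tau>) \<^bold>\<rightarrow> (\<rho> \<^bold>\<rightarrow> \<sigma>) \<^bold>\<rightarrow> \<rho> \<^bold>\<rightarrow> \<tau>"

text \<open>
  Locally nameless syntax: a free variable is a name together with its type (the same name at
  two types gives two different variables), a bound variable is a de Bruijn index. Terms have no
  binder; only \<open>All\<close> binds. The only atomic formulas are equality and order at type \<open>Num\<close>.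
\<close>

datatype trm = Var nat ty | Bnd nat | Cst const | App trm trm (infixl "\<^bold>\<cdot>" 90)

datatype fm = Eq trm trm | Less trm trm | Fls | Imp fm fm | All ty fm

fun typ_of :: "ty list \<Rightarrow> trm \<Rightarrow> ty option" where
  "typ_of \<Gamma> (Var x \<tau>) = Some \<tau>"
| "typ_of \<Gamma> (Bnd k) = (if k < length \<Gamma> then Some (\<Gamma> ! k) else None)"
| "typ_of \<Gamma> (Cst c) = Some (const_ty c)"
| "typ_of \<Gamma> (s \<^bold>\<cdot> t) =
     (case typ_of \<Gamma> s of
        Some (\<sigma> \<^bold>\<rightarrow> \<tau>) \<Rightarrow> (if typ_of \<Gamma> t = Some \<sigma> then Some \<tau> else None)
      | _ \<Rightarrow> None)"

primrec wff :: "ty list \<Rightarrow> fm \<Rightarrow> bool" where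
  "wff \<Gamma> (Eq s t) \<longleftrightarrow> typ_of \<Gamma> s = Some Num \<and> typ_of \<Gamma> t = Some Num"
| "wff \<Gamma> (Less s t) \<longleftrightarrow> typ_of \<Gamma> s = Some Num \<and> typ_of \<Gamma> t = Some Num"
| "wff \<Gamma> Fls \<longleftrightarrow> True"
| "wff \<Gamma> (Imp A B) \<longleftrightarrow> wff \<Gamma> A \<and> wff \<Gamma> B"
| "wff \<Gamma> (All \<tau> A) \<longleftrightarrow> wff (\<tau> # \<Gamma>) A"

primrec qf :: "fm \<Rightarrow> bool" where
  "qf (Eq s t) \<longleftrightarrow> True"
| "qf (Less s t) \<longleftrightarrow> True"
| "qf Fls \<longleftrightarrow> True"
| "qf (Imp A B) \<longleftrightarrow> qf A \<and> qf B"
| "qf (All \<tau> A) \<longleftrightarrow> False"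

primrec frees_t :: "trm \<Rightarrow> (nat \<times> ty) set" where
  "frees_t (Var x \<tau>) = {(x, \<tau>)}"
| "frees_t (Bnd k) = {}"
| "frees_t (Cst c) = {}"
| "frees_t (s \<^bold>\<cdot> t) = frees_t s \<union> frees_t t"

primrec frees :: "fm \<Rightarrow> (nat \<times> ty) set" where
  "frees (Eq s t) = frees_t s \<union> frees_t t"
| "frees (Less s t) = frees_t s \<union> frees_t t"
| "frees Fls = {}"
| "frees (Imp A B) = frees A \<union> frees B"
| "frees (All \<tau> A) = frees A"

text \<open>\<open>inst k u A\<close> puts the term \<open>u\<close>, which must not contain bound indices, for the bound
  variable \<open>k\<close>; \<open>close k x \<tau> A\<close> turns the free variable \<open>(x, \<tau>)\<close> into the bound variable \<open>k\<close>.\<close>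

primrec inst_t :: "nat \<Rightarrow> trm \<Rightarrow> trm \<Rightarrow> trm" where
  "inst_t k u (Var x \<tau>) = Var x \<tau>"
| "inst_t k u (Bnd j) = (if j = k then u else Bnd j)"
| "inst_t k u (Cst c) = Cst c"
| "inst_t k u (s \<^bold>\<cdot> t) = inst_t k u s \<^bold>\<cdot> inst_t k u t"

primrec inst :: "nat \<Rightarrow> trm \<Rightarrow> fm \<Rightarrow> fm" where
  "inst k u (Eq s t) = Eq (inst_t k u s) (inst_t k u t)"
| "inst k u (Less s t) = Less (inst_t k u s) (inst_t k u t)"
| "inst k u Fls = Fls"
| "inst k u (Imp A B) = Imp (inst k u A) (inst k u B)"
| "inst k u (All \<tau> A) = All \<tau> (inst (Suc k) u A)"

primrec close_t :: "nat \<Rightarrow> nat \<Rightarrow> ty \<Rightarrow> trm \<Rightarrow> trm" where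
  "close_t k x \<tau> (Var y \<sigma>) = (if (y, \<sigma>) = (x, \<tau>) then Bnd k else Var y \<sigma>)"
| "close_t k x \<tau> (Bnd j) = Bnd j"
| "close_t k x \<tau> (Cst c) = Cst c"
| "close_t k x \<tau> (s \<^bold>\<cdot> t) = close_t k x \<tau> s \<^bold>\<cdot> close_t k x \<tau> t"

primrec close :: "nat \<Rightarrow> nat \<Rightarrow> ty \<Rightarrow> fm \<Rightarrow> fm" where
  "close k x \<tau> (Eq s t) = Eq (close_t k x \<tau> s) (close_t k x \<tau> t)"
| "close k x \<tau> (Less s t) = Less (close_t k x \<tau> s) (close_t k x \<tau> t)"
| "close k x \<tau> Fls = Fls"
| "close k x \<tau> (Imp A B) = Imp (close k x \<tau> A) (close k x \<tau> B)"
| "close k x \<tau> (All \<sigma> A) = All \<sigma> (close (Suc k) x \<tau> A)"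

definition subst :: "nat \<Rightarrow> ty \<Rightarrow> trm \<Rightarrow> fm \<Rightarrow> fm" where
  "subst x \<tau> u A = inst 0 u (close 0 x \<tau> A)"

definition Neg :: "fm \<Rightarrow> fm" ("\<^bold>\<not> _" [40] 40) where
  "(\<^bold>\<not> A) = Imp A Fls"

notation Imp (infixr "\<^bold>\<longrightarrow>" 25)
notation Eq (infix "\<^bold>=" 50)
notation Less (infix "\<^bold><" 50)

definition Disj :: "fm \<Rightarrow> fm \<Rightarrow> fm" (infixr "\<^bold>\<or>" 30) where
  "(A \<^bold>\<or> B) = (\<^bold>\<not> A \<^bold>\<longrightarrow> B)"

definition Conj :: "fm \<Rightarrow> fm \<Rightarrow> fm" (infixr "\<^bold>\<and>" 35) where
  "(A \<^bold>\<and> B) = (\<^bold>\<not> (A \<^bold>\<longrightarrow> \<^bold>\<not> B))"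

definition Iff :: "fm \<Rightarrow> fm \<Rightarrow> fm" (infixr "\<^bold>\<longleftrightarrow>" 25) where
  "(A \<^bold>\<longleftrightarrow> B) = ((A \<^bold>\<longrightarrow> B) \<^bold>\<and> (B \<^bold>\<longrightarrow> A))"

definition AllV :: "nat \<Rightarrow> ty \<Rightarrow> fm \<Rightarrow> fm" where
  "AllV x \<tau> A = All \<tau> (close 0 x \<tau> A)"

definition ExV :: "nat \<Rightarrow> ty \<Rightarrow> fm \<Rightarrow> fm" where
  "ExV x \<tau> A = (\<^bold>\<not> AllV x \<tau> (\<^bold>\<not> A))"


section \<open>Classical many-sorted logic with equality at type 0\<close>

inductive derives :: "fm set \<Rightarrow> fm list \<Rightarrow> fm \<Rightarrow> bool" for T where
  Ax: "A \<in> T \<Longrightarrow> wff [] A \<Longrightarrow> derives T H A"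
| Assm: "A \<in> set H \<Longrightarrow> wff [] A \<Longrightarrow> derives T H A"
| ImpI: "wff [] A \<Longrightarrow> derives T (A # H) B \<Longrightarrow> derives T H (A \<^bold>\<longrightarrow> B)"
| ImpE: "derives T H (A \<^bold>\<longrightarrow> B) \<Longrightarrow> derives T H A \<Longrightarrow> derives T H B"
| Contr: "wff [] A \<Longrightarrow> derives T ((\<^bold>\<not> A) # H) Fls \<Longrightarrow> derives T H A"
| AllI: "derives T H (inst 0 (Var x \<tau>) A) \<Longrightarrow> (x, \<tau>) \<notin> frees A \<union> \<Union> (frees ` set H)
           \<Longrightarrow> derives T H (All \<tau> A)"
| AllE: "derives T H (All \<tau> A) \<Longrightarrow> typ_of [] t = Some \<tau> \<Longrightarrow> derives T H (inst 0 t A)"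
| EqRefl: "typ_of [] t = Some Num \<Longrightarrow> derives T H (t \<^bold>= t)"
| EqSubst: "wff [Num] A \<Longrightarrow> derives T H (s \<^bold>= t) \<Longrightarrow> derives T H (inst 0 s A)
           \<Longrightarrow> derives T H (inst 0 t A)"

text \<open>Axioms may have free variables, which are read universally.\<close>

definition proves :: "fm set \<Rightarrow> fm \<Rightarrow> bool" (infix "\<^bold>\<turnstile>" 20) where
  "(T \<^bold>\<turnstile> A) \<longleftrightarrow> derives T [] A"


section \<open>Writing object-level binders with meta-level ones\<close>

text \<open>
  \<open>Forall \<tau> F\<close> is the formula ``for all \<open>x\<close> of type \<open>\<tau>\<close>, \<open>F x\<close>''. The object variable used is named
  by a number above all the names occurring in the body, so nothing is captured.
\<close>

primrec bound_t :: "trm \<Rightarrow> nat" where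
  "bound_t (Var x \<tau>) = Suc x"
| "bound_t (Bnd k) = 0"
| "bound_t (Cst c) = 0"
| "bound_t (s \<^bold>\<cdot> t) = max (bound_t s) (bound_t t)"

primrec bound :: "fm \<Rightarrow> nat" where
  "bound (Eq s t) = max (bound_t s) (bound_t t)"
| "bound (Less s t) = max (bound_t s) (bound_t t)"
| "bound Fls = 0"
| "bound (Imp A B) = max (bound A) (bound B)"
| "bound (All \<tau> A) = bound A"

definition Forall :: "ty \<Rightarrow> (trm \<Rightarrow> fm) \<Rightarrow> fm" where
  "Forall \<tau> F = (let x = bound (F (Var 0 \<tau>)) in AllV x \<tau> (F (Var x \<tau>)))"

definition Exists :: "ty \<Rightarrow> (trm \<Rightarrow> fm) \<Rightarrow> fm" where
  "Exists \<tau> F = (\<^bold>\<not> Forall \<tau> (\<lambda>x. \<^bold>\<not> F x))"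

definition All0 :: "(trm \<Rightarrow> fm) \<Rightarrow> fm" (binder "\<^bold>\<forall>\<^sup>0" 10) where "All0 F = Forall Num F"
definition Ex0 :: "(trm \<Rightarrow> fm) \<Rightarrow> fm" (binder "\<^bold>\<exists>\<^sup>0" 10) where "Ex0 F = Exists Num F"
definition All1 :: "(trm \<Rightarrow> fm) \<Rightarrow> fm" (binder "\<^bold>\<forall>\<^sup>1" 10) where "All1 F = Forall ty1 F"
definition Ex1 :: "(trm \<Rightarrow> fm) \<Rightarrow> fm" (binder "\<^bold>\<exists>\<^sup>1" 10) where "Ex1 F = Exists ty1 F"

text \<open>Bracket abstraction: \<open>lamV x \<sigma> t\<close> is a combinator term denoting \<open>\<lambda>x. t\<close>. It is meant for
  well-typed \<open>t\<close> without bound indices; on other terms its value is irrelevant.\<close>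

fun lamV :: "nat \<Rightarrow> ty \<Rightarrow> trm \<Rightarrow> trm" where
  "lamV x \<sigma> t =
     (if (x, \<sigma>) \<notin> frees_t t
      then (case typ_of [] t of Some \<tau> \<Rightarrow> Cst (CK \<tau> \<sigma>) \<^bold>\<cdot> t | None \<Rightarrow> t)
      else (case t of
          r \<^bold>\<cdot> s \<Rightarrow>
            (case typ_of [] r of
               Some (\<rho> \<^bold>\<rightarrow> \<tau>) \<Rightarrow> Cst (CS \<sigma> \<rho> \<tau>) \<^bold>\<cdot> lamV x \<sigma> r \<^bold>\<cdot> lamV x \<sigma> s
             | _ \<Rightarrow> t)
        | _ \<Rightarrow> Cst (CS \<sigma> (\<sigma> \<^bold>\<rightarrow> \<sigma>) \<sigma>) \<^bold>\<cdot> Cst (CK \<sigma> (\<sigma> \<^bold>\<rightarrow> \<sigma>)) \<^bold>\<cdot> Cst (CK \<sigma> \<sigma>)))"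

declare lamV.simps [simp del]

definition Lam0 :: "(trm \<Rightarrow> trm) \<Rightarrow> trm" (binder "\<^bold>\<lambda>" 10) where
  "Lam0 F = (let x = bound_t (F (Var 0 Num)) in lamV x Num (F (Var x Num)))"


section \<open>The systems\<close>

abbreviation zero :: trm ("\<^bold>0") where "\<^bold>0 \<equiv> Cst CZero"
abbreviation suc :: "trm \<Rightarrow> trm" where "suc t \<equiv> Cst CSucc \<^bold>\<cdot> t"
abbreviation plus :: "trm \<Rightarrow> trm \<Rightarrow> trm" (infixl "\<^bold>+" 65) where
  "s \<^bold>+ t \<equiv> Cst CPlus \<^bold>\<cdot> s \<^bold>\<cdot> t"
abbreviation times :: "trm \<Rightarrow> trm \<Rightarrow> trm" (infixl "\<^bold>*" 70) where
  "s \<^bold>* t \<equiv> Cst CTimes \<^bold>\<cdot> s \<^bold>\<cdot> t"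
abbreviation rec :: "trm \<Rightarrow> trm \<Rightarrow> trm \<Rightarrow> trm" where
  "rec f m n \<equiv> Cst CRec \<^bold>\<cdot> f \<^bold>\<cdot> m \<^bold>\<cdot> n"

text \<open>Equality at higher types is defined pointwise.\<close>

primrec eq_ty :: "ty \<Rightarrow> trm \<Rightarrow> trm \<Rightarrow> fm" where
  "eq_ty Num = Eq"
| "eq_ty (\<sigma> \<^bold>\<rightarrow> \<tau>) = (\<lambda>s t. Forall \<sigma> (\<lambda>x. eq_ty \<tau> (s \<^bold>\<cdot> x) (t \<^bold>\<cdot> x)))"

definition arith_axioms :: "fm set" where
  "arith_axioms =
    {\<^bold>\<forall>\<^sup>0n. \<^bold>\<not> (suc n \<^bold>= \<^bold>0),
     \<^bold>\<forall>\<^sup>0m. \<^bold>\<forall>\<^sup>0n. suc m \<^bold>= suc n \<^bold>\<longrightarrow> m \<^bold>= n,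
     \<^bold>\<forall>\<^sup>0m. m \<^bold>+ \<^bold>0 \<^bold>= m,
     \<^bold>\<forall>\<^sup>0m. \<^bold>\<forall>\<^sup>0n. m \<^bold>+ suc n \<^bold>= suc (m \<^bold>+ n),
     \<^bold>\<forall>\<^sup>0m. m \<^bold>* \<^bold>0 \<^bold>= \<^bold>0,
     \<^bold>\<forall>\<^sup>0m. \<^bold>\<forall>\<^sup>0n. m \<^bold>* suc n \<^bold>= m \<^bold>* n \<^bold>+ m,
     \<^bold>\<forall>\<^sup>0m. \<^bold>\<not> (m \<^bold>< \<^bold>0),
     \<^bold>\<forall>\<^sup>0m. \<^bold>\<forall>\<^sup>0n. m \<^bold>< suc n \<^bold>\<longleftrightarrow> (m \<^bold>< n \<^bold>\<or> m \<^bold>= n)}"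

definition combinator_axioms :: "fm set" where
  "combinator_axioms =
     {Forall \<sigma> (\<lambda>x. Forall \<tau> (\<lambda>y. eq_ty \<sigma> (Cst (CK \<sigma> \<tau>) \<^bold>\<cdot> x \<^bold>\<cdot> y) x)) | \<sigma> \<tau>. True} \<union>
     {Forall (\<rho> \<^bold>\<rightarrow> \<sigma> \<^bold>\<rightarrow> \<tau>) (\<lambda>x. Forall (\<rho> \<^bold>\<rightarrow> \<sigma>) (\<lambda>y. Forall \<rho> (\<lambda>z.
        eq_ty \<tau> (Cst (CS \<rho> \<sigma> \<tau>) \<^bold>\<cdot> x \<^bold>\<cdot> y \<^bold>\<cdot> z) (x \<^bold>\<cdot> z \<^bold>\<cdot> (y \<^bold>\<cdot> z))))) | \<rho> \<sigma> \<tau>. True}"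

definition recursor_axioms :: "fm set" where
  "recursor_axioms =
    {Forall (Num \<^bold>\<rightarrow> Num \<^bold>\<rightarrow> Num) (\<lambda>f. \<^bold>\<forall>\<^sup>0m. rec f m \<^bold>0 \<^bold>= m),
     Forall (Num \<^bold>\<rightarrow> Num \<^bold>\<rightarrow> Num) (\<lambda>f. \<^bold>\<forall>\<^sup>0m. \<^bold>\<forall>\<^sup>0n. rec f m (suc n) \<^bold>= f \<^bold>\<cdot> n \<^bold>\<cdot> rec f m n)}"

definition extensionality_axioms :: "fm set" where
  "extensionality_axioms =
     {Forall \<sigma> (\<lambda>x. Forall \<sigma> (\<lambda>y. Forall (\<sigma> \<^bold>\<rightarrow> \<tau>) (\<lambda>f.
        eq_ty \<sigma> x y \<^bold>\<longrightarrow> eq_ty \<tau> (f \<^bold>\<cdot> x) (f \<^bold>\<cdot> y)))) | \<sigma> \<tau>. True}"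

definition QF_IA :: "fm set" where
  "QF_IA =
     {subst x Num \<^bold>0 A \<^bold>\<longrightarrow> AllV x Num (A \<^bold>\<longrightarrow> subst x Num (suc (Var x Num)) A) \<^bold>\<longrightarrow> AllV x Num A
      | A x. wff [] A \<and> qf A}"

definition QF_AC :: "ty \<Rightarrow> ty \<Rightarrow> fm set" where
  "QF_AC \<sigma> \<tau> =
     {AllV x \<sigma> (ExV y \<tau> A)
        \<^bold>\<longrightarrow> ExV Y (\<sigma> \<^bold>\<rightarrow> \<tau>) (AllV x \<sigma> (subst y \<tau> (Var Y (\<sigma> \<^bold>\<rightarrow> \<tau>) \<^bold>\<cdot> Var x \<sigma>) A))
      | A x y Y. wff [] A \<and> qf A \<and> (x, \<sigma>) \<noteq> (y, \<tau>) \<and> (Y, \<sigma> \<^bold>\<rightarrow> \<tau>) \<notin> frees A}"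

definition RCA0_omega :: "fm set" where
  "RCA0_omega = arith_axioms \<union> combinator_axioms \<union> recursor_axioms \<union> extensionality_axioms
     \<union> QF_IA \<union> QF_AC ty1 Num"


section \<open>Primitive recursive functions as closed terms\<close>

abbreviation one :: trm ("\<^bold>1") where "\<^bold>1 \<equiv> suc \<^bold>0"

definition pred_trm :: trm where
  "pred_trm = (\<^bold>\<lambda>m. rec (\<^bold>\<lambda>n. \<^bold>\<lambda>r. n) \<^bold>0 m)"

definition monus_trm :: trm where
  "monus_trm = (\<^bold>\<lambda>m. \<^bold>\<lambda>n. rec (\<^bold>\<lambda>k. pred_trm) m n)"

abbreviation monus :: "trm \<Rightarrow> trm \<Rightarrow> trm" (infixl "\<^bold>-" 65) where
  "s \<^bold>- t \<equiv> monus_trm \<^bold>\<cdot> s \<^bold>\<cdot> t"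

definition sg_trm :: trm where
  "sg_trm = (\<^bold>\<lambda>n. \<^bold>1 \<^bold>- (\<^bold>1 \<^bold>- n))"

definition pow2_trm :: trm where
  "pow2_trm = (\<^bold>\<lambda>n. rec (\<^bold>\<lambda>k. \<^bold>\<lambda>r. r \<^bold>+ r) \<^bold>1 n)"

text \<open>\<open>half (n + 1) = n - half n\<close>\<close>

definition half_trm :: trm where
  "half_trm = (\<^bold>\<lambda>m. rec (\<^bold>\<lambda>n. \<^bold>\<lambda>r. n \<^bold>- r) \<^bold>0 m)"

text \<open>
  Cantor's pairing \<open>(m, n) \<mapsto> tri (m + n) + m\<close> with \<open>tri k = 0 + 1 + \<dots> + k\<close>.
  \<open>troot z\<close> is the largest \<open>k\<close> with \<open>tri k \<le> z\<close>; it increases by one from \<open>n\<close> to \<open>n + 1\<close> exactly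
  when \<open>tri (troot n + 1) \<le> n + 1\<close>.
\<close>

definition tri_trm :: trm where
  "tri_trm = (\<^bold>\<lambda>n. rec (\<^bold>\<lambda>k. \<^bold>\<lambda>r. r \<^bold>+ suc k) \<^bold>0 n)"

definition troot_trm :: trm where
  "troot_trm =
     (\<^bold>\<lambda>z. rec (\<^bold>\<lambda>n. \<^bold>\<lambda>r. r \<^bold>+ (\<^bold>1 \<^bold>- (tri_trm \<^bold>\<cdot> suc r \<^bold>- suc n))) \<^bold>0 z)"

definition pair_trm :: trm where
  "pair_trm = (\<^bold>\<lambda>m. \<^bold>\<lambda>n. tri_trm \<^bold>\<cdot> (m \<^bold>+ n) \<^bold>+ m)"

definition fst_trm :: trm where
  "fst_trm = (\<^bold>\<lambda>z. z \<^bold>- tri_trm \<^bold>\<cdot> (troot_trm \<^bold>\<cdot> z))"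

definition snd_trm :: trm where
  "snd_trm = (\<^bold>\<lambda>z. troot_trm \<^bold>\<cdot> z \<^bold>- fst_trm \<^bold>\<cdot> z)"


section \<open>Rational numbers\<close>

text \<open>
  A rational is a signed quotient of natural numbers: \<open>pair s (pair a d)\<close> codes \<open>a / (d + 1)\<close> if
  \<open>s = 0\<close> and \<open>- a / (d + 1)\<close> otherwise. Every number codes a rational; equality of rationals is not
  equality of codes. \<open>qpos\<close> and \<open>qneg\<close> give the positive and negative part of the numerator, \<open>qden\<close>
  the denominator, and \<open>qdiff a b d\<close> is the rational \<open>(a - b) / (d + 1)\<close>.
\<close>

definition qpos_trm :: trm where
  "qpos_trm = (\<^bold>\<lambda>q. (\<^bold>1 \<^bold>- fst_trm \<^bold>\<cdot> q) \<^bold>* (fst_trm \<^bold>\<cdot> (snd_trm \<^bold>\<cdot> q)))"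

definition qneg_trm :: trm where
  "qneg_trm = (\<^bold>\<lambda>q. (sg_trm \<^bold>\<cdot> (fst_trm \<^bold>\<cdot> q)) \<^bold>* (fst_trm \<^bold>\<cdot> (snd_trm \<^bold>\<cdot> q)))"

definition qden_trm :: trm where
  "qden_trm = (\<^bold>\<lambda>q. suc (snd_trm \<^bold>\<cdot> (snd_trm \<^bold>\<cdot> q)))"

definition qdiff_trm :: trm where
  "qdiff_trm = (\<^bold>\<lambda>a. \<^bold>\<lambda>b. \<^bold>\<lambda>d.
     pair_trm \<^bold>\<cdot> (sg_trm \<^bold>\<cdot> (b \<^bold>- a)) \<^bold>\<cdot> (pair_trm \<^bold>\<cdot> ((a \<^bold>- b) \<^bold>+ (b \<^bold>- a)) \<^bold>\<cdot> d))"

definition qminus_trm :: trm where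
  "qminus_trm = (\<^bold>\<lambda>p. \<^bold>\<lambda>q. qdiff_trm
      \<^bold>\<cdot> (qpos_trm \<^bold>\<cdot> p \<^bold>* (qden_trm \<^bold>\<cdot> q) \<^bold>+ qneg_trm \<^bold>\<cdot> q \<^bold>* (qden_trm \<^bold>\<cdot> p))
      \<^bold>\<cdot> (qneg_trm \<^bold>\<cdot> p \<^bold>* (qden_trm \<^bold>\<cdot> q) \<^bold>+ qpos_trm \<^bold>\<cdot> q \<^bold>* (qden_trm \<^bold>\<cdot> p))
      \<^bold>\<cdot> (pred_trm \<^bold>\<cdot> (qden_trm \<^bold>\<cdot> p \<^bold>* (qden_trm \<^bold>\<cdot> q))))"

definition qabs_trm :: trm where
  "qabs_trm = (\<^bold>\<lambda>q. pair_trm \<^bold>\<cdot> \<^bold>0 \<^bold>\<cdot> (snd_trm \<^bold>\<cdot> q))"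

text \<open>\<open>qpow a n\<close> is the rational \<open>a / 2 ^ n\<close>.\<close>

definition qpow_trm :: trm where
  "qpow_trm = (\<^bold>\<lambda>a. \<^bold>\<lambda>n. pair_trm \<^bold>\<cdot> \<^bold>0 \<^bold>\<cdot> (pair_trm \<^bold>\<cdot> a \<^bold>\<cdot> (pred_trm \<^bold>\<cdot> (pow2_trm \<^bold>\<cdot> n))))"

abbreviation qzero :: trm where "qzero \<equiv> pair_trm \<^bold>\<cdot> \<^bold>0 \<^bold>\<cdot> (pair_trm \<^bold>\<cdot> \<^bold>0 \<^bold>\<cdot> \<^bold>0)"
abbreviation qone :: trm where "qone \<equiv> pair_trm \<^bold>\<cdot> \<^bold>0 \<^bold>\<cdot> (pair_trm \<^bold>\<cdot> \<^bold>1 \<^bold>\<cdot> \<^bold>0)"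

definition lt_Q :: "trm \<Rightarrow> trm \<Rightarrow> fm" (infix "<\<^sub>Q" 50) where
  "(p <\<^sub>Q q) =
     (qpos_trm \<^bold>\<cdot> p \<^bold>* (qden_trm \<^bold>\<cdot> q) \<^bold>+ qneg_trm \<^bold>\<cdot> q \<^bold>* (qden_trm \<^bold>\<cdot> p) \<^bold><
      qpos_trm \<^bold>\<cdot> q \<^bold>* (qden_trm \<^bold>\<cdot> p) \<^bold>+ qneg_trm \<^bold>\<cdot> p \<^bold>* (qden_trm \<^bold>\<cdot> q))"

definition le_Q :: "trm \<Rightarrow> trm \<Rightarrow> fm" (infix "\<le>\<^sub>Q" 50) where
  "(p \<le>\<^sub>Q q) = (\<^bold>\<not> (q <\<^sub>Q p))"


section \<open>Real numbers\<close>

definition is_real :: "trm \<Rightarrow> fm" where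
  "is_real x =
     (\<^bold>\<forall>\<^sup>0n. \<^bold>\<forall>\<^sup>0i. qabs_trm \<^bold>\<cdot> (qminus_trm \<^bold>\<cdot> (x \<^bold>\<cdot> n) \<^bold>\<cdot> (x \<^bold>\<cdot> (n \<^bold>+ i))) <\<^sub>Q qpow_trm \<^bold>\<cdot> \<^bold>1 \<^bold>\<cdot> n)"

definition AllR :: "(trm \<Rightarrow> fm) \<Rightarrow> fm" (binder "\<^bold>\<forall>\<^sup>R" 10) where
  "AllR F = (\<^bold>\<forall>\<^sup>1x. is_real x \<^bold>\<longrightarrow> F x)"

definition eq_R :: "trm \<Rightarrow> trm \<Rightarrow> fm" (infix "=\<^sub>R" 50) where
  "(x =\<^sub>R y) =
     (\<^bold>\<forall>\<^sup>0n. qabs_trm \<^bold>\<cdot> (qminus_trm \<^bold>\<cdot> (x \<^bold>\<cdot> n) \<^bold>\<cdot> (y \<^bold>\<cdot> n)) \<le>\<^sub>Q qpow_trm \<^bold>\<cdot> suc \<^bold>1 \<^bold>\<cdot> n)"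

definition lt_R :: "trm \<Rightarrow> trm \<Rightarrow> fm" (infix "<\<^sub>R" 50) where
  "(x <\<^sub>R y) = (\<^bold>\<exists>\<^sup>0n. qpow_trm \<^bold>\<cdot> suc \<^bold>1 \<^bold>\<cdot> n <\<^sub>Q qminus_trm \<^bold>\<cdot> (y \<^bold>\<cdot> n) \<^bold>\<cdot> (x \<^bold>\<cdot> n))"

definition le_R :: "trm \<Rightarrow> trm \<Rightarrow> fm" (infix "\<le>\<^sub>R" 50) where
  "(x \<le>\<^sub>R y) = (\<^bold>\<not> (y <\<^sub>R x))"

definition real_of_Q :: "trm \<Rightarrow> trm" where
  "real_of_Q q = (\<^bold>\<lambda>n. q)"

definition minus_R :: "trm \<Rightarrow> trm \<Rightarrow> trm" (infixl "-\<^sub>R" 65) where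
  "x -\<^sub>R y = (\<^bold>\<lambda>n. qminus_trm \<^bold>\<cdot> (x \<^bold>\<cdot> suc n) \<^bold>\<cdot> (y \<^bold>\<cdot> suc n))"

definition abs_R :: "trm \<Rightarrow> trm" where
  "abs_R x = (\<^bold>\<lambda>n. qabs_trm \<^bold>\<cdot> (x \<^bold>\<cdot> n))"


section \<open>Sets of reals\<close>

definition is_real_fun :: "trm \<Rightarrow> fm" where
  "is_real_fun F =
     ((\<^bold>\<forall>\<^sup>Rx. is_real (F \<^bold>\<cdot> x)) \<^bold>\<and> (\<^bold>\<forall>\<^sup>Rx. \<^bold>\<forall>\<^sup>Ry. x =\<^sub>R y \<^bold>\<longrightarrow> F \<^bold>\<cdot> x =\<^sub>R F \<^bold>\<cdot> y))"

definition mem_R :: "trm \<Rightarrow> trm \<Rightarrow> fm" (infix "\<^bold>\<in>" 50) where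
  "(x \<^bold>\<in> Y) = (real_of_Q qzero <\<^sub>R Y \<^bold>\<cdot> x)"

definition nmem_R :: "trm \<Rightarrow> trm \<Rightarrow> fm" (infix "\<^bold>\<notin>" 50) where
  "(x \<^bold>\<notin> Y) = (\<^bold>\<not> (x \<^bold>\<in> Y))"

text \<open>The radius \<open>r\<close> of the ball \<open>B(x, r)\<close> ranges over the rationals.\<close>

definition open_set :: "trm \<Rightarrow> fm" where
  "open_set Y =
     (is_real_fun Y \<^bold>\<and>
      (\<^bold>\<forall>\<^sup>Rx. x \<^bold>\<in> Y \<^bold>\<longrightarrow>
         (\<^bold>\<exists>\<^sup>0r. qzero <\<^sub>Q r \<^bold>\<and> (\<^bold>\<forall>\<^sup>Ry. abs_R (x -\<^sub>R y) <\<^sub>R real_of_Q r \<^bold>\<longrightarrow> y \<^bold>\<in> Y))))"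

text \<open>
  A closed set \<open>C\<close> is one whose complement is an open set, that is, an open set given by a function
  \<open>D\<close>; so \<open>C\<close> is presented by \<open>D\<close>, and \<open>x \<in> C\<close> means \<open>\<not> D x > 0\<close>. Giving \<open>C\<close> by a function that is
  positive exactly on \<open>C\<close> is a different notion without arithmetical comprehension: \<open>[0, 1]\<close> need
  not have such a function, whereas \<open>{x. \<exists>n. x < q n}\<close> always has one, and has a complement
  containing a ball around each of its points when \<open>q\<close> is increasing without a supremum.
\<close>

definition HBC_s :: fm where
  "HBC_s =
     Forall (ty1 \<^bold>\<rightarrow> ty1) (\<lambda>D. Forall (Num \<^bold>\<rightarrow> ty1 \<^bold>\<rightarrow> ty1) (\<lambda>U.
       open_set D
       \<^bold>\<and> (\<^bold>\<forall>\<^sup>Rx. x \<^bold>\<notin> D \<^bold>\<longrightarrow> real_of_Q qzero \<le>\<^sub>R x \<^bold>\<and> x \<le>\<^sub>R real_of_Q qone)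
       \<^bold>\<and> (\<^bold>\<forall>\<^sup>0n. open_set (U \<^bold>\<cdot> n))
       \<^bold>\<and> (\<^bold>\<forall>\<^sup>Rx. x \<^bold>\<notin> D \<^bold>\<longrightarrow> (\<^bold>\<exists>\<^sup>0n. x \<^bold>\<in> U \<^bold>\<cdot> n))
       \<^bold>\<longrightarrow> (\<^bold>\<exists>\<^sup>0n0. \<^bold>\<forall>\<^sup>Rx. x \<^bold>\<notin> D \<^bold>\<longrightarrow> (\<^bold>\<exists>\<^sup>0n. (n \<^bold>< n0 \<^bold>\<or> n \<^bold>= n0) \<^bold>\<and> x \<^bold>\<in> U \<^bold>\<cdot> n))))"


section \<open>Binary trees\<close>

text \<open>
  Finite binary sequences are coded bijectively by numbers: the empty one by \<open>0\<close>, and \<open>s\<close> followed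
  by the bit \<open>b\<close> by \<open>2 s + 1 + b\<close>. \<open>cut k s\<close> removes the last \<open>k\<close> bits of \<open>s\<close> (all of them, if there
  are fewer), and the length of \<open>s\<close> is the number of \<open>k < s\<close> for which \<open>cut k s\<close> is not empty.
\<close>

definition snoc_trm :: trm where
  "snoc_trm = (\<^bold>\<lambda>s. \<^bold>\<lambda>b. suc (s \<^bold>+ s) \<^bold>+ b)"

definition cut_trm :: trm where
  "cut_trm = (\<^bold>\<lambda>k. \<^bold>\<lambda>s. rec (\<^bold>\<lambda>j. \<^bold>\<lambda>r. half_trm \<^bold>\<cdot> (pred_trm \<^bold>\<cdot> r)) s k)"

definition length_trm :: trm where
  "length_trm = (\<^bold>\<lambda>s. rec (\<^bold>\<lambda>k. \<^bold>\<lambda>r. r \<^bold>+ sg_trm \<^bold>\<cdot> (cut_trm \<^bold>\<cdot> k \<^bold>\<cdot> s)) \<^bold>0 s)"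

definition initial_segment :: "trm \<Rightarrow> trm \<Rightarrow> fm" (infix "\<^bold>\<sqsubseteq>" 50) where
  "(s \<^bold>\<sqsubseteq> t) = (\<^bold>\<exists>\<^sup>0k. s \<^bold>= cut_trm \<^bold>\<cdot> k \<^bold>\<cdot> t)"

text \<open>\<open>prefix_code a n\<close> is the code of the sequence \<open>a 0, \<dots>, a (n - 1)\<close>.\<close>

definition prefix_code :: "trm \<Rightarrow> trm \<Rightarrow> trm" where
  "prefix_code a n = rec (\<^bold>\<lambda>k. \<^bold>\<lambda>r. snoc_trm \<^bold>\<cdot> r \<^bold>\<cdot> (a \<^bold>\<cdot> k)) \<^bold>0 n"

definition binary :: "trm \<Rightarrow> fm" where
  "binary a = (\<^bold>\<forall>\<^sup>0n. a \<^bold>\<cdot> n \<^bold>= \<^bold>0 \<^bold>\<or> a \<^bold>\<cdot> n \<^bold>= \<^bold>1)"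

text \<open>A set of numbers is given by its characteristic function.\<close>

definition is_tree :: "trm \<Rightarrow> fm" where
  "is_tree T = (binary T \<^bold>\<and> (\<^bold>\<forall>\<^sup>0s. \<^bold>\<forall>\<^sup>0t. s \<^bold>\<sqsubseteq> t \<^bold>\<and> T \<^bold>\<cdot> t \<^bold>= \<^bold>1 \<^bold>\<longrightarrow> T \<^bold>\<cdot> s \<^bold>= \<^bold>1))"

definition is_infinite :: "trm \<Rightarrow> fm" where
  "is_infinite T = (\<^bold>\<forall>\<^sup>0n. \<^bold>\<exists>\<^sup>0s. length_trm \<^bold>\<cdot> s \<^bold>= n \<^bold>\<and> T \<^bold>\<cdot> s \<^bold>= \<^bold>1)"

definition is_path :: "trm \<Rightarrow> trm \<Rightarrow> fm" where
  "is_path a T = (binary a \<^bold>\<and> (\<^bold>\<forall>\<^sup>0n. T \<^bold>\<cdot> prefix_code a n \<^bold>= \<^bold>1))"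

definition WKL :: fm where
  "WKL = (\<^bold>\<forall>\<^sup>1T. is_tree T \<^bold>\<and> is_infinite T \<^bold>\<longrightarrow> (\<^bold>\<exists>\<^sup>1a. is_path a T))"

end

theory Submission
  imports Defs "HOL-Library.Countable_Set" "HOL-Computational_Algebra.Fraction_Field"
begin

text \<open>
  By Henkin's completeness theorem, it suffices to show that the equivalence holds in every model of the
  theory; such a model is a type structure over a possibly nonstandard set of numbers, closed under
  lambda-definability and under the two choice schemata.

  If all covers of closed subsets of the unit interval have finite subcovers and \<open>T\<close> is an infinite tree,
  let \<open>U n\<close> be the set of the reals at distance more than \<open>4 ^ - n\<close> from the centers attached to the strings
  of \<open>T\<close> of length \<open>n\<close>. No finite subfamily covers \<open>[0, 1]\<close>, and a point in none of the \<open>U n\<close> yields a path.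

  Conversely, the reals of \<open>[0, 1]\<close> are expanded with digits 0, 1, 2, and choice gives a functional \<open>\<Phi>\<close>
  selecting an index of a set which contains a given point, together with a witness. If \<open>\<Phi>\<close> is bounded,
  there is a finite subcover. Otherwise there are points \<open>g n\<close> with \<open>n \<le> \<Phi> (g n)\<close>. Weak Koenig's lemma then
  yields arithmetical comprehension, hence a cluster point of the \<open>g n\<close>; now Grilliot's trick makes
  \<open>\<exists>s. p s = 0\<close> decidable by a functional. So membership in the sets is decidable, choice gives points
  outside the first \<open>n\<close> sets, and a cluster point of these points is not covered.
\<close>

section \<open>Substitution and typing\<close>

text \<open>This shapes everything after the completeness theorem. Functions come with proofs of
  representability, unbounded quantifiers are kept out of induction formulas, and the rationals are
  the fraction field of the formal differences of numbers, where linear arithmetic does the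
  estimates. In the first direction, base 4 leaves gaps between the centers of one level, so a
  rational approximation of a point suffices to name its string. In the second direction the
  redundant digit 2 serves the opposite purpose: subintervals overlap, and a digit can be chosen
  from an approximation without deciding on which side of a boundary the real lies. The functional
  obtained from choice need not be continuous. If it is unbounded along a sequence with a cluster
  point, it is discontinuous there, and a discontinuity is exactly what can be turned into a search
  operator. The unbounded case is therefore the one with more comprehension, not the bad
  one.\<close>

lemma typ_of_weaken: "typ_of \<Gamma> t = Some \<tau> \<Longrightarrow> typ_of (\<Gamma> @ \<Delta>) t = Some \<tau>"
  by (induction \<Gamma> t arbitrary: \<tau> rule: typ_of.induct)
    (auto simp: nth_append split: if_splits option.splits ty.splits)

lemma wff_weaken: "wff \<Gamma> A \<Longrightarrow> wff (\<Gamma> @ \<Delta>) A"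
  by (induction A arbitrary: \<Gamma>) (auto dest: typ_of_weaken, metis append_Cons)

lemma inst_t_typed: "typ_of \<Gamma> t = Some \<tau> \<Longrightarrow> length \<Gamma> \<le> k \<Longrightarrow> inst_t k u t = t"
  by (induction \<Gamma> t arbitrary: \<tau> rule: typ_of.induct)
    (auto split: if_splits option.splits ty.splits)

lemma inst_wff: "wff \<Gamma> A \<Longrightarrow> length \<Gamma> \<le> k \<Longrightarrow> inst k u A = A"
proof (induction A arbitrary: \<Gamma> k)
  case (All \<sigma> A)
  from All.IH[of "\<sigma> # \<Gamma>" "Suc k"] All.prems show ?case by simp
qed (auto simp: inst_t_typed)

lemma typ_of_inst_t:
  assumes "typ_of [] u = Some \<sigma>"
  shows "typ_of \<Gamma> (inst_t (length \<Gamma>) u t) = typ_of (\<Gamma> @ [\<sigma>]) t"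
  using typ_of_weaken[OF assms, of \<Gamma>]
  by (induction t) (auto simp: nth_append split: option.splits ty.splits)

text \<open>An equation rather than an implication: \<open>derives_wff\<close> must also go back
  from an instance to the quantified formula, in the case of \<open>AllI\<close>.\<close>

lemma wff_inst:
  assumes "typ_of [] u = Some \<sigma>"
  shows "wff \<Gamma> (inst (length \<Gamma>) u A) = wff (\<Gamma> @ [\<sigma>]) A"
  using typ_of_inst_t[OF assms]
  by (induction A arbitrary: \<Gamma>) (auto, (metis append_Cons length_Cons)+)

lemmas wff_inst0 = wff_inst[of _ _ "[]", simplified]

lemma typ_of_close_t: "typ_of \<Gamma> t = Some \<sigma> \<Longrightarrow> typ_of (\<Gamma> @ [\<tau>]) (close_t (length \<Gamma>) x \<tau> t) = Some \<sigma>"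
  by (induction t arbitrary: \<sigma>) (auto simp: nth_append split: option.splits ty.splits if_splits)

lemma wff_close: "wff \<Gamma> A \<Longrightarrow> wff (\<Gamma> @ [\<tau>]) (close (length \<Gamma>) x \<tau> A)"
proof (induction A arbitrary: \<Gamma>)
  case (All \<sigma> A)
  from All.IH[of "\<sigma> # \<Gamma>"] All.prems show ?case by simp
qed (auto simp: typ_of_close_t)

lemmas wff_close0 = wff_close[of "[]", simplified]

lemma inst_close_t: "typ_of \<Gamma> t = Some \<sigma> \<Longrightarrow> inst_t (length \<Gamma>) (Var x \<tau>) (close_t (length \<Gamma>) x \<tau> t) = t"
  by (induction t arbitrary: \<sigma>) (auto split: option.splits ty.splits if_splits)

lemma inst_close: "wff \<Gamma> A \<Longrightarrow> inst (length \<Gamma>) (Var x \<tau>) (close (length \<Gamma>) x \<tau> A) = A"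
proof (induction A arbitrary: \<Gamma>)
  case (All \<sigma> A)
  from All.IH[of "\<sigma> # \<Gamma>"] All.prems show ?case by simp
qed (auto simp: inst_close_t)

lemmas inst_close0 = inst_close[of "[]", simplified]

lemma frees_close_t: "frees_t (close_t k x \<tau> t) = frees_t t - {(x, \<tau>)}"
  by (induction t) auto

lemma frees_close: "frees (close k x \<tau> A) = frees A - {(x, \<tau>)}"
  by (induction A arbitrary: k) (auto simp: frees_close_t)

lemma finite_frees_t [simp]: "finite (frees_t t)"
  by (induction t) auto

lemma finite_frees [simp]: "finite (frees A)"
  by (induction A) auto

lemma derives_wff: "derives T H A \<Longrightarrow> wff [] A"
proof (induction rule: derives.induct)
  case (AllI H x \<tau> A)
  then show ?case using wff_inst0[of "Var x \<tau>"] by auto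
next
  case (EqSubst A H s t)
  then show ?case using wff_inst0[of s] wff_inst0[of t] by auto
qed (auto simp: wff_inst0 Neg_def)

section \<open>Henkin's completeness theorem\<close>

context
  fixes T :: "fm set"
begin

section \<open>Hilbert-style rules and deduction from finitely many hypotheses\<close>

lemma prov_K: "wff [] A \<Longrightarrow> wff [] B \<Longrightarrow> T \<^bold>\<turnstile> A \<^bold>\<longrightarrow> B \<^bold>\<longrightarrow> A"
  unfolding proves_def by (intro derives.ImpI derives.Assm) auto

lemma prov_S:
  assumes "wff [] A" "wff [] B" "wff [] C"
  shows "T \<^bold>\<turnstile> (A \<^bold>\<longrightarrow> B \<^bold>\<longrightarrow> C) \<^bold>\<longrightarrow> (A \<^bold>\<longrightarrow> B) \<^bold>\<longrightarrow> A \<^bold>\<longrightarrow> C"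
  unfolding proves_def
proof (intro derives.ImpI)
  let ?H = "[A, A \<^bold>\<longrightarrow> B, A \<^bold>\<longrightarrow> B \<^bold>\<longrightarrow> C]"
  have a: "derives T ?H A" and ab: "derives T ?H (A \<^bold>\<longrightarrow> B)" and abc: "derives T ?H (A \<^bold>\<longrightarrow> B \<^bold>\<longrightarrow> C)"
    by (rule derives.Assm; use assms in simp)+
  show "derives T ?H C"
    by (rule derives.ImpE[OF derives.ImpE[OF abc a] derives.ImpE[OF ab a]])
qed (use assms in auto)

lemma prov_mp: "T \<^bold>\<turnstile> A \<^bold>\<longrightarrow> B \<Longrightarrow> T \<^bold>\<turnstile> A \<Longrightarrow> T \<^bold>\<turnstile> B"
  unfolding proves_def by (rule derives.ImpE)

lemma prov_contr:
  assumes "wff [] A"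
  shows "T \<^bold>\<turnstile> (((A \<^bold>\<longrightarrow> Fls) \<^bold>\<longrightarrow> Fls) \<^bold>\<longrightarrow> A)"
  unfolding proves_def
  by (intro derives.ImpI, simp add: assms, rule derives.Contr, simp add: assms,
      rule derives.ImpE[where A = "A \<^bold>\<longrightarrow> Fls"])
    (auto simp: assms Neg_def intro!: derives.Assm)

lemma prov_dist:
  assumes "wff [] A" "wff [\<tau>] B"
  shows "T \<^bold>\<turnstile> (All \<tau> (A \<^bold>\<longrightarrow> B) \<^bold>\<longrightarrow> A \<^bold>\<longrightarrow> All \<tau> B)"
proof -
  have "finite (frees A \<union> frees B)" by simp
  then have "finite (fst ` (frees A \<union> frees B))" by (rule finite_imageI)
  then obtain x where "x \<notin> fst ` (frees A \<union> frees B)" using ex_new_if_finite infinite_UNIV_nat by blast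
  then have x: "(x, \<tau>) \<notin> frees A \<union> frees B" by force
  let ?H = "[A, All \<tau> (A \<^bold>\<longrightarrow> B)]"
  have w: "wff [] (All \<tau> (A \<^bold>\<longrightarrow> B))" using assms wff_weaken[of "[]" A "[\<tau>]"] by simp
  have "derives T ?H (inst 0 (Var x \<tau>) (A \<^bold>\<longrightarrow> B))"
    by (rule derives.AllE[where \<tau> = \<tau>]) (use w in \<open>auto intro!: derives.Assm\<close>)
  then have "derives T ?H (A \<^bold>\<longrightarrow> inst 0 (Var x \<tau>) B)" using inst_wff[OF assms(1)] by simp
  then have "derives T ?H (inst 0 (Var x \<tau>) B)"
    by (rule derives.ImpE) (auto simp: assms intro!: derives.Assm)
  then have "derives T ?H (All \<tau> B)"
    by (rule derives.AllI) (use x in auto)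
  then show ?thesis unfolding proves_def using w assms by (intro derives.ImpI) auto
qed

lemma prov_AllE:
  assumes "wff [\<tau>] A" "typ_of [] t = Some \<tau>"
  shows "T \<^bold>\<turnstile> (All \<tau> A \<^bold>\<longrightarrow> inst 0 t A)"
  unfolding proves_def using assms
  by (intro derives.ImpI derives.AllE[where \<tau> = \<tau>] derives.Assm) auto

lemma prov_gen:
  "T \<^bold>\<turnstile> inst 0 (Var x \<tau>) A \<Longrightarrow> (x, \<tau>) \<notin> frees A \<Longrightarrow> T \<^bold>\<turnstile> All \<tau> A"
  unfolding proves_def by (rule derives.AllI) auto

text \<open>Hypotheses are folded into nested implications, and provability is used with an empty
  hypothesis list only. Weakening is then an instance of \<open>prov_K\<close>; for
  \<open>derives\<close> it would clash with the eigenvariable condition of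
  \<open>AllI\<close>.\<close>

primrec imps :: "fm list \<Rightarrow> fm \<Rightarrow> fm" where
  "imps [] A = A"
| "imps (B # H) A = imps H (B \<^bold>\<longrightarrow> A)"

definition ded :: "fm list \<Rightarrow> fm \<Rightarrow> bool" where
  "ded H A \<longleftrightarrow> (T \<^bold>\<turnstile> imps H A)"

lemma ded_Cons: "ded (B # H) A = ded H (B \<^bold>\<longrightarrow> A)"
  by (simp add: ded_def)

lemma imps_wff: "wff [] (imps H A) = ((\<forall>B\<in>set H. wff [] B) \<and> wff [] A)"
  by (induction H arbitrary: A) auto

lemma ded_wff: "ded H A \<Longrightarrow> wff [] A \<and> (\<forall>B\<in>set H. wff [] B)"
  unfolding ded_def proves_def using derives_wff imps_wff by blast

lemma prov_wff: "T \<^bold>\<turnstile> A \<Longrightarrow> wff [] A"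
  unfolding proves_def by (rule derives_wff)

lemma ded_prov: "T \<^bold>\<turnstile> A \<Longrightarrow> \<forall>B\<in>set H. wff [] B \<Longrightarrow> ded H A"
proof (induction H arbitrary: A)
  case Nil then show ?case by (simp add: ded_def)
next
  case (Cons B H)
  have "T \<^bold>\<turnstile> B \<^bold>\<longrightarrow> A" using prov_mp[OF prov_K Cons.prems(1)] Cons.prems prov_wff by auto
  then show ?case using Cons by (simp add: ded_Cons)
qed

lemma ded_mp: "ded H (A \<^bold>\<longrightarrow> B) \<Longrightarrow> ded H A \<Longrightarrow> ded H B"
proof (induction H arbitrary: A B)
  case Nil then show ?case by (auto simp: ded_def intro: prov_mp)
next
  case (Cons C H)
  then have w: "wff [] C" "wff [] A" "wff [] B" "\<forall>B\<in>set H. wff [] B" by (auto dest!: ded_wff)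
  from Cons.IH[OF Cons.IH[OF ded_prov[OF prov_S[OF w(1-3)] w(4)]]] Cons.prems
  show ?case by (simp add: ded_Cons)
qed

lemma ded_weak: "ded H A \<Longrightarrow> wff [] B \<Longrightarrow> ded (B # H) A"
  unfolding ded_Cons by (rule ded_mp[OF ded_prov[OF prov_K]]) (auto dest: ded_wff)

lemma ded_assm: "B \<in> set H \<Longrightarrow> \<forall>B\<in>set H. wff [] B \<Longrightarrow> ded H B"
proof (induction H)
  case (Cons C H)
  have w: "wff [] C" "wff [] (C \<^bold>\<longrightarrow> C)" using Cons.prems by auto
  have "T \<^bold>\<turnstile> C \<^bold>\<longrightarrow> C" using prov_mp[OF prov_mp[OF prov_S prov_K] prov_K] w by blast
  then have "ded (C # H) C" using Cons.prems ded_prov by (simp add: ded_Cons)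
  then show ?case using Cons by (auto intro: ded_weak)
qed simp

text \<open>The quantifier moves inward past one hypothesis at a time by \<open>prov_dist\<close>;
  freshness of \<open>x\<close> lets the whole implication be generalised first.\<close>

lemma ded_gen:
  "ded H (inst 0 (Var x \<tau>) A) \<Longrightarrow> (x, \<tau>) \<notin> frees A \<union> \<Union> (frees ` set H) \<Longrightarrow> ded H (All \<tau> A)"
proof (induction H arbitrary: A)
  case Nil then show ?case by (auto simp: ded_def intro: prov_gen)
next
  case (Cons B H)
  have w: "wff [] B" "wff [\<tau>] A" "\<forall>B\<in>set H. wff [] B"
    using ded_wff[OF Cons.prems(1)] wff_inst0[of "Var x \<tau>"] by auto
  have "ded H (inst 0 (Var x \<tau>) (B \<^bold>\<longrightarrow> A))" using Cons.prems inst_wff[OF w(1)] by (simp add: ded_Cons)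
  then have "ded H (All \<tau> (B \<^bold>\<longrightarrow> A))" by (rule Cons.IH) (use Cons.prems in auto)
  then show ?case unfolding ded_Cons using ded_mp[OF ded_prov[OF prov_dist[OF w(1,2)] w(3)]] by blast
qed

section \<open>Consistent lists and their extension to Henkin sets\<close>

definition cons :: "fm list \<Rightarrow> bool" where
  "cons H \<longleftrightarrow> (\<forall>B\<in>set H. wff [] B) \<and> \<not> ded H Fls"

lemma cons_extend:
  assumes "cons H" "wff [] A"
  shows "cons (A # H) \<or> cons ((A \<^bold>\<longrightarrow> Fls) # H)"
  using assms ded_mp[of H "A \<^bold>\<longrightarrow> Fls" Fls] unfolding cons_def by (auto simp: ded_Cons)

lemma ded_contr: "ded H ((A \<^bold>\<longrightarrow> Fls) \<^bold>\<longrightarrow> Fls) \<Longrightarrow> ded H A"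
  by (rule ded_mp[OF ded_prov[OF prov_contr]]) (auto dest: ded_wff)

text \<open>Fresh variables serve as Henkin witnesses, so the language is not enlarged: if the
  negated instance at a fresh \<open>x\<close> were refutable, generalising over \<open>x\<close>
  would prove \<open>All \<tau> A\<close>, whose negation is a hypothesis.\<close>

lemma cons_witness:
  assumes c: "cons H" and m: "(All \<tau> A \<^bold>\<longrightarrow> Fls) \<in> set H"
    and x: "(x, \<tau>) \<notin> frees A \<union> \<Union> (frees ` set H)"
  shows "cons ((inst 0 (Var x \<tau>) A \<^bold>\<longrightarrow> Fls) # H)"
proof -
  have w: "wff [\<tau>] A" using c m by (auto simp: cons_def)
  have "ded H Fls" if "ded H ((inst 0 (Var x \<tau>) A \<^bold>\<longrightarrow> Fls) \<^bold>\<longrightarrow> Fls)"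
    using ded_gen[OF ded_contr[OF that] x] ded_mp[OF ded_assm[OF m]] c by (auto simp: cons_def)
  then show ?thesis using c w by (auto simp: cons_def ded_Cons wff_inst0)
qed

end

instance ty :: countable by countable_datatype
instance const :: countable by countable_datatype
instance trm :: countable by countable_datatype
instance fm :: countable by countable_datatype

text \<open>Deciding a formula and adding a counterexample to a negated quantifier happen in the
  same step. Each stage thus remains a finite list, and a fresh variable is always left.\<close>

fun henkin_step :: "fm set \<Rightarrow> fm list \<Rightarrow> fm \<Rightarrow> fm list" where
  "henkin_step T H A =
    (if \<not> wff [] A then H
     else if cons T (A # H) then
       (case A of
          Imp (All \<tau> B) Fls \<Rightarrow>
            (inst 0 (Var (SOME x. (x, \<tau>) \<notin> frees B \<union> \<Union> (frees ` set (A # H))) \<tau>) B \<^bold>\<longrightarrow> Fls) # A # H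
        | _ \<Rightarrow> A # H)
     else (A \<^bold>\<longrightarrow> Fls) # H)"

declare henkin_step.simps [simp del]

lemma fresh_ex: "\<exists>x. (x, \<tau>) \<notin> frees B \<union> \<Union> (frees ` set H)"
proof -
  have "finite (fst ` (frees B \<union> \<Union> (frees ` set H)))" by auto
  then obtain x where "x \<notin> fst ` (frees B \<union> \<Union> (frees ` set H))" using ex_new_if_finite infinite_UNIV_nat by blast
  then show ?thesis by (metis fst_conv imageI)
qed

lemma henkin_step_cons: "cons T H \<Longrightarrow> cons T (henkin_step T H A)"
proof (cases "wff [] A \<and> cons T (A # H)")
  case True
  assume "cons T H"
  show ?thesis
  proof (cases "\<exists>\<tau> B. A = (All \<tau> B \<^bold>\<longrightarrow> Fls)")
    case t: True
    then obtain \<tau> B where A: "A = (All \<tau> B \<^bold>\<longrightarrow> Fls)" by blast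
    have "(SOME x. (x, \<tau>) \<notin> frees B \<union> \<Union> (frees ` set (A # H)), \<tau>) \<notin> frees B \<union> \<Union> (frees ` set (A # H))"
      by (rule someI_ex[OF fresh_ex])
    from cons_witness[OF _ _ this, of T] True show ?thesis using A by (simp add: henkin_step.simps)
  next
    case False
    then have "henkin_step T H A = A # H" using True by (auto simp: henkin_step.simps split: fm.splits)
    then show ?thesis using True by simp
  qed
next
  case False
  assume "cons T H"
  then show ?thesis using False cons_extend[of T H A] by (auto simp: henkin_step.simps)
qed

lemma henkin_step_suffix: "\<exists>xs. henkin_step T H A = xs @ H"
  by (simp add: henkin_step.simps split: fm.splits)

lemma henkin_step_decides: "wff [] A \<Longrightarrow> A \<in> set (henkin_step T H A) \<or> (A \<^bold>\<longrightarrow> Fls) \<in> set (henkin_step T H A)"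
  by (simp add: henkin_step.simps split: fm.splits)

lemma henkin_step_witness:
  assumes "wff [\<tau>] B" "cons T ((All \<tau> B \<^bold>\<longrightarrow> Fls) # H)"
  shows "\<exists>x. (inst 0 (Var x \<tau>) B \<^bold>\<longrightarrow> Fls) \<in> set (henkin_step T H (All \<tau> B \<^bold>\<longrightarrow> Fls))"
  using assms by (auto simp: henkin_step.simps)

primrec henkin_chain :: "fm set \<Rightarrow> fm list \<Rightarrow> nat \<Rightarrow> fm list" where
  "henkin_chain T H 0 = H"
| "henkin_chain T H (Suc n) = henkin_step T (henkin_chain T H n) (from_nat n)"

text \<open>Truth clauses for membership, where a quantifier ranges over all terms of its type
  without bound indices. Such terms may have free variables, which act as constants.\<close>

definition henkin_set :: "fm set \<Rightarrow> fm set \<Rightarrow> bool" where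
  "henkin_set T G \<longleftrightarrow>
     (\<forall>A. (T \<^bold>\<turnstile> A) \<longrightarrow> A \<in> G) \<and> Fls \<notin> G \<and>
     (\<forall>A B. wff [] A \<longrightarrow> wff [] B \<longrightarrow> ((A \<^bold>\<longrightarrow> B) \<in> G \<longleftrightarrow> (A \<in> G \<longrightarrow> B \<in> G))) \<and>
     (\<forall>\<tau> A. wff [\<tau>] A \<longrightarrow> (All \<tau> A \<in> G \<longleftrightarrow> (\<forall>t. typ_of [] t = Some \<tau> \<longrightarrow> inst 0 t A \<in> G)))"

lemma henkin_extension:
  assumes A0: "wff [] A0" and np: "\<not> (T \<^bold>\<turnstile> A0)"
  shows "\<exists>G. henkin_set T G \<and> A0 \<notin> G"
proof -
  let ?c = "henkin_chain T [A0 \<^bold>\<longrightarrow> Fls]"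
  define G where "G = (\<Union>n. set (?c n))"
  have "\<not> ded T [A0 \<^bold>\<longrightarrow> Fls] Fls" using np ded_contr[of T "[]" A0] by (auto simp: ded_Cons ded_def)
  then have c0: "cons T [A0 \<^bold>\<longrightarrow> Fls]" using A0 by (auto simp: cons_def)
  have c: "cons T (?c n)" for n by (induction n) (auto simp: c0 henkin_step_cons)
  have suf: "\<exists>xs. ?c (n + k) = xs @ ?c n" for n k
  proof (induction k)
    case (Suc k)
    then show ?case using henkin_step_suffix[of T "?c (n + k)" "from_nat (n + k)"] by auto
  qed simp
  have mono: "set (?c n) \<subseteq> set (?c m)" if "n \<le> m" for n m
    using suf[of n "m - n"] that by auto
  have wffc: "\<forall>B\<in>set (?c n). wff [] B" for n using c by (auto simp: cons_def)
  have dedmono: "ded T (?c m) A" if "ded T (?c n) A" "n \<le> m" for n m A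
  proof -
    have "\<forall>B\<in>set xs. wff [] B \<Longrightarrow> ded T (xs @ ?c n) A" for xs
      by (induction xs) (use that in \<open>auto intro: ded_weak\<close>)
    moreover have "\<exists>xs. ?c m = xs @ ?c n" using suf[of n "m - n"] that by simp
    then obtain xs where "?c m = xs @ ?c n" by blast
    ultimately show ?thesis using wffc[of m] by auto
  qed
  \<comment> \<open>\<open>from_nat\<close> reaches \<open>A\<close> at stage
    \<open>to_nat A\<close>.\<close>
  have dec: "A \<in> G \<or> (A \<^bold>\<longrightarrow> Fls) \<in> G" if "wff [] A" for A
    using henkin_step_decides[OF that, of T "?c (to_nat A)"] unfolding G_def
    by (auto intro: exI[of _ "Suc (to_nat A)"])
  have incons: False if "ded T (?c n) A" "(A \<^bold>\<longrightarrow> Fls) \<in> G" for n A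
  proof -
    from that obtain m where m: "(A \<^bold>\<longrightarrow> Fls) \<in> set (?c m)" by (auto simp: G_def)
    let ?k = "max n m"
    have "(A \<^bold>\<longrightarrow> Fls) \<in> set (?c ?k)" using m mono[of m ?k] by auto
    then have "ded T (?c ?k) (A \<^bold>\<longrightarrow> Fls)" using wffc by (intro ded_assm)
    then show False using ded_mp[of T "?c ?k" A Fls] dedmono[OF that(1), of ?k] c[of ?k] by (auto simp: cons_def)
  qed
  have closed: "A \<in> G" if "ded T (?c n) A" for n A
    using incons[OF that] dec ded_wff[OF that] by blast
  have prov: "A \<in> G" if "T \<^bold>\<turnstile> A" for A by (rule closed[OF ded_prov[OF that wffc]])
  have wffG: "wff [] A" if "A \<in> G" for A using that wffc by (auto simp: G_def)
  have dedG: "\<exists>n. ded T (?c n) A" if "A \<in> G" for A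
    using that ded_assm[OF _ wffc] unfolding G_def by blast
  have mp: "B \<in> G" if AB: "(A \<^bold>\<longrightarrow> B) \<in> G" "A \<in> G" for A B
  proof -
    obtain n m where "ded T (?c n) (A \<^bold>\<longrightarrow> B)" "ded T (?c m) A" using AB dedG by blast
    then have "ded T (?c (max n m)) (A \<^bold>\<longrightarrow> B)" "ded T (?c (max n m)) A" using dedmono by simp_all
    then show ?thesis by (rule closed[OF ded_mp])
  qed
  have F: "Fls \<notin> G" using dedG c unfolding cons_def by blast
  have contr: "A \<in> G" if "wff [] A" "(A \<^bold>\<longrightarrow> Fls) \<notin> G" for A using dec that by blast
  have imp: "(A \<^bold>\<longrightarrow> B) \<in> G \<longleftrightarrow> (A \<in> G \<longrightarrow> B \<in> G)" if w: "wff [] A" "wff [] B" for A B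
  proof
    assume r: "A \<in> G \<longrightarrow> B \<in> G"
    show "(A \<^bold>\<longrightarrow> B) \<in> G"
    proof (cases "B \<in> G")
      case True
      then show ?thesis using mp[OF prov[OF prov_K]] w by blast
    next
      case False
      then have nA: "(A \<^bold>\<longrightarrow> Fls) \<in> G" using r dec w by blast
      have FB: "T \<^bold>\<turnstile> (Fls \<^bold>\<longrightarrow> B)"
        unfolding proves_def by (intro derives.ImpI, simp, rule derives.Contr, simp add: w, rule derives.Assm) auto
      have "T \<^bold>\<turnstile> (A \<^bold>\<longrightarrow> Fls) \<^bold>\<longrightarrow> (A \<^bold>\<longrightarrow> B)"
        using prov_mp[OF prov_S prov_mp[OF prov_K FB]] w by auto
      then show ?thesis using nA mp prov by blast
    qed
  qed (use mp in blast)
  have all: "All \<tau> A \<in> G \<longleftrightarrow> (\<forall>t. typ_of [] t = Some \<tau> \<longrightarrow> inst 0 t A \<in> G)" if w: "wff [\<tau>] A" for \<tau> A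
  proof (intro iffI allI impI)
    fix t assume "All \<tau> A \<in> G" "typ_of [] t = Some \<tau>"
    then show "inst 0 t A \<in> G" using mp[OF prov[OF prov_AllE[OF w]]] by blast
  next
    assume r: "\<forall>t. typ_of [] t = Some \<tau> \<longrightarrow> inst 0 t A \<in> G"
    show "All \<tau> A \<in> G"
    proof (rule contr)
      show "wff [] (All \<tau> A)" using w by simp
      show "(All \<tau> A \<^bold>\<longrightarrow> Fls) \<notin> G"
      proof
        let ?N = "All \<tau> A \<^bold>\<longrightarrow> Fls"
        let ?n = "to_nat ?N"
        assume N: "?N \<in> G"
        \<comment> \<open>If \<open>?N\<close> had been rejected at its stage, its negation would be
          in \<open>G\<close> as well.\<close>
        have "cons T (?N # ?c ?n)"
        proof (rule ccontr)
          assume nc: "\<not> ?thesis"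
          have "wff [] ?N" using w by simp
          then have "(?N \<^bold>\<longrightarrow> Fls) \<in> set (?c (Suc ?n))" using nc by (simp add: henkin_step.simps)
          then have "(?N \<^bold>\<longrightarrow> Fls) \<in> G" unfolding G_def by blast
          then show False using mp N F by blast
        qed
        from henkin_step_witness[OF w this] obtain x
          where "(inst 0 (Var x \<tau>) A \<^bold>\<longrightarrow> Fls) \<in> set (?c (Suc ?n))" by auto
        then have "(inst 0 (Var x \<tau>) A \<^bold>\<longrightarrow> Fls) \<in> G" unfolding G_def by blast
        moreover have "inst 0 (Var x \<tau>) A \<in> G" using r by simp
        ultimately show False using mp F by blast
      qed
    qed
  qed
  have "A0 \<notin> G"
  proof
    assume "A0 \<in> G"
    moreover have "(A0 \<^bold>\<longrightarrow> Fls) \<in> G" unfolding G_def by (rule UN_I[of 0]) auto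
    ultimately show False using mp F by blast
  qed
  then show ?thesis using prov F imp all unfolding henkin_set_def by blast
qed

section \<open>Henkin structures\<close>

type_synonym 'u valuation = "nat \<times> ty \<Rightarrow> 'u"

primrec val :: "('u \<Rightarrow> 'u \<Rightarrow> 'u) \<Rightarrow> (const \<Rightarrow> 'u) \<Rightarrow> 'u valuation \<Rightarrow> 'u list \<Rightarrow> trm \<Rightarrow> 'u" where
  "val ap I \<rho> e (Var x \<tau>) = \<rho> (x, \<tau>)"
| "val ap I \<rho> e (Bnd k) = e ! k"
| "val ap I \<rho> e (Cst c) = I c"
| "val ap I \<rho> e (s \<^bold>\<cdot> t) = ap (val ap I \<rho> e s) (val ap I \<rho> e t)"

text \<open>Equality is a parameter because two structures are used: terms, with equality as
  membership in the Henkin set, and their quotient, with identity.\<close>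

primrec sat :: "(ty \<Rightarrow> 'u set) \<Rightarrow> ('u \<Rightarrow> 'u \<Rightarrow> 'u) \<Rightarrow> (const \<Rightarrow> 'u) \<Rightarrow> ('u \<Rightarrow> 'u \<Rightarrow> bool)
    \<Rightarrow> ('u \<Rightarrow> 'u \<Rightarrow> bool) \<Rightarrow> 'u valuation \<Rightarrow> 'u list \<Rightarrow> fm \<Rightarrow> bool" where
  "sat D ap I eq ls \<rho> e (Eq s t) = eq (val ap I \<rho> e s) (val ap I \<rho> e t)"
| "sat D ap I eq ls \<rho> e (Less s t) = ls (val ap I \<rho> e s) (val ap I \<rho> e t)"
| "sat D ap I eq ls \<rho> e Fls = False"
| "sat D ap I eq ls \<rho> e (Imp A B) = (sat D ap I eq ls \<rho> e A \<longrightarrow> sat D ap I eq ls \<rho> e B)"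
| "sat D ap I eq ls \<rho> e (All \<tau> A) = (\<forall>a\<in>D \<tau>. sat D ap I eq ls \<rho> (a # e) A)"

definition val_ok :: "(ty \<Rightarrow> 'u set) \<Rightarrow> 'u valuation \<Rightarrow> bool" where
  "val_ok D \<rho> \<longleftrightarrow> (\<forall>x \<tau>. \<rho> (x, \<tau>) \<in> D \<tau>)"

lemma val_cong: "\<forall>v\<in>frees_t t. \<rho> v = \<rho>' v \<Longrightarrow> val ap I \<rho> e t = val ap I \<rho>' e t"
  by (induction t) auto

lemma sat_cong: "\<forall>v\<in>frees A. \<rho> v = \<rho>' v \<Longrightarrow> sat D ap I eq ls \<rho> e A = sat D ap I eq ls \<rho>' e A"
proof (induction A arbitrary: e)
  case (Eq s t) then show ?case using val_cong[of s \<rho> \<rho>'] val_cong[of t \<rho> \<rho>'] by simp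
next
  case (Less s t) then show ?case using val_cong[of s \<rho> \<rho>'] val_cong[of t \<rho> \<rho>'] by simp
qed auto

lemma val_close: "typ_of \<Gamma> t = Some \<sigma> \<Longrightarrow> length \<Gamma> = length e \<Longrightarrow>
   val ap I \<rho> (e @ [a]) (close_t (length e) x \<tau> t) = val ap I (\<rho>((x, \<tau>) := a)) e t"
  by (induction t arbitrary: \<sigma>) (auto simp: nth_append split: option.splits ty.splits if_splits)

lemma sat_close: "wff \<Gamma> A \<Longrightarrow> length \<Gamma> = length e \<Longrightarrow>
   sat D ap I eq ls \<rho> (e @ [a]) (close (length e) x \<tau> A) = sat D ap I eq ls (\<rho>((x, \<tau>) := a)) e A"
proof (induction A arbitrary: \<Gamma> e)
  case (All \<sigma> A)
  from All.IH[of "\<sigma> # \<Gamma>" "_ # e"] All.prems show ?case by simp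
qed (auto simp: val_close)

lemmas sat_close0 = sat_close[where e = "[]" and \<Gamma> = "[]", simplified]

lemma sat_AllV:
  "wff [] A \<Longrightarrow> sat D ap I eq ls \<rho> [] (AllV x \<tau> A) = (\<forall>a\<in>D \<tau>. sat D ap I eq ls (\<rho>((x, \<tau>) := a)) [] A)"
  by (simp add: AllV_def sat_close0)

section \<open>The term structure of a Henkin set\<close>

abbreviation tdom :: "ty \<Rightarrow> trm set" where "tdom \<tau> \<equiv> {t. typ_of [] t = Some \<tau>}"

abbreviation idv :: "trm valuation" where "idv \<equiv> \<lambda>(x, \<tau>). Var x \<tau>"

text \<open>Replaces the indices from \<open>k\<close> on by the entries of an environment, all at
  once. The entries are meant to have no bound indices, so nothing is shifted under binders.\<close>

primrec psub_t :: "nat \<Rightarrow> trm list \<Rightarrow> trm \<Rightarrow> trm" where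
  "psub_t k e (Var x \<tau>) = Var x \<tau>"
| "psub_t k e (Bnd j) = (if j < k then Bnd j else e ! (j - k))"
| "psub_t k e (Cst c) = Cst c"
| "psub_t k e (s \<^bold>\<cdot> t) = psub_t k e s \<^bold>\<cdot> psub_t k e t"

primrec psub :: "nat \<Rightarrow> trm list \<Rightarrow> fm \<Rightarrow> fm" where
  "psub k e (Eq s t) = Eq (psub_t k e s) (psub_t k e t)"
| "psub k e (Less s t) = Less (psub_t k e s) (psub_t k e t)"
| "psub k e Fls = Fls"
| "psub k e (Imp A B) = Imp (psub k e A) (psub k e B)"
| "psub k e (All \<tau> A) = All \<tau> (psub (Suc k) e A)"

lemma val_idv: "val App Cst idv e t = psub_t 0 e t"
  by (induction t) auto

abbreviation etyped :: "trm list \<Rightarrow> ty list \<Rightarrow> bool" where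
  "etyped \<equiv> list_all2 (\<lambda>t \<tau>. typ_of [] t = Some \<tau>)"

lemma typ_of_psub: "typ_of (\<Gamma> @ \<Delta>) t = Some \<sigma> \<Longrightarrow> etyped e \<Delta> \<Longrightarrow>
   typ_of \<Gamma> (psub_t (length \<Gamma>) e t) = Some \<sigma>"
proof (induction t arbitrary: \<sigma>)
  case (Bnd j)
  show ?case
  proof (cases "j < length \<Gamma>")
    case False
    then have "typ_of [] (e ! (j - length \<Gamma>)) = Some (\<Delta> ! (j - length \<Gamma>))"
      using Bnd by (auto simp: list_all2_conv_all_nth split: if_splits)
    then show ?thesis using False Bnd typ_of_weaken[of "[]" _ _ \<Gamma>] by (auto simp: nth_append split: if_splits)
  qed (use Bnd in \<open>auto simp: nth_append\<close>)
qed (auto split: option.splits ty.splits if_splits)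

lemma wff_psub: "wff (\<Gamma> @ \<Delta>) A \<Longrightarrow> etyped e \<Delta> \<Longrightarrow> wff \<Gamma> (psub (length \<Gamma>) e A)"
proof (induction A arbitrary: \<Gamma>)
  case (All \<sigma> A)
  from All.IH[of "\<sigma> # \<Gamma>"] All.prems show ?case by simp
qed (auto simp: typ_of_psub)

lemma inst_psub_t:
  assumes "etyped e \<Delta>"
  shows "typ_of (\<Gamma> @ \<tau> # \<Delta>) t = Some \<sigma> \<Longrightarrow>
    inst_t (length \<Gamma>) u (psub_t (Suc (length \<Gamma>)) e t) = psub_t (length \<Gamma>) (u # e) t"
proof (induction t arbitrary: \<sigma>)
  case (Bnd j)
  have "inst_t (length \<Gamma>) u (e ! (j - Suc (length \<Gamma>))) = e ! (j - Suc (length \<Gamma>))" if "Suc (length \<Gamma>) \<le> j"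
  proof (rule inst_t_typed)
    show "typ_of [] (e ! (j - Suc (length \<Gamma>))) = Some (\<Delta> ! (j - Suc (length \<Gamma>)))"
      using assms Bnd that by (auto simp: list_all2_conv_all_nth split: if_splits)
  qed simp
  then show ?case by (auto simp: nth_Cons' Suc_diff_Suc)
qed (auto split: option.splits ty.splits if_splits)

lemma inst_psub:
  assumes "etyped e \<Delta>"
  shows "wff (\<Gamma> @ \<tau> # \<Delta>) A \<Longrightarrow> inst (length \<Gamma>) u (psub (Suc (length \<Gamma>)) e A) = psub (length \<Gamma>) (u # e) A"
proof (induction A arbitrary: \<Gamma>)
  case (All \<sigma> A)
  from All.IH[of "\<sigma> # \<Gamma>"] All.prems show ?case by simp
qed (auto simp: inst_psub_t[OF assms])

lemma psub_t_Nil: "typ_of \<Gamma> t = Some \<sigma> \<Longrightarrow> psub_t (length \<Gamma>) [] t = t"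
  by (induction t arbitrary: \<sigma>) (auto split: option.splits ty.splits if_splits)

lemma psub_Nil: "wff \<Gamma> A \<Longrightarrow> psub (length \<Gamma>) [] A = A"
proof (induction A arbitrary: \<Gamma>)
  case (All \<sigma> A)
  from All.IH[of "\<sigma> # \<Gamma>"] All.prems show ?case by simp
qed (auto simp: psub_t_Nil)

locale henkin =
  fixes T G :: "fm set"
  assumes G: "henkin_set T G"
begin

abbreviation teq :: "trm \<Rightarrow> trm \<Rightarrow> bool" where "teq s t \<equiv> Eq s t \<in> G"
abbreviation tls :: "trm \<Rightarrow> trm \<Rightarrow> bool" where "tls s t \<equiv> Less s t \<in> G"
abbreviation tsat :: "trm valuation \<Rightarrow> trm list \<Rightarrow> fm \<Rightarrow> bool" where
  "tsat \<equiv> sat tdom App Cst teq tls"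

text \<open>The domain consists of terms, so extending the environment by one of its elements is the
  substitution instance in the quantifier clause of \<open>henkin_set\<close>.\<close>

lemma truth: "wff \<Delta> A \<Longrightarrow> etyped e \<Delta> \<Longrightarrow> tsat idv e A \<longleftrightarrow> psub 0 e A \<in> G"
proof (induction A arbitrary: \<Delta> e)
  case Fls then show ?case using G by (simp add: henkin_set_def)
next
  case (Imp A B)
  then have "wff [] (psub 0 e A)" "wff [] (psub 0 e B)" using wff_psub[of "[]"] by auto
  then show ?case using Imp G by (auto simp: henkin_set_def)
next
  case (All \<tau> A)
  have "wff [\<tau>] (psub 1 e A)" using All.prems wff_psub[of "[\<tau>]" \<Delta> A e] by simp
  then have "All \<tau> (psub 1 e A) \<in> G \<longleftrightarrow> (\<forall>t. typ_of [] t = Some \<tau> \<longrightarrow> inst 0 t (psub 1 e A) \<in> G)"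
    using G unfolding henkin_set_def by blast
  moreover have "inst 0 t (psub 1 e A) = psub 0 (t # e) A" for t
    using inst_psub[OF All.prems(2), of "[]" \<tau> A] All.prems by simp
  ultimately show ?case using All.IH[of "\<tau> # \<Delta>"] All.prems by auto
qed (simp_all only: sat.simps psub.simps val_idv)

lemma prov_tsat_idv: "T \<^bold>\<turnstile> A \<Longrightarrow> tsat idv [] A"
  using truth[of "[]" A "[]"] psub_Nil[of "[]" A] prov_wff[of T A] G by (auto simp: henkin_set_def)

lemma prov_AllV: "T \<^bold>\<turnstile> A \<Longrightarrow> T \<^bold>\<turnstile> AllV x \<tau> A"
  unfolding AllV_def using prov_wff[of T A]
  by (intro prov_gen[where x = x]) (auto simp: inst_close0 frees_close)

text \<open>\<open>truth\<close> covers the identity valuation only. Generalising a theorem over one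
  variable and instantiating it at a chosen element changes the valuation at that variable, and only
  finitely many variables matter.\<close>

lemma prov_tsat:
  assumes pr: "T \<^bold>\<turnstile> A" and ok: "val_ok tdom \<rho>"
  shows "tsat \<rho> [] A"
proof -
  have *: "T \<^bold>\<turnstile> B \<Longrightarrow> val_ok tdom \<rho>' \<Longrightarrow> \<forall>v. v \<notin> set vs \<longrightarrow> \<rho>' v = idv v \<Longrightarrow> tsat \<rho>' [] B" for vs \<rho>' B
  proof (induction vs arbitrary: B \<rho>')
    case Nil
    then have "\<rho>' = idv" by auto
    then show ?case using prov_tsat_idv Nil by simp
  next
    case (Cons v vs)
    obtain x \<tau> where v: "v = (x, \<tau>)" by force
    let ?\<rho> = "\<rho>'(v := Var x \<tau>)"
    have "tsat ?\<rho> [] (AllV x \<tau> B)"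
      using Cons.prems by (intro Cons.IH prov_AllV) (auto simp: val_ok_def v)
    then have "tsat (?\<rho>((x, \<tau>) := \<rho>' (x, \<tau>))) [] B"
      using Cons.prems by (auto simp: sat_AllV prov_wff[OF Cons.prems(1)] val_ok_def)
    then show ?case by (simp add: v)
  qed
  obtain vs where vs: "set vs = frees A" using finite_list[OF finite_frees] by blast
  let ?\<rho> = "\<lambda>v. if v \<in> frees A then \<rho> v else idv v"
  have "tsat ?\<rho> [] A" by (rule *[OF pr, of _ vs]) (use ok vs in \<open>auto simp: val_ok_def\<close>)
  then show ?thesis using sat_cong[of A ?\<rho> \<rho>] by auto
qed

lemma not_tsat: "wff [] A \<Longrightarrow> A \<notin> G \<Longrightarrow> \<not> tsat idv [] A"
  using truth[of "[]" A "[]"] psub_Nil[of "[]" A] by auto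

lemma derives_rewrite:
  assumes "wff [Num] A" "(s \<^bold>= t) \<in> set H" "typ_of [] s = Some Num" "typ_of [] t = Some Num"
    "derives T H B" "B = inst 0 s A" "C = inst 0 t A"
  shows "derives T H C"
  using derives.EqSubst[OF assms(1) derives.Assm[OF assms(2)]] assms(3-) by simp

lemma prov_eq_sym: "T \<^bold>\<turnstile> (Var 0 Num \<^bold>= Var 1 Num \<^bold>\<longrightarrow> Var 1 Num \<^bold>= Var 0 Num)"
  unfolding proves_def
  by (intro derives.ImpI, simp,
      rule derives_rewrite[of "Bnd 0 \<^bold>= Var 0 Num" "Var 0 Num" "Var 1 Num" _ "Var 0 Num \<^bold>= Var 0 Num"])
    (auto intro: derives.EqRefl)

lemma prov_eq_trans:
  "T \<^bold>\<turnstile> (Var 0 Num \<^bold>= Var 1 Num \<^bold>\<longrightarrow> Var 1 Num \<^bold>= Var 2 Num \<^bold>\<longrightarrow> Var 0 Num \<^bold>= Var 2 Num)"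
  unfolding proves_def
  by (intro derives.ImpI, simp, simp,
      rule derives_rewrite[of "Var 0 Num \<^bold>= Bnd 0" "Var 1 Num" "Var 2 Num" _ "Var 0 Num \<^bold>= Var 1 Num"])
    (auto intro: derives.Assm)

lemma prov_less_left:
  "T \<^bold>\<turnstile> (Var 0 Num \<^bold>= Var 1 Num \<^bold>\<longrightarrow> Var 0 Num \<^bold>< Var 2 Num \<^bold>\<longrightarrow> Var 1 Num \<^bold>< Var 2 Num)"
  unfolding proves_def
  by (intro derives.ImpI, simp, simp,
      rule derives_rewrite[of "Bnd 0 \<^bold>< Var 2 Num" "Var 0 Num" "Var 1 Num" _ "Var 0 Num \<^bold>< Var 2 Num"])
    (auto intro: derives.Assm)

lemma prov_less_right:
  "T \<^bold>\<turnstile> (Var 0 Num \<^bold>= Var 1 Num \<^bold>\<longrightarrow> Var 2 Num \<^bold>< Var 0 Num \<^bold>\<longrightarrow> Var 2 Num \<^bold>< Var 1 Num)"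
  unfolding proves_def
  by (intro derives.ImpI, simp, simp,
      rule derives_rewrite[of "Var 2 Num \<^bold>< Bnd 0" "Var 0 Num" "Var 1 Num" _ "Var 2 Num \<^bold>< Var 0 Num"])
    (auto intro: derives.Assm)

lemma val_ok_upd: "val_ok tdom \<rho> \<Longrightarrow> typ_of [] a = Some \<tau> \<Longrightarrow> val_ok tdom (\<rho>((x, \<tau>) := a))"
  by (simp add: val_ok_def)

lemma val_ok_idv: "val_ok tdom idv"
  by (simp add: val_ok_def)

lemma teq_refl: "a \<in> tdom Num \<Longrightarrow> teq a a"
  using G derives.EqRefl[of a] by (auto simp: henkin_set_def proves_def)

lemma teq_sym: "a \<in> tdom Num \<Longrightarrow> b \<in> tdom Num \<Longrightarrow> teq a b \<Longrightarrow> teq b a"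
  using prov_tsat[OF prov_eq_sym, of "idv((0, Num) := a, (1, Num) := b)"] by (simp add: val_ok_upd val_ok_idv)

lemma teq_trans: "a \<in> tdom Num \<Longrightarrow> b \<in> tdom Num \<Longrightarrow> c \<in> tdom Num \<Longrightarrow> teq a b \<Longrightarrow> teq b c \<Longrightarrow> teq a c"
  using prov_tsat[OF prov_eq_trans, of "idv((0, Num) := a, (1, Num) := b, (2, Num) := c)"]
  by (simp add: val_ok_upd val_ok_idv)

lemma tls_left: "a \<in> tdom Num \<Longrightarrow> b \<in> tdom Num \<Longrightarrow> c \<in> tdom Num \<Longrightarrow> teq a b \<Longrightarrow> tls a c \<Longrightarrow> tls b c"
  using prov_tsat[OF prov_less_left, of "idv((0, Num) := a, (1, Num) := b, (2, Num) := c)"]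
  by (simp add: val_ok_upd val_ok_idv)

lemma tls_right: "a \<in> tdom Num \<Longrightarrow> b \<in> tdom Num \<Longrightarrow> c \<in> tdom Num \<Longrightarrow> teq a b \<Longrightarrow> tls c a \<Longrightarrow> tls c b"
  using prov_tsat[OF prov_less_right, of "idv((0, Num) := a, (1, Num) := b, (2, Num) := c)"]
  by (simp add: val_ok_upd val_ok_idv)

end

section \<open>Formulas with meta-level binders\<close>

lemma frees_t_bound: "v \<in> frees_t t \<Longrightarrow> fst v < bound_t t"
  by (induction t) auto

lemma frees_bound: "v \<in> frees A \<Longrightarrow> fst v < bound A"
  by (induction A) (auto dest: frees_t_bound)

lemma frees_Forall: "(\<And>x. S \<subseteq> frees (F (Var x \<tau>))) \<Longrightarrow> S \<subseteq> frees (Forall \<tau> F)"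
  using frees_bound[of _ "F (Var 0 \<tau>)"]
  by (fastforce simp: Forall_def Let_def AllV_def frees_close)

lemma wff_AllV: "wff [] A \<Longrightarrow> wff [] (AllV x \<tau> A)"
  by (simp add: AllV_def wff_close0)

lemma wff_Forall: "(\<And>x. wff [] (F (Var x \<tau>))) \<Longrightarrow> wff [] (Forall \<tau> F)"
  by (simp add: Forall_def Let_def wff_AllV)

text \<open>The valuations agreeing with \<open>\<rho>\<close> on a set \<open>S\<close> of variables free in the body absorb the
  choice of the name of the bound variable.\<close>

lemma sat_Forall:
  assumes wff: "\<And>x. wff [] (F (Var x \<tau>))" and S: "\<And>x. S \<subseteq> frees (F (Var x \<tau>))"
    and ok: "val_ok D \<rho>"
    and body: "\<And>x a \<rho>'. a \<in> D \<tau> \<Longrightarrow> val_ok D \<rho>' \<Longrightarrow> \<rho>' (x, \<tau>) = a \<Longrightarrow> \<forall>v\<in>S. \<rho>' v = \<rho> v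
      \<Longrightarrow> sat D ap I eq ls \<rho>' [] (F (Var x \<tau>)) = P a"
  shows "sat D ap I eq ls \<rho> [] (Forall \<tau> F) = (\<forall>a\<in>D \<tau>. P a)"
proof -
  let ?x = "bound (F (Var 0 \<tau>))"
  have "(?x, \<tau>) \<notin> S" using S[of 0] frees_bound[of "(?x, \<tau>)" "F (Var 0 \<tau>)"] by auto
  then have "sat D ap I eq ls (\<rho>((?x, \<tau>) := a)) [] (F (Var ?x \<tau>)) = P a" if "a \<in> D \<tau>" for a
    by (intro body) (use that ok in \<open>auto simp: val_ok_def\<close>)
  then show ?thesis by (simp add: Forall_def Let_def sat_AllV[OF wff])
qed

lemma val_agree: "\<forall>v\<in>S. \<rho>' v = \<rho> v \<Longrightarrow> frees_t t \<subseteq> S \<Longrightarrow> val ap I \<rho>' e t = val ap I \<rho> e t"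
  by (rule val_cong) auto

primrec EQ :: "(ty \<Rightarrow> 'u set) \<Rightarrow> ('u \<Rightarrow> 'u \<Rightarrow> 'u) \<Rightarrow> ('u \<Rightarrow> 'u \<Rightarrow> bool) \<Rightarrow> ty \<Rightarrow> 'u \<Rightarrow> 'u \<Rightarrow> bool" where
  "EQ D ap eq Num = eq"
| "EQ D ap eq (\<sigma> \<^bold>\<rightarrow> \<tau>) = (\<lambda>f g. \<forall>a\<in>D \<sigma>. EQ D ap eq \<tau> (ap f a) (ap g a))"

lemma frees_eq_ty: "frees_t s \<union> frees_t t \<subseteq> frees (eq_ty \<tau> s t)"
proof (induction \<tau> arbitrary: s t)
  case (Fn \<sigma> \<tau>)
  have "frees_t s \<union> frees_t t \<subseteq> frees (eq_ty \<tau> (s \<^bold>\<cdot> Var x \<sigma>) (t \<^bold>\<cdot> Var x \<sigma>))" for x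
    using Fn.IH(2)[of "s \<^bold>\<cdot> Var x \<sigma>" "t \<^bold>\<cdot> Var x \<sigma>"] by auto
  then show ?case by (simp add: frees_Forall)
qed simp

lemma wff_eq_ty: "typ_of [] s = Some \<tau> \<Longrightarrow> typ_of [] t = Some \<tau> \<Longrightarrow> wff [] (eq_ty \<tau> s t)"
  by (induction \<tau> arbitrary: s t) (auto intro!: wff_Forall)

lemma sat_eq_ty:
  assumes "typ_of [] s = Some \<tau>" "typ_of [] t = Some \<tau>" "val_ok D \<rho>"
  shows "sat D ap I eq ls \<rho> [] (eq_ty \<tau> s t) = EQ D ap eq \<tau> (val ap I \<rho> [] s) (val ap I \<rho> [] t)"
  using assms
proof (induction \<tau> arbitrary: s t \<rho>)
  case (Fn \<sigma> \<tau>)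
  show ?case unfolding eq_ty.simps EQ.simps
  proof (rule sat_Forall[where S = "frees_t s \<union> frees_t t"])
    show "wff [] (eq_ty \<tau> (s \<^bold>\<cdot> Var x \<sigma>) (t \<^bold>\<cdot> Var x \<sigma>))" for x using Fn.prems by (auto intro!: wff_eq_ty)
    show "frees_t s \<union> frees_t t \<subseteq> frees (eq_ty \<tau> (s \<^bold>\<cdot> Var x \<sigma>) (t \<^bold>\<cdot> Var x \<sigma>))" for x
      using frees_eq_ty[of "s \<^bold>\<cdot> Var x \<sigma>" "t \<^bold>\<cdot> Var x \<sigma>" \<tau>] by auto
    fix x a \<rho>'
    assume "val_ok D \<rho>'" "\<rho>' (x, \<sigma>) = a" and agree: "\<forall>v\<in>frees_t s \<union> frees_t t. \<rho>' v = \<rho> v"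
    then show "sat D ap I eq ls \<rho>' [] (eq_ty \<tau> (s \<^bold>\<cdot> Var x \<sigma>) (t \<^bold>\<cdot> Var x \<sigma>)) =
        EQ D ap eq \<tau> (ap (val ap I \<rho> [] s) a) (ap (val ap I \<rho> [] t) a)"
      using Fn.IH(2)[of "s \<^bold>\<cdot> Var x \<sigma>" "t \<^bold>\<cdot> Var x \<sigma>" \<rho>'] Fn.prems
        val_agree[OF agree, of s] val_agree[OF agree, of t] by simp
  qed fact
qed simp

abbreviation ext_fm :: "ty \<Rightarrow> ty \<Rightarrow> fm" where
  "ext_fm \<sigma> \<tau> \<equiv> Forall \<sigma> (\<lambda>x. Forall \<sigma> (\<lambda>y. Forall (\<sigma> \<^bold>\<rightarrow> \<tau>) (\<lambda>f.
        eq_ty \<sigma> x y \<^bold>\<longrightarrow> eq_ty \<tau> (f \<^bold>\<cdot> x) (f \<^bold>\<cdot> y))))"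

lemma sat_extensionality:
  assumes "val_ok D \<rho>"
  shows "sat D ap I eq ls \<rho> [] (ext_fm \<sigma> \<tau>) =
     (\<forall>a\<in>D \<sigma>. \<forall>b\<in>D \<sigma>. \<forall>f\<in>D (\<sigma> \<^bold>\<rightarrow> \<tau>). EQ D ap eq \<sigma> a b \<longrightarrow> EQ D ap eq \<tau> (ap f a) (ap f b))"
    and "wff [] (ext_fm \<sigma> \<tau>)"
proof -
  let ?C = "\<lambda>x y f. eq_ty \<sigma> x y \<^bold>\<longrightarrow> eq_ty \<tau> (f \<^bold>\<cdot> x) (f \<^bold>\<cdot> y)"
  have w: "wff [] (?C (Var x \<sigma>) (Var y \<sigma>) (Var f (\<sigma> \<^bold>\<rightarrow> \<tau>)))" for x y f by (simp add: wff_eq_ty)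
  have s: "{(x, \<sigma>), (y, \<sigma>)} \<subseteq> frees (?C (Var x \<sigma>) (Var y \<sigma>) f)" for x y f
    using frees_eq_ty[of "Var x \<sigma>" "Var y \<sigma>" \<sigma>] by auto
  show "wff [] (ext_fm \<sigma> \<tau>)" by (intro wff_Forall w)
  show "sat D ap I eq ls \<rho> [] (ext_fm \<sigma> \<tau>) = (\<forall>a\<in>D \<sigma>. \<forall>b\<in>D \<sigma>. \<forall>f\<in>D (\<sigma> \<^bold>\<rightarrow> \<tau>). EQ D ap eq \<sigma> a b \<longrightarrow> EQ D ap eq \<tau> (ap f a) (ap f b))"
  proof (rule sat_Forall[where S = "{}"])
    fix x a \<rho>1 assume 1: "a \<in> D \<sigma>" "val_ok D \<rho>1" "\<rho>1 (x, \<sigma>) = a"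
    show "sat D ap I eq ls \<rho>1 [] (Forall \<sigma> (\<lambda>y. Forall (\<sigma> \<^bold>\<rightarrow> \<tau>) (\<lambda>f. ?C (Var x \<sigma>) y f))) =
      (\<forall>b\<in>D \<sigma>. \<forall>f\<in>D (\<sigma> \<^bold>\<rightarrow> \<tau>). EQ D ap eq \<sigma> a b \<longrightarrow> EQ D ap eq \<tau> (ap f a) (ap f b))"
    proof (rule sat_Forall[where S = "{(x, \<sigma>)}"])
      fix y b \<rho>2 assume 2: "b \<in> D \<sigma>" "val_ok D \<rho>2" "\<rho>2 (y, \<sigma>) = b" "\<forall>v\<in>{(x, \<sigma>)}. \<rho>2 v = \<rho>1 v"
      show "sat D ap I eq ls \<rho>2 [] (Forall (\<sigma> \<^bold>\<rightarrow> \<tau>) (\<lambda>f. ?C (Var x \<sigma>) (Var y \<sigma>) f)) =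
        (\<forall>f\<in>D (\<sigma> \<^bold>\<rightarrow> \<tau>). EQ D ap eq \<sigma> a b \<longrightarrow> EQ D ap eq \<tau> (ap f a) (ap f b))"
      proof (rule sat_Forall[where S = "{(x, \<sigma>), (y, \<sigma>)}"])
        fix f c \<rho>3 assume 3: "c \<in> D (\<sigma> \<^bold>\<rightarrow> \<tau>)" "val_ok D \<rho>3" "\<rho>3 (f, \<sigma> \<^bold>\<rightarrow> \<tau>) = c"
            "\<forall>v\<in>{(x, \<sigma>), (y, \<sigma>)}. \<rho>3 v = \<rho>2 v"
        then show "sat D ap I eq ls \<rho>3 [] (?C (Var x \<sigma>) (Var y \<sigma>) (Var f (\<sigma> \<^bold>\<rightarrow> \<tau>))) =
          (EQ D ap eq \<sigma> a b \<longrightarrow> EQ D ap eq \<tau> (ap c a) (ap c b))"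
          using 1 2 by (simp add: sat_eq_ty)
      qed (rule w s 2)+
    next
      fix y show "{(x, \<sigma>)} \<subseteq> frees (Forall (\<sigma> \<^bold>\<rightarrow> \<tau>) (\<lambda>f. ?C (Var x \<sigma>) (Var y \<sigma>) f))"
        by (rule frees_Forall) (use s[of x y] in blast)
    qed (rule wff_Forall w 1)+
  qed (rule wff_Forall w assms empty_subsetI)+
qed

section \<open>The extensional quotient\<close>

text \<open>Henkin models in extensional form: elements of a function type are determined by their
  values, but need not exhaust the functions between the domains, and numerals need not exhaust
  \<open>D Num\<close>.\<close>

definition is_model :: "fm set \<Rightarrow> (ty \<Rightarrow> 'u set) \<Rightarrow> ('u \<Rightarrow> 'u \<Rightarrow> 'u) \<Rightarrow> (const \<Rightarrow> 'u) \<Rightarrow> ('u \<Rightarrow> 'u \<Rightarrow> bool) \<Rightarrow> bool" where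
  "is_model T D ap I ls \<longleftrightarrow>
     (\<forall>c. I c \<in> D (const_ty c)) \<and>
     (\<forall>\<sigma> \<tau>. \<forall>f\<in>D (\<sigma> \<^bold>\<rightarrow> \<tau>). \<forall>a\<in>D \<sigma>. ap f a \<in> D \<tau>) \<and>
     (\<forall>\<sigma> \<tau>. \<forall>f\<in>D (\<sigma> \<^bold>\<rightarrow> \<tau>). \<forall>g\<in>D (\<sigma> \<^bold>\<rightarrow> \<tau>). (\<forall>a\<in>D \<sigma>. ap f a = ap g a) \<longrightarrow> f = g) \<and>
     (\<forall>A \<rho>. (T \<^bold>\<turnstile> A) \<longrightarrow> val_ok D \<rho> \<longrightarrow> sat D ap I (=) ls \<rho> [] A)"

locale ext_henkin = henkin +
  assumes ext_ax: "extensionality_axioms \<subseteq> T"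
begin

abbreviation E :: "ty \<Rightarrow> trm \<Rightarrow> trm \<Rightarrow> bool" where "E \<equiv> EQ tdom App teq"

lemma E_refl: "a \<in> tdom \<tau> \<Longrightarrow> E \<tau> a a"
  by (induction \<tau> arbitrary: a) (auto intro: teq_refl)

lemma E_sym: "a \<in> tdom \<tau> \<Longrightarrow> b \<in> tdom \<tau> \<Longrightarrow> E \<tau> a b \<Longrightarrow> E \<tau> b a"
  by (induction \<tau> arbitrary: a b) (auto intro: teq_sym)

lemma E_trans: "a \<in> tdom \<tau> \<Longrightarrow> b \<in> tdom \<tau> \<Longrightarrow> c \<in> tdom \<tau> \<Longrightarrow> E \<tau> a b \<Longrightarrow> E \<tau> b c \<Longrightarrow> E \<tau> a c"
proof (induction \<tau> arbitrary: a b c)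
  case Num then show ?case using teq_trans[of a b c] by simp
next
  case (Fn \<sigma> \<tau>)
  show ?case unfolding EQ.simps
  proof
    fix x assume x: "x \<in> tdom \<sigma>"
    have "E \<tau> (a \<^bold>\<cdot> x) (b \<^bold>\<cdot> x)" "E \<tau> (b \<^bold>\<cdot> x) (c \<^bold>\<cdot> x)" using Fn.prems(4,5) x by simp_all
    moreover have "a \<^bold>\<cdot> x \<in> tdom \<tau>" "b \<^bold>\<cdot> x \<in> tdom \<tau>" "c \<^bold>\<cdot> x \<in> tdom \<tau>" using Fn.prems(1-3) x by simp_all
    ultimately show "E \<tau> (a \<^bold>\<cdot> x) (c \<^bold>\<cdot> x)" using Fn.IH(2) by blast
  qed
qed

text \<open>Here the extensionality axioms enter: application respects pointwise equality in its
  argument as well, so it descends to classes.\<close>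

lemma E_app:
  assumes "f \<in> tdom (\<sigma> \<^bold>\<rightarrow> \<tau>)" "g \<in> tdom (\<sigma> \<^bold>\<rightarrow> \<tau>)" "a \<in> tdom \<sigma>" "b \<in> tdom \<sigma>" "E (\<sigma> \<^bold>\<rightarrow> \<tau>) f g" "E \<sigma> a b"
  shows "E \<tau> (f \<^bold>\<cdot> a) (g \<^bold>\<cdot> b)"
proof -
  let ?A = "ext_fm \<sigma> \<tau>"
  have "?A \<in> T" using ext_ax by (auto simp: extensionality_axioms_def)
  then have "T \<^bold>\<turnstile> ?A" unfolding proves_def by (intro derives.Ax sat_extensionality(2)[OF val_ok_idv])
  then have "\<forall>a\<in>tdom \<sigma>. \<forall>b\<in>tdom \<sigma>. \<forall>f\<in>tdom (\<sigma> \<^bold>\<rightarrow> \<tau>). E \<sigma> a b \<longrightarrow> E \<tau> (f \<^bold>\<cdot> a) (f \<^bold>\<cdot> b)"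
    using prov_tsat[OF _ val_ok_idv] sat_extensionality(1)[OF val_ok_idv, of App Cst teq tls] by blast
  then have "E \<tau> (g \<^bold>\<cdot> a) (g \<^bold>\<cdot> b)" using assms by blast
  moreover have "E \<tau> (f \<^bold>\<cdot> a) (g \<^bold>\<cdot> a)" using assms by simp
  ultimately show ?thesis using assms by (intro E_trans[of "f \<^bold>\<cdot> a" \<tau> "g \<^bold>\<cdot> a" "g \<^bold>\<cdot> b"]) auto
qed

text \<open>For typed terms the choice depends on the class of \<open>t\<close> only, so
  representatives can stand for classes and the universe remains the countable type
  \<open>trm\<close>.\<close>

definition rep :: "trm \<Rightarrow> trm" where
  "rep t = (SOME s. typ_of [] s = typ_of [] t \<and> E (the (typ_of [] t)) t s)"

lemma rep:
  assumes "t \<in> tdom \<tau>"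
  shows "rep t \<in> tdom \<tau>" "E \<tau> t (rep t)"
proof -
  have "\<exists>s. typ_of [] s = typ_of [] t \<and> E (the (typ_of [] t)) t s" using E_refl assms by auto
  from someI_ex[OF this] show "rep t \<in> tdom \<tau>" "E \<tau> t (rep t)" using assms unfolding rep_def by simp_all
qed

lemma rep_eq_iff:
  assumes "s \<in> tdom \<tau>" "t \<in> tdom \<tau>"
  shows "rep s = rep t \<longleftrightarrow> E \<tau> s t"
proof
  assume "rep s = rep t"
  then show "E \<tau> s t"
    using rep[OF assms(1)] rep[OF assms(2)] E_sym[of t \<tau> "rep t"] assms
    by (intro E_trans[of s \<tau> "rep s" t]) auto
next
  assume st: "E \<tau> s t"
  have "E \<tau> s u \<longleftrightarrow> E \<tau> t u" if "u \<in> tdom \<tau>" for u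
    using E_trans[of s \<tau> t u] E_trans[of t \<tau> s u] E_sym[of s \<tau> t] st that assms by blast
  then have "(typ_of [] u = typ_of [] s \<and> E (the (typ_of [] s)) s u) = (typ_of [] u = typ_of [] t \<and> E (the (typ_of [] t)) t u)" for u
    using assms by auto
  then show "rep s = rep t" unfolding rep_def by simp
qed

definition qdom :: "ty \<Rightarrow> trm set" where "qdom \<tau> = rep ` tdom \<tau>"
definition qap :: "trm \<Rightarrow> trm \<Rightarrow> trm" where "qap a b = rep (a \<^bold>\<cdot> b)"

lemma rep_rep: "t \<in> tdom \<tau> \<Longrightarrow> rep (rep t) = rep t"
  using rep[of t \<tau>] rep_eq_iff[of "rep t" \<tau> t] E_sym[of t \<tau> "rep t"] by auto

lemma qdom_tdom: "t \<in> qdom \<tau> \<Longrightarrow> t \<in> tdom \<tau> \<and> rep t = t"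
  using rep(1) rep_rep by (auto simp: qdom_def simp del: mem_Collect_eq)

lemma qap_rep:
  assumes "f \<in> tdom (\<sigma> \<^bold>\<rightarrow> \<tau>)" "a \<in> tdom \<sigma>"
  shows "qap (rep f) (rep a) = rep (f \<^bold>\<cdot> a)"
proof -
  have "E \<tau> (rep f \<^bold>\<cdot> rep a) (f \<^bold>\<cdot> a)"
    using rep[OF assms(1)] rep[OF assms(2)] assms by (intro E_app[where \<sigma> = \<sigma>] E_sym[of _ _ "rep _"]) auto
  then show ?thesis unfolding qap_def using rep(1)[OF assms(1)] rep(1)[OF assms(2)] assms
    by (intro rep_eq_iff[THEN iffD2, of _ \<tau>]) auto
qed

lemma val_typed: "typ_of \<Delta> t = Some \<tau> \<Longrightarrow> val_ok tdom \<rho> \<Longrightarrow> etyped e \<Delta> \<Longrightarrow> val App Cst \<rho> e t \<in> tdom \<tau>"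
  by (induction t arbitrary: \<tau>)
    (auto simp: val_ok_def list_all2_conv_all_nth split: option.splits ty.splits if_splits)

lemma val_rep: "typ_of \<Delta> t = Some \<tau> \<Longrightarrow> val_ok tdom \<rho> \<Longrightarrow> etyped e \<Delta> \<Longrightarrow>
   val qap (rep \<circ> Cst) (rep \<circ> \<rho>) (map rep e) t = rep (val App Cst \<rho> e t)"
proof (induction t arbitrary: \<tau>)
  case (Bnd k) then show ?case by (auto simp: list_all2_conv_all_nth split: if_splits)
next
  case (App s t)
  then obtain \<sigma> where st: "typ_of \<Delta> s = Some (\<sigma> \<^bold>\<rightarrow> \<tau>)" "typ_of \<Delta> t = Some \<sigma>"
    by (auto split: option.splits ty.splits if_splits)
  then show ?case using App.IH App.prems
    by (simp add: qap_rep[OF val_typed[OF st(1)] val_typed[OF st(2)]])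
qed auto

lemma sat_rep: "wff \<Delta> A \<Longrightarrow> val_ok tdom \<rho> \<Longrightarrow> etyped e \<Delta> \<Longrightarrow>
   sat qdom qap (rep \<circ> Cst) (=) tls (rep \<circ> \<rho>) (map rep e) A = tsat \<rho> e A"
proof (induction A arbitrary: \<Delta> e)
  case (Eq s t)
  have "val App Cst \<rho> e s \<in> tdom Num" "val App Cst \<rho> e t \<in> tdom Num"
    using val_typed[of \<Delta> s Num \<rho> e] val_typed[of \<Delta> t Num \<rho> e] Eq by simp_all
  then have "(rep (val App Cst \<rho> e s) = rep (val App Cst \<rho> e t)) = teq (val App Cst \<rho> e s) (val App Cst \<rho> e t)"
    using rep_eq_iff[of _ Num] by simp
  then show ?case using Eq val_rep[of \<Delta> s Num \<rho> e] val_rep[of \<Delta> t Num \<rho> e] by (simp only: sat.simps wff.simps)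
next
  case (Less s t)
  let ?s = "val App Cst \<rho> e s" and ?t = "val App Cst \<rho> e t"
  have st: "?s \<in> tdom Num" "?t \<in> tdom Num" using Less val_typed[of \<Delta> _ Num \<rho> e] by auto
  note r = rep[OF st(1)] rep[OF st(2)]
  then have e: "teq ?s (rep ?s)" "teq ?t (rep ?t)" by simp_all
  have e': "teq (rep ?s) ?s" "teq (rep ?t) ?t" using teq_sym e r st by blast+
  have "tls (rep ?s) (rep ?t) = tls ?s ?t"
    using tls_left[OF r(1) st(1) r(3) e'(1)] tls_right[OF r(3) st(2) st(1) e'(2)]
      tls_left[OF st(1) r(1) st(2) e(1)] tls_right[OF st(2) r(3) r(1) e(2)] by blast
  then show ?case using Less val_rep[of \<Delta> s Num \<rho> e] val_rep[of \<Delta> t Num \<rho> e] by (simp only: sat.simps wff.simps)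
next
  case (All \<tau> A)
  have "sat qdom qap (rep \<circ> Cst) (=) tls (rep \<circ> \<rho>) (rep a # map rep e) A = tsat \<rho> (a # e) A" if "a \<in> tdom \<tau>" for a
    using All.IH[of "\<tau> # \<Delta>" "a # e"] All.prems that by (simp add: comp_def)
  moreover have "(\<forall>a\<in>qdom \<tau>. P a) \<longleftrightarrow> (\<forall>a\<in>tdom \<tau>. P (rep a))" for P
    by (simp add: qdom_def[of \<tau>])
  ultimately show ?case by (simp add: comp_def)
qed auto

lemma is_model_quotient: "is_model T qdom qap (rep \<circ> Cst) tls"
  unfolding is_model_def
proof (intro conjI allI ballI impI)
  show "(rep \<circ> Cst) c \<in> qdom (const_ty c)" for c by (auto simp: qdom_def)
  show "qap f a \<in> qdom \<tau>" if "f \<in> qdom (\<sigma> \<^bold>\<rightarrow> \<tau>)" "a \<in> qdom \<sigma>" for \<sigma> \<tau> f a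
    using qdom_tdom[OF that(1)] qdom_tdom[OF that(2)] by (auto simp: qdom_def qap_def)
  show "f = g" if f: "f \<in> qdom (\<sigma> \<^bold>\<rightarrow> \<tau>)" and g: "g \<in> qdom (\<sigma> \<^bold>\<rightarrow> \<tau>)" and fg: "\<forall>a\<in>qdom \<sigma>. qap f a = qap g a" for \<sigma> \<tau> f g
  proof -
    note F = qdom_tdom[OF f] and G = qdom_tdom[OF g]
    have "E \<tau> (f \<^bold>\<cdot> a) (g \<^bold>\<cdot> a)" if a: "a \<in> tdom \<sigma>" for a
    proof -
      have "qap (rep f) (rep a) = qap (rep g) (rep a)" using F G fg a by (auto simp: qdom_def)
      then have "rep (f \<^bold>\<cdot> a) = rep (g \<^bold>\<cdot> a)"
        using F G a qap_rep[of f \<sigma> \<tau> a] qap_rep[of g \<sigma> \<tau> a] by simp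
      then show ?thesis using F G a by (subst rep_eq_iff[symmetric]) auto
    qed
    then have "rep f = rep g" using F G by (subst rep_eq_iff[of _ "\<sigma> \<^bold>\<rightarrow> \<tau>"]) auto
    then show ?thesis using F G by simp
  qed
  show "sat qdom qap (rep \<circ> Cst) (=) tls \<rho> [] A" if "T \<^bold>\<turnstile> A" "val_ok qdom \<rho>" for A \<rho>
  proof -
    have ok: "val_ok tdom \<rho>" and "rep \<circ> \<rho> = \<rho>"
      using that(2) qdom_tdom by (auto simp: val_ok_def fun_eq_iff)
    then show ?thesis using sat_rep[of "[]" A \<rho> "[]"] prov_tsat[OF that(1) ok] prov_wff[OF that(1)] by simp
  qed
qed

lemma not_sat_quotient: "wff [] A \<Longrightarrow> A \<notin> G \<Longrightarrow>
   val_ok qdom (rep \<circ> idv) \<and> \<not> sat qdom qap (rep \<circ> Cst) (=) tls (rep \<circ> idv) [] A"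
  using sat_rep[of "[]" A idv "[]"] not_tsat[of A] val_ok_idv by (auto simp: val_ok_def qdom_def)

end

text \<open>The universe \<open>trm\<close> is countable; carrying the numbers of a countermodel
  over to \<open>nat\<close> at the end relies on this.\<close>

theorem completeness:
  assumes "extensionality_axioms \<subseteq> T" "wff [] A" "\<not> (T \<^bold>\<turnstile> A)"
  shows "\<exists>(D :: ty \<Rightarrow> trm set) ap I ls \<rho>. is_model T D ap I ls \<and> val_ok D \<rho> \<and> \<not> sat D ap I (=) ls \<rho> [] A"
proof -
  obtain G where *: "henkin_set T G" "A \<notin> G" using henkin_extension assms by blast
  then interpret ext_henkin T G using assms by unfold_locales auto
  show ?thesis using is_model_quotient not_sat_quotient[OF assms(2) *(2)] by blast
qed

section \<open>Models of the base theory\<close>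

lemma sat_Forall2:
  assumes wff: "\<And>x y. wff [] (F (Var x \<sigma>) (Var y \<tau>))"
    and S: "\<And>x y. insert (x, \<sigma>) S \<subseteq> frees (F (Var x \<sigma>) (Var y \<tau>))"
    and ok: "val_ok D \<rho>"
    and body: "\<And>x y a b \<rho>'. a \<in> D \<sigma> \<Longrightarrow> b \<in> D \<tau> \<Longrightarrow> val_ok D \<rho>' \<Longrightarrow> \<rho>' (x, \<sigma>) = a \<Longrightarrow> \<rho>' (y, \<tau>) = b
      \<Longrightarrow> \<forall>v\<in>S. \<rho>' v = \<rho> v \<Longrightarrow> sat D ap I eq ls \<rho>' [] (F (Var x \<sigma>) (Var y \<tau>)) = P a b"
  shows "sat D ap I eq ls \<rho> [] (Forall \<sigma> (\<lambda>x. Forall \<tau> (\<lambda>y. F x y))) = (\<forall>a\<in>D \<sigma>. \<forall>b\<in>D \<tau>. P a b)"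
proof (rule sat_Forall[where S = S])
  fix x a \<rho>1 assume 1: "a \<in> D \<sigma>" "val_ok D \<rho>1" "\<rho>1 (x, \<sigma>) = a" "\<forall>v\<in>S. \<rho>1 v = \<rho> v"
  show "sat D ap I eq ls \<rho>1 [] (Forall \<tau> (\<lambda>y. F (Var x \<sigma>) y)) = (\<forall>b\<in>D \<tau>. P a b)"
  proof (rule sat_Forall[where S = "insert (x, \<sigma>) S"])
    fix y b \<rho>2 assume "b \<in> D \<tau>" "val_ok D \<rho>2" "\<rho>2 (y, \<tau>) = b" "\<forall>v\<in>insert (x, \<sigma>) S. \<rho>2 v = \<rho>1 v"
    then show "sat D ap I eq ls \<rho>2 [] (F (Var x \<sigma>) (Var y \<tau>)) = P a b"
      using 1 by (intro body) auto
  qed (rule wff S 1)+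
next
  fix x show "S \<subseteq> frees (Forall \<tau> (\<lambda>y. F (Var x \<sigma>) y))"
    by (rule frees_Forall) (use S in blast)
qed (rule wff_Forall wff ok)+

lemma sat_Forall3:
  assumes wff: "\<And>x y z. wff [] (F (Var x \<rho>) (Var y \<sigma>) (Var z \<tau>))"
    and S: "\<And>x y z. insert (x, \<rho>) (insert (y, \<sigma>) S) \<subseteq> frees (F (Var x \<rho>) (Var y \<sigma>) (Var z \<tau>))"
    and ok: "val_ok D w"
    and body: "\<And>x y z a b c w'. a \<in> D \<rho> \<Longrightarrow> b \<in> D \<sigma> \<Longrightarrow> c \<in> D \<tau> \<Longrightarrow> val_ok D w' \<Longrightarrow> w' (x, \<rho>) = a \<Longrightarrow>
      w' (y, \<sigma>) = b \<Longrightarrow> w' (z, \<tau>) = c \<Longrightarrow> \<forall>v\<in>S. w' v = w v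
      \<Longrightarrow> sat D ap I eq ls w' [] (F (Var x \<rho>) (Var y \<sigma>) (Var z \<tau>)) = P a b c"
  shows "sat D ap I eq ls w [] (Forall \<rho> (\<lambda>x. Forall \<sigma> (\<lambda>y. Forall \<tau> (\<lambda>z. F x y z)))) =
    (\<forall>a\<in>D \<rho>. \<forall>b\<in>D \<sigma>. \<forall>c\<in>D \<tau>. P a b c)"
proof (rule sat_Forall[where S = S])
  fix x a w1 assume 1: "a \<in> D \<rho>" "val_ok D w1" "w1 (x, \<rho>) = a" "\<forall>v\<in>S. w1 v = w v"
  show "sat D ap I eq ls w1 [] (Forall \<sigma> (\<lambda>y. Forall \<tau> (\<lambda>z. F (Var x \<rho>) y z))) = (\<forall>b\<in>D \<sigma>. \<forall>c\<in>D \<tau>. P a b c)"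
  proof (rule sat_Forall2[where S = "insert (x, \<rho>) S"])
    fix y z b c w2 assume "b \<in> D \<sigma>" "c \<in> D \<tau>" "val_ok D w2" "w2 (y, \<sigma>) = b" "w2 (z, \<tau>) = c"
      "\<forall>v\<in>insert (x, \<rho>) S. w2 v = w1 v"
    then show "sat D ap I eq ls w2 [] (F (Var x \<rho>) (Var y \<sigma>) (Var z \<tau>)) = P a b c"
      using 1 by (intro body) auto
  next
    fix y z show "insert (y, \<sigma>) (insert (x, \<rho>) S) \<subseteq> frees (F (Var x \<rho>) (Var y \<sigma>) (Var z \<tau>))"
      using S[of x y z] by blast
  qed (rule wff 1)+
next
  fix x show "S \<subseteq> frees (Forall \<sigma> (\<lambda>y. Forall \<tau> (\<lambda>z. F (Var x \<rho>) y z)))"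
    by (intro frees_Forall) (use S in blast)
qed (rule wff_Forall wff ok)+

lemmas binder_defs = All0_def All1_def Ex0_def Ex1_def Exists_def
lemmas prop_defs = Neg_def Disj_def Conj_def Iff_def

lemma typ_of_lamV: "typ_of [] t = Some \<tau> \<Longrightarrow> typ_of [] (lamV x \<sigma> t) = Some (\<sigma> \<^bold>\<rightarrow> \<tau>)"
proof (induction t arbitrary: \<tau>)
  case (App r s)
  then show ?case by (subst lamV.simps) (auto split: option.splits ty.splits if_splits)
qed (subst lamV.simps; auto split: if_splits)+

lemma frees_lamV: "typ_of [] t = Some \<tau> \<Longrightarrow> frees_t (lamV x \<sigma> t) = frees_t t - {(x, \<sigma>)}"
proof (induction t arbitrary: \<tau>)
  case (App r s)
  then show ?case by (subst lamV.simps) (auto split: option.splits ty.splits if_splits)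
qed (subst lamV.simps; auto split: if_splits)+

lemma typ_of_Lam0: "(\<And>x. typ_of [] (F (Var x Num)) = Some \<tau>) \<Longrightarrow> typ_of [] (Lam0 F) = Some (Num \<^bold>\<rightarrow> \<tau>)"
  by (simp add: Lam0_def Let_def typ_of_lamV)

lemma frees_Lam0:
  assumes "\<And>x. typ_of [] (F (Var x Num)) = Some \<tau>" "\<And>x. S \<subseteq> frees_t (F (Var x Num))"
  shows "S \<subseteq> frees_t (Lam0 F)"
proof
  fix v assume v: "v \<in> S"
  then have "fst v < bound_t (F (Var 0 Num))" using assms(2)[of 0] frees_t_bound by blast
  then show "v \<in> frees_t (Lam0 F)" using v assms(2) by (auto simp: Lam0_def Let_def frees_lamV[OF assms(1)])
qed

abbreviation T0 :: "fm set" where "T0 \<equiv> RCA0_omega \<union> QF_AC Num ty1"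

locale model =
  fixes D :: "ty \<Rightarrow> 'u set" and ap :: "'u \<Rightarrow> 'u \<Rightarrow> 'u" and I :: "const \<Rightarrow> 'u" and ls :: "'u \<Rightarrow> 'u \<Rightarrow> bool"
  assumes model: "is_model T0 D ap I ls"
begin

abbreviation mval :: "'u valuation \<Rightarrow> trm \<Rightarrow> 'u" where "mval \<rho> t \<equiv> val ap I \<rho> [] t"
abbreviation msat :: "'u valuation \<Rightarrow> fm \<Rightarrow> bool" where "msat \<rho> A \<equiv> sat D ap I (=) ls \<rho> [] A"
abbreviation ok :: "'u valuation \<Rightarrow> bool" where "ok \<equiv> val_ok D"

lemma I_dom: "I c \<in> D (const_ty c)"
  using model by (simp add: is_model_def)

lemma ap_dom: "f \<in> D (\<sigma> \<^bold>\<rightarrow> \<tau>) \<Longrightarrow> a \<in> D \<sigma> \<Longrightarrow> ap f a \<in> D \<tau>"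
  using model unfolding is_model_def by blast

lemma ap_ext: "f \<in> D (\<sigma> \<^bold>\<rightarrow> \<tau>) \<Longrightarrow> g \<in> D (\<sigma> \<^bold>\<rightarrow> \<tau>) \<Longrightarrow> (\<And>a. a \<in> D \<sigma> \<Longrightarrow> ap f a = ap g a) \<Longrightarrow> f = g"
  using model unfolding is_model_def by blast

lemma msat_prov: "T0 \<^bold>\<turnstile> A \<Longrightarrow> ok \<rho> \<Longrightarrow> msat \<rho> A"
  using model by (auto simp: is_model_def)

lemma msat_axiom: "A \<in> T0 \<Longrightarrow> wff [] A \<Longrightarrow> ok \<rho> \<Longrightarrow> msat \<rho> A"
  by (rule msat_prov) (auto simp: proves_def intro: derives.Ax)

lemma I_doms:
  "I CZero \<in> D Num" "I CSucc \<in> D (Num \<^bold>\<rightarrow> Num)" "I CPlus \<in> D (Num \<^bold>\<rightarrow> Num \<^bold>\<rightarrow> Num)"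
  "I CTimes \<in> D (Num \<^bold>\<rightarrow> Num \<^bold>\<rightarrow> Num)"
  "I CRec \<in> D ((Num \<^bold>\<rightarrow> Num \<^bold>\<rightarrow> Num) \<^bold>\<rightarrow> Num \<^bold>\<rightarrow> Num \<^bold>\<rightarrow> Num)"
  "I (CK \<sigma> \<tau>) \<in> D (\<sigma> \<^bold>\<rightarrow> \<tau> \<^bold>\<rightarrow> \<sigma>)"
  "I (CS \<rho> \<sigma> \<tau>) \<in> D ((\<rho> \<^bold>\<rightarrow> \<sigma> \<^bold>\<rightarrow> \<tau>) \<^bold>\<rightarrow> (\<rho> \<^bold>\<rightarrow> \<sigma>) \<^bold>\<rightarrow> \<rho> \<^bold>\<rightarrow> \<tau>)"
  using I_dom[of CZero] I_dom[of CSucc] I_dom[of CPlus] I_dom[of CTimes] I_dom[of CRec]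
    I_dom[of "CK \<sigma> \<tau>"] I_dom[of "CS \<rho> \<sigma> \<tau>"] by simp_all

lemma D_nonempty: "\<exists>a. a \<in> D \<tau>"
proof (induction \<tau>)
  case Num then show ?case using I_doms(1) by blast
next
  case (Fn \<sigma> \<tau>)
  then obtain a where "a \<in> D \<tau>" by blast
  then have "ap (I (CK \<tau> \<sigma>)) a \<in> D (\<sigma> \<^bold>\<rightarrow> \<tau>)" by (rule ap_dom[OF I_doms(6)])
  then show ?case by blast
qed

definition \<rho>0 :: "'u valuation" where "\<rho>0 = (\<lambda>(x, \<tau>). SOME a. a \<in> D \<tau>)"

lemma ok0 [simp]: "ok \<rho>0"
  using someI_ex[OF D_nonempty] by (auto simp: val_ok_def \<rho>0_def)

lemma ok_upd [simp]: "ok \<rho> \<Longrightarrow> a \<in> D \<tau> \<Longrightarrow> ok (\<rho>((x, \<tau>) := a))"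
  by (simp add: val_ok_def)

lemma ok_dom: "ok \<rho> \<Longrightarrow> \<rho> (x, \<tau>) \<in> D \<tau>"
  by (simp add: val_ok_def)

lemma val_dom: "typ_of [] t = Some \<tau> \<Longrightarrow> ok \<rho> \<Longrightarrow> mval \<rho> t \<in> D \<tau>"
  by (induction t arbitrary: \<tau>) (auto simp: val_ok_def I_dom intro: ap_dom split: option.splits ty.splits if_splits)

text \<open>By extensionality at each type, hereditary pointwise equality is identity; hence the
  equational axioms become HOL equations.\<close>

lemma EQ_eq: "a \<in> D \<tau> \<Longrightarrow> b \<in> D \<tau> \<Longrightarrow> EQ D ap (=) \<tau> a b = (a = b)"
proof (induction \<tau> arbitrary: a b)
  case (Fn \<sigma> \<tau>)
  have "EQ D ap (=) \<tau> (ap a x) (ap b x) = (ap a x = ap b x)" if "x \<in> D \<sigma>" for x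
    by (rule Fn.IH(2)[OF ap_dom ap_dom]) (rule Fn.prems that)+
  then show ?case using ap_ext[of a \<sigma> \<tau> b] Fn.prems by auto
qed simp

lemma K_eq:
  assumes "a \<in> D \<sigma>" "b \<in> D \<tau>"
  shows "ap (ap (I (CK \<sigma> \<tau>)) a) b = a"
proof -
  let ?F = "\<lambda>x y. eq_ty \<sigma> (Cst (CK \<sigma> \<tau>) \<^bold>\<cdot> x \<^bold>\<cdot> y) x"
  let ?A = "Forall \<sigma> (\<lambda>x. Forall \<tau> (\<lambda>y. ?F x y))"
  have w: "wff [] (?F (Var x \<sigma>) (Var y \<tau>))" for x y by (simp add: wff_eq_ty)
  have "?A \<in> T0" by (auto simp: RCA0_omega_def combinator_axioms_def)
  then have "msat \<rho>0 ?A" by (intro msat_axiom wff_Forall w ok0)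
  moreover have "msat \<rho>0 ?A = (\<forall>a\<in>D \<sigma>. \<forall>b\<in>D \<tau>. ap (ap (I (CK \<sigma> \<tau>)) a) b = a)"
  proof (rule sat_Forall2[where S = "{}"])
    show "insert (x, \<sigma>) {} \<subseteq> frees (?F (Var x \<sigma>) (Var y \<tau>))" for x y
      using frees_eq_ty[of "Cst (CK \<sigma> \<tau>) \<^bold>\<cdot> Var x \<sigma> \<^bold>\<cdot> Var y \<tau>" "Var x \<sigma>" \<sigma>] by simp
    fix x y a b \<rho> assume "a \<in> D \<sigma>" "b \<in> D \<tau>" "ok \<rho>" "\<rho> (x, \<sigma>) = a" "\<rho> (y, \<tau>) = b"
    then show "msat \<rho> (?F (Var x \<sigma>) (Var y \<tau>)) = (ap (ap (I (CK \<sigma> \<tau>)) a) b = a)"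
      using ap_dom[OF ap_dom[OF I_doms(6)]] by (simp add: sat_eq_ty EQ_eq)
  qed (rule w ok0)+
  ultimately show ?thesis using assms by blast
qed

lemma S_eq:
  assumes "a \<in> D (\<rho> \<^bold>\<rightarrow> \<sigma> \<^bold>\<rightarrow> \<tau>)" "b \<in> D (\<rho> \<^bold>\<rightarrow> \<sigma>)" "c \<in> D \<rho>"
  shows "ap (ap (ap (I (CS \<rho> \<sigma> \<tau>)) a) b) c = ap (ap a c) (ap b c)"
proof -
  let ?r = "\<rho> \<^bold>\<rightarrow> \<sigma> \<^bold>\<rightarrow> \<tau>" and ?s = "\<rho> \<^bold>\<rightarrow> \<sigma>"
  let ?F = "\<lambda>x y z. eq_ty \<tau> (Cst (CS \<rho> \<sigma> \<tau>) \<^bold>\<cdot> x \<^bold>\<cdot> y \<^bold>\<cdot> z) (x \<^bold>\<cdot> z \<^bold>\<cdot> (y \<^bold>\<cdot> z))"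
  let ?A = "Forall ?r (\<lambda>x. Forall ?s (\<lambda>y. Forall \<rho> (\<lambda>z. ?F x y z)))"
  have w: "wff [] (?F (Var x ?r) (Var y ?s) (Var z \<rho>))" for x y z by (simp add: wff_eq_ty)
  have "?A \<in> T0" unfolding RCA0_omega_def combinator_axioms_def by blast
  then have "msat \<rho>0 ?A" by (intro msat_axiom wff_Forall w ok0)
  moreover have "msat \<rho>0 ?A = (\<forall>a\<in>D ?r. \<forall>b\<in>D ?s. \<forall>c\<in>D \<rho>.
      ap (ap (ap (I (CS \<rho> \<sigma> \<tau>)) a) b) c = ap (ap a c) (ap b c))"
  proof (rule sat_Forall3[where S = "{}"])
    show "insert (x, ?r) (insert (y, ?s) {}) \<subseteq> frees (?F (Var x ?r) (Var y ?s) (Var z \<rho>))" for x y z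
      using frees_eq_ty[of "Cst (CS \<rho> \<sigma> \<tau>) \<^bold>\<cdot> Var x ?r \<^bold>\<cdot> Var y ?s \<^bold>\<cdot> Var z \<rho>" "Var x ?r \<^bold>\<cdot> Var z \<rho> \<^bold>\<cdot> (Var y ?s \<^bold>\<cdot> Var z \<rho>)" \<tau>] by auto
    fix x y z a b c w assume *: "a \<in> D ?r" "b \<in> D ?s" "c \<in> D \<rho>" "ok w" "w (x, ?r) = a" "w (y, ?s) = b" "w (z, \<rho>) = c"
    then have "ap (ap (ap (I (CS \<rho> \<sigma> \<tau>)) a) b) c \<in> D \<tau>" "ap (ap a c) (ap b c) \<in> D \<tau>"
      by (meson ap_dom I_doms(7))+
    then show "msat w (?F (Var x ?r) (Var y ?s) (Var z \<rho>)) = (ap (ap (ap (I (CS \<rho> \<sigma> \<tau>)) a) b) c = ap (ap a c) (ap b c))"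
      using * by (simp add: sat_eq_ty EQ_eq)
  qed (rule w ok0)+
  ultimately show ?thesis using assms by blast
qed

text \<open>Bracket abstraction evaluated clause by clause: \<open>K\<close> for a term without the
  variable, \<open>S\<close> for an application, and \<open>S K K\<close> as the identity.\<close>

lemma val_lamV:
  "typ_of [] t = Some \<tau> \<Longrightarrow> ok \<rho> \<Longrightarrow> a \<in> D \<sigma> \<Longrightarrow> ap (mval \<rho> (lamV x \<sigma> t)) a = mval (\<rho>((x, \<sigma>) := a)) t"
proof (induction t arbitrary: \<tau>)
  case (App r s)
  show ?case
  proof (cases "(x, \<sigma>) \<in> frees_t (r \<^bold>\<cdot> s)")
    case False
    then have "lamV x \<sigma> (r \<^bold>\<cdot> s) = Cst (CK \<tau> \<sigma>) \<^bold>\<cdot> (r \<^bold>\<cdot> s)"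
      by (subst lamV.simps) (use App.prems in simp)
    moreover have "mval (\<rho>((x, \<sigma>) := a)) (r \<^bold>\<cdot> s) = mval \<rho> (r \<^bold>\<cdot> s)"
      by (rule val_cong) (use False in auto)
    ultimately show ?thesis using K_eq[OF val_dom[OF App.prems(1,2)] App.prems(3)] by (simp only: val.simps)
  next
    case True
    obtain \<rho>' where rs: "typ_of [] r = Some (\<rho>' \<^bold>\<rightarrow> \<tau>)" "typ_of [] s = Some \<rho>'"
      using App.prems by (auto split: option.splits ty.splits if_splits)
    have "ap (mval \<rho> (lamV x \<sigma> (r \<^bold>\<cdot> s))) a = ap (ap (mval \<rho> (lamV x \<sigma> r)) a) (ap (mval \<rho> (lamV x \<sigma> s)) a)"
      using True rs S_eq[OF val_dom val_dom, of "lamV x \<sigma> r" \<sigma> \<rho>' \<tau> \<rho> "lamV x \<sigma> s" \<rho> a] App.prems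
      by (subst lamV.simps) (simp add: typ_of_lamV)
    then show ?thesis using App rs by simp
  qed
next
  case (Var y \<upsilon>)
  show ?case
  proof (cases "(y, \<upsilon>) = (x, \<sigma>)")
    case True
    have "ap (I (CK \<sigma> \<sigma>)) a \<in> D (\<sigma> \<^bold>\<rightarrow> \<sigma>)" using ap_dom[OF I_doms(6)] Var by blast
    then show ?thesis using True Var
        S_eq[of "I (CK \<sigma> (\<sigma> \<^bold>\<rightarrow> \<sigma>))" \<sigma> "\<sigma> \<^bold>\<rightarrow> \<sigma>" \<sigma> "I (CK \<sigma> \<sigma>)" a, OF I_doms(6) I_doms(6)] K_eq[of a \<sigma> "ap (I (CK \<sigma> \<sigma>)) a" "\<sigma> \<^bold>\<rightarrow> \<sigma>"]
      by (subst lamV.simps) auto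
  next
    case False
    then show ?thesis using Var by (subst lamV.simps) (auto simp: K_eq ok_dom)
  qed
qed (subst lamV.simps; auto simp: K_eq I_dom)+

lemma val_Lam0:
  assumes "\<And>x. typ_of [] (F (Var x Num)) = Some \<tau>" "\<And>x. S \<subseteq> frees_t (F (Var x Num))" "ok \<rho>" "a \<in> D Num"
    and body: "\<And>x \<rho>'. ok \<rho>' \<Longrightarrow> \<rho>' (x, Num) = a \<Longrightarrow> \<forall>v\<in>S. \<rho>' v = \<rho> v \<Longrightarrow> mval \<rho>' (F (Var x Num)) = r"
  shows "ap (mval \<rho> (Lam0 F)) a = r"
proof -
  let ?x = "bound_t (F (Var 0 Num))"
  have "(?x, Num) \<notin> S" using assms(2)[of 0] frees_t_bound[of "(?x, Num)" "F (Var 0 Num)"] by auto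
  then have "mval (\<rho>((?x, Num) := a)) (F (Var ?x Num)) = r" by (intro body) (use assms in auto)
  then show ?thesis by (simp add: Lam0_def Let_def val_lamV[OF assms(1,3,4)])
qed

lemma val_Lam0_2:
  assumes ty: "\<And>x y. typ_of [] (F (Var x Num) (Var y Num)) = Some \<tau>"
    and S: "\<And>x y. insert (x, Num) S \<subseteq> frees_t (F (Var x Num) (Var y Num))" and "ok \<rho>" "a \<in> D Num" "b \<in> D Num"
    and body: "\<And>x y \<rho>'. ok \<rho>' \<Longrightarrow> \<rho>' (x, Num) = a \<Longrightarrow> \<rho>' (y, Num) = b \<Longrightarrow> \<forall>v\<in>S. \<rho>' v = \<rho> v
      \<Longrightarrow> mval \<rho>' (F (Var x Num) (Var y Num)) = r"
  shows "ap (ap (mval \<rho> (Lam0 (\<lambda>x. Lam0 (\<lambda>y. F x y)))) a) b = r"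
proof -
  let ?r = "\<lambda>x. Lam0 (\<lambda>y. F (Var x Num) y)" and ?x = "bound_t (Lam0 (\<lambda>y. F (Var 0 Num) y))"
  let ?\<rho> = "\<rho>((?x, Num) := a)"
  have s: "S \<subseteq> frees_t (?r x)" for x by (rule frees_Lam0) (use S ty in blast)+
  have "(?x, Num) \<notin> S" using s[of 0] frees_t_bound[of "(?x, Num)" "?r 0"] by auto
  then have *: "\<forall>v\<in>S. ?\<rho> v = \<rho> v" by auto
  have "ap (mval ?\<rho> (?r ?x)) b = r"
  proof (rule val_Lam0[where S = "insert (?x, Num) S"])
    fix y \<rho>' assume "ok \<rho>'" "\<rho>' (y, Num) = b" "\<forall>v\<in>insert (?x, Num) S. \<rho>' v = ?\<rho> v"
    then show "mval \<rho>' (F (Var ?x Num) (Var y Num)) = r" by (intro body) (use * in auto)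
  qed (use assms in \<open>auto simp del: insert_subset\<close>)
  moreover have "ap (mval \<rho> (Lam0 (\<lambda>x. Lam0 (\<lambda>y. F x y)))) a = mval ?\<rho> (?r ?x)"
    using val_lamV[OF typ_of_Lam0[of "F (Var _ Num)", OF ty] \<open>ok \<rho>\<close> \<open>a \<in> D Num\<close>] by (simp add: Lam0_def[of "\<lambda>x. Lam0 (\<lambda>y. F x y)"] Let_def)
  ultimately show ?thesis by simp
qed

end

lemma val_closed: "typ_of [] u = Some \<tau> \<Longrightarrow> val ap I \<rho> e u = val ap I \<rho> [] u"
  by (induction u arbitrary: \<tau>) (auto split: option.splits ty.splits if_splits)

lemma val_inst:
  assumes "typ_of [] u = Some \<tau>"
  shows "typ_of (\<Gamma> @ [\<tau>]) t = Some \<sigma> \<Longrightarrow> length \<Gamma> = length e \<Longrightarrow>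
    val ap I \<rho> e (inst_t (length e) u t) = val ap I \<rho> (e @ [val ap I \<rho> [] u]) t"
  using val_closed[OF assms]
  by (induction t arbitrary: \<sigma>) (auto simp: nth_append split: option.splits ty.splits if_splits)

lemma sat_inst:
  assumes "typ_of [] u = Some \<tau>"
  shows "wff (\<Gamma> @ [\<tau>]) A \<Longrightarrow> length \<Gamma> = length e \<Longrightarrow>
    sat D ap I eq ls \<rho> e (inst (length e) u A) = sat D ap I eq ls \<rho> (e @ [val ap I \<rho> [] u]) A"
proof (induction A arbitrary: \<Gamma> e)
  case (All \<sigma> A)
  from All.IH[of "\<sigma> # \<Gamma>" "_ # e"] All.prems show ?case by simp
qed (auto simp: val_inst[OF assms])

lemma sat_subst:
  assumes "wff [] A" "typ_of [] u = Some \<tau>"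
  shows "sat D ap I eq ls \<rho> [] (subst x \<tau> u A) = sat D ap I eq ls (\<rho>((x, \<tau>) := val ap I \<rho> [] u)) [] A"
  using sat_inst[OF assms(2), of "[]" "close 0 x \<tau> A" "[]" D ap I eq ls \<rho>] wff_close0[OF assms(1)]
    sat_close0[OF assms(1), of D ap I eq ls \<rho>]
  by (simp add: subst_def)

lemma wff_subst: "wff [] A \<Longrightarrow> typ_of [] u = Some \<tau> \<Longrightarrow> wff [] (subst x \<tau> u A)"
  by (simp add: subst_def wff_inst0 wff_close0)

lemma frees_Lam0_le:
  assumes "\<And>x. typ_of [] (F (Var x Num)) = Some \<tau>" "\<And>x. frees_t (F (Var x Num)) \<subseteq> insert (x, Num) S"
  shows "frees_t (Lam0 F) \<subseteq> S"
  using assms(2) by (auto simp: Lam0_def Let_def frees_lamV[OF assms(1)])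

lemma typ_pred [simp]: "typ_of [] pred_trm = Some (Num \<^bold>\<rightarrow> Num)"
  and frees_pred: "frees_t pred_trm \<subseteq> {}"
  unfolding pred_trm_def by (intro typ_of_Lam0 frees_Lam0_le | simp add: typ_of_Lam0)+

lemma typ_monus [simp]: "typ_of [] monus_trm = Some (Num \<^bold>\<rightarrow> Num \<^bold>\<rightarrow> Num)"
  unfolding monus_trm_def by (intro typ_of_Lam0) (simp add: typ_of_Lam0)

lemma frees_monus: "frees_t monus_trm \<subseteq> {}"
proof -
  have "frees_t (Lam0 (\<lambda>k. pred_trm)) \<subseteq> {}"
    by (rule frees_Lam0_le[OF typ_pred]) (use frees_pred in auto)
  then show ?thesis
    unfolding monus_trm_def by (intro frees_Lam0_le typ_of_Lam0) (auto simp: typ_of_Lam0)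
qed

context model
begin

section \<open>The axioms of arithmetic, recursion, induction and choice as facts about the
  model\<close>

abbreviation N where "N \<equiv> D Num"
abbreviation Z where "Z \<equiv> I CZero"
abbreviation Sc where "Sc a \<equiv> ap (I CSucc) a"
abbreviation ad where "ad a b \<equiv> ap (ap (I CPlus) a) b"
abbreviation ml where "ml a b \<equiv> ap (ap (I CTimes) a) b"
abbreviation rc where "rc f a b \<equiv> ap (ap (ap (I CRec) f) a) b"

lemma N_closed [simp]:
  "Z \<in> N" "a \<in> N \<Longrightarrow> Sc a \<in> N" "a \<in> N \<Longrightarrow> b \<in> N \<Longrightarrow> ad a b \<in> N" "a \<in> N \<Longrightarrow> b \<in> N \<Longrightarrow> ml a b \<in> N"
  by (rule I_doms ap_dom[OF I_doms(2)] ap_dom[OF ap_dom[OF I_doms(3)]] ap_dom[OF ap_dom[OF I_doms(4)]]; assumption)+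

lemma rc_dom: "f \<in> D (Num \<^bold>\<rightarrow> Num \<^bold>\<rightarrow> Num) \<Longrightarrow> a \<in> N \<Longrightarrow> b \<in> N \<Longrightarrow> rc f a b \<in> N"
  by (meson ap_dom I_doms(5))

lemma Sc_neq_Z: "a \<in> N \<Longrightarrow> Sc a \<noteq> Z"
proof -
  have "msat \<rho>0 (\<^bold>\<forall>\<^sup>0n. \<^bold>\<not> (suc n \<^bold>= \<^bold>0))"
    by (rule msat_axiom)
      (auto simp: RCA0_omega_def arith_axioms_def binder_defs prop_defs intro!: wff_Forall)
  also have "msat \<rho>0 (\<^bold>\<forall>\<^sup>0n. \<^bold>\<not> (suc n \<^bold>= \<^bold>0)) = (\<forall>a\<in>N. Sc a \<noteq> Z)"
    unfolding binder_defs by (rule sat_Forall[where S = "{}"]) (auto simp: prop_defs)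
  finally show "a \<in> N \<Longrightarrow> Sc a \<noteq> Z" by blast
qed

lemma Sc_inj: "a \<in> N \<Longrightarrow> b \<in> N \<Longrightarrow> Sc a = Sc b \<Longrightarrow> a = b"
proof -
  have "msat \<rho>0 (\<^bold>\<forall>\<^sup>0m. \<^bold>\<forall>\<^sup>0n. suc m \<^bold>= suc n \<^bold>\<longrightarrow> m \<^bold>= n)"
    by (rule msat_axiom)
      (auto simp: RCA0_omega_def arith_axioms_def binder_defs intro!: wff_Forall)
  also have "msat \<rho>0 (\<^bold>\<forall>\<^sup>0m. \<^bold>\<forall>\<^sup>0n. suc m \<^bold>= suc n \<^bold>\<longrightarrow> m \<^bold>= n) = (\<forall>a\<in>N. \<forall>b\<in>N. Sc a = Sc b \<longrightarrow> a = b)"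
    unfolding binder_defs by (rule sat_Forall2[where S = "{}"]) auto
  finally show "a \<in> N \<Longrightarrow> b \<in> N \<Longrightarrow> Sc a = Sc b \<Longrightarrow> a = b" by blast
qed

lemma ad_Z: "a \<in> N \<Longrightarrow> ad a Z = a"
proof -
  have "msat \<rho>0 (\<^bold>\<forall>\<^sup>0m. m \<^bold>+ \<^bold>0 \<^bold>= m)"
    by (rule msat_axiom)
      (auto simp: RCA0_omega_def arith_axioms_def binder_defs intro!: wff_Forall)
  also have "msat \<rho>0 (\<^bold>\<forall>\<^sup>0m. m \<^bold>+ \<^bold>0 \<^bold>= m) = (\<forall>a\<in>N. ad a Z = a)"
    unfolding binder_defs by (rule sat_Forall[where S = "{}"]) auto
  finally show "a \<in> N \<Longrightarrow> ad a Z = a" by blast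
qed

lemma ad_Sc: "a \<in> N \<Longrightarrow> b \<in> N \<Longrightarrow> ad a (Sc b) = Sc (ad a b)"
proof -
  have "msat \<rho>0 (\<^bold>\<forall>\<^sup>0m. \<^bold>\<forall>\<^sup>0n. m \<^bold>+ suc n \<^bold>= suc (m \<^bold>+ n))"
    by (rule msat_axiom)
      (auto simp: RCA0_omega_def arith_axioms_def binder_defs intro!: wff_Forall)
  also have "msat \<rho>0 (\<^bold>\<forall>\<^sup>0m. \<^bold>\<forall>\<^sup>0n. m \<^bold>+ suc n \<^bold>= suc (m \<^bold>+ n)) = (\<forall>a\<in>N. \<forall>b\<in>N. ad a (Sc b) = Sc (ad a b))"
    unfolding binder_defs by (rule sat_Forall2[where S = "{}"]) auto
  finally show "a \<in> N \<Longrightarrow> b \<in> N \<Longrightarrow> ad a (Sc b) = Sc (ad a b)" by blast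
qed

lemma ml_Z: "a \<in> N \<Longrightarrow> ml a Z = Z"
proof -
  have "msat \<rho>0 (\<^bold>\<forall>\<^sup>0m. m \<^bold>* \<^bold>0 \<^bold>= \<^bold>0)"
    by (rule msat_axiom)
      (auto simp: RCA0_omega_def arith_axioms_def binder_defs intro!: wff_Forall)
  also have "msat \<rho>0 (\<^bold>\<forall>\<^sup>0m. m \<^bold>* \<^bold>0 \<^bold>= \<^bold>0) = (\<forall>a\<in>N. ml a Z = Z)"
    unfolding binder_defs by (rule sat_Forall[where S = "{}"]) auto
  finally show "a \<in> N \<Longrightarrow> ml a Z = Z" by blast
qed

lemma ml_Sc: "a \<in> N \<Longrightarrow> b \<in> N \<Longrightarrow> ml a (Sc b) = ad (ml a b) a"
proof -
  have "msat \<rho>0 (\<^bold>\<forall>\<^sup>0m. \<^bold>\<forall>\<^sup>0n. m \<^bold>* suc n \<^bold>= m \<^bold>* n \<^bold>+ m)"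
    by (rule msat_axiom)
      (auto simp: RCA0_omega_def arith_axioms_def binder_defs intro!: wff_Forall)
  also have "msat \<rho>0 (\<^bold>\<forall>\<^sup>0m. \<^bold>\<forall>\<^sup>0n. m \<^bold>* suc n \<^bold>= m \<^bold>* n \<^bold>+ m) = (\<forall>a\<in>N. \<forall>b\<in>N. ml a (Sc b) = ad (ml a b) a)"
    unfolding binder_defs by (rule sat_Forall2[where S = "{}"]) auto
  finally show "a \<in> N \<Longrightarrow> b \<in> N \<Longrightarrow> ml a (Sc b) = ad (ml a b) a" by blast
qed

lemma ls_Z: "a \<in> N \<Longrightarrow> \<not> ls a Z"
proof -
  have "msat \<rho>0 (\<^bold>\<forall>\<^sup>0m. \<^bold>\<not> (m \<^bold>< \<^bold>0))"
    by (rule msat_axiom)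
      (auto simp: RCA0_omega_def arith_axioms_def binder_defs prop_defs intro!: wff_Forall)
  also have "msat \<rho>0 (\<^bold>\<forall>\<^sup>0m. \<^bold>\<not> (m \<^bold>< \<^bold>0)) = (\<forall>a\<in>N. \<not> ls a Z)"
    unfolding binder_defs by (rule sat_Forall[where S = "{}"]) (auto simp: prop_defs)
  finally show "a \<in> N \<Longrightarrow> \<not> ls a Z" by blast
qed

lemma ls_Sc: "a \<in> N \<Longrightarrow> b \<in> N \<Longrightarrow> ls a (Sc b) = (ls a b \<or> a = b)"
proof -
  have "msat \<rho>0 (\<^bold>\<forall>\<^sup>0m. \<^bold>\<forall>\<^sup>0n. m \<^bold>< suc n \<^bold>\<longleftrightarrow> (m \<^bold>< n \<^bold>\<or> m \<^bold>= n))"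
    by (rule msat_axiom)
      (auto simp: RCA0_omega_def arith_axioms_def binder_defs prop_defs intro!: wff_Forall)
  also have "msat \<rho>0 (\<^bold>\<forall>\<^sup>0m. \<^bold>\<forall>\<^sup>0n. m \<^bold>< suc n \<^bold>\<longleftrightarrow> (m \<^bold>< n \<^bold>\<or> m \<^bold>= n)) =
      (\<forall>a\<in>N. \<forall>b\<in>N. ls a (Sc b) = (ls a b \<or> a = b))"
    unfolding binder_defs by (rule sat_Forall2[where S = "{}"]) (auto simp: prop_defs)
  finally show "a \<in> N \<Longrightarrow> b \<in> N \<Longrightarrow> ls a (Sc b) = (ls a b \<or> a = b)" by blast
qed

lemma rc_Z: "f \<in> D (Num \<^bold>\<rightarrow> Num \<^bold>\<rightarrow> Num) \<Longrightarrow> a \<in> N \<Longrightarrow> rc f a Z = a"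
proof -
  have "msat \<rho>0 (Forall (Num \<^bold>\<rightarrow> Num \<^bold>\<rightarrow> Num) (\<lambda>f. \<^bold>\<forall>\<^sup>0m. rec f m \<^bold>0 \<^bold>= m))"
    by (rule msat_axiom)
      (auto simp: RCA0_omega_def recursor_axioms_def binder_defs intro!: wff_Forall)
  also have "msat \<rho>0 (Forall (Num \<^bold>\<rightarrow> Num \<^bold>\<rightarrow> Num) (\<lambda>f. \<^bold>\<forall>\<^sup>0m. rec f m \<^bold>0 \<^bold>= m)) =
      (\<forall>f\<in>D (Num \<^bold>\<rightarrow> Num \<^bold>\<rightarrow> Num). \<forall>a\<in>N. rc f a Z = a)"
    unfolding binder_defs by (rule sat_Forall2[where S = "{}"]) auto
  finally show "f \<in> D (Num \<^bold>\<rightarrow> Num \<^bold>\<rightarrow> Num) \<Longrightarrow> a \<in> N \<Longrightarrow> rc f a Z = a" by blast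
qed

lemma rc_Sc: "f \<in> D (Num \<^bold>\<rightarrow> Num \<^bold>\<rightarrow> Num) \<Longrightarrow> a \<in> N \<Longrightarrow> b \<in> N \<Longrightarrow> rc f a (Sc b) = ap (ap f b) (rc f a b)"
proof -
  let ?A = "Forall (Num \<^bold>\<rightarrow> Num \<^bold>\<rightarrow> Num) (\<lambda>f. \<^bold>\<forall>\<^sup>0m. \<^bold>\<forall>\<^sup>0n. rec f m (suc n) \<^bold>= f \<^bold>\<cdot> n \<^bold>\<cdot> rec f m n)"
  have "msat \<rho>0 ?A"
    by (rule msat_axiom)
      (auto simp: RCA0_omega_def recursor_axioms_def binder_defs intro!: wff_Forall)
  also have "msat \<rho>0 ?A =
      (\<forall>f\<in>D (Num \<^bold>\<rightarrow> Num \<^bold>\<rightarrow> Num). \<forall>a\<in>N. \<forall>b\<in>N. rc f a (Sc b) = ap (ap f b) (rc f a b))"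
    unfolding binder_defs by (rule sat_Forall3[where S = "{}"]) auto
  finally show "f \<in> D (Num \<^bold>\<rightarrow> Num \<^bold>\<rightarrow> Num) \<Longrightarrow> a \<in> N \<Longrightarrow> b \<in> N \<Longrightarrow> rc f a (Sc b) = ap (ap f b) (rc f a b)" by blast
qed

text \<open>The valuation supplies parameters of every type. With a parameter \<open>u\<close> of
  type 1 the single formula \<open>u x = 0\<close> will cover all decidable predicates, see
  \<open>num_induct\<close>.\<close>

lemma N_induct:
  assumes A: "qf A" "wff [] A" and "ok \<rho>" and 0: "msat (\<rho>((x, Num) := Z)) A"
    and step: "\<And>n. n \<in> N \<Longrightarrow> msat (\<rho>((x, Num) := n)) A \<Longrightarrow> msat (\<rho>((x, Num) := Sc n)) A" and n: "n \<in> N"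
  shows "msat (\<rho>((x, Num) := n)) A"
proof -
  let ?S = "subst x Num (suc (Var x Num)) A"
  let ?F = "subst x Num \<^bold>0 A \<^bold>\<longrightarrow> AllV x Num (A \<^bold>\<longrightarrow> ?S) \<^bold>\<longrightarrow> AllV x Num A"
  have w: "wff [] (A \<^bold>\<longrightarrow> ?S)" "wff [] ?S" using A by (auto simp: wff_subst)
  have "?F \<in> T0" unfolding RCA0_omega_def QF_IA_def using A by blast
  moreover have "wff [] ?F" using A w by (simp add: wff_subst wff_AllV)
  ultimately have "msat \<rho> ?F" using \<open>ok \<rho>\<close> by (rule msat_axiom)
  moreover have "msat \<rho> (AllV x Num (A \<^bold>\<longrightarrow> ?S))"
    using step A by (simp add: sat_AllV[OF w(1)] sat_subst)
  moreover have "msat \<rho> (subst x Num \<^bold>0 A)" using 0 A by (simp add: sat_subst)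
  ultimately have "msat \<rho> (AllV x Num A)" by simp
  then show ?thesis using n by (simp add: sat_AllV[OF A(2)])
qed

text \<open>The inequalities of types keep the variable for the choice function apart from those for
  argument and value, so that the updates of the valuation do not interfere, whatever the names
  are.\<close>

lemma QF_AC_sat:
  assumes A: "qf A" "wff [] A" and st: "QF_AC \<sigma> \<tau> \<subseteq> T0" "(x, \<sigma>) \<noteq> (y, \<tau>)" "\<tau> \<noteq> \<sigma> \<^bold>\<rightarrow> \<tau>" "\<sigma> \<noteq> \<sigma> \<^bold>\<rightarrow> \<tau>"
    and "ok \<rho>" and ex: "\<And>a. a \<in> D \<sigma> \<Longrightarrow> \<exists>b\<in>D \<tau>. msat (\<rho>((x, \<sigma>) := a, (y, \<tau>) := b)) A"
  shows "\<exists>f\<in>D (\<sigma> \<^bold>\<rightarrow> \<tau>). \<forall>a\<in>D \<sigma>. msat (\<rho>((x, \<sigma>) := a, (y, \<tau>) := ap f a)) A"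
proof -
  have "finite (fst ` frees A)" by simp
  then obtain Y where "Y \<notin> fst ` frees A" using ex_new_if_finite infinite_UNIV_nat by blast
  then have Y: "(Y, \<sigma> \<^bold>\<rightarrow> \<tau>) \<notin> frees A" by force
  let ?t = "Var Y (\<sigma> \<^bold>\<rightarrow> \<tau>) \<^bold>\<cdot> Var x \<sigma>"
  let ?S = "subst y \<tau> ?t A"
  let ?F = "AllV x \<sigma> (ExV y \<tau> A) \<^bold>\<longrightarrow> ExV Y (\<sigma> \<^bold>\<rightarrow> \<tau>) (AllV x \<sigma> ?S)"
  have w: "wff [] ?S" "wff [] (AllV x \<sigma> ?S)" "wff [] (\<^bold>\<not> A)" "wff [] (ExV y \<tau> A)" "wff [] (\<^bold>\<not> AllV x \<sigma> ?S)"
    using A by (auto simp: wff_subst wff_AllV ExV_def Neg_def)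
  have "?F \<in> QF_AC \<sigma> \<tau>" unfolding QF_AC_def using A Y st by blast
  moreover have "wff [] ?F" using w by (simp add: wff_AllV ExV_def[of Y] Neg_def)
  ultimately have "msat \<rho> ?F" using \<open>ok \<rho>\<close> st by (intro msat_axiom) auto
  moreover have "msat \<rho> (AllV x \<sigma> (ExV y \<tau> A))"
    using ex by (simp add: sat_AllV w(4)) (simp add: ExV_def Neg_def sat_AllV[OF w(3), unfolded Neg_def])
  ultimately have "msat \<rho> (ExV Y (\<sigma> \<^bold>\<rightarrow> \<tau>) (AllV x \<sigma> ?S))" by simp
  then obtain f where f: "f \<in> D (\<sigma> \<^bold>\<rightarrow> \<tau>)" "msat (\<rho>((Y, \<sigma> \<^bold>\<rightarrow> \<tau>) := f)) (AllV x \<sigma> ?S)"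
    by (auto simp: ExV_def Neg_def sat_AllV[OF w(5), unfolded Neg_def])
  have "msat (\<rho>((x, \<sigma>) := a, (y, \<tau>) := ap f a)) A" if "a \<in> D \<sigma>" for a
  proof -
    have "msat (\<rho>((Y, \<sigma> \<^bold>\<rightarrow> \<tau>) := f, (x, \<sigma>) := a)) ?S" using f that by (auto simp: sat_AllV[OF w(1)])
    then have "msat (\<rho>((Y, \<sigma> \<^bold>\<rightarrow> \<tau>) := f, (x, \<sigma>) := a, (y, \<tau>) := ap f a)) A" using st
      by (subst (asm) sat_subst) (auto simp: A)
    then show ?thesis by (subst sat_cong) (use Y in auto)
  qed
  then show ?thesis using f by blast
qed

lemma AC_10:
  assumes X: "X \<in> D (ty1 \<^bold>\<rightarrow> Num \<^bold>\<rightarrow> Num)" and ex: "\<And>f. f \<in> D ty1 \<Longrightarrow> \<exists>n\<in>N. ap (ap X f) n = Z"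
  shows "\<exists>Y\<in>D (ty1 \<^bold>\<rightarrow> Num). \<forall>f\<in>D ty1. ap (ap X f) (ap Y f) = Z"
  using QF_AC_sat[of "Eq (Var 2 (ty1 \<^bold>\<rightarrow> Num \<^bold>\<rightarrow> Num) \<^bold>\<cdot> Var 0 ty1 \<^bold>\<cdot> Var 1 Num) \<^bold>0" ty1 Num 0 1
      "\<rho>0((2, ty1 \<^bold>\<rightarrow> Num \<^bold>\<rightarrow> Num) := X)"] assms
  by (simp add: RCA0_omega_def le_supI1)

lemma AC_01:
  assumes X: "X \<in> D (Num \<^bold>\<rightarrow> ty1 \<^bold>\<rightarrow> Num)" and ex: "\<And>n. n \<in> N \<Longrightarrow> \<exists>f\<in>D ty1. ap (ap X n) f = Z"
  shows "\<exists>Y\<in>D (Num \<^bold>\<rightarrow> ty1). \<forall>n\<in>N. ap (ap X n) (ap Y n) = Z"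
  using QF_AC_sat[of "Eq (Var 2 (Num \<^bold>\<rightarrow> ty1 \<^bold>\<rightarrow> Num) \<^bold>\<cdot> Var 0 Num \<^bold>\<cdot> Var 1 ty1) \<^bold>0" Num ty1 0 1
      "\<rho>0((2, Num \<^bold>\<rightarrow> ty1 \<^bold>\<rightarrow> Num) := X)"] assms
  by simp

end

section \<open>Arithmetic in a model\<close>

context model
begin

lemma mval_closed: "frees_t t \<subseteq> {} \<Longrightarrow> mval \<rho> t = mval \<rho>0 t"
  by (rule val_cong) auto

definition pr :: "'u \<Rightarrow> 'u" where "pr a = ap (mval \<rho>0 pred_trm) a"
definition mn :: "'u \<Rightarrow> 'u \<Rightarrow> 'u" where "mn a b = ap (ap (mval \<rho>0 monus_trm) a) b"

lemmas mval_pred = mval_closed[OF frees_pred] and mval_monus = mval_closed[OF frees_monus]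

lemma ap_pred [simp]: "ap (mval \<rho> pred_trm) a = pr a"
  by (simp add: pr_def mval_pred[of \<rho>])

lemma ap_monus [simp]: "ap (ap (mval \<rho> monus_trm) a) b = mn a b"
  by (simp add: mn_def mval_monus[of \<rho>])

lemma pr_dom [simp]: "a \<in> N \<Longrightarrow> pr a \<in> N"
  unfolding pr_def using val_dom[OF typ_pred ok0] by (rule ap_dom)

lemma mn_dom [simp]: "a \<in> N \<Longrightarrow> b \<in> N \<Longrightarrow> mn a b \<in> N"
  unfolding mn_def using ap_dom[OF ap_dom[OF val_dom[OF typ_monus ok0]]] by blast

lemma pr_Z [simp]: "pr Z = Z"
  unfolding pr_def pred_trm_def
  by (rule val_Lam0[where S = "{}" and \<tau> = Num]) (auto simp: typ_of_Lam0 intro!: rc_Z val_dom)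

lemma pr_Sc [simp]: "a \<in> N \<Longrightarrow> pr (Sc a) = a"
proof -
  let ?g = "\<^bold>\<lambda>n. \<^bold>\<lambda>r. n"
  assume a: "a \<in> N"
  have t: "typ_of [] ?g = Some (Num \<^bold>\<rightarrow> Num \<^bold>\<rightarrow> Num)" by (simp add: typ_of_Lam0)
  have g: "ap (ap (mval \<rho> ?g) b) c = b" if "ok \<rho>" "b \<in> N" "c \<in> N" for \<rho> b c
    by (rule val_Lam0_2[where S = "{}" and \<tau> = Num]) (use that in auto)
  show ?thesis
    unfolding pr_def pred_trm_def
  proof (rule val_Lam0[where S = "{}" and \<tau> = Num])
    fix x \<rho> assume "ok \<rho>" "\<rho> (x, Num) = Sc a"
    then show "mval \<rho> (rec ?g \<^bold>0 (Var x Num)) = a"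
      using val_dom[OF t \<open>ok \<rho>\<close>] a by (simp add: rc_Sc g rc_dom)
  qed (use a in \<open>auto simp: typ_of_Lam0\<close>)
qed

lemma mn_Z [simp]: "a \<in> N \<Longrightarrow> mn a Z = a"
  unfolding mn_def monus_trm_def
  by (rule val_Lam0_2[where S = "{}" and \<tau> = Num]) (auto simp: typ_of_Lam0 intro!: rc_Z val_dom)

lemma mn_Sc [simp]: 
  assumes "a \<in> N" "b \<in> N" shows "mn a (Sc b) = pr (mn a b)"
proof -
  let ?g = "\<^bold>\<lambda>k. pred_trm"
  have t: "typ_of [] ?g = Some (Num \<^bold>\<rightarrow> Num \<^bold>\<rightarrow> Num)" by (simp add: typ_of_Lam0)
  have g: "ap (ap (mval \<rho> ?g) b) c = pr c" if "ok \<rho>" "b \<in> N" "c \<in> N" for \<rho> b c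
  proof -
    have "ap (mval \<rho> ?g) b = mval \<rho>0 pred_trm"
      by (rule val_Lam0[where S = "{}" and \<tau> = "Num \<^bold>\<rightarrow> Num"]) (use that mval_pred in auto)
    then show ?thesis by simp
  qed
  have *: "mn a c = rc (mval \<rho>0 ?g) a c" if "c \<in> N" for c
    unfolding mn_def monus_trm_def
  proof (rule val_Lam0_2[where S = "{}" and \<tau> = Num])
    fix x y \<rho> assume r: "ok \<rho>" "\<rho> (x, Num) = a" "\<rho> (y, Num) = c"
    have "frees_t ?g \<subseteq> {}" by (rule frees_Lam0_le[OF typ_pred]) (use frees_pred in auto)
    from mval_closed[OF this, of \<rho>] r show "mval \<rho> (rec ?g (Var x Num) (Var y Num)) = rc (mval \<rho>0 ?g) a c"
      by simp
  qed (use assms that in \<open>auto simp: typ_of_Lam0\<close>)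
  show ?thesis using assms val_dom[OF t ok0] by (simp add: * rc_Sc g rc_dom)
qed

abbreviation v1 where "v1 \<equiv> Var 1 Num"
abbreviation v2 where "v2 \<equiv> Var 2 Num"
abbreviation vx where "vx \<equiv> Var 0 Num"
abbreviation vl where "vl a b \<equiv> \<rho>0((1, Num) := a, (2, Num) := b)"

text \<open>Variable \<open>0\<close> carries the induction; variables \<open>1\<close> and
  \<open>2\<close> are parameters, enough for the laws of arithmetic below.\<close>

lemma ind2:
  assumes "qf A" "wff [] A" "m \<in> N" "k \<in> N" "n \<in> N"
    "msat ((vl m k)((0, Num) := Z)) A"
    "\<And>n. n \<in> N \<Longrightarrow> msat ((vl m k)((0, Num) := n)) A \<Longrightarrow> msat ((vl m k)((0, Num) := Sc n)) A"
  shows "msat ((vl m k)((0, Num) := n)) A"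
  by (rule N_induct) (use assms in auto)

lemma ad_assoc: "m \<in> N \<Longrightarrow> k \<in> N \<Longrightarrow> n \<in> N \<Longrightarrow> ad (ad m k) n = ad m (ad k n)"
  using ind2[of "(v1 \<^bold>+ v2) \<^bold>+ vx \<^bold>= v1 \<^bold>+ (v2 \<^bold>+ vx)" m k n] by (simp add: ad_Z ad_Sc)

lemma ad_Zl: "n \<in> N \<Longrightarrow> ad Z n = n"
  using ind2[of "\<^bold>0 \<^bold>+ vx \<^bold>= vx" Z Z n] by (simp add: ad_Z ad_Sc)

lemma ad_Scl: "m \<in> N \<Longrightarrow> n \<in> N \<Longrightarrow> ad (Sc m) n = Sc (ad m n)"
  using ind2[of "suc v1 \<^bold>+ vx \<^bold>= suc (v1 \<^bold>+ vx)" m Z n] by (simp add: ad_Z ad_Sc)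

lemma ad_comm: "m \<in> N \<Longrightarrow> n \<in> N \<Longrightarrow> ad m n = ad n m"
  using ind2[of "v1 \<^bold>+ vx \<^bold>= vx \<^bold>+ v1" m Z n] by (simp add: ad_Z ad_Sc ad_Zl ad_Scl)

lemma ad_lcomm: "m \<in> N \<Longrightarrow> k \<in> N \<Longrightarrow> n \<in> N \<Longrightarrow> ad m (ad k n) = ad k (ad m n)"
  by (metis ad_assoc ad_comm)

lemma ml_Zl: "n \<in> N \<Longrightarrow> ml Z n = Z"
  using ind2[of "\<^bold>0 \<^bold>* vx \<^bold>= \<^bold>0" Z Z n] by (simp add: ml_Z ml_Sc ad_Z)

lemma ml_Scl: "m \<in> N \<Longrightarrow> n \<in> N \<Longrightarrow> ml (Sc m) n = ad (ml m n) n"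
  using ind2[of "suc v1 \<^bold>* vx \<^bold>= v1 \<^bold>* vx \<^bold>+ vx" m Z n]
  by (simp add: ml_Z ml_Sc ad_Z ad_Sc ad_assoc ad_lcomm ad_comm[of m])

lemma ml_comm: "m \<in> N \<Longrightarrow> n \<in> N \<Longrightarrow> ml m n = ml n m"
  using ind2[of "v1 \<^bold>* vx \<^bold>= vx \<^bold>* v1" m Z n] by (simp add: ml_Z ml_Sc ml_Zl ml_Scl)

lemma ml_distrib: "m \<in> N \<Longrightarrow> k \<in> N \<Longrightarrow> n \<in> N \<Longrightarrow> ml m (ad k n) = ad (ml m k) (ml m n)"
  using ind2[of "v1 \<^bold>* (v2 \<^bold>+ vx) \<^bold>= v1 \<^bold>* v2 \<^bold>+ v1 \<^bold>* vx" m k n] by (simp add: ml_Z ml_Sc ad_Z ad_Sc ad_assoc)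

lemma ml_assoc: "m \<in> N \<Longrightarrow> k \<in> N \<Longrightarrow> n \<in> N \<Longrightarrow> ml (ml m k) n = ml m (ml k n)"
  using ind2[of "(v1 \<^bold>* v2) \<^bold>* vx \<^bold>= v1 \<^bold>* (v2 \<^bold>* vx)" m k n] by (simp add: ml_Z ml_Sc ml_distrib)

lemma mn_Sc_Sc: "m \<in> N \<Longrightarrow> n \<in> N \<Longrightarrow> mn (Sc m) (Sc n) = mn m n"
  using ind2[of "suc v1 \<^bold>- suc vx \<^bold>= v1 \<^bold>- vx" m Z n] by simp

lemma mn_ad: "m \<in> N \<Longrightarrow> n \<in> N \<Longrightarrow> mn (ad m n) n = m"
  using ind2[of "(v1 \<^bold>+ vx) \<^bold>- vx \<^bold>= v1" m Z n] by (simp add: ad_Z ad_Sc mn_Sc_Sc del: mn_Sc)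

lemma mn_Zl: "n \<in> N \<Longrightarrow> mn Z n = Z"
  using ind2[of "\<^bold>0 \<^bold>- vx \<^bold>= \<^bold>0" Z Z n] by simp

lemma mn_mn: "m \<in> N \<Longrightarrow> k \<in> N \<Longrightarrow> n \<in> N \<Longrightarrow> mn (mn m k) n = mn m (ad k n)"
  using ind2[of "(v1 \<^bold>- v2) \<^bold>- vx \<^bold>= v1 \<^bold>- (v2 \<^bold>+ vx)" m k n] by (simp add: ad_Z ad_Sc)

lemma N_cases: "n \<in> N \<Longrightarrow> n = Z \<or> n = Sc (pr n)"
  using ind2[of "vx \<^bold>= \<^bold>0 \<^bold>\<or> vx \<^bold>= suc (pred_trm \<^bold>\<cdot> vx)" Z Z n] by (simp add: prop_defs) blast

lemma Z_ls_Sc: "n \<in> N \<Longrightarrow> ls Z (Sc n)"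
  using ind2[of "\<^bold>0 \<^bold>< suc vx" Z Z n] by (simp add: ls_Sc)

lemma ls_Sc_mono: "m \<in> N \<Longrightarrow> n \<in> N \<Longrightarrow> ls m n \<Longrightarrow> ls (Sc m) (Sc n)"
  using ind2[of "v1 \<^bold>< vx \<^bold>\<longrightarrow> suc v1 \<^bold>< suc vx" m Z n] by (auto simp: ls_Sc ls_Z)

lemma ls_Sc_less: "m \<in> N \<Longrightarrow> n \<in> N \<Longrightarrow> ls (Sc m) n \<Longrightarrow> ls m n"
proof -
  assume *: "m \<in> N" "n \<in> N" "ls (Sc m) n"
  have "msat ((vl m Z)((0, Num) := n)) (suc v1 \<^bold>< vx \<^bold>\<longrightarrow> v1 \<^bold>< vx)"
    by (rule ind2) (use * in \<open>auto simp: ls_Sc ls_Z\<close>)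
  then show ?thesis using * by simp
qed

lemma ls_Sc_Sc: "m \<in> N \<Longrightarrow> n \<in> N \<Longrightarrow> ls (Sc m) (Sc n) = ls m n"
  using ls_Sc_mono[of m n] ls_Sc[of "Sc m" n] ls_Sc_less[of m n] ls_Sc[of m m] by auto

lemma ls_irrefl: "n \<in> N \<Longrightarrow> \<not> ls n n"
  using ind2[of "\<^bold>\<not> (vx \<^bold>< vx)" Z Z n] by (simp add: prop_defs ls_Z ls_Sc_Sc)

lemma ls_linear: "m \<in> N \<Longrightarrow> n \<in> N \<Longrightarrow> ls m n \<or> m = n \<or> ls n m"
proof -
  assume m: "m \<in> N" and n: "n \<in> N"
  have "m = Z \<or> ls Z m" using N_cases[OF m] Z_ls_Sc[of "pr m"] m by (metis pr_dom)
  moreover have "ls m (Sc k) \<or> m = Sc k \<or> ls (Sc k) m" if "k \<in> N" "ls m k \<or> m = k \<or> ls k m" for k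
    using that m ls_Sc_mono[of k m] by (auto simp: ls_Sc)
  ultimately show ?thesis
    using ind2[of "v1 \<^bold>< vx \<^bold>\<or> v1 \<^bold>= vx \<^bold>\<or> vx \<^bold>< v1" m Z n] m n by (simp add: prop_defs) blast
qed

lemma ls_trans: "a \<in> N \<Longrightarrow> b \<in> N \<Longrightarrow> c \<in> N \<Longrightarrow> ls a b \<Longrightarrow> ls b c \<Longrightarrow> ls a c"
  using ind2[of "v2 \<^bold>< vx \<^bold>\<longrightarrow> v1 \<^bold>< vx" a b c] by (auto simp: ls_Sc ls_Z)

lemma ls_ad: "a \<in> N \<Longrightarrow> b \<in> N \<Longrightarrow> c \<in> N \<Longrightarrow> ls a b \<Longrightarrow> ls (ad a c) (ad b c)"
  using ind2[of "v1 \<^bold>+ vx \<^bold>< v2 \<^bold>+ vx" a b c] by (simp add: ad_Z ad_Sc ls_Sc_Sc)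

lemma ls_ml: "a \<in> N \<Longrightarrow> b \<in> N \<Longrightarrow> c \<in> N \<Longrightarrow> ls a b \<Longrightarrow> ls (ml a (Sc c)) (ml b (Sc c))"
proof -
  assume ab: "a \<in> N" "b \<in> N" "ls a b" and c: "c \<in> N"
  have "ls (ad (ml a (Sc k)) a) (ad (ml b (Sc k)) b)" if "k \<in> N" "ls (ml a (Sc k)) (ml b (Sc k))" for k
  proof (rule ls_trans)
    show "ls (ad (ml a (Sc k)) a) (ad (ml b (Sc k)) a)" using ab that by (intro ls_ad) auto
    show "ls (ad (ml b (Sc k)) a) (ad (ml b (Sc k)) b)"
      using ab that ls_ad[of a b "ml b (Sc k)"] by (simp add: ad_comm[of _ "ml b (Sc k)"])
  qed (use ab that in auto)
  then show ?thesis using ind2[of "v1 \<^bold>* suc vx \<^bold>< v2 \<^bold>* suc vx" a b c] ab c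
    by (simp add: ml_Sc[of _ "Sc _"]) (simp add: ml_Sc ml_Z ad_Zl)
qed

lemma mn_inverse: "n \<in> N \<Longrightarrow> m \<in> N \<Longrightarrow> ls n m \<or> n = m \<Longrightarrow> ad n (mn m n) = m"
proof -
  assume n: "n \<in> N" and m: "m \<in> N" and le: "ls n m \<or> n = m"
  have self: "mn k k = Z" if "k \<in> N" for k using mn_ad[of Z k] that by (simp add: ad_Zl)
  have S: "ad n (mn (Sc k) n) = Sc k" if k: "k \<in> N" and "ad n (mn k n) = k" for k
  proof -
    have "ad (Sc (mn k n)) n = Sc k" using that n by (simp add: ad_Scl ad_comm[of _ n] ad_Sc)
    then have "mn (Sc k) n = Sc (mn k n)" using mn_ad[of "Sc (mn k n)" n] n k by simp
    then show ?thesis using that n by (simp add: ad_Sc)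
  qed
  \<comment> \<open>Either \<open>n\<close> is at most \<open>k\<close>, where the induction
    hypothesis applies, or \<open>n\<close> is the successor itself and the difference is
    zero.\<close>
  have step: "ad n (mn (Sc k) n) = Sc k" if "k \<in> N" "ls n k \<or> n = k \<longrightarrow> ad n (mn k n) = k" "ls n (Sc k) \<or> n = Sc k" for k
    using that S[of k] n self[of n] by (auto simp: ls_Sc ad_Z)
  let ?A = "(v1 \<^bold>< vx \<^bold>\<or> v1 \<^bold>= vx) \<^bold>\<longrightarrow> v1 \<^bold>+ (vx \<^bold>- v1) \<^bold>= vx"
  have ev: "msat ((vl n Z)((0, Num) := k)) ?A \<longleftrightarrow> (ls n k \<or> n = k \<longrightarrow> ad n (mn k n) = k)" for k
    by (simp add: prop_defs disj_imp)
  have "msat ((vl n Z)((0, Num) := m)) ?A"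
  proof (rule ind2)
    show "msat ((vl n Z)((0, Num) := Z)) ?A" unfolding ev using n by (auto simp: ls_Z ad_Z)
    show "msat ((vl n Z)((0, Num) := Sc k)) ?A" if "k \<in> N" "msat ((vl n Z)((0, Num) := k)) ?A" for k
      using that step[of k] unfolding ev by blast
  qed (use n m in \<open>auto simp: prop_defs\<close>)
  then show ?thesis using le unfolding ev by blast
qed

end

section \<open>The numbers of a model as a type\<close>

text \<open>Discretely ordered semirings with subtraction: laws of numbers that also hold in a
  nonstandard model. With \<open>0 - a = 0\<close> the cancellation laws force all subtraction to be
  truncated, see \<open>minus_eq_0\<close>.\<close>

class mnat = linordered_semidom +
  assumes zero_least [simp]: "0 \<le> a"
    and less_succ: "a < b + 1 \<longleftrightarrow> a \<le> b"
    and zero_minus [simp]: "0 - a = 0"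

text \<open>Formal differences: the quotient is the ring of integers of the model.\<close>

definition equidiff :: "'a::mnat \<times> 'a \<Rightarrow> 'a \<times> 'a \<Rightarrow> bool" where
  "equidiff p q \<longleftrightarrow> fst p + snd q = fst q + snd p"

quotient_type (overloaded) 'a mint = "'a::mnat \<times> 'a" / equidiff morphisms Rep_mint Abs_mint
proof (rule equivpI)
  show "transp (equidiff :: 'a \<times> 'a \<Rightarrow> _)"
  proof (rule transpI)
    fix p q r :: "'a \<times> 'a" assume "equidiff p q" "equidiff q r"
    then have "(fst p + snd r) + (fst q + snd q) = (fst r + snd p) + (fst q + snd q)"
      unfolding equidiff_def by (metis (no_types, lifting) add.assoc add.commute)
    then show "equidiff p r" by (simp add: equidiff_def)
  qed
qed (auto simp: reflp_def symp_def equidiff_def)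

instantiation mint :: (mnat) comm_ring_1
begin

lift_definition zero_mint :: "'a mint" is "(0, 0)" .
lift_definition one_mint :: "'a mint" is "(1, 0)" .
lift_definition plus_mint :: "'a mint \<Rightarrow> 'a mint \<Rightarrow> 'a mint"
  is "\<lambda>p q. (fst p + fst q, snd p + snd q)"
  by (auto simp: equidiff_def) (metis (no_types, lifting) add.assoc add.commute)
lift_definition uminus_mint :: "'a mint \<Rightarrow> 'a mint" is "\<lambda>p. (snd p, fst p)"
  by (auto simp: equidiff_def add.commute)
lift_definition minus_mint :: "'a mint \<Rightarrow> 'a mint \<Rightarrow> 'a mint"
  is "\<lambda>p q. (fst p + snd q, snd p + fst q)"
  by (auto simp: equidiff_def) (metis (no_types, lifting) add.assoc add.commute)
lift_definition times_mint :: "'a mint \<Rightarrow> 'a mint \<Rightarrow> 'a mint"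
  is "\<lambda>p q. (fst p * fst q + snd p * snd q, fst p * snd q + snd p * fst q)"
proof -
  fix p p' q q' :: "'a \<times> 'a" assume "equidiff p p'" "equidiff q q'"
  then obtain a b c d a' b' c' d' where pq: "p = (a, b)" "p' = (a', b')" "q = (c, d)" "q' = (c', d')"
    and 1: "a + b' = a' + b" and 2: "c + d' = c' + d"
    by (cases p; cases p'; cases q; cases q') (auto simp: equidiff_def)
  have "(a + b') * c + (a' + b) * d + a' * (c + d') + b' * (c' + d) =
    (a' + b) * c + (a + b') * d + a' * (c' + d) + b' * (c + d')" using 1 2 by simp
  then have "(a * c + b * d + (a' * d' + b' * c')) + (b' * c + a' * d + a' * c + b' * d) =
    (a' * c' + b' * d' + (a * d + b * c)) + (b' * c + a' * d + a' * c + b' * d)" by (simp add: algebra_simps)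
  then have "a * c + b * d + (a' * d' + b' * c') = a' * c' + b' * d' + (a * d + b * c)" by (rule add_right_imp_eq)
  then show "equidiff (fst p * fst q + snd p * snd q, fst p * snd q + snd p * fst q)
      (fst p' * fst q' + snd p' * snd q', fst p' * snd q' + snd p' * fst q')"
    by (simp add: equidiff_def pq)
qed

instance
  by standard (transfer; auto simp: equidiff_def algebra_simps)+

end

instantiation mint :: (mnat) linorder
begin

lift_definition less_eq_mint :: "'a mint \<Rightarrow> 'a mint \<Rightarrow> bool" is "\<lambda>p q. fst p + snd q \<le> fst q + snd p"
proof -
  fix p p' q q' :: "'a \<times> 'a" assume *: "equidiff p p'" "equidiff q q'"
  have "fst p + snd q \<le> fst q + snd p \<longleftrightarrow> (fst p + snd q) + (snd p' + snd q') \<le> (fst q + snd p) + (snd p' + snd q')" by simp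
  also have "\<dots> \<longleftrightarrow> (fst p + snd p') + (snd q + snd q') \<le> (fst q + snd q') + (snd p + snd p')" by (simp add: ac_simps)
  also have "\<dots> \<longleftrightarrow> (fst p' + snd q') + (snd p + snd q) \<le> (fst q' + snd p') + (snd p + snd q)"
    by (simp only: *[unfolded equidiff_def]) (simp only: ac_simps)
  finally show "fst p + snd q \<le> fst q + snd p \<longleftrightarrow> fst p' + snd q' \<le> fst q' + snd p'" by simp
qed

definition less_mint :: "'a mint \<Rightarrow> 'a mint \<Rightarrow> bool" where "less_mint a b \<longleftrightarrow> a \<le> b \<and> \<not> b \<le> a"

instance
proof
  fix x y z :: "'a mint"
  show "x < y \<longleftrightarrow> x \<le> y \<and> \<not> y \<le> x" by (rule less_mint_def)
  show "x \<le> x" by transfer simp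
  show "x \<le> y \<or> y \<le> x" by transfer auto
  show "x \<le> y \<Longrightarrow> y \<le> x \<Longrightarrow> x = y" by transfer (auto simp: equidiff_def)
  show "x \<le> y \<Longrightarrow> y \<le> z \<Longrightarrow> x \<le> z"
  proof transfer
    fix x y z :: "'a \<times> 'a" assume "fst x + snd y \<le> fst y + snd x" "fst y + snd z \<le> fst z + snd y"
    then have "(fst x + snd y) + (fst y + snd z) \<le> (fst y + snd x) + (fst z + snd y)" by (rule add_mono)
    then have "(fst x + snd z) + (fst y + snd y) \<le> (fst z + snd x) + (fst y + snd y)" by (simp add: ac_simps)
    then show "fst x + snd z \<le> fst z + snd x" by simp
  qed
qed

end

section \<open>The ordered field of rationals of the model\<close>

lift_definition of_mnat :: "'a::mnat \<Rightarrow> 'a mint" is "\<lambda>n. (n, 0)" .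

lemma of_mnat_simps [simp]:
  "of_mnat 0 = 0" "of_mnat 1 = 1" "of_mnat (a + b) = of_mnat a + of_mnat b"
  "of_mnat (a * b) = of_mnat a * of_mnat b" "of_mnat a \<le> of_mnat b \<longleftrightarrow> a \<le> b"
  "of_mnat a = of_mnat b \<longleftrightarrow> a = b"
  by (transfer; simp add: equidiff_def)+

lemma diff_nonneg_of_mnat:
  assumes "0 \<le> (x :: 'a::mnat mint)"
  shows "\<exists>n. x = of_mnat n"
  using assms
proof transfer
  fix x :: "'a \<times> 'a" assume "fst (0::'a, 0::'a) + snd x \<le> fst x + snd (0::'a, 0::'a)"
  then show "\<exists>n. equidiff x (n, 0)" by (intro exI[of _ "fst x - snd x"]) (simp add: equidiff_def)
qed

instantiation mint :: (mnat) linordered_idom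
begin

definition abs_mint :: "'a mint \<Rightarrow> 'a mint" where "abs_mint a = (if a < 0 then - a else a)"
definition sgn_mint :: "'a mint \<Rightarrow> 'a mint" where "sgn_mint a = (if a = 0 then 0 else if 0 < a then 1 else - 1)"

instance
proof
  fix a b c :: "'a mint"
  show add: "a \<le> b \<Longrightarrow> c + a \<le> c + b" for a b c :: "'a mint"
  proof transfer
    fix a b c :: "'a \<times> 'a" assume "fst a + snd b \<le> fst b + snd a"
    then have "(fst a + snd b) + (fst c + snd c) \<le> (fst b + snd a) + (fst c + snd c)" by simp
    then show "fst (fst c + fst a, snd c + snd a) + snd (fst c + fst b, snd c + snd b)
        \<le> fst (fst c + fst b, snd c + snd b) + snd (fst c + fst a, snd c + snd a)"
      by (simp only: fst_conv snd_conv) (simp only: ac_simps)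
  qed
  have sub: "x < y \<longleftrightarrow> 0 < y - x" for x y :: "'a mint"
    using add[of x y "- x"] add[of y x "- x"] add[of 0 "y - x" x] add[of "y - x" 0 x] by (auto simp: less_mint_def)
  have pos: "0 < x * y" if xy: "0 < x" "0 < y" for x y :: "'a mint"
  proof -
    obtain m n where "x = of_mnat m" "y = of_mnat n"
      using diff_nonneg_of_mnat[of x] diff_nonneg_of_mnat[of y] xy by (auto dest: order.strict_implies_order)
    with xy of_mnat_simps(5,6)[of 0] show ?thesis
      by (metis less_le mult_pos_pos of_mnat_simps(1) of_mnat_simps(4) of_mnat_simps(5) of_mnat_simps(6))
  qed
  show "a < b \<Longrightarrow> 0 < c \<Longrightarrow> c * a < c * b"
    using pos[of c "b - a"] by (simp add: sub[of a b] sub[of "c * a"] right_diff_distrib)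
qed (auto simp: abs_mint_def sgn_mint_def)

end

lemma of_mnat_less [simp]: "of_mnat a < of_mnat b \<longleftrightarrow> a < b"
  by (simp add: less_le)

definition fr :: "'a::mnat \<Rightarrow> 'a mint fract" where "fr n = Fract (of_mnat n) 1"

lemma fr_simps [simp]:
  "fr 0 = 0" "fr 1 = 1" "fr (a + b) = fr a + fr b" "fr (a * b) = fr a * fr b"
  "fr a \<le> fr b \<longleftrightarrow> a \<le> b" "fr a < fr b \<longleftrightarrow> a < b" "fr a = fr b \<longleftrightarrow> a = b"
  by (simp_all add: fr_def Zero_fract_def One_fract_def eq_fract)

lemma fr_nonneg [simp]: "0 \<le> fr a"
  using fr_simps(5)[of 0 a] by simp

lemma fr_pos [simp]: "0 < fr a \<longleftrightarrow> 0 < a"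
  using fr_simps(6)[of 0 a] by simp

lemma fr_minus: "b \<le> a \<Longrightarrow> fr (a - b) = fr a - fr b"
  by (metis add_diff_cancel_left' fr_simps(3) le_add_diff_inverse)

lemma diff_fr_diff: "\<exists>a b. (x :: 'a::mnat mint) = of_mnat a - of_mnat b"
  by (cases "0 \<le> x") (metis diff_nonneg_of_mnat diff_zero of_mnat_simps(1), metis diff_nonneg_of_mnat diff_0 linear minus_minus neg_0_le_iff_le of_mnat_simps(1))

lemma fract_cases: "\<exists>a b d. 0 < d \<and> (x :: 'a::mnat mint fract) = (fr a - fr b) / fr d"
proof -
  obtain y z where x: "x = Fract y z" "0 < z"
  proof (cases x)
    case (Fract y w)
    then show thesis using that[of y w] that[of "- y" "- w"] by (cases "0 < w") auto
  qed
  obtain a b where "y = of_mnat a - of_mnat b" using diff_fr_diff by blast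
  moreover obtain d where d: "z = of_mnat d" using x diff_nonneg_of_mnat[of z] by (auto dest: less_imp_le)
  ultimately show ?thesis using x of_mnat_less[of 0 d]
    by (intro exI[of _ a] exI[of _ b] exI[of _ d]) (simp add: fr_def eq_fract)
qed

text \<open>Archimedean relative to the numbers of the model only, which suffices because
  convergence is measured by these numbers. A denominator is at least 1, so the positive part of the
  numerator is a bound.\<close>

lemma fr_archimedean: "\<exists>n. (x :: 'a::mnat mint fract) < fr n"
proof -
  obtain a b d where d: "0 < d" "x = (fr a - fr b) / fr d" using fract_cases by blast
  have "1 \<le> d" using d less_succ[of 0 "d"] by (metis add.left_neutral less_succ not_le)
  then have "1 \<le> fr d" using fr_simps(5)[of 1 d] by simp
  have "x \<le> fr a / fr d" using d by (simp add: divide_right_mono)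
  also have "\<dots> \<le> fr a" using \<open>1 \<le> fr d\<close> using mult_left_mono[of 1 "fr d" "fr a"] d by (simp add: divide_le_eq)
  also have "\<dots> < fr (a + 1)" by (simp only: fr_simps less_add_one)
  finally show ?thesis by blast
qed

lemma (in mnat) minus_eq_0 [simp]: "a \<le> b \<Longrightarrow> a - b = 0"
  by (metis add_diff_cancel_left' diff_diff_add le_add_diff_inverse add_0_right zero_minus)

lemma one_minus_mnat: "(1 :: 'n::mnat) - d = (if d = 0 then 1 else 0)"
proof (cases "d = 0")
  case True
  then show ?thesis using add_diff_cancel_left'[of "0::'n" 1] by simp
next
  case False
  then have "0 < d" using zero_least[of d] by (simp add: less_le)
  then have "1 \<le> d" using less_succ[of 1 d] less_succ[of 0 d] by (metis less_succ add_0 not_le)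
  then show ?thesis using False by simp
qed

lemma mnat_pos: "(n::'n::mnat) \<noteq> 0 \<longleftrightarrow> 0 < n"
  using zero_least[of n] by (auto simp: less_le)

lemma mnat_ge_1: "(1::'n::mnat) \<le> n \<longleftrightarrow> 0 < n"
  using less_succ[of n 0] by (metis add_0 mnat_pos not_le zero_least antisym)

section \<open>Definability\<close>

text \<open>Applicative polynomials over the model: parameters, de Bruijn variables and application.
  There is no binder; abstraction is recovered in \<open>pty_lam\<close>.\<close>

datatype 'u pol = PC 'u | PV nat | PA "'u pol" "'u pol"

text \<open>Identifying the numbers of the model with a type of class \<open>mnat\<close> makes the
  algebra and order of type classes applicable to them.\<close>

locale nmodel = model D ap I ls for D :: "ty \<Rightarrow> 'u set" and ap I ls +
  fixes num :: "'u \<Rightarrow> 'n::mnat"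
  assumes num_bij: "bij_betw num (D Num) UNIV"
    and num_Z [simp]: "num (I CZero) = 0"
    and num_Sc [simp]: "a \<in> D Num \<Longrightarrow> num (ap (I CSucc) a) = num a + 1"
    and num_ad [simp]: "a \<in> D Num \<Longrightarrow> b \<in> D Num \<Longrightarrow> num (ap (ap (I CPlus) a) b) = num a + num b"
    and num_ml [simp]: "a \<in> D Num \<Longrightarrow> b \<in> D Num \<Longrightarrow> num (ap (ap (I CTimes) a) b) = num a * num b"
    and num_ls [simp]: "a \<in> D Num \<Longrightarrow> b \<in> D Num \<Longrightarrow> ls a b \<longleftrightarrow> num a < num b"
begin

definition un :: "'n \<Rightarrow> 'u" where "un = inv_into (D Num) num"

lemma un_dom [simp]: "un n \<in> N" and num_un [simp]: "num (un n) = n"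
  using num_bij unfolding un_def bij_betw_def by (metis UNIV_I inv_into_into, metis UNIV_I f_inv_into_f)

lemma un_num [simp]: "a \<in> N \<Longrightarrow> un (num a) = a"
  using num_bij unfolding un_def bij_betw_def by simp

lemma num_inj: "a \<in> N \<Longrightarrow> b \<in> N \<Longrightarrow> num a = num b \<longleftrightarrow> a = b"
  by (metis un_num)

text \<open>The locale says nothing about truncated subtraction; the laws of \<open>mnat\<close>
  determine it, through \<open>mn_inverse\<close> when \<open>b\<close> is at most \<open>a\<close>
  and through truncation to zero otherwise.\<close>

lemma num_mn [simp]: "a \<in> N \<Longrightarrow> b \<in> N \<Longrightarrow> num (mn a b) = num a - num b"
proof (cases "ls b a \<or> b = a")
  case True
  assume ab: "a \<in> N" "b \<in> N"
  have "num b + num (mn a b) = num a" using mn_inverse[OF ab(2,1) True] ab by (metis mn_dom num_ad)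
  then show ?thesis by (metis add_diff_cancel_left')
next
  case False
  assume ab: "a \<in> N" "b \<in> N"
  then have l: "ls a b" using False ls_linear by blast
  have "mn a b = mn a (ad a (mn b a))" using mn_inverse[OF ab] l by simp
  also have "\<dots> = mn (mn a a) (mn b a)" using ab by (simp add: mn_mn)
  also have "mn a a = Z" using mn_ad[of Z a] ab by (simp add: ad_Zl)
  finally show ?thesis using ab l by (simp add: mn_Zl)
qed

text \<open>A sort pairs a type of the language with the relation between the elements of that type in the
  model and the objects of some HOL type which they represent.\<close>

definition r0 :: "ty \<times> ('u \<Rightarrow> 'n \<Rightarrow> bool)" where
  "r0 = (Num, \<lambda>u n. u \<in> N \<and> num u = n)"

definition rfun :: "ty \<times> ('u \<Rightarrow> 'a \<Rightarrow> bool) \<Rightarrow> ty \<times> ('u \<Rightarrow> 'b \<Rightarrow> bool) \<Rightarrow> ty \<times> ('u \<Rightarrow> ('a \<Rightarrow> 'b) \<Rightarrow> bool)" where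
  "rfun A B = (fst A \<^bold>\<rightarrow> fst B, \<lambda>f F. f \<in> D (fst A \<^bold>\<rightarrow> fst B) \<and> (\<forall>a x. snd A a x \<longrightarrow> snd B (ap f a) (F x)))"

text \<open>A HOL object has at most one representative. Conversely an element may represent many
  HOL functions, since their values at arguments outside the model are not constrained.\<close>

definition good :: "ty \<times> ('u \<Rightarrow> 'a \<Rightarrow> bool) \<Rightarrow> bool" where
  "good A \<longleftrightarrow> (\<forall>u x. snd A u x \<longrightarrow> u \<in> D (fst A)) \<and> (\<forall>u\<in>D (fst A). \<exists>x. snd A u x) \<and>
     (\<forall>u v x. snd A u x \<longrightarrow> snd A v x \<longrightarrow> u = v)"

definition rl :: "ty \<times> ('u \<Rightarrow> 'a \<Rightarrow> bool) \<Rightarrow> 'a \<Rightarrow> bool" where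
  "rl A x \<longleftrightarrow> (\<exists>u. snd A u x)"

abbreviation r1 where "r1 \<equiv> rfun r0 r0"

lemma fst_r0 [simp]: "fst r0 = Num" by (simp add: r0_def)
lemma fst_rfun [simp]: "fst (rfun A B) = fst A \<^bold>\<rightarrow> fst B" by (simp add: rfun_def)
lemma snd_r0: "snd r0 u n \<longleftrightarrow> u \<in> N \<and> num u = n" by (simp add: r0_def)
lemma snd_rfun: "snd (rfun A B) f F \<longleftrightarrow> f \<in> D (fst A \<^bold>\<rightarrow> fst B) \<and> (\<forall>a x. snd A a x \<longrightarrow> snd B (ap f a) (F x))"
  by (simp add: rfun_def)

lemma appD: "snd (rfun A B) f F \<Longrightarrow> snd A a x \<Longrightarrow> snd B (ap f a) (F x)" by (simp add: snd_rfun)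
lemma r0_un: "snd r0 (un n) n" by (simp add: snd_r0)

lemma good_dom: "good A \<Longrightarrow> snd A u x \<Longrightarrow> u \<in> D (fst A)" by (auto simp: good_def)
lemma good_total: "good A \<Longrightarrow> u \<in> D (fst A) \<Longrightarrow> \<exists>x. snd A u x" by (auto simp: good_def)
lemma good_unique: "good A \<Longrightarrow> snd A u x \<Longrightarrow> snd A v x \<Longrightarrow> u = v" unfolding good_def by blast

lemma good_r0 [simp]: "good r0"
  unfolding good_def by (auto simp: snd_r0 num_inj)

lemma good_rfun [simp]:
  assumes A: "good A" and B: "good B"
  shows "good (rfun A B)"
  unfolding good_def
proof (intro conjI allI ballI impI)
  fix f assume f: "f \<in> D (fst (rfun A B))"
  have "\<exists>y. \<forall>a. snd A a x \<longrightarrow> snd B (ap f a) y" for x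
  proof (cases "\<exists>a. snd A a x")
    case True
    then obtain a where a: "snd A a x" by blast
    then have "ap f a \<in> D (fst B)" using ap_dom f good_dom[OF A] by simp
    then show ?thesis using good_total[OF B] good_unique[OF A a] by blast
  qed simp
  then obtain F where "\<forall>x a. snd A a x \<longrightarrow> snd B (ap f a) (F x)" by metis
  then show "\<exists>F. snd (rfun A B) f F" using f by (auto simp: snd_rfun)
next
  fix f g F assume fg: "snd (rfun A B) f F" "snd (rfun A B) g F"
  show "f = g"
  proof (rule ap_ext)
    fix a assume "a \<in> D (fst A)"
    then show "ap f a = ap g a" using fg good_total[OF A] good_unique[OF B] by (auto simp: snd_rfun) blast
  qed (use fg in \<open>auto simp: snd_rfun\<close>)
qed (auto simp: snd_rfun)

section \<open>Applicative polynomials and combinatory completeness\<close>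

primrec pev :: "'u list \<Rightarrow> 'u pol \<Rightarrow> 'u" where
  "pev e (PC u) = u"
| "pev e (PV k) = e ! k"
| "pev e (PA p q) = ap (pev e p) (pev e q)"

primrec pty :: "ty list \<Rightarrow> 'u pol \<Rightarrow> ty \<Rightarrow> bool" where
  "pty \<Gamma> (PC u) \<tau> \<longleftrightarrow> u \<in> D \<tau>"
| "pty \<Gamma> (PV k) \<tau> \<longleftrightarrow> k < length \<Gamma> \<and> \<Gamma> ! k = \<tau>"
| "pty \<Gamma> (PA p q) \<tau> \<longleftrightarrow> (\<exists>\<sigma>. pty \<Gamma> p (\<sigma> \<^bold>\<rightarrow> \<tau>) \<and> pty \<Gamma> q \<sigma>)"

abbreviation envs :: "'u list \<Rightarrow> ty list \<Rightarrow> bool" where "envs \<equiv> list_all2 (\<lambda>a \<tau>. a \<in> D \<tau>)"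

lemma pev_dom: "pty \<Gamma> p \<tau> \<Longrightarrow> envs e \<Gamma> \<Longrightarrow> pev e p \<in> D \<tau>"
  by (induction p arbitrary: \<tau>) (auto simp: list_all2_conv_all_nth intro: ap_dom)

lemma id_ex: "\<exists>i\<in>D (\<sigma> \<^bold>\<rightarrow> \<sigma>). \<forall>a\<in>D \<sigma>. ap i a = a"
proof
  let ?i = "mval \<rho>0 (lamV 0 \<sigma> (Var 0 \<sigma>))"
  show "?i \<in> D (\<sigma> \<^bold>\<rightarrow> \<sigma>)" by (rule val_dom) (simp_all add: typ_of_lamV)
  show "\<forall>a\<in>D \<sigma>. ap ?i a = a" using val_lamV[of "Var 0 \<sigma>" \<sigma> \<rho>0 _ \<sigma> 0] by simp
qed

text \<open>Combinatory completeness: bracket abstraction again, uniformly in the remaining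
  variables and with elements of the model as parameters.\<close>

lemma pty_lam:
  "pty (\<sigma> # \<Gamma>) p \<tau> \<Longrightarrow> \<exists>q. pty \<Gamma> q (\<sigma> \<^bold>\<rightarrow> \<tau>) \<and> (\<forall>e. envs e \<Gamma> \<longrightarrow> (\<forall>a\<in>D \<sigma>. ap (pev e q) a = pev (a # e) p))"
proof (induction p arbitrary: \<tau>)
  case (PC u)
  then show ?case using ap_dom[OF I_doms(6)] K_eq by (intro exI[of _ "PC (ap (I (CK \<tau> \<sigma>)) u)"]) auto
next
  case (PV k)
  show ?case
  proof (cases k)
    case 0
    then show ?thesis using PV id_ex[of \<sigma>] by (auto intro: exI[of _ "PC _"])
  next
    case (Suc j)
    then show ?thesis using PV I_doms(6) K_eq
      by (intro exI[of _ "PA (PC (I (CK \<tau> \<sigma>))) (PV j)"]) (auto simp: list_all2_conv_all_nth)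
  qed
next
  case (PA p1 p2)
  from PA.prems obtain \<rho> where "pty (\<sigma> # \<Gamma>) p1 (\<rho> \<^bold>\<rightarrow> \<tau>)" "pty (\<sigma> # \<Gamma>) p2 \<rho>" by auto
  then obtain q1 q2 where q: "pty \<Gamma> q1 (\<sigma> \<^bold>\<rightarrow> \<rho> \<^bold>\<rightarrow> \<tau>)" "pty \<Gamma> q2 (\<sigma> \<^bold>\<rightarrow> \<rho>)"
    and e: "envs e \<Gamma> \<Longrightarrow> a \<in> D \<sigma> \<Longrightarrow> ap (pev e q1) a = pev (a # e) p1"
      "envs e \<Gamma> \<Longrightarrow> a \<in> D \<sigma> \<Longrightarrow> ap (pev e q2) a = pev (a # e) p2" for e a
    using PA.IH by meson
  have "pty \<Gamma> (PA (PA (PC (I (CS \<sigma> \<rho> \<tau>))) q1) q2) (\<sigma> \<^bold>\<rightarrow> \<tau>)"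
    unfolding pty.simps using q I_doms(7)[of \<sigma> \<rho> \<tau>] by blast
  moreover have "ap (pev f (PA (PA (PC (I (CS \<sigma> \<rho> \<tau>))) q1) q2)) a = pev (a # f) (PA p1 p2)"
    if "envs f \<Gamma>" "a \<in> D \<sigma>" for f a
    using S_eq[OF pev_dom[OF q(1)] pev_dom[OF q(2)]] e that by simp
  ultimately show ?case by blast
qed

definition cnil :: "ty list \<times> ('u list \<Rightarrow> unit \<Rightarrow> bool)" where "cnil = ([], \<lambda>e c. e = [])"

text \<open>A context relates a list of elements to a nested tuple of the objects they represent;
  variable \<open>k\<close> is the projection \<open>fst\<close> after \<open>k\<close> times
  \<open>snd\<close>.\<close>

definition ccons :: "ty \<times> ('u \<Rightarrow> 'a \<Rightarrow> bool) \<Rightarrow> ty list \<times> ('u list \<Rightarrow> 'c \<Rightarrow> bool) \<Rightarrow> ty list \<times> ('u list \<Rightarrow> 'a \<times> 'c \<Rightarrow> bool)" where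
  "ccons A G = (fst A # fst G, \<lambda>e c. \<exists>a f. e = a # f \<and> snd A a (fst c) \<and> snd G f (snd c))"

definition gctx :: "ty list \<times> ('u list \<Rightarrow> 'c \<Rightarrow> bool) \<Rightarrow> bool" where
  "gctx G \<longleftrightarrow> (\<forall>e c. snd G e c \<longrightarrow> envs e (fst G))"

lemma gctx_nil: "gctx cnil" by (simp add: gctx_def cnil_def)
lemma gctx_cons: "good A \<Longrightarrow> gctx G \<Longrightarrow> gctx (ccons A G)" by (auto simp: gctx_def ccons_def good_def)

text \<open>\<open>dfn G A F\<close>: the map \<open>F\<close> from the objects described by the context \<open>G\<close> to those of sort \<open>A\<close> is
  represented uniformly by an applicative term with parameters from the model.\<close>

definition dfn :: "ty list \<times> ('u list \<Rightarrow> 'c \<Rightarrow> bool) \<Rightarrow> ty \<times> ('u \<Rightarrow> 'a \<Rightarrow> bool) \<Rightarrow> ('c \<Rightarrow> 'a) \<Rightarrow> bool" where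
  "dfn G A F \<longleftrightarrow> (\<exists>p. pty (fst G) p (fst A) \<and> (\<forall>e c. snd G e c \<longrightarrow> snd A (pev e p) (F c)))"

lemma dfn_const: "good A \<Longrightarrow> rl A x \<Longrightarrow> dfn G A (\<lambda>c. x)"
  unfolding dfn_def rl_def by (metis good_dom pev.simps(1) pty.simps(1))

lemma dfn_fst: "dfn (ccons A G) A (\<lambda>c. fst c)"
  unfolding dfn_def by (rule exI[of _ "PV 0"]) (auto simp: ccons_def)

lemma pty_shift: "pty \<Gamma> p \<tau> \<Longrightarrow> \<exists>q. pty (\<sigma> # \<Gamma>) q \<tau> \<and> (\<forall>a e. pev (a # e) q = pev e p)"
proof (induction p arbitrary: \<tau>)
  case (PC u) then show ?case by (intro exI[of _ "PC u"]) auto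
next
  case (PV k) then show ?case by (intro exI[of _ "PV (Suc k)"]) auto
next
  case (PA p1 p2)
  then obtain \<rho> where "pty \<Gamma> p1 (\<rho> \<^bold>\<rightarrow> \<tau>)" "pty \<Gamma> p2 \<rho>" by auto
  then obtain q1 q2 where "pty (\<sigma> # \<Gamma>) q1 (\<rho> \<^bold>\<rightarrow> \<tau>)" "\<forall>a e. pev (a # e) q1 = pev e p1"
      "pty (\<sigma> # \<Gamma>) q2 \<rho>" "\<forall>a e. pev (a # e) q2 = pev e p2" using PA.IH by meson
  then show ?case by (intro exI[of _ "PA q1 q2"]) auto
qed

lemma dfn_snd: "dfn G B F \<Longrightarrow> dfn (ccons A G) B (\<lambda>c. F (snd c))"
proof -
  assume "dfn G B F"
  then obtain p where p: "pty (fst G) p (fst B)" "\<forall>e c. snd G e c \<longrightarrow> snd B (pev e p) (F c)" by (auto simp: dfn_def)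
  then obtain q where "pty (fst A # fst G) q (fst B)" "\<forall>a e. pev (a # e) q = pev e p" using pty_shift by meson
  then show ?thesis using p unfolding dfn_def by (intro exI[of _ q]) (auto simp: ccons_def)
qed

lemma dfn_app: "dfn G (rfun A B) f \<Longrightarrow> dfn G A x \<Longrightarrow> dfn G B (\<lambda>c. f c (x c))"
proof -
  assume "dfn G (rfun A B) f" "dfn G A x"
  then obtain p q where "pty (fst G) p (fst A \<^bold>\<rightarrow> fst B)" "\<forall>e c. snd G e c \<longrightarrow> snd (rfun A B) (pev e p) (f c)"
     "pty (fst G) q (fst A)" "\<forall>e c. snd G e c \<longrightarrow> snd A (pev e q) (x c)" by (auto simp: dfn_def)
  then show ?thesis unfolding dfn_def by (intro exI[of _ "PA p q"]) (auto simp: snd_rfun)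
qed

lemma dfn_lam:
  assumes "dfn (ccons A G) B (\<lambda>c. F (snd c) (fst c))" "good A" "gctx G"
  shows "dfn G (rfun A B) (\<lambda>c x. F c x)"
proof -
  from assms(1) obtain p where p: "pty (fst A # fst G) p (fst B)"
      "\<forall>e c. snd (ccons A G) e c \<longrightarrow> snd B (pev e p) (F (snd c) (fst c))" by (auto simp: dfn_def ccons_def)
  then obtain q where q: "pty (fst G) q (fst A \<^bold>\<rightarrow> fst B)"
      "\<And>e a. envs e (fst G) \<Longrightarrow> a \<in> D (fst A) \<Longrightarrow> ap (pev e q) a = pev (a # e) p" using pty_lam by meson
  have "snd (rfun A B) (pev e q) (F c)" if "snd G e c" for e c
    unfolding snd_rfun
  proof (intro conjI allI impI)
    have e: "envs e (fst G)" using assms(3) that by (auto simp: gctx_def)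
    show "pev e q \<in> D (fst A \<^bold>\<rightarrow> fst B)" using pev_dom[OF q(1) e] .
    fix a x assume "snd A a x"
    then show "snd B (ap (pev e q) a) (F c x)"
      using q(2)[OF e] good_dom[OF assms(2)] p(2)[rule_format, of "a # e" "(x, c)"] that by (simp add: ccons_def)
  qed
  then show ?thesis using q(1) unfolding dfn_def by auto
qed

lemma dfn_rl: "dfn cnil A (\<lambda>c. x) \<Longrightarrow> rl A x"
  unfolding dfn_def rl_def cnil_def by auto

lemma rl_app: "rl (rfun A B) f \<Longrightarrow> rl A x \<Longrightarrow> rl B (f x)"
  unfolding rl_def by (auto simp: snd_rfun)

lemma rl_lam: "dfn (ccons A cnil) B (\<lambda>c. F (fst c)) \<Longrightarrow> good A \<Longrightarrow> rl (rfun A B) F"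
  by (rule dfn_rl, rule dfn_lam[where F = "\<lambda>c. F"]) (auto simp: gctx_nil)

lemma rl_lam2:
  assumes "dfn (ccons B (ccons A cnil)) C (\<lambda>c. F (fst (snd c)) (fst c))" "good A" "good B"
  shows "rl (rfun A (rfun B C)) F"
  using assms by (intro rl_lam dfn_lam) (auto simp: gctx_nil gctx_cons)

lemma dfn_app1: "rl (rfun A B) h \<Longrightarrow> good A \<Longrightarrow> good B \<Longrightarrow> dfn G A x \<Longrightarrow> dfn G B (\<lambda>c. h (x c))"
  by (rule dfn_app[where f = "\<lambda>c. h"], rule dfn_const) auto

lemma dfn_app2: "rl (rfun A (rfun B C)) h \<Longrightarrow> good A \<Longrightarrow> good B \<Longrightarrow> good C \<Longrightarrow> dfn G A x \<Longrightarrow> dfn G B y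
   \<Longrightarrow> dfn G C (\<lambda>c. h (x c) (y c))"
  by (rule dfn_app[where x = y], rule dfn_app1[where h = h]) auto

lemma dfn_app_var0: "dfn (ccons (rfun A B) G) A x \<Longrightarrow> dfn (ccons (rfun A B) G) B (\<lambda>c. fst c (x c))"
  by (rule dfn_app[OF dfn_fst])

lemma dfn_app_var1: "dfn (ccons X (ccons (rfun A B) G)) A x \<Longrightarrow> dfn (ccons X (ccons (rfun A B) G)) B (\<lambda>c. fst (snd c) (x c))"
  by (rule dfn_app[OF dfn_snd[OF dfn_fst]])

lemma dfn_app_var2: "dfn (ccons Y (ccons X (ccons (rfun A B) G))) A x
   \<Longrightarrow> dfn (ccons Y (ccons X (ccons (rfun A B) G))) B (\<lambda>c. fst (snd (snd c)) (x c))"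
  by (rule dfn_app[OF dfn_snd[OF dfn_snd[OF dfn_fst]]])

lemma dfn_app_var3: "dfn (ccons Z' (ccons Y (ccons X (ccons (rfun A B) G)))) A x
   \<Longrightarrow> dfn (ccons Z' (ccons Y (ccons X (ccons (rfun A B) G)))) B (\<lambda>c. fst (snd (snd (snd c))) (x c))"
  by (rule dfn_app[OF dfn_snd[OF dfn_snd[OF dfn_snd[OF dfn_fst]]]])

lemma dfn_app_var4: "dfn (ccons W (ccons Z' (ccons Y (ccons X (ccons (rfun A B) G))))) A x
   \<Longrightarrow> dfn (ccons W (ccons Z' (ccons Y (ccons X (ccons (rfun A B) G))))) B (\<lambda>c. fst (snd (snd (snd (snd c)))) (x c))"
  by (rule dfn_app[OF dfn_snd[OF dfn_snd[OF dfn_snd[OF dfn_snd[OF dfn_fst]]]]])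

lemmas dfn_vars = dfn_app_var0 dfn_app_var1 dfn_app_var2 dfn_app_var3 dfn_app_var4 dfn_fst dfn_snd

section \<open>Definable arithmetic, recursion and decidable predicates\<close>

lemma rl_plus: "rl (rfun r0 (rfun r0 r0)) (+)"
  and rl_times: "rl (rfun r0 (rfun r0 r0)) (*)"
  and rl_minus: "rl (rfun r0 (rfun r0 r0)) (-)"
proof -
  have "snd (rfun r0 (rfun r0 r0)) (I CPlus) (+)" "snd (rfun r0 (rfun r0 r0)) (I CTimes) (*)"
    by (auto simp: snd_rfun snd_r0 intro: ap_dom I_doms)
  moreover have "mval \<rho>0 monus_trm \<in> D (Num \<^bold>\<rightarrow> Num \<^bold>\<rightarrow> Num)" by (rule val_dom) auto
  then have "snd (rfun r0 (rfun r0 r0)) (mval \<rho>0 monus_trm) (-)" by (auto simp: snd_rfun snd_r0 intro: ap_dom)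
  ultimately show "rl (rfun r0 (rfun r0 r0)) (+)" "rl (rfun r0 (rfun r0 r0)) (*)" "rl (rfun r0 (rfun r0 r0)) (-)"
    unfolding rl_def by blast+
qed

lemma rl_0: "rl r0 n"
  unfolding rl_def by (auto simp: snd_r0 intro!: exI[of _ "un n"])

lemmas dfn_num [simp] = dfn_const[OF good_r0 rl_0]

lemmas dfn_plus = dfn_app2[OF rl_plus good_r0 good_r0 good_r0]
lemmas dfn_times = dfn_app2[OF rl_times good_r0 good_r0 good_r0]
lemmas dfn_minus = dfn_app2[OF rl_minus good_r0 good_r0 good_r0]

abbreviation rrec where "rrec \<equiv> rfun (rfun r0 (rfun r0 r0)) (rfun r0 (rfun r0 r0))"

text \<open>Recursion along possibly nonstandard numbers is that of the model's recursor. It fixes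
  the values at representable step functions only, hence the hypothesis in \<open>prc_0\<close> and
  \<open>prc_Suc\<close>.\<close>

definition prc :: "('n \<Rightarrow> 'n \<Rightarrow> 'n) \<Rightarrow> 'n \<Rightarrow> 'n \<Rightarrow> 'n" where
  "prc = (SOME R. snd rrec (I CRec) R)"

lemma prc: "snd rrec (I CRec) prc"
  unfolding prc_def
  by (rule someI_ex[of "snd rrec (I CRec)"], rule good_total) (auto intro: I_doms)

lemma dfn_prc: "dfn G (rfun r0 (rfun r0 r0)) f \<Longrightarrow> dfn G r0 a \<Longrightarrow> dfn G r0 n \<Longrightarrow> dfn G r0 (\<lambda>c. prc (f c) (a c) (n c))"
  by (rule dfn_app[where x = n], rule dfn_app2[where h = prc]) (use prc in \<open>auto simp: rl_def\<close>)

lemma prc_0: "rl (rfun r0 (rfun r0 r0)) f \<Longrightarrow> prc f a 0 = a"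
  and prc_Suc: "rl (rfun r0 (rfun r0 r0)) f \<Longrightarrow> prc f a (n + 1) = f n (prc f a n)"
proof -
  assume "rl (rfun r0 (rfun r0 r0)) f"
  then obtain u where u: "snd (rfun r0 (rfun r0 r0)) u f" by (auto simp: rl_def)
  then have ud: "u \<in> D (Num \<^bold>\<rightarrow> Num \<^bold>\<rightarrow> Num)" by (simp add: snd_rfun)
  have r: "num (rc u (un a) (un n)) = prc f a n" for a n
    using appD[OF appD[OF appD[OF prc u] r0_un] r0_un] by (simp add: snd_r0)
  have f: "num (ap (ap u (un a)) (un b)) = f a b" for a b
    using appD[OF appD[OF u r0_un] r0_un] by (simp add: snd_r0)
  show "prc f a 0 = a" using r[of a 0] rc_Z[OF ud un_dom, of a] un_num[of Z] by simp
  have 1: "un (n + 1) = Sc (un n)" by (metis N_closed(2) num_Sc num_un un_dom un_num)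
  have "prc f a (n + 1) = num (ap (ap u (un n)) (rc u (un a) (un n)))"
    using r[of a "n + 1"] rc_Sc[OF ud, of "un a" "un n"] by (simp add: 1)
  also have "rc u (un a) (un n) = un (prc f a n)" using r[of a n] rc_dom[OF ud] by (metis un_dom un_num)
  finally show "prc f a (n + 1) = f n (prc f a n)" using f by simp
qed

text \<open>Truth is coded by \<open>0\<close>, so that a decidable predicate becomes an equation
  \<open>u n = 0\<close>, the shape to which induction and choice are applied.\<close>

definition pd :: "ty list \<times> ('u list \<Rightarrow> 'c \<Rightarrow> bool) \<Rightarrow> ('c \<Rightarrow> bool) \<Rightarrow> bool" where
  "pd G P \<longleftrightarrow> dfn G r0 (\<lambda>c. if P c then 0 else 1)"

lemma pd_less: "dfn G r0 a \<Longrightarrow> dfn G r0 b \<Longrightarrow> pd G (\<lambda>c. a c < b c)"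
proof -
  assume ab: "dfn G r0 a" "dfn G r0 b"
  have "(if a c < b c then 0 else 1) = 1 - (b c - a c)" for c
    by (auto simp: one_minus_mnat) (metis add_0_right le_add_diff_inverse less_imp_le less_irrefl)
  then show ?thesis unfolding pd_def by (simp only:) (rule dfn_minus dfn_num ab)+
qed

lemma pd_not: "pd G P \<Longrightarrow> pd G (\<lambda>c. \<not> P c)"
proof -
  assume P: "pd G P"
  have "(if \<not> P c then 0 else 1::'n) = 1 - (if P c then 0 else 1)" for c by (simp add: one_minus_mnat)
  then show ?thesis using P unfolding pd_def by (simp only:) (rule dfn_minus dfn_num | assumption)+
qed

lemma pd_disj: "pd G P \<Longrightarrow> pd G Q \<Longrightarrow> pd G (\<lambda>c. P c \<or> Q c)"
proof -
  assume P: "pd G P" "pd G Q"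
  have "(if P c \<or> Q c then 0 else 1::'n) = (if P c then 0 else 1) * (if Q c then 0 else 1)" for c by simp
  then show ?thesis using P unfolding pd_def by (simp only:) (rule dfn_times | assumption)+
qed

lemma conj_eq_not_disj: "(P \<and> Q) = (\<not> (\<not> P \<or> \<not> Q))" by simp

lemma pd_conj: "pd G P \<Longrightarrow> pd G Q \<Longrightarrow> pd G (\<lambda>c. P c \<and> Q c)"
  unfolding conj_eq_not_disj by (intro pd_not pd_disj)

lemma pd_imp: "pd G P \<Longrightarrow> pd G Q \<Longrightarrow> pd G (\<lambda>c. P c \<longrightarrow> Q c)"
  unfolding imp_conv_disj by (intro pd_not pd_disj)

lemma pd_le: "dfn G r0 a \<Longrightarrow> dfn G r0 b \<Longrightarrow> pd G (\<lambda>c. a c \<le> b c)"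
  using pd_not[OF pd_less[of G b a]] by (simp add: not_less)

lemma pd_eq: "dfn G r0 a \<Longrightarrow> dfn G r0 b \<Longrightarrow> pd G (\<lambda>c. a c = b c)"
  using pd_conj[OF pd_le[of G a b] pd_le[of G b a]] by (simp add: eq_iff)

lemma pd_const: "pd G (\<lambda>c. P)"
  unfolding pd_def by (cases P) auto

lemma dfn_if: "pd G P \<Longrightarrow> dfn G r0 a \<Longrightarrow> dfn G r0 b \<Longrightarrow> dfn G r0 (\<lambda>c. if P c then a c else b c)"
proof -
  assume P: "pd G P" and ab: "dfn G r0 a" "dfn G r0 b"
  have e: "(if P c then a c else b c) = (if \<not> P c then 0 else 1) * a c + (if P c then 0 else 1) * b c" for c by simp
  show ?thesis unfolding e using P pd_not[OF P] ab unfolding pd_def by (intro dfn_plus dfn_times)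
qed

lemmas dfn_ops = dfn_plus dfn_times dfn_minus dfn_if
lemmas pd_ops = pd_const pd_not pd_conj pd_disj pd_imp pd_less pd_le pd_eq
lemmas dfn_good = good_r0 good_rfun gctx_nil gctx_cons
lemmas dfn_base = dfn_num dfn_ops pd_ops dfn_vars dfn_prc

text \<open>The characteristic function becomes a parameter of type 1 in a quantifier-free formula.
  Definability cannot be dropped: in a nonstandard model the predicate of being a standard number is
  inductive without being true everywhere.\<close>

lemma num_induct:
  assumes "pd (ccons r0 cnil) (\<lambda>c. P (fst c))" and 0: "P 0" and Suc: "\<And>n. P n \<Longrightarrow> P (n + 1)"
  shows "P n"
proof -
  have "rl r1 (\<lambda>n. if P n then 0 else 1)" using assms(1) unfolding pd_def by (intro rl_lam) auto
  then obtain u where u: "snd r1 u (\<lambda>n. if P n then 0 else 1)" by (auto simp: rl_def)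
  then have ud: "u \<in> D ty1" by (simp add: snd_rfun)
  have uP: "ap u a = Z \<longleftrightarrow> P (num a)" if "a \<in> N" for a
  proof -
    have "ap u a \<in> N" "num (ap u a) = (if P (num a) then 0 else 1)" using u that by (auto simp: snd_rfun snd_r0)
    then show ?thesis using num_inj[of "ap u a" Z] by (auto split: if_splits)
  qed
  have "msat ((\<rho>0((1, ty1) := u))((0, Num) := un n)) (Eq (Var 1 ty1 \<^bold>\<cdot> Var 0 Num) \<^bold>0)"
    by (rule N_induct) (use ud 0 Suc uP in auto)
  then show ?thesis using uP by simp
qed

end

context nmodel
begin

lemma not_less_0 [simp]: "\<not> (k::'n) < 0" by (simp add: not_less)
lemma le_0 [simp]: "(k::'n) \<le> 0 \<longleftrightarrow> k = 0" using zero_least[of k] by (auto intro: antisym)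

subsection \<open>Bounded quantifiers, least numbers and choice\<close>

lemma dfn_cong: "(\<And>e c. snd G e c \<Longrightarrow> F c = F' c) \<Longrightarrow> dfn G A F \<Longrightarrow> dfn G A F'"
  unfolding dfn_def by auto

lemma dfn_point: "dfn G A F \<Longrightarrow> snd G e c \<Longrightarrow> rl A (F c)"
  unfolding dfn_def rl_def by auto

abbreviation dec :: "('n \<Rightarrow> bool) \<Rightarrow> bool" where "dec P \<equiv> pd (ccons r0 cnil) (\<lambda>c. P (fst c))"

lemma pd_snd: "pd G P \<Longrightarrow> pd (ccons A G) (\<lambda>c. P (snd c))"
  unfolding pd_def by (rule dfn_snd)

text \<open>A bounded universal quantifier is a recursion whose value changes from 0 to 1 at the
  first failure and then stays there.\<close>

lemma prc_ball:
  assumes f: "rl (rfun r0 (rfun r0 r0)) (\<lambda>k r. if r = 0 \<and> P k then 0 else 1)" (is "rl _ ?f")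
  shows "prc ?f 0 n = (if \<forall>k<n. P k then 0 else 1)"
proof -
  let ?g = "prc ?f 0"
  have g: "rl r1 ?g"
    by (rule rl_lam) (rule dfn_prc dfn_const[OF _ f] dfn_num dfn_fst dfn_good)+
  note gS = prc_Suc[OF f, of 0] and g0 = prc_0[OF f, of 0]
  have 1: "k < n \<longrightarrow> ?g n = 0 \<longrightarrow> P k" for k n
    by (rule num_induct[where n = n], (rule pd_ops dfn_app1[OF g] dfn_fst dfn_num dfn_good)+)
      (auto simp: g0 gS less_succ le_less split: if_splits)
  \<comment> \<open>Bounded quantifiers cannot occur in induction formulas before
    \<open>pd_ball\<close>, so the assumption is fixed at \<open>n\<close> and the induction runs
    over the \<open>m\<close> up to it.\<close>
  have 2: "m \<le> n \<longrightarrow> ?g m = 0" if "\<forall>k<n. P k" for m n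
  proof (rule num_induct[where n = m], (rule pd_ops dfn_app1[OF g] dfn_fst dfn_num dfn_good)+)
    fix m assume "m \<le> n \<longrightarrow> ?g m = 0"
    moreover have "m < n" if "m + 1 \<le> n" using that less_succ[of m m] by (meson less_le_trans order_refl)
    ultimately show "m + 1 \<le> n \<longrightarrow> ?g (m + 1) = 0" using that by (auto simp: gS)
  qed (simp add: g0)
  have 3: "?g n = 0 \<or> ?g n = 1"
    by (rule num_induct[where n = n], (rule pd_ops dfn_app1[OF g] dfn_fst dfn_num dfn_good)+) (auto simp: g0 gS)
  show ?thesis using 1 2[of n n] 3 by auto
qed

lemma pd_ball:
  assumes P: "pd (ccons r0 G) (\<lambda>c. P (snd c) (fst c))" and b: "dfn G r0 b" and G: "gctx G"
  shows "pd G (\<lambda>c. \<forall>k<b c. P c k)"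
proof -
  have f: "dfn G (rfun r0 (rfun r0 r0)) (\<lambda>c k r. if r = 0 \<and> P c k then 0 else 1)"
    by (rule dfn_lam, rule dfn_lam) (rule dfn_if pd_conj pd_eq dfn_fst dfn_num dfn_good G pd_snd[OF P])+
  show ?thesis unfolding pd_def
  proof (rule dfn_cong)
    show "dfn G r0 (\<lambda>c. prc (\<lambda>k r. if r = 0 \<and> P c k then 0 else 1) 0 (b c))"
      by (rule dfn_prc f b dfn_num)+
    fix e c assume "snd G e c"
    from prc_ball[OF dfn_point[OF f this]]
    show "prc (\<lambda>k r. if r = 0 \<and> P c k then 0 else 1) 0 (b c) = (if \<forall>k<b c. P c k then 0 else 1)" .
  qed
qed

lemma pd_bex:
  assumes P: "pd (ccons r0 G) (\<lambda>c. P (snd c) (fst c))" and b: "dfn G r0 b" and G: "gctx G"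
  shows "pd G (\<lambda>c. \<exists>k<b c. P c k)"
  using pd_not[OF pd_ball[OF pd_not[OF P] b G]] by simp

lemma pd_ball_le:
  assumes "pd (ccons r0 G) (\<lambda>c. P (snd c) (fst c))" "dfn G r0 b" "gctx G"
  shows "pd G (\<lambda>c. \<forall>k\<le>b c. P c k)"
  using pd_ball[OF assms(1) dfn_plus[OF assms(2) dfn_num[of _ 1]] assms(3)] by (simp add: less_succ)

lemma pd_bex_le:
  assumes P: "pd (ccons r0 G) (\<lambda>c. P (snd c) (fst c))" and b: "dfn G r0 b" and G: "gctx G"
  shows "pd G (\<lambda>c. \<exists>k\<le>b c. P c k)"
  using pd_not[OF pd_ball_le[OF pd_not[OF P] b G]] by simp

lemmas pd_bdd = pd_ball pd_bex pd_ball_le pd_bex_le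

lemma dec_app: "dec P \<Longrightarrow> dfn G r0 x \<Longrightarrow> pd G (\<lambda>c. P (x c))"
  unfolding pd_def by (rule dfn_app1[where h = "\<lambda>n. if P n then 0 else 1"], rule rl_lam) auto

lemma num_least:
  assumes P: "dec P" and n: "P n"
  obtains m where "P m" "\<forall>k<m. \<not> P k"
proof -
  have "\<exists>m. P m \<and> (\<forall>k<m. \<not> P k)"
  proof (rule ccontr)
    assume nex: "\<not> ?thesis"
    have "\<forall>k<m. \<not> P k" for m
    proof (rule num_induct[where n = m])
      show "dec (\<lambda>m. \<forall>k<m. \<not> P k)"
        by (rule pd_ball pd_not dec_app[OF P] dfn_fst dfn_good)+
    qed (use nex in \<open>auto simp: less_succ le_less\<close>)
    then show False using n less_add_one by blast
  qed
  then show thesis using that by blast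
qed

lemma num_cases: "(n::'n) = 0 \<or> (\<exists>m. n = m + 1)"
  by (metis add.commute le_add_diff_inverse mnat_ge_1 mnat_pos)

lemma choice_10:
  assumes P: "pd (ccons r0 (ccons r1 cnil)) (\<lambda>c. P (fst (snd c)) (fst c))"
    and ex: "\<And>f. rl r1 f \<Longrightarrow> \<exists>n. P f n"
  shows "\<exists>\<Phi>. rl (rfun r1 r0) \<Phi> \<and> (\<forall>f. rl r1 f \<longrightarrow> P f (\<Phi> f))"
proof -
  have "rl (rfun r1 (rfun r0 r0)) (\<lambda>f n. if P f n then 0 else 1)"
    by (rule rl_lam2) (use P in \<open>auto simp: pd_def\<close>)
  then obtain X where X: "snd (rfun r1 (rfun r0 r0)) X (\<lambda>f n. if P f n then 0 else 1)" by (auto simp: rl_def)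
  have XP: "ap (ap X u) v = Z \<longleftrightarrow> P f n" if "snd r1 u f" "snd r0 v n" for u v f n
  proof -
    have "snd r0 (ap (ap X u) v) (if P f n then 0 else 1)" using appD[OF appD[OF X that(1)] that(2)] by simp
    then show ?thesis using num_inj[of "ap (ap X u) v" Z] by (auto simp: snd_r0 split: if_splits)
  qed
  have "\<exists>Y\<in>D (ty1 \<^bold>\<rightarrow> Num). \<forall>u\<in>D ty1. ap (ap X u) (ap Y u) = Z"
  proof (rule AC_10)
    show "X \<in> D (ty1 \<^bold>\<rightarrow> Num \<^bold>\<rightarrow> Num)" using X by (simp add: snd_rfun)
    fix u assume "u \<in> D ty1"
    then obtain f where f: "snd r1 u f" using good_total[of r1 u] by auto
    then obtain n where "P f n" using ex by (auto simp: rl_def)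
    then show "\<exists>v\<in>N. ap (ap X u) v = Z" using XP[OF f r0_un] by (intro bexI[of _ "un n"]) auto
  qed
  then obtain Y where Y: "Y \<in> D (ty1 \<^bold>\<rightarrow> Num)" "\<forall>u\<in>D ty1. ap (ap X u) (ap Y u) = Z" by blast
  obtain \<Phi> where \<Phi>: "snd (rfun r1 r0) Y \<Phi>" using good_total[of "rfun r1 r0" Y] Y by auto
  have "P f (\<Phi> f)" if "rl r1 f" for f
  proof -
    from that obtain u where u: "snd r1 u f" by (auto simp: rl_def)
    then have "u \<in> D ty1" by (simp add: snd_rfun)
    then show ?thesis using XP[OF u appD[OF \<Phi> u]] Y by simp
  qed
  then show ?thesis using \<Phi> by (auto simp: rl_def)
qed

lemma choice_01:
  assumes P: "pd (ccons r1 (ccons r0 cnil)) (\<lambda>c. P (fst (snd c)) (fst c))"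
    and ex: "\<And>n. \<exists>f. rl r1 f \<and> P n f"
  shows "\<exists>\<Phi>. rl (rfun r0 r1) \<Phi> \<and> (\<forall>n. P n (\<Phi> n))"
proof -
  have "rl (rfun r0 (rfun r1 r0)) (\<lambda>n f. if P n f then 0 else 1)"
    by (rule rl_lam2) (use P in \<open>auto simp: pd_def\<close>)
  then obtain X where X: "snd (rfun r0 (rfun r1 r0)) X (\<lambda>n f. if P n f then 0 else 1)" by (auto simp: rl_def)
  have XP: "ap (ap X v) u = Z \<longleftrightarrow> P n f" if "snd r1 u f" "snd r0 v n" for u v f n
  proof -
    have "snd r0 (ap (ap X v) u) (if P n f then 0 else 1)" using appD[OF appD[OF X that(2)] that(1)] by simp
    then show ?thesis using num_inj[of "ap (ap X v) u" Z] by (auto simp: snd_r0 split: if_splits)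
  qed
  have "\<exists>Y\<in>D (Num \<^bold>\<rightarrow> ty1). \<forall>v\<in>N. ap (ap X v) (ap Y v) = Z"
  proof (rule AC_01)
    show "X \<in> D (Num \<^bold>\<rightarrow> ty1 \<^bold>\<rightarrow> Num)" using X by (simp add: snd_rfun)
    fix v assume v: "v \<in> N"
    obtain f u where "P (num v) f" "snd r1 u f" using ex[of "num v"] by (auto simp: rl_def)
    then show "\<exists>u\<in>D ty1. ap (ap X v) u = Z" using XP[of u f v "num v"] v
      by (intro bexI[of _ u]) (auto simp: snd_r0 snd_rfun)
  qed
  then obtain Y where Y: "Y \<in> D (Num \<^bold>\<rightarrow> ty1)" "\<forall>v\<in>N. ap (ap X v) (ap Y v) = Z" by blast
  obtain \<Phi> where \<Phi>: "snd (rfun r0 r1) Y \<Phi>" using good_total[of "rfun r0 r1" Y] Y by auto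
  have "P n (\<Phi> n)" for n using XP[OF appD[OF \<Phi> r0_un[of n]] r0_un[of n]] Y by simp
  then show ?thesis using \<Phi> by (auto simp: rl_def)
qed

text \<open>Choice for type-1 arguments gives choice for numbers: a number is passed as a constant
  function and read back as its value at \<open>0\<close>.\<close>

lemma choice_00:
  assumes P: "pd (ccons r0 (ccons r0 cnil)) (\<lambda>c. P (fst (snd c)) (fst c))" and ex: "\<And>n. \<exists>m. P n m"
  shows "\<exists>h. rl r1 h \<and> (\<forall>n. P n (h n))"
proof -
  have "rl (rfun r0 (rfun r0 r0)) (\<lambda>n m. if P n m then 0 else 1)"
    by (rule rl_lam2) (use P in \<open>auto simp: pd_def\<close>)
  note * = dfn_app2[OF this good_r0 good_r0 good_r0]
  have "pd (ccons r0 (ccons r1 cnil)) (\<lambda>c. P (fst (snd c) 0) (fst c))"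
    unfolding pd_def by (rule * dfn_num dfn_vars)+
  then obtain \<Phi> where \<Phi>: "rl (rfun r1 r0) \<Phi>" "\<forall>f. rl r1 f \<longrightarrow> P (f 0) (\<Phi> f)"
    using choice_10[of "\<lambda>f. P (f 0)"] ex by blast
  have "rl r1 (\<lambda>n. \<Phi> (\<lambda>k. n))"
    by (rule rl_lam) (rule dfn_app1[OF \<Phi>(1)] dfn_lam dfn_fst dfn_snd dfn_good)+
  moreover have "rl r1 (\<lambda>k. n)" for n by (rule rl_lam) (rule dfn_num dfn_good)+
  ultimately show ?thesis using \<Phi>(2) by blast
qed

subsection \<open>Evaluation of terms\<close>

definition nv :: "'u valuation \<Rightarrow> trm \<Rightarrow> 'n" where "nv \<rho> t = num (mval \<rho> t)"
definition fv :: "'u valuation \<Rightarrow> trm \<Rightarrow> 'n \<Rightarrow> 'n" where "fv \<rho> t = (\<lambda>n. num (ap (mval \<rho> t) (un n)))"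
definition gv :: "'u valuation \<Rightarrow> trm \<Rightarrow> 'n \<Rightarrow> 'n \<Rightarrow> 'n" where
  "gv \<rho> t = (\<lambda>m n. num (ap (ap (mval \<rho> t) (un m)) (un n)))"

lemma r0_nv: "typ_of [] t = Some Num \<Longrightarrow> ok \<rho> \<Longrightarrow> snd r0 (mval \<rho> t) (nv \<rho> t)"
  using val_dom[of t Num \<rho>] by (simp add: snd_r0 nv_def)

lemma r1_fv: "typ_of [] t = Some ty1 \<Longrightarrow> ok \<rho> \<Longrightarrow> snd r1 (mval \<rho> t) (fv \<rho> t)"
  using val_dom[of t ty1 \<rho>] by (auto simp: snd_rfun snd_r0 fv_def intro: ap_dom)

lemma r1_unique: "snd r1 u f \<Longrightarrow> f = (\<lambda>n. num (ap u (un n)))"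
  using appD[of r0 r0 u f, OF _ r0_un] by (auto simp: snd_r0 fun_eq_iff)

lemma r2_gv: "typ_of [] t = Some (Num \<^bold>\<rightarrow> ty1) \<Longrightarrow> ok \<rho> \<Longrightarrow> snd (rfun r0 r1) (mval \<rho> t) (gv \<rho> t)"
  using val_dom[of t "Num \<^bold>\<rightarrow> ty1" \<rho>] by (auto simp: snd_rfun snd_r0 gv_def intro: ap_dom)

lemma nv_Var: "nv \<rho> (Var x Num) = num (\<rho> (x, Num))" by (simp add: nv_def)
lemma nv_zero: "nv \<rho> \<^bold>0 = 0" by (simp add: nv_def)
lemma nv_suc: "typ_of [] t = Some Num \<Longrightarrow> ok \<rho> \<Longrightarrow> nv \<rho> (suc t) = nv \<rho> t + 1"
  using val_dom[of t Num \<rho>] by (simp add: nv_def)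
lemma nv_plus: "typ_of [] s = Some Num \<Longrightarrow> typ_of [] t = Some Num \<Longrightarrow> ok \<rho> \<Longrightarrow> nv \<rho> (s \<^bold>+ t) = nv \<rho> s + nv \<rho> t"
  using val_dom[of t Num \<rho>] val_dom[of s Num \<rho>] by (simp add: nv_def)
lemma nv_times: "typ_of [] s = Some Num \<Longrightarrow> typ_of [] t = Some Num \<Longrightarrow> ok \<rho> \<Longrightarrow> nv \<rho> (s \<^bold>* t) = nv \<rho> s * nv \<rho> t"
  using val_dom[of t Num \<rho>] val_dom[of s Num \<rho>] by (simp add: nv_def)
lemma nv_monus: "typ_of [] s = Some Num \<Longrightarrow> typ_of [] t = Some Num \<Longrightarrow> ok \<rho> \<Longrightarrow> nv \<rho> (s \<^bold>- t) = nv \<rho> s - nv \<rho> t"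
  using val_dom[of t Num \<rho>] val_dom[of s Num \<rho>] by (simp add: nv_def)

lemma pr_minus: "a \<in> N \<Longrightarrow> num (pr a) = num a - 1"
  using num_mn[of a "Sc Z"] mn_Sc[of a Z] by simp

lemma nv_pred: "typ_of [] t = Some Num \<Longrightarrow> ok \<rho> \<Longrightarrow> nv \<rho> (pred_trm \<^bold>\<cdot> t) = nv \<rho> t - 1"
  using val_dom[of t Num \<rho>] by (simp add: nv_def pr_minus)

lemma nv_app: "typ_of [] f = Some ty1 \<Longrightarrow> typ_of [] t = Some Num \<Longrightarrow> ok \<rho> \<Longrightarrow> nv \<rho> (f \<^bold>\<cdot> t) = fv \<rho> f (nv \<rho> t)"
  using val_dom[of t Num \<rho>] by (simp add: nv_def fv_def)

lemma nv_app2: "typ_of [] f = Some (Num \<^bold>\<rightarrow> ty1) \<Longrightarrow> typ_of [] s = Some Num \<Longrightarrow> typ_of [] t = Some Num \<Longrightarrow> ok \<rho>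
    \<Longrightarrow> nv \<rho> (f \<^bold>\<cdot> s \<^bold>\<cdot> t) = gv \<rho> f (nv \<rho> s) (nv \<rho> t)"
  using val_dom[of t Num \<rho>] val_dom[of s Num \<rho>] by (simp add: nv_def gv_def)

lemma nv_rec: "typ_of [] g = Some (Num \<^bold>\<rightarrow> ty1) \<Longrightarrow> typ_of [] s = Some Num \<Longrightarrow> typ_of [] t = Some Num \<Longrightarrow> ok \<rho>
    \<Longrightarrow> nv \<rho> (rec g s t) = prc (gv \<rho> g) (nv \<rho> s) (nv \<rho> t)"
  using appD[OF appD[OF appD[OF prc r2_gv] r0_nv] r0_nv] by (simp add: nv_def snd_r0)

lemma fv_Lam0:
  assumes "\<And>x. typ_of [] (F (Var x Num)) = Some Num" "\<And>x. S \<subseteq> frees_t (F (Var x Num))" "ok \<rho>"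
    and body: "\<And>x n \<rho>'. ok \<rho>' \<Longrightarrow> nv \<rho>' (Var x Num) = n \<Longrightarrow> \<forall>v\<in>S. \<rho>' v = \<rho> v \<Longrightarrow> nv \<rho>' (F (Var x Num)) = R n"
  shows "fv \<rho> (Lam0 F) = R"
proof
  fix n
  have "ap (mval \<rho> (Lam0 F)) (un n) = un (R n)"
  proof (rule val_Lam0[where F = F and S = S and \<tau> = Num])
    fix x \<rho>' assume r: "ok \<rho>'" "\<rho>' (x, Num) = un n" "\<forall>v\<in>S. \<rho>' v = \<rho> v"
    have "nv \<rho>' (F (Var x Num)) = R n" by (rule body) (use r in \<open>auto simp: nv_def\<close>)
    then show "mval \<rho>' (F (Var x Num)) = un (R n)" using val_dom[OF assms(1) r(1)] by (metis nv_def un_num)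
  qed (rule assms un_dom)+
  then show "fv \<rho> (Lam0 F) n = R n" by (simp add: fv_def)
qed

lemma gv_Lam0:
  assumes "\<And>x y. typ_of [] (F (Var x Num) (Var y Num)) = Some Num"
    "\<And>x y. insert (x, Num) S \<subseteq> frees_t (F (Var x Num) (Var y Num))" "ok \<rho>"
    and body: "\<And>x y m n \<rho>'. ok \<rho>' \<Longrightarrow> nv \<rho>' (Var x Num) = m \<Longrightarrow> nv \<rho>' (Var y Num) = n \<Longrightarrow> \<forall>v\<in>S. \<rho>' v = \<rho> v
      \<Longrightarrow> nv \<rho>' (F (Var x Num) (Var y Num)) = R m n"
  shows "gv \<rho> (Lam0 (\<lambda>x. Lam0 (\<lambda>y. F x y))) = R"
proof (intro ext)
  fix m n
  have "ap (ap (mval \<rho> (Lam0 (\<lambda>x. Lam0 (\<lambda>y. F x y)))) (un m)) (un n) = un (R m n)"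
  proof (rule val_Lam0_2[where F = F and S = S and \<tau> = Num])
    fix x y \<rho>' assume r: "ok \<rho>'" "\<rho>' (x, Num) = un m" "\<rho>' (y, Num) = un n" "\<forall>v\<in>S. \<rho>' v = \<rho> v"
    have "nv \<rho>' (F (Var x Num) (Var y Num)) = R m n" by (rule body) (use r in \<open>auto simp: nv_def\<close>)
    then show "mval \<rho>' (F (Var x Num) (Var y Num)) = un (R m n)" using val_dom[OF assms(1) r(1)] by (metis nv_def un_num)
  qed (rule assms un_dom)+
  then show "gv \<rho> (Lam0 (\<lambda>x. Lam0 (\<lambda>y. F x y))) m n = R m n" by (simp add: gv_def)
qed

text \<open>Here \<open>R\<close> ignores the outer argument: the second assumption of \<open>gv_Lam0\<close> fails when the outer variable
  does not occur in the body.\<close>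

lemma gv_Lam0_inner:
  assumes ty: "\<And>x y. typ_of [] (F (Var x Num) (Var y Num)) = Some Num"
    and S: "\<And>x y. S \<subseteq> frees_t (F (Var x Num) (Var y Num))" and "ok \<rho>"
    and body: "\<And>x y n \<rho>'. ok \<rho>' \<Longrightarrow> nv \<rho>' (Var y Num) = n \<Longrightarrow> \<forall>v\<in>S. \<rho>' v = \<rho> v
      \<Longrightarrow> nv \<rho>' (F (Var x Num) (Var y Num)) = R n"
  shows "gv \<rho> (Lam0 (\<lambda>x. Lam0 (\<lambda>y. F x y))) = (\<lambda>m. R)"
proof (intro ext)
  fix m n
  let ?L = "\<lambda>x. Lam0 (\<lambda>y. F (Var x Num) y)" and ?x = "bound_t (Lam0 (\<lambda>y. F (Var 0 Num) y))"
  let ?\<rho> = "\<rho>((?x, Num) := un m)"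
  have "S \<subseteq> frees_t (?L 0)" by (rule frees_Lam0[where \<tau> = Num]) (rule ty S)+
  then have "(?x, Num) \<notin> S" using frees_t_bound[of "(?x, Num)" "?L 0"] by auto
  then have "\<forall>v\<in>S. ?\<rho> v = \<rho> v" by auto
  then have "fv ?\<rho> (?L ?x) = R" 
  proof (intro fv_Lam0[where S = S])
    fix y n \<rho>' assume "ok \<rho>'" "nv \<rho>' (Var y Num) = n" "\<forall>v\<in>S. \<rho>' v = ?\<rho> v"
    then show "nv \<rho>' (F (Var ?x Num) (Var y Num)) = R n"
      using \<open>\<forall>v\<in>S. ?\<rho> v = \<rho> v\<close> by (intro body) auto
  qed (use \<open>ok \<rho>\<close> ty S in auto)
  moreover have "ap (mval \<rho> (Lam0 (\<lambda>x. Lam0 (\<lambda>y. F x y)))) (un m) = mval ?\<rho> (?L ?x)"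
    using val_lamV[OF typ_of_Lam0[of "F (Var _ Num)", OF ty] \<open>ok \<rho>\<close> un_dom] by (simp add: Lam0_def[of "\<lambda>x. Lam0 (\<lambda>y. F x y)"] Let_def)
  ultimately show "gv \<rho> (Lam0 (\<lambda>x. Lam0 (\<lambda>y. F x y))) m n = R n" by (simp add: gv_def fv_def fun_eq_iff)
qed

lemma nv_agree: "\<forall>v\<in>S. \<rho>' v = \<rho> v \<Longrightarrow> frees_t t \<subseteq> S \<Longrightarrow> nv \<rho>' t = nv \<rho> t"
  unfolding nv_def by (simp add: val_agree)
lemma fv_agree: "\<forall>v\<in>S. \<rho>' v = \<rho> v \<Longrightarrow> frees_t t \<subseteq> S \<Longrightarrow> fv \<rho>' t = fv \<rho> t"
  unfolding fv_def by (simp add: val_agree)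

lemma rl_fv: "typ_of [] t = Some ty1 \<Longrightarrow> ok \<rho> \<Longrightarrow> rl r1 (fv \<rho> t)"
  unfolding rl_def using r1_fv by blast
lemma rl_gv: "typ_of [] t = Some (Num \<^bold>\<rightarrow> ty1) \<Longrightarrow> ok \<rho> \<Longrightarrow> rl (rfun r0 r1) (gv \<rho> t)"
  unfolding rl_def using r2_gv by blast

end

subsection \<open>The primitive recursive terms\<close>

lemma frees_App_le: "frees_t s \<subseteq> S \<Longrightarrow> frees_t t \<subseteq> S \<Longrightarrow> frees_t (s \<^bold>\<cdot> t) \<subseteq> S" by simp
lemma frees_Var_le: "(x, \<tau>) \<in> S \<Longrightarrow> frees_t (Var x \<tau>) \<subseteq> S" by simp
lemma frees_Cst_le: "frees_t (Cst c) \<subseteq> S" by simp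

lemmas frees_le = frees_App_le frees_Var_le frees_Cst_le subset_trans[OF frees_pred empty_subsetI] subset_trans[OF frees_monus empty_subsetI] insertI1 insertI2

lemma typ_sg [simp]: "typ_of [] sg_trm = Some (ty1)"
  unfolding sg_trm_def by (simp add: typ_of_Lam0)

lemma frees_sg: "frees_t sg_trm \<subseteq> S"
  unfolding sg_trm_def by (rule frees_Lam0_le frees_le | simp add: typ_of_Lam0)+

lemma typ_pow2 [simp]: "typ_of [] pow2_trm = Some (ty1)"
  unfolding pow2_trm_def by (simp add: typ_of_Lam0)

lemma frees_pow2: "frees_t pow2_trm \<subseteq> S"
  unfolding pow2_trm_def by (rule frees_Lam0_le frees_le frees_sg | simp add: typ_of_Lam0)+

lemma typ_half [simp]: "typ_of [] half_trm = Some (ty1)"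
  unfolding half_trm_def by (simp add: typ_of_Lam0)

lemma frees_half: "frees_t half_trm \<subseteq> S"
  unfolding half_trm_def by (rule frees_Lam0_le frees_le frees_sg frees_pow2 | simp add: typ_of_Lam0)+

lemma typ_tri [simp]: "typ_of [] tri_trm = Some (ty1)"
  unfolding tri_trm_def by (simp add: typ_of_Lam0)

lemma frees_tri: "frees_t tri_trm \<subseteq> S"
  unfolding tri_trm_def by (rule frees_Lam0_le frees_le frees_sg frees_pow2 frees_half | simp add: typ_of_Lam0)+

lemma typ_troot [simp]: "typ_of [] troot_trm = Some (ty1)"
  unfolding troot_trm_def by (simp add: typ_of_Lam0)

lemma frees_troot: "frees_t troot_trm \<subseteq> S"
  unfolding troot_trm_def by (rule frees_Lam0_le frees_le frees_sg frees_pow2 frees_half frees_tri | simp add: typ_of_Lam0)+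

lemma typ_pair [simp]: "typ_of [] pair_trm = Some (Num \<^bold>\<rightarrow> ty1)"
  unfolding pair_trm_def by (simp add: typ_of_Lam0)

lemma frees_pair: "frees_t pair_trm \<subseteq> S"
  unfolding pair_trm_def by (rule frees_Lam0_le frees_le frees_sg frees_pow2 frees_half frees_tri frees_troot | simp add: typ_of_Lam0)+

lemma typ_fst [simp]: "typ_of [] fst_trm = Some (ty1)"
  unfolding fst_trm_def by (simp add: typ_of_Lam0)

lemma frees_fst: "frees_t fst_trm \<subseteq> S"
  unfolding fst_trm_def by (rule frees_Lam0_le frees_le frees_sg frees_pow2 frees_half frees_tri frees_troot frees_pair | simp add: typ_of_Lam0)+

lemma typ_snd [simp]: "typ_of [] snd_trm = Some (ty1)"
  unfolding snd_trm_def by (simp add: typ_of_Lam0)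

lemma frees_snd: "frees_t snd_trm \<subseteq> S"
  unfolding snd_trm_def by (rule frees_Lam0_le frees_le frees_sg frees_pow2 frees_half frees_tri frees_troot frees_pair frees_fst | simp add: typ_of_Lam0)+

lemma typ_qpos [simp]: "typ_of [] qpos_trm = Some (ty1)"
  unfolding qpos_trm_def by (simp add: typ_of_Lam0)

lemma frees_qpos: "frees_t qpos_trm \<subseteq> S"
  unfolding qpos_trm_def by (rule frees_Lam0_le frees_le frees_sg frees_pow2 frees_half frees_tri frees_troot frees_pair frees_fst frees_snd | simp add: typ_of_Lam0)+

lemma typ_qneg [simp]: "typ_of [] qneg_trm = Some (ty1)"
  unfolding qneg_trm_def by (simp add: typ_of_Lam0)

lemma frees_qneg: "frees_t qneg_trm \<subseteq> S"
  unfolding qneg_trm_def by (rule frees_Lam0_le frees_le frees_sg frees_pow2 frees_half frees_tri frees_troot frees_pair frees_fst frees_snd frees_qpos | simp add: typ_of_Lam0)+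

lemma typ_qden [simp]: "typ_of [] qden_trm = Some (ty1)"
  unfolding qden_trm_def by (simp add: typ_of_Lam0)

lemma frees_qden: "frees_t qden_trm \<subseteq> S"
  unfolding qden_trm_def by (rule frees_Lam0_le frees_le frees_sg frees_pow2 frees_half frees_tri frees_troot frees_pair frees_fst frees_snd frees_qpos frees_qneg | simp add: typ_of_Lam0)+

lemma typ_qdiff [simp]: "typ_of [] qdiff_trm = Some (Num \<^bold>\<rightarrow> Num \<^bold>\<rightarrow> ty1)"
  unfolding qdiff_trm_def by (simp add: typ_of_Lam0)

lemma frees_qdiff: "frees_t qdiff_trm \<subseteq> S"
  unfolding qdiff_trm_def by (rule frees_Lam0_le frees_le frees_sg frees_pow2 frees_half frees_tri frees_troot frees_pair frees_fst frees_snd frees_qpos frees_qneg frees_qden | simp add: typ_of_Lam0)+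

lemma typ_qminus [simp]: "typ_of [] qminus_trm = Some (Num \<^bold>\<rightarrow> ty1)"
  unfolding qminus_trm_def by (simp add: typ_of_Lam0)

lemma frees_qminus: "frees_t qminus_trm \<subseteq> S"
  unfolding qminus_trm_def by (rule frees_Lam0_le frees_le frees_sg frees_pow2 frees_half frees_tri frees_troot frees_pair frees_fst frees_snd frees_qpos frees_qneg frees_qden frees_qdiff | simp add: typ_of_Lam0)+

lemma typ_qabs [simp]: "typ_of [] qabs_trm = Some (ty1)"
  unfolding qabs_trm_def by (simp add: typ_of_Lam0)

lemma frees_qabs: "frees_t qabs_trm \<subseteq> S"
  unfolding qabs_trm_def by (rule frees_Lam0_le frees_le frees_sg frees_pow2 frees_half frees_tri frees_troot frees_pair frees_fst frees_snd frees_qpos frees_qneg frees_qden frees_qdiff frees_qminus | simp add: typ_of_Lam0)+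

lemma typ_qpow [simp]: "typ_of [] qpow_trm = Some (Num \<^bold>\<rightarrow> ty1)"
  unfolding qpow_trm_def by (simp add: typ_of_Lam0)

lemma frees_qpow: "frees_t qpow_trm \<subseteq> S"
  unfolding qpow_trm_def by (rule frees_Lam0_le frees_le frees_sg frees_pow2 frees_half frees_tri frees_troot frees_pair frees_fst frees_snd frees_qpos frees_qneg frees_qden frees_qdiff frees_qminus frees_qabs | simp add: typ_of_Lam0)+

lemma typ_snoc [simp]: "typ_of [] snoc_trm = Some (Num \<^bold>\<rightarrow> ty1)"
  unfolding snoc_trm_def by (simp add: typ_of_Lam0)

lemma frees_snoc: "frees_t snoc_trm \<subseteq> S"
  unfolding snoc_trm_def by (rule frees_Lam0_le frees_le frees_sg frees_pow2 frees_half frees_tri frees_troot frees_pair frees_fst frees_snd frees_qpos frees_qneg frees_qden frees_qdiff frees_qminus frees_qabs frees_qpow | simp add: typ_of_Lam0)+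

lemma typ_cut [simp]: "typ_of [] cut_trm = Some (Num \<^bold>\<rightarrow> ty1)"
  unfolding cut_trm_def by (simp add: typ_of_Lam0)

lemma frees_cut: "frees_t cut_trm \<subseteq> S"
  unfolding cut_trm_def by (rule frees_Lam0_le frees_le frees_sg frees_pow2 frees_half frees_tri frees_troot frees_pair frees_fst frees_snd frees_qpos frees_qneg frees_qden frees_qdiff frees_qminus frees_qabs frees_qpow frees_snoc | simp add: typ_of_Lam0)+

lemma typ_length [simp]: "typ_of [] length_trm = Some (ty1)"
  unfolding length_trm_def by (simp add: typ_of_Lam0)

lemma frees_length: "frees_t length_trm \<subseteq> S"
  unfolding length_trm_def by (rule frees_Lam0_le frees_le frees_sg frees_pow2 frees_half frees_tri frees_troot frees_pair frees_fst frees_snd frees_qpos frees_qneg frees_qden frees_qdiff frees_qminus frees_qabs frees_qpow frees_snoc frees_cut | simp add: typ_of_Lam0)+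

context nmodel
begin

lemmas nv_simps = nv_Var nv_zero nv_suc nv_plus nv_times nv_monus nv_pred

text \<open>Functions given by recursion are named as the denotations of their terms and get
  recursion equations later; explicit ones are written as HOL formulas and proved equal to the
  denotations.\<close>

definition p2 where "p2 = fv \<rho>0 pow2_trm"
definition hf where "hf = fv \<rho>0 half_trm"
definition tri where "tri = fv \<rho>0 tri_trm"
definition troot where "troot = fv \<rho>0 troot_trm"
definition sg where "sg n = (if n = 0 then 0 else (1::'n))"
definition pair where "pair a b = tri (a + b) + a"
definition nfst where "nfst z = z - tri (troot z)"
definition nsnd where "nsnd z = troot z - nfst z"
definition qpos where "qpos q = (1 - nfst q) * nfst (nsnd q)"
definition qneg where "qneg q = sg (nfst q) * nfst (nsnd q)"
definition qden where "qden q = nsnd (nsnd q) + 1"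
definition qdiff where "qdiff a b d = pair (sg (b - a)) (pair ((a - b) + (b - a)) d)"
definition qminus where "qminus p q =
  qdiff (qpos p * qden q + qneg q * qden p) (qneg p * qden q + qpos q * qden p) (qden p * qden q - 1)"
definition qabs where "qabs q = pair 0 (nsnd q)"
definition qpow where "qpow a n = pair 0 (pair a (p2 n - 1))"
definition snoc where "snoc s b = s + s + 1 + (b::'n)"
definition cut where "cut = gv \<rho>0 cut_trm"
definition len where "len = fv \<rho>0 length_trm"

lemma nv_closed1: "typ_of [] c = Some ty1 \<Longrightarrow> frees_t c \<subseteq> {} \<Longrightarrow> typ_of [] t = Some Num \<Longrightarrow> ok \<rho> \<Longrightarrow>
   nv \<rho> (c \<^bold>\<cdot> t) = fv \<rho>0 c (nv \<rho> t)"
  using fv_agree[of "{}" \<rho> \<rho>0 c] by (simp add: nv_app)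

lemma nv_closed2: "typ_of [] c = Some (Num \<^bold>\<rightarrow> ty1) \<Longrightarrow> frees_t c \<subseteq> {} \<Longrightarrow> typ_of [] s = Some Num \<Longrightarrow>
   typ_of [] t = Some Num \<Longrightarrow> ok \<rho> \<Longrightarrow> nv \<rho> (c \<^bold>\<cdot> s \<^bold>\<cdot> t) = gv \<rho>0 c (nv \<rho> s) (nv \<rho> t)"
  using val_agree[of "{}" \<rho> \<rho>0 c] by (simp add: nv_app2 gv_def)

lemma nv_pow2: "typ_of [] t = Some Num \<Longrightarrow> ok \<rho> \<Longrightarrow> nv \<rho> (pow2_trm \<^bold>\<cdot> t) = p2 (nv \<rho> t)"
  and nv_half: "typ_of [] t = Some Num \<Longrightarrow> ok \<rho> \<Longrightarrow> nv \<rho> (half_trm \<^bold>\<cdot> t) = hf (nv \<rho> t)"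
  and nv_tri: "typ_of [] t = Some Num \<Longrightarrow> ok \<rho> \<Longrightarrow> nv \<rho> (tri_trm \<^bold>\<cdot> t) = tri (nv \<rho> t)"
  and nv_troot: "typ_of [] t = Some Num \<Longrightarrow> ok \<rho> \<Longrightarrow> nv \<rho> (troot_trm \<^bold>\<cdot> t) = troot (nv \<rho> t)"
  and nv_length: "typ_of [] t = Some Num \<Longrightarrow> ok \<rho> \<Longrightarrow> nv \<rho> (length_trm \<^bold>\<cdot> t) = len (nv \<rho> t)"
  and nv_cut: "typ_of [] s = Some Num \<Longrightarrow> typ_of [] t = Some Num \<Longrightarrow> ok \<rho> \<Longrightarrow>
    nv \<rho> (cut_trm \<^bold>\<cdot> s \<^bold>\<cdot> t) = cut (nv \<rho> s) (nv \<rho> t)"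
  by (simp_all add: nv_closed1 nv_closed2 p2_def hf_def tri_def troot_def len_def cut_def
      frees_pow2 frees_half frees_tri frees_troot frees_length frees_cut del: subset_empty)

lemma nv_by_fv: "typ_of [] c = Some ty1 \<Longrightarrow> frees_t c \<subseteq> {} \<Longrightarrow> fv \<rho>0 c = R \<Longrightarrow> typ_of [] t = Some Num \<Longrightarrow> ok \<rho> \<Longrightarrow>
   nv \<rho> (c \<^bold>\<cdot> t) = R (nv \<rho> t)"
  by (simp add: nv_closed1)

lemma nv_by_gv: "typ_of [] c = Some (Num \<^bold>\<rightarrow> ty1) \<Longrightarrow> frees_t c \<subseteq> {} \<Longrightarrow> gv \<rho>0 c = R \<Longrightarrow> typ_of [] s = Some Num \<Longrightarrow>
   typ_of [] t = Some Num \<Longrightarrow> ok \<rho> \<Longrightarrow> nv \<rho> (c \<^bold>\<cdot> s \<^bold>\<cdot> t) = R (nv \<rho> s) (nv \<rho> t)"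
  by (simp add: nv_closed2)

lemma fv_sg: "fv \<rho>0 sg_trm = sg"
  unfolding sg_trm_def by (rule fv_Lam0[where S = "{}"]) (auto simp: nv_simps sg_def one_minus_mnat)

lemmas nv_sg = nv_by_fv[OF typ_sg frees_sg fv_sg]

lemma gv_pair: "gv \<rho>0 pair_trm = pair"
  unfolding pair_trm_def by (rule gv_Lam0[where S = "{}"]) (auto simp: nv_simps nv_tri pair_def)

lemmas nv_pair = nv_by_gv[OF typ_pair frees_pair gv_pair]

lemma fv_fst: "fv \<rho>0 fst_trm = nfst"
  unfolding fst_trm_def by (rule fv_Lam0[where S = "{}"]) (auto simp: nv_simps nv_tri nv_troot nfst_def)

lemmas nv_fst = nv_by_fv[OF typ_fst frees_fst fv_fst]

lemma fv_snd: "fv \<rho>0 snd_trm = nsnd"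
  unfolding snd_trm_def by (rule fv_Lam0[where S = "{}"]) (auto simp: nv_simps nv_fst nv_troot nsnd_def)

lemmas nv_snd = nv_by_fv[OF typ_snd frees_snd fv_snd]

lemma fv_qpos: "fv \<rho>0 qpos_trm = qpos"
  unfolding qpos_trm_def by (rule fv_Lam0[where S = "{}"]) (auto simp: nv_simps nv_fst nv_snd qpos_def)

lemmas nv_qpos = nv_by_fv[OF typ_qpos frees_qpos fv_qpos]

lemma fv_qneg: "fv \<rho>0 qneg_trm = qneg"
  unfolding qneg_trm_def by (rule fv_Lam0[where S = "{}"]) (auto simp: nv_simps nv_fst nv_snd nv_sg qneg_def)

lemmas nv_qneg = nv_by_fv[OF typ_qneg frees_qneg fv_qneg]

lemma fv_qden: "fv \<rho>0 qden_trm = qden"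
  unfolding qden_trm_def by (rule fv_Lam0[where S = "{}"]) (auto simp: nv_simps nv_snd qden_def)

lemmas nv_qden = nv_by_fv[OF typ_qden frees_qden fv_qden]

lemma nv_qdiff:
  assumes "typ_of [] s = Some Num" "typ_of [] t = Some Num" "typ_of [] u = Some Num" "ok \<rho>"
  shows "nv \<rho> (qdiff_trm \<^bold>\<cdot> s \<^bold>\<cdot> t \<^bold>\<cdot> u) = qdiff (nv \<rho> s) (nv \<rho> t) (nv \<rho> u)"
proof -
  let ?a = "nv \<rho> s" and ?b = "nv \<rho> t"
  let ?F = "\<lambda>a b. \<^bold>\<lambda>d. pair_trm \<^bold>\<cdot> (sg_trm \<^bold>\<cdot> (b \<^bold>- a)) \<^bold>\<cdot> (pair_trm \<^bold>\<cdot> ((a \<^bold>- b) \<^bold>+ (b \<^bold>- a)) \<^bold>\<cdot> d)"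
  \<comment> \<open>\<open>R\<close> is what remains after two arguments, an element of type 1. It
    is the same for all valuations, since \<open>qdiff ?a ?b\<close> has only one
    representative.\<close>
  define R where "R = (SOME r. snd r1 r (qdiff ?a ?b))"
  have F: "snd r1 (mval \<rho>' (?F (Var x Num) (Var y Num))) (qdiff ?a ?b)"
    if r: "ok \<rho>'" "\<rho>' (x, Num) = mval \<rho> s" "\<rho>' (y, Num) = mval \<rho> t" for \<rho>' x y
  proof -
    have "fv \<rho>' (?F (Var x Num) (Var y Num)) = qdiff ?a ?b"
    proof (rule fv_Lam0[where S = "{(x, Num), (y, Num)}"])
      fix z n \<rho>'' assume "ok \<rho>''" "nv \<rho>'' (Var z Num) = n" "\<forall>v\<in>{(x, Num), (y, Num)}. \<rho>'' v = \<rho>' v"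
      then show "nv \<rho>'' (pair_trm \<^bold>\<cdot> (sg_trm \<^bold>\<cdot> (Var y Num \<^bold>- Var x Num)) \<^bold>\<cdot>
        (pair_trm \<^bold>\<cdot> ((Var x Num \<^bold>- Var y Num) \<^bold>+ (Var y Num \<^bold>- Var x Num)) \<^bold>\<cdot> Var z Num)) = qdiff ?a ?b n"
        using r by (simp add: nv_simps nv_pair nv_sg qdiff_def) (simp add: nv_def)
    qed (use r in auto)
    then show ?thesis using r1_fv[of "?F (Var x Num) (Var y Num)" \<rho>'] r by (simp add: typ_of_Lam0)
  qed
  have *: "ap (ap (mval \<rho> qdiff_trm) (mval \<rho> s)) (mval \<rho> t) = R"
    unfolding qdiff_trm_def
  proof (rule val_Lam0_2[where S = "{}" and \<tau> = ty1])
    fix x y \<rho>' assume "ok \<rho>'" "\<rho>' (x, Num) = mval \<rho> s" "\<rho>' (y, Num) = mval \<rho> t"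
    note F' = F[OF this]
    have "snd r1 R (qdiff ?a ?b)" unfolding R_def by (rule someI[of "\<lambda>r. snd r1 r (qdiff ?a ?b)", OF F'])
    then show "mval \<rho>' (?F (Var x Num) (Var y Num)) = R" using good_unique[of r1] F' by simp
  next
    fix x y show "insert (x, Num) {} \<subseteq> frees_t (?F (Var x Num) (Var y Num))"
      by (rule frees_Lam0) auto
  qed (use assms val_dom in \<open>auto simp: typ_of_Lam0\<close>)
  let ?\<rho> = "\<rho>0((0, Num) := mval \<rho> s, (1, Num) := mval \<rho> t)"
  have "snd r1 (mval ?\<rho> (?F (Var 0 Num) (Var 1 Num))) (qdiff ?a ?b)"
    by (rule F) (use assms val_dom in auto)
  then have "snd r1 R (qdiff ?a ?b)" unfolding R_def by (rule someI[of "\<lambda>r. snd r1 r (qdiff ?a ?b)"])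
  from appD[OF this r0_nv[OF assms(3,4)]] show ?thesis by (simp add: nv_def * snd_r0)
qed

lemma gv_qminus: "gv \<rho>0 qminus_trm = qminus"
  unfolding qminus_trm_def
  by (rule gv_Lam0[where S = "{}"]) (auto simp: nv_simps nv_qdiff nv_qpos nv_qneg nv_qden qminus_def)

lemmas nv_qminus = nv_by_gv[OF typ_qminus frees_qminus gv_qminus]

lemma fv_qabs: "fv \<rho>0 qabs_trm = qabs"
  unfolding qabs_trm_def by (rule fv_Lam0[where S = "{}"]) (auto simp: nv_simps nv_pair nv_snd qabs_def)

lemmas nv_qabs = nv_by_fv[OF typ_qabs frees_qabs fv_qabs]

lemma gv_qpow: "gv \<rho>0 qpow_trm = qpow"
  unfolding qpow_trm_def
  by (rule gv_Lam0[where S = "{}"]) (auto simp: nv_simps nv_pair nv_pow2 qpow_def)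

lemmas nv_qpow = nv_by_gv[OF typ_qpow frees_qpow gv_qpow]

lemma gv_snoc: "gv \<rho>0 snoc_trm = snoc"
  unfolding snoc_trm_def by (rule gv_Lam0[where S = "{}"]) (auto simp: nv_simps snoc_def)

lemmas nv_snoc = nv_by_gv[OF typ_snoc frees_snoc gv_snoc]

lemma rl_terms:
  "rl r1 p2" "rl r1 hf" "rl r1 tri" "rl r1 troot" "rl r1 len" "rl r1 sg" "rl r1 nfst" "rl r1 nsnd"
  "rl r1 qpos" "rl r1 qneg" "rl r1 qden" "rl r1 qabs"
  using rl_fv[of pow2_trm \<rho>0] rl_fv[of half_trm \<rho>0] rl_fv[of tri_trm \<rho>0] rl_fv[of troot_trm \<rho>0]
    rl_fv[of length_trm \<rho>0] rl_fv[of sg_trm \<rho>0] rl_fv[of fst_trm \<rho>0] rl_fv[of snd_trm \<rho>0]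
    rl_fv[of qpos_trm \<rho>0] rl_fv[of qneg_trm \<rho>0] rl_fv[of qden_trm \<rho>0] rl_fv[of qabs_trm \<rho>0]
  by (simp_all add: p2_def hf_def tri_def troot_def len_def fv_sg fv_fst fv_snd fv_qpos fv_qneg fv_qden fv_qabs)

lemma rl_terms2:
  "rl (rfun r0 r1) pair" "rl (rfun r0 r1) qminus" "rl (rfun r0 r1) qpow" "rl (rfun r0 r1) snoc" "rl (rfun r0 r1) cut"
  using rl_gv[of pair_trm \<rho>0] rl_gv[of qminus_trm \<rho>0] rl_gv[of qpow_trm \<rho>0] rl_gv[of snoc_trm \<rho>0] rl_gv[of cut_trm \<rho>0]
  by (simp_all add: gv_pair gv_qminus gv_qpow gv_snoc cut_def)

lemmas dfn_terms1 = rl_terms[THEN dfn_app1, OF good_r0 good_r0]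
lemmas dfn_terms2 = rl_terms2[THEN dfn_app2, OF good_r0 good_r0 good_r0]
lemmas dfn_terms = dfn_terms1 dfn_terms2

lemma dfn_qdiff: "dfn G r0 a \<Longrightarrow> dfn G r0 b \<Longrightarrow> dfn G r0 d \<Longrightarrow> dfn G r0 (\<lambda>c. qdiff (a c) (b c) (d c))"
  unfolding qdiff_def by (rule dfn_terms dfn_ops | assumption)+

lemma p2_0 [simp]: "p2 0 = 1" and p2_Suc: "p2 (n + 1) = p2 n + p2 n"
proof -
  have f: "rl (rfun r0 r1) (\<lambda>k r. r + r)" by (rule rl_lam2) (rule dfn_base dfn_good)+
  have "gv \<rho> (\<^bold>\<lambda>k. \<^bold>\<lambda>r. r \<^bold>+ r) = (\<lambda>k r. r + r)" if "ok \<rho>" for \<rho>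
    by (rule gv_Lam0_inner[where S = "{}"]) (use that in \<open>auto simp: nv_simps\<close>)
  then have "p2 = prc (\<lambda>k r. r + r) 1"
    unfolding p2_def pow2_trm_def
    by (intro fv_Lam0[where S = "{}"]) (auto simp: nv_simps nv_rec typ_of_Lam0)
  then show "p2 0 = 1" "p2 (n + 1) = p2 n + p2 n" using prc_0[OF f] prc_Suc[OF f] by simp_all
qed

lemma hf_0 [simp]: "hf 0 = 0" and hf_Suc: "hf (n + 1) = n - hf n"
proof -
  have f: "rl (rfun r0 r1) (\<lambda>k r. k - r)" by (rule rl_lam2) (rule dfn_base dfn_good)+
  have "gv \<rho> (\<^bold>\<lambda>n. \<^bold>\<lambda>r. n \<^bold>- r) = (\<lambda>k r. k - r)" if "ok \<rho>" for \<rho>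
    by (rule gv_Lam0[where S = "{}"]) (use that in \<open>auto simp: nv_simps\<close>)
  then have "hf = prc (\<lambda>k r. k - r) 0"
    unfolding hf_def half_trm_def
    by (intro fv_Lam0[where S = "{}"]) (auto simp: nv_simps nv_rec typ_of_Lam0)
  then show "hf 0 = 0" "hf (n + 1) = n - hf n" using prc_0[OF f] prc_Suc[OF f] by simp_all
qed

lemma tri_0 [simp]: "tri 0 = 0" and tri_Suc: "tri (n + 1) = tri n + (n + 1)"
proof -
  have f: "rl (rfun r0 r1) (\<lambda>k r. r + (k + 1))" by (rule rl_lam2) (rule dfn_base dfn_good)+
  have "gv \<rho> (\<^bold>\<lambda>k. \<^bold>\<lambda>r. r \<^bold>+ suc k) = (\<lambda>k r. r + (k + 1))" if "ok \<rho>" for \<rho>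
    by (rule gv_Lam0[where S = "{}"]) (use that in \<open>auto simp: nv_simps\<close>)
  then have "tri = prc (\<lambda>k r. r + (k + 1)) 0"
    unfolding tri_def tri_trm_def
    by (intro fv_Lam0[where S = "{}"]) (auto simp: nv_simps nv_rec typ_of_Lam0)
  then show "tri 0 = 0" "tri (n + 1) = tri n + (n + 1)" using prc_0[OF f] prc_Suc[OF f] by simp_all
qed

lemma troot_0 [simp]: "troot 0 = 0"
  and troot_Suc: "troot (n + 1) = troot n + (1 - (tri (troot n + 1) - (n + 1)))"
proof -
  let ?f = "\<lambda>k r. r + (1 - (tri (r + 1) - (k + 1)))"
  have f: "rl (rfun r0 r1) ?f" by (rule rl_lam2) (rule dfn_terms dfn_base dfn_good)+
  have "gv \<rho> (\<^bold>\<lambda>n. \<^bold>\<lambda>r. r \<^bold>+ (\<^bold>1 \<^bold>- (tri_trm \<^bold>\<cdot> suc r \<^bold>- suc n))) = ?f" if "ok \<rho>" for \<rho>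
    by (rule gv_Lam0[where S = "{}"]) (use that in \<open>auto simp: nv_simps nv_tri\<close>)
  then have "troot = prc ?f 0"
    unfolding troot_def troot_trm_def
    by (intro fv_Lam0[where S = "{}"]) (auto simp: nv_simps nv_rec typ_of_Lam0)
  then show "troot 0 = 0" "troot (n + 1) = troot n + (1 - (tri (troot n + 1) - (n + 1)))"
    using prc_0[OF f] prc_Suc[OF f] by simp_all
qed

lemma cut_0 [simp]: "cut 0 s = s" and cut_Suc: "cut (k + 1) s = hf (cut k s - 1)"
proof -
  let ?f = "\<lambda>k r. hf (r - 1)"
  have f: "rl (rfun r0 r1) ?f" by (rule rl_lam2) (rule dfn_terms dfn_base dfn_good)+
  have "gv \<rho> (\<^bold>\<lambda>j. \<^bold>\<lambda>r. half_trm \<^bold>\<cdot> (pred_trm \<^bold>\<cdot> r)) = ?f" if "ok \<rho>" for \<rho>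
    by (rule gv_Lam0_inner[where S = "{}"]) (use that in \<open>auto simp: nv_simps nv_half\<close>)
  then have "cut = (\<lambda>k s. prc ?f s k)"
    unfolding cut_def cut_trm_def
    by (intro gv_Lam0[where S = "{}"]) (auto simp: nv_simps nv_rec typ_of_Lam0)
  then show "cut 0 s = s" "cut (k + 1) s = hf (cut k s - 1)" using prc_0[OF f] prc_Suc[OF f] by simp_all
qed

text \<open>In the length, \<open>s\<close> is both the string and the bound of the count; a
  separate bound makes induction on it possible.\<close>

definition cnt where "cnt s n = prc (\<lambda>k r. r + sg (cut k s)) 0 n"

lemma rl_cnt: "rl (rfun r0 r1) cnt"
  unfolding cnt_def by (rule rl_lam2) (rule dfn_prc dfn_lam dfn_terms dfn_base dfn_good)+

lemma cnt_0 [simp]: "cnt s 0 = 0" and cnt_Suc: "cnt s (n + 1) = cnt s n + sg (cut n s)"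
  and len_cnt: "len s = cnt s s"
proof -
  let ?f = "\<lambda>s k r. r + sg (cut k s)"
  have f: "rl (rfun r0 r1) (?f s)" for s by (rule rl_lam2) (rule dfn_terms dfn_base dfn_good)+
  show "cnt s 0 = 0" "cnt s (n + 1) = cnt s n + sg (cut n s)"
    unfolding cnt_def using prc_0[OF f] prc_Suc[OF f] by simp_all
  have g: "gv \<rho> (\<^bold>\<lambda>k. \<^bold>\<lambda>r. r \<^bold>+ sg_trm \<^bold>\<cdot> (cut_trm \<^bold>\<cdot> k \<^bold>\<cdot> Var x Num)) = ?f (nv \<rho> (Var x Num))" if "ok \<rho>" for \<rho> x
    by (rule gv_Lam0[where S = "{(x, Num)}"]) (use that in \<open>auto simp: nv_simps nv_sg nv_cut\<close>)
  have "len = (\<lambda>s. prc (?f s) 0 s)"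
    unfolding len_def length_trm_def
    by (intro fv_Lam0[where S = "{}"]) (auto simp: nv_simps nv_rec typ_of_Lam0 g)
  then show "len s = cnt s s" by (simp add: cnt_def)
qed

end

lemma frees_closed [simp]:
  "frees_t pred_trm = {}" "frees_t monus_trm = {}" "frees_t sg_trm = {}" "frees_t pow2_trm = {}"
  "frees_t half_trm = {}" "frees_t tri_trm = {}" "frees_t troot_trm = {}" "frees_t pair_trm = {}"
  "frees_t fst_trm = {}" "frees_t snd_trm = {}" "frees_t qpos_trm = {}" "frees_t qneg_trm = {}"
  "frees_t qden_trm = {}" "frees_t qdiff_trm = {}" "frees_t qminus_trm = {}" "frees_t qabs_trm = {}"
  "frees_t qpow_trm = {}" "frees_t snoc_trm = {}" "frees_t cut_trm = {}" "frees_t length_trm = {}"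
  by (rule subset_empty[THEN iffD1], rule frees_pred frees_monus frees_sg frees_pow2 frees_half frees_tri
    frees_troot frees_pair frees_fst frees_snd frees_qpos frees_qneg frees_qden frees_qdiff frees_qminus
    frees_qabs frees_qpow frees_snoc frees_cut frees_length)+

lemma fr_numeral [simp]: "fr (numeral k) = numeral k"
  by (induction k) (simp_all only: numeral_Bit0 numeral_Bit1 numeral_One fr_simps)

lemmas to_fr = fr_simps(5-7)[symmetric]

lemma Suc_le_mnat: "(a::'n::mnat) + 1 \<le> b \<longleftrightarrow> a < b"
  using less_succ[of b a] by (meson not_le)

lemma minus_0_iff: "(a::'n::mnat) - b = 0 \<longleftrightarrow> a \<le> b"
proof
  assume "a - b = 0"
  then show "a \<le> b" using le_add_diff_inverse[of b a] by (cases "b \<le> a") auto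
qed simp

lemma mnat_Suc_pos [simp]: "(0::'n::mnat) < a + 1"
  by (simp add: less_succ)

context nmodel
begin

subsection \<open>Pairs and rational numbers\<close>

lemma tri_mono: "k \<le> m \<Longrightarrow> tri k \<le> tri m"
proof -
  have "k \<le> m \<longrightarrow> tri k \<le> tri m"
    by (rule num_induct[where n = m], (rule pd_ops dfn_terms dfn_base)+)
      (auto simp: tri_Suc le_less[of k "_ + 1"] less_succ intro: order_trans add_increasing2)
  then show "k \<le> m \<Longrightarrow> tri k \<le> tri m" by blast
qed

lemma troot_bounds: "tri (troot z) \<le> z \<and> z < tri (troot z + 1)"
proof (rule num_induct[where n = z], (rule pd_ops dfn_terms dfn_base)+)
  show "tri (troot 0) \<le> 0 \<and> 0 < tri (troot 0 + 1)" using tri_Suc[of 0] by simp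
  fix n assume *: "tri (troot n) \<le> n \<and> n < tri (troot n + 1)"
  let ?r = "troot n"
  show "tri (troot (n + 1)) \<le> n + 1 \<and> n + 1 < tri (troot (n + 1) + 1)"
  proof (cases "tri (?r + 1) = n + 1")
    case True
    then have "troot (n + 1) = ?r + 1" by (simp add: troot_Suc)
    then show ?thesis using True by (simp add: tri_Suc[of "?r + 1"])
  next
    case False
    moreover have "n + 1 \<le> tri (?r + 1)" unfolding Suc_le_mnat using * by blast
    ultimately have "n + 1 < tri (?r + 1)" by (simp add: less_le)
    then have "tri (?r + 1) - (n + 1) \<noteq> 0" by (simp add: minus_0_iff not_le)
    then have "troot (n + 1) = ?r" by (simp add: troot_Suc one_minus_mnat)
    moreover have "tri ?r \<le> n + 1" using * less_add_one[of n] by (meson less_imp_le order_trans)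
    ultimately show ?thesis using \<open>n + 1 < tri (?r + 1)\<close> by simp
  qed
qed

lemma troot_unique: "tri k \<le> z \<Longrightarrow> z < tri (k + 1) \<Longrightarrow> troot z = k"
proof (rule ccontr)
  assume z: "tri k \<le> z" "z < tri (k + 1)" and "troot z \<noteq> k"
  then consider "k + 1 \<le> troot z" | "troot z + 1 \<le> k" unfolding Suc_le_mnat by (meson linorder_neqE)
  then show False
  proof cases
    case 1
    show False using tri_mono[OF 1] z troot_bounds[of z] by (meson leD le_less_trans less_le_trans)
  next
    case 2
    show False using tri_mono[OF 2] z troot_bounds[of z] by (meson leD le_less_trans less_le_trans)
  qed
qed

lemma troot_pair: "troot (pair a b) = a + b"
proof (rule troot_unique)
  show "tri (a + b) \<le> pair a b" by (simp add: pair_def)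
  show "pair a b < tri (a + b + 1)" unfolding pair_def to_fr tri_Suc fr_simps(1-4)
    using fr_nonneg[of b] by linarith
qed

lemma nfst_pair [simp]: "nfst (pair a b) = a"
  unfolding nfst_def troot_pair by (simp add: pair_def)

lemma nsnd_pair [simp]: "nsnd (pair a b) = b"
  unfolding nsnd_def nfst_pair troot_pair by simp

text \<open>Different codes may have the same value, so all estimates are made in the field and not
  with codes.\<close>

definition qv :: "'n \<Rightarrow> 'n mint fract" where "qv q = (fr (qpos q) - fr (qneg q)) / fr (qden q)"

lemma qden_pos [simp]: "0 < qden q"
  by (simp add: qden_def add_nonneg_pos)

lemma qv_pair: "qv (pair s (pair a d)) = (if s = 0 then fr a else - fr a) / (fr d + 1)"
  by (simp add: qv_def qpos_def qneg_def qden_def sg_def one_minus_mnat)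

lemma qv_qdiff: "qv (qdiff a b d) = (fr a - fr b) / (fr d + 1)"
proof (cases "b \<le> a")
  case True
  then show ?thesis by (simp add: qdiff_def qv_pair sg_def fr_minus)
next
  case False
  then have "a \<le> b" "b - a \<noteq> 0" by (auto simp: minus_0_iff)
  then show ?thesis by (simp add: qdiff_def qv_pair sg_def fr_minus)
qed

lemma qv_qminus: "qv (qminus p q) = qv p - qv q"
proof -
  have "1 \<le> qden p * qden q" using qden_pos[of p] qden_pos[of q] by (simp add: mnat_ge_1)
  then have "fr (qden p * qden q - 1) + 1 = fr (qden p) * fr (qden q)" by (simp add: fr_minus)
  then show ?thesis
    using qden_pos[of p] qden_pos[of q] unfolding mnat_pos[symmetric]
    by (simp add: qminus_def qv_qdiff) (simp add: qv_def field_simps fr_simps(7)[of _ 0, simplified])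
qed

lemma qv_qabs: "qv (qabs q) = \<bar>qv q\<bar>"
proof -
  have "qv q = (if nfst q = 0 then fr (nfst (nsnd q)) else - fr (nfst (nsnd q))) / fr (qden q)"
    by (simp add: qv_def qpos_def qneg_def sg_def one_minus_mnat)
  moreover have "qv (qabs q) = fr (nfst (nsnd q)) / fr (qden q)"
    by (simp add: qabs_def qv_def qpos_def qneg_def sg_def qden_def)
  ultimately show ?thesis by (simp add: abs_divide)
qed

lemma p2_pos [simp]: "0 < p2 n"
  by (rule num_induct[where n = n], (rule pd_ops dfn_terms dfn_base)+) (auto simp: p2_Suc add_pos_pos)

definition P2 :: "'n \<Rightarrow> 'n mint fract" where "P2 n = fr (p2 n)"

lemma P2_0 [simp]: "P2 0 = 1" and P2_Suc: "P2 (n + 1) = 2 * P2 n" and P2_pos [simp]: "0 < P2 n"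
  by (simp_all add: P2_def p2_Suc)

lemma qv_qpow: "qv (qpow a n) = fr a / P2 n"
proof -
  have "1 \<le> p2 n" by (simp add: mnat_ge_1)
  then show ?thesis by (simp add: qpow_def qv_pair P2_def fr_minus)
qed

lemma qv_0: "qv (pair 0 (pair 0 0)) = 0" and qv_1: "qv (pair 0 (pair 1 0)) = 1"
  by (simp_all add: qv_pair)

lemma qv_less: "qpos p * qden q + qneg q * qden p < qpos q * qden p + qneg p * qden q \<longleftrightarrow> qv p < qv q"
proof -
  have "qv p < qv q \<longleftrightarrow> (fr (qpos p) - fr (qneg p)) * fr (qden q) < (fr (qpos q) - fr (qneg q)) * fr (qden p)"
    unfolding qv_def using qden_pos[of p] qden_pos[of q] by (simp add: divide_less_eq less_divide_eq mult.commute)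
  then show ?thesis unfolding to_fr by (simp add: algebra_simps)
qed

subsection \<open>Satisfaction of formulas\<close>

end

lemma wff_props [simp]:
  "wff \<Gamma> (\<^bold>\<not> A) = wff \<Gamma> A" "wff \<Gamma> (A \<^bold>\<and> B) = (wff \<Gamma> A \<and> wff \<Gamma> B)"
  "wff \<Gamma> (A \<^bold>\<or> B) = (wff \<Gamma> A \<and> wff \<Gamma> B)" "wff \<Gamma> (A \<^bold>\<longleftrightarrow> B) = (wff \<Gamma> A \<and> wff \<Gamma> B)"
  by (auto simp: prop_defs)

lemma frees_props [simp]:
  "frees (\<^bold>\<not> A) = frees A" "frees (A \<^bold>\<and> B) = frees A \<union> frees B"
  "frees (A \<^bold>\<or> B) = frees A \<union> frees B" "frees (A \<^bold>\<longleftrightarrow> B) = frees A \<union> frees B"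
  by (auto simp: prop_defs)

context nmodel
begin

lemma msat_props [simp]:
  "msat \<rho> (\<^bold>\<not> A) = (\<not> msat \<rho> A)" "msat \<rho> (A \<^bold>\<and> B) = (msat \<rho> A \<and> msat \<rho> B)"
  "msat \<rho> (A \<^bold>\<or> B) = (msat \<rho> A \<or> msat \<rho> B)" "msat \<rho> (A \<^bold>\<longleftrightarrow> B) = (msat \<rho> A \<longleftrightarrow> msat \<rho> B)"
  by (auto simp: prop_defs)

end

lemma wff_binders:
  "(\<And>x. wff [] (F (Var x Num))) \<Longrightarrow> wff [] (All0 F)" "(\<And>x. wff [] (F (Var x Num))) \<Longrightarrow> wff [] (Ex0 F)"
  "(\<And>x. wff [] (F (Var x ty1))) \<Longrightarrow> wff [] (All1 F)" "(\<And>x. wff [] (F (Var x ty1))) \<Longrightarrow> wff [] (Ex1 F)"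
  unfolding binder_defs by (simp_all add: wff_Forall)

lemma frees_binders:
  "(\<And>x. S \<subseteq> frees (F (Var x Num))) \<Longrightarrow> S \<subseteq> frees (All0 F)" "(\<And>x. S \<subseteq> frees (F (Var x Num))) \<Longrightarrow> S \<subseteq> frees (Ex0 F)"
  "(\<And>x. S \<subseteq> frees (F (Var x ty1))) \<Longrightarrow> S \<subseteq> frees (All1 F)" "(\<And>x. S \<subseteq> frees (F (Var x ty1))) \<Longrightarrow> S \<subseteq> frees (Ex1 F)"
  unfolding binder_defs by (simp_all add: frees_Forall)

context nmodel
begin

lemma msat_All0:
  assumes "\<And>x. wff [] (F (Var x Num))" "\<And>x. S \<subseteq> frees (F (Var x Num))" "ok \<rho>"
    and body: "\<And>x n \<rho>'. ok \<rho>' \<Longrightarrow> nv \<rho>' (Var x Num) = n \<Longrightarrow> \<forall>v\<in>S. \<rho>' v = \<rho> v \<Longrightarrow> msat \<rho>' (F (Var x Num)) = P n"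
  shows "msat \<rho> (All0 F) = (\<forall>n. P n)"
proof -
  have "msat \<rho> (All0 F) = (\<forall>a\<in>N. P (num a))" unfolding All0_def
    by (rule sat_Forall[where S = S]) (use assms in \<open>auto simp: nv_Var\<close>)
  then show ?thesis by (metis num_un un_dom)
qed

lemma msat_Ex0:
  assumes "\<And>x. wff [] (F (Var x Num))" "\<And>x. S \<subseteq> frees (F (Var x Num))" "ok \<rho>"
    and body: "\<And>x n \<rho>'. ok \<rho>' \<Longrightarrow> nv \<rho>' (Var x Num) = n \<Longrightarrow> \<forall>v\<in>S. \<rho>' v = \<rho> v \<Longrightarrow> msat \<rho>' (F (Var x Num)) = P n"
  shows "msat \<rho> (Ex0 F) = (\<exists>n. P n)"
proof -
  have "msat \<rho> (All0 (\<lambda>x. \<^bold>\<not> F x)) = (\<forall>n. \<not> P n)"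
    by (rule msat_All0[where S = S]) (use assms in auto)
  then show ?thesis by (simp add: Ex0_def Exists_def All0_def)
qed

text \<open>Every number is represented, so an element of type 1 represents exactly one HOL
  function, and the quantifier ranges over the functions with \<open>rl r1\<close>.\<close>

lemma msat_All1:
  assumes "\<And>x. wff [] (F (Var x ty1))" "\<And>x. S \<subseteq> frees (F (Var x ty1))" "ok \<rho>"
    and body: "\<And>x f \<rho>'. ok \<rho>' \<Longrightarrow> fv \<rho>' (Var x ty1) = f \<Longrightarrow> rl r1 f \<Longrightarrow> \<forall>v\<in>S. \<rho>' v = \<rho> v
      \<Longrightarrow> msat \<rho>' (F (Var x ty1)) = P f"
  shows "msat \<rho> (All1 F) = (\<forall>f. rl r1 f \<longrightarrow> P f)"
proof -
  have r: "snd r1 a (\<lambda>n. num (ap a (un n)))" if "a \<in> D ty1" for a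
    using that by (auto simp: snd_rfun snd_r0 intro: ap_dom)
  have "msat \<rho> (All1 F) = (\<forall>a\<in>D ty1. P (\<lambda>n. num (ap a (un n))))" unfolding All1_def
  proof (rule sat_Forall[where S = S])
    fix x a \<rho>' assume *: "a \<in> D ty1" "ok \<rho>'" "\<rho>' (x, ty1) = a" "\<forall>v\<in>S. \<rho>' v = \<rho> v"
    show "msat \<rho>' (F (Var x ty1)) = P (\<lambda>n. num (ap a (un n)))"
      by (rule body) (use * r in \<open>auto simp: fv_def rl_def\<close>)
  qed (use assms in auto)
  also have "\<dots> = (\<forall>f. rl r1 f \<longrightarrow> P f)"
    using r r1_unique good_dom[OF good_rfun[OF good_r0 good_r0]] unfolding rl_def by (metis fst_r0 fst_rfun)
  finally show ?thesis .
qed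

lemma msat_Ex1:
  assumes "\<And>x. wff [] (F (Var x ty1))" "\<And>x. S \<subseteq> frees (F (Var x ty1))" "ok \<rho>"
    and body: "\<And>x f \<rho>'. ok \<rho>' \<Longrightarrow> fv \<rho>' (Var x ty1) = f \<Longrightarrow> rl r1 f \<Longrightarrow> \<forall>v\<in>S. \<rho>' v = \<rho> v
      \<Longrightarrow> msat \<rho>' (F (Var x ty1)) = P f"
  shows "msat \<rho> (Ex1 F) = (\<exists>f. rl r1 f \<and> P f)"
proof -
  have "msat \<rho> (All1 (\<lambda>x. \<^bold>\<not> F x)) = (\<forall>f. rl r1 f \<longrightarrow> \<not> P f)"
    by (rule msat_All1[where S = S]) (use assms in auto)
  then show ?thesis by (simp add: Ex1_def Exists_def All1_def)
qed

lemma msat_Eq: "typ_of [] s = Some Num \<Longrightarrow> typ_of [] t = Some Num \<Longrightarrow> ok \<rho> \<Longrightarrow> msat \<rho> (s \<^bold>= t) = (nv \<rho> s = nv \<rho> t)"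
  using val_dom[of s Num \<rho>] val_dom[of t Num \<rho>] by (simp add: nv_def num_inj)

lemma msat_Less: "typ_of [] s = Some Num \<Longrightarrow> typ_of [] t = Some Num \<Longrightarrow> ok \<rho> \<Longrightarrow> msat \<rho> (s \<^bold>< t) = (nv \<rho> s < nv \<rho> t)"
  using val_dom[of s Num \<rho>] val_dom[of t Num \<rho>] by (simp add: nv_def)

declare sat.simps(1,2) [simp del]

end

lemma wff_lt_Q [simp]: "wff [] (p <\<^sub>Q q) \<longleftrightarrow> typ_of [] p = Some Num \<and> typ_of [] q = Some Num"
  by (auto simp: lt_Q_def split: option.splits ty.splits if_splits)

lemma frees_lt_Q [simp]: "frees (p <\<^sub>Q q) = frees_t p \<union> frees_t q"
  by (auto simp: lt_Q_def)

context nmodel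
begin

lemma msat_lt_Q: "typ_of [] p = Some Num \<Longrightarrow> typ_of [] q = Some Num \<Longrightarrow> ok \<rho> \<Longrightarrow>
    msat \<rho> (p <\<^sub>Q q) = (qv (nv \<rho> p) < qv (nv \<rho> q))"
  by (simp add: lt_Q_def msat_Less nv_simps nv_qpos nv_qden nv_qneg qv_less)

end

lemma wff_le_Q [simp]: "wff [] (p \<le>\<^sub>Q q) \<longleftrightarrow> typ_of [] p = Some Num \<and> typ_of [] q = Some Num"
  by (auto simp: le_Q_def)

lemma frees_le_Q [simp]: "frees (p \<le>\<^sub>Q q) = frees_t p \<union> frees_t q"
  by (auto simp: le_Q_def)

context nmodel
begin

lemma msat_le_Q: "typ_of [] p = Some Num \<Longrightarrow> typ_of [] q = Some Num \<Longrightarrow> ok \<rho> \<Longrightarrow>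
    msat \<rho> (p \<le>\<^sub>Q q) = (qv (nv \<rho> p) \<le> qv (nv \<rho> q))"
  by (simp add: le_Q_def msat_lt_Q not_less)

section \<open>Statements about reals and sets of reals, read in HOL\<close>

definition isr :: "('n \<Rightarrow> 'n) \<Rightarrow> bool" where
  "isr X \<longleftrightarrow> (\<forall>n i. \<bar>qv (X n) - qv (X (n + i))\<bar> < 1 / P2 n)"
definition eqr :: "('n \<Rightarrow> 'n) \<Rightarrow> ('n \<Rightarrow> 'n) \<Rightarrow> bool" where
  "eqr X Y \<longleftrightarrow> (\<forall>n. \<bar>qv (X n) - qv (Y n)\<bar> \<le> 2 / P2 n)"
definition ltr :: "('n \<Rightarrow> 'n) \<Rightarrow> ('n \<Rightarrow> 'n) \<Rightarrow> bool" where
  "ltr X Y \<longleftrightarrow> (\<exists>n. 2 / P2 n < qv (Y n) - qv (X n))"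

end

lemma wff_real_rels [simp]:
  "typ_of [] x = Some ty1 \<Longrightarrow> wff [] (is_real x)"
  "typ_of [] x = Some ty1 \<Longrightarrow> typ_of [] y = Some ty1 \<Longrightarrow> wff [] (x =\<^sub>R y)"
  "typ_of [] x = Some ty1 \<Longrightarrow> typ_of [] y = Some ty1 \<Longrightarrow> wff [] (x <\<^sub>R y)"
  "typ_of [] x = Some ty1 \<Longrightarrow> typ_of [] y = Some ty1 \<Longrightarrow> wff [] (x \<le>\<^sub>R y)"
  unfolding is_real_def eq_R_def lt_R_def le_R_def by (auto intro!: wff_binders)

lemma frees_real_rels:
  "frees_t x \<subseteq> frees (is_real x)"
  "frees_t x \<union> frees_t y \<subseteq> frees (x =\<^sub>R y)"
  "frees_t x \<union> frees_t y \<subseteq> frees (x <\<^sub>R y)"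
  "frees_t x \<union> frees_t y \<subseteq> frees (x \<le>\<^sub>R y)"
  unfolding is_real_def eq_R_def lt_R_def le_R_def frees_props by (intro frees_binders; auto)+

context nmodel
begin

lemma msat_is_real:
  assumes "typ_of [] x = Some ty1" "ok \<rho>"
  shows "msat \<rho> (is_real x) = isr (fv \<rho> x)"
  unfolding is_real_def isr_def
proof (rule msat_All0[where S = "frees_t x"])
  fix m n \<rho>1 assume 1: "ok \<rho>1" "nv \<rho>1 (Var m Num) = n" "\<forall>v\<in>frees_t x. \<rho>1 v = \<rho> v"
  show "msat \<rho>1 (\<^bold>\<forall>\<^sup>0i. qabs_trm \<^bold>\<cdot> (qminus_trm \<^bold>\<cdot> (x \<^bold>\<cdot> Var m Num) \<^bold>\<cdot> (x \<^bold>\<cdot> (Var m Num \<^bold>+ i))) <\<^sub>Q qpow_trm \<^bold>\<cdot> \<^bold>1 \<^bold>\<cdot> Var m Num)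
    = (\<forall>i. \<bar>qv (fv \<rho> x n) - qv (fv \<rho> x (n + i))\<bar> < 1 / P2 n)"
  proof (rule msat_All0[where S = "insert (m, Num) (frees_t x)"])
    fix k i \<rho>2 assume 2: "ok \<rho>2" "nv \<rho>2 (Var k Num) = i" "\<forall>v\<in>insert (m, Num) (frees_t x). \<rho>2 v = \<rho>1 v"
    then have "fv \<rho>2 x = fv \<rho> x" "nv \<rho>2 (Var m Num) = n"
      using 1 by (auto intro: fv_agree[of "frees_t x"] simp: nv_Var)
    then show "msat \<rho>2 (qabs_trm \<^bold>\<cdot> (qminus_trm \<^bold>\<cdot> (x \<^bold>\<cdot> Var m Num) \<^bold>\<cdot> (x \<^bold>\<cdot> (Var m Num \<^bold>+ Var k Num))) <\<^sub>Q qpow_trm \<^bold>\<cdot> \<^bold>1 \<^bold>\<cdot> Var m Num)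
      = (\<bar>qv (fv \<rho> x n) - qv (fv \<rho> x (n + i))\<bar> < 1 / P2 n)"
      using 1 2 assms
      by (simp add: msat_lt_Q nv_qabs nv_qminus nv_qpow nv_app[of x] nv_plus nv_suc nv_zero qv_qabs qv_qminus qv_qpow)
  qed (use assms 1 in auto)
qed (use assms in \<open>auto intro!: wff_binders frees_binders\<close>)

lemma msat_eq_R:
  assumes "typ_of [] x = Some ty1" "typ_of [] y = Some ty1" "ok \<rho>"
  shows "msat \<rho> (x =\<^sub>R y) = eqr (fv \<rho> x) (fv \<rho> y)"
  unfolding eq_R_def eqr_def
proof (rule msat_All0[where S = "frees_t x \<union> frees_t y"])
  fix m n \<rho>' assume 1: "ok \<rho>'" "nv \<rho>' (Var m Num) = n" "\<forall>v\<in>frees_t x \<union> frees_t y. \<rho>' v = \<rho> v"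
  then have "fv \<rho>' x = fv \<rho> x" "fv \<rho>' y = fv \<rho> y" by (auto intro: fv_agree[of "frees_t x \<union> frees_t y"])
  then show "msat \<rho>' (qabs_trm \<^bold>\<cdot> (qminus_trm \<^bold>\<cdot> (x \<^bold>\<cdot> Var m Num) \<^bold>\<cdot> (y \<^bold>\<cdot> Var m Num)) \<le>\<^sub>Q qpow_trm \<^bold>\<cdot> suc \<^bold>1 \<^bold>\<cdot> Var m Num)
     = (\<bar>qv (fv \<rho> x n) - qv (fv \<rho> y n)\<bar> \<le> 2 / P2 n)"
    using 1 assms
    by (simp add: msat_le_Q nv_qabs nv_qminus nv_qpow nv_app[of x] nv_app[of y] nv_suc nv_zero qv_qabs qv_qminus qv_qpow)
qed (use assms in auto)

lemma msat_lt_R: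
  assumes "typ_of [] x = Some ty1" "typ_of [] y = Some ty1" "ok \<rho>"
  shows "msat \<rho> (x <\<^sub>R y) = ltr (fv \<rho> x) (fv \<rho> y)"
  unfolding lt_R_def ltr_def
proof (rule msat_Ex0[where S = "frees_t x \<union> frees_t y"])
  fix m n \<rho>' assume 1: "ok \<rho>'" "nv \<rho>' (Var m Num) = n" "\<forall>v\<in>frees_t x \<union> frees_t y. \<rho>' v = \<rho> v"
  then have "fv \<rho>' x = fv \<rho> x" "fv \<rho>' y = fv \<rho> y" by (auto intro: fv_agree[of "frees_t x \<union> frees_t y"])
  then show "msat \<rho>' (qpow_trm \<^bold>\<cdot> suc \<^bold>1 \<^bold>\<cdot> Var m Num <\<^sub>Q qminus_trm \<^bold>\<cdot> (y \<^bold>\<cdot> Var m Num) \<^bold>\<cdot> (x \<^bold>\<cdot> Var m Num))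
     = (2 / P2 n < qv (fv \<rho> y n) - qv (fv \<rho> x n))"
    using 1 assms
    by (simp add: msat_lt_Q nv_qminus nv_qpow nv_app[of x] nv_app[of y] nv_suc nv_zero qv_qminus qv_qpow)
qed (use assms in auto)

lemma msat_le_R:
  "typ_of [] x = Some ty1 \<Longrightarrow> typ_of [] y = Some ty1 \<Longrightarrow> ok \<rho> \<Longrightarrow> msat \<rho> (x \<le>\<^sub>R y) = (\<not> ltr (fv \<rho> y) (fv \<rho> x))"
  by (simp add: le_R_def msat_lt_R)

end

abbreviation ty2 :: ty where "ty2 \<equiv> ty1 \<^bold>\<rightarrow> ty1"

lemma typ_real_ops [simp]:
  "typ_of [] q = Some Num \<Longrightarrow> typ_of [] (real_of_Q q) = Some ty1"
  "typ_of [] x = Some ty1 \<Longrightarrow> typ_of [] y = Some ty1 \<Longrightarrow> typ_of [] (x -\<^sub>R y) = Some ty1"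
  "typ_of [] x = Some ty1 \<Longrightarrow> typ_of [] (abs_R x) = Some ty1"
  unfolding real_of_Q_def minus_R_def abs_R_def by (rule typ_of_Lam0; simp)+

lemma frees_real_ops:
  "typ_of [] q = Some Num \<Longrightarrow> frees_t q \<subseteq> frees_t (real_of_Q q)"
  "typ_of [] x = Some ty1 \<Longrightarrow> typ_of [] y = Some ty1 \<Longrightarrow> frees_t x \<union> frees_t y \<subseteq> frees_t (x -\<^sub>R y)"
  "typ_of [] x = Some ty1 \<Longrightarrow> frees_t x \<subseteq> frees_t (abs_R x)"
  unfolding real_of_Q_def minus_R_def abs_R_def by (rule frees_Lam0[where \<tau> = Num]; auto)+

lemma typ_prefix_code [simp]:
  "typ_of [] a = Some ty1 \<Longrightarrow> typ_of [] n = Some Num \<Longrightarrow> typ_of [] (prefix_code a n) = Some Num"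
  unfolding prefix_code_def by (simp add: typ_of_Lam0)

lemma frees_prefix_code:
  assumes "typ_of [] a = Some ty1"
  shows "frees_t a \<union> frees_t n \<subseteq> frees_t (prefix_code a n)"
proof -
  have "frees_t a \<subseteq> frees_t (\<^bold>\<lambda>k. \<^bold>\<lambda>r. snoc_trm \<^bold>\<cdot> r \<^bold>\<cdot> (a \<^bold>\<cdot> k))"
    by (rule frees_Lam0[where \<tau> = ty1], simp add: typ_of_Lam0 assms, rule frees_Lam0[where \<tau> = Num])
      (use assms in auto)
  then show ?thesis unfolding prefix_code_def by auto
qed

context nmodel
begin

lemma fv_real_of_Q:
  assumes "typ_of [] q = Some Num" "ok \<rho>" shows "fv \<rho> (real_of_Q q) = (\<lambda>n. nv \<rho> q)"
  unfolding real_of_Q_def by (rule fv_Lam0[where S = "frees_t q"]) (use assms in \<open>auto intro: nv_agree\<close>)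

lemma fv_minus_R:
  assumes "typ_of [] x = Some ty1" "typ_of [] y = Some ty1" "ok \<rho>"
  shows "fv \<rho> (x -\<^sub>R y) = (\<lambda>n. qminus (fv \<rho> x (n + 1)) (fv \<rho> y (n + 1)))"
  unfolding minus_R_def
proof (rule fv_Lam0[where S = "frees_t x \<union> frees_t y"])
  fix m n \<rho>' assume 1: "ok \<rho>'" "nv \<rho>' (Var m Num) = n" "\<forall>v\<in>frees_t x \<union> frees_t y. \<rho>' v = \<rho> v"
  then have "fv \<rho>' x = fv \<rho> x" "fv \<rho>' y = fv \<rho> y" by (auto intro: fv_agree[of "frees_t x \<union> frees_t y"])
  then show "nv \<rho>' (qminus_trm \<^bold>\<cdot> (x \<^bold>\<cdot> suc (Var m Num)) \<^bold>\<cdot> (y \<^bold>\<cdot> suc (Var m Num))) = qminus (fv \<rho> x (n + 1)) (fv \<rho> y (n + 1))"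
    using 1 assms by (simp add: nv_qminus nv_app[of x] nv_app[of y] nv_suc)
qed (use assms in auto)

lemma fv_abs_R:
  assumes "typ_of [] x = Some ty1" "ok \<rho>"
  shows "fv \<rho> (abs_R x) = (\<lambda>n. qabs (fv \<rho> x n))"
  unfolding abs_R_def
proof (rule fv_Lam0[where S = "frees_t x"])
  fix m n \<rho>' assume 1: "ok \<rho>'" "nv \<rho>' (Var m Num) = n" "\<forall>v\<in>frees_t x. \<rho>' v = \<rho> v"
  then have "fv \<rho>' x = fv \<rho> x" by (auto intro: fv_agree[of "frees_t x"])
  then show "nv \<rho>' (qabs_trm \<^bold>\<cdot> (x \<^bold>\<cdot> (Var m Num))) = qabs (fv \<rho> x n)"
    using 1 assms by (simp add: nv_qabs nv_app[of x])
qed (use assms in auto)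

definition pc :: "('n \<Rightarrow> 'n) \<Rightarrow> 'n \<Rightarrow> 'n" where "pc a n = prc (\<lambda>k r. snoc r (a k)) 0 n"

lemma nv_prefix_code:
  assumes "typ_of [] a = Some ty1" "typ_of [] n = Some Num" "ok \<rho>"
  shows "nv \<rho> (prefix_code a n) = pc (fv \<rho> a) (nv \<rho> n)"
proof -
  let ?g = "\<^bold>\<lambda>k. \<^bold>\<lambda>r. snoc_trm \<^bold>\<cdot> r \<^bold>\<cdot> (a \<^bold>\<cdot> k)"
  have "gv \<rho> ?g = (\<lambda>k r. snoc r (fv \<rho> a k))"
  proof (rule gv_Lam0[where S = "frees_t a"])
    fix x y m n \<rho>' assume 1: "ok \<rho>'" "nv \<rho>' (Var x Num) = m" "nv \<rho>' (Var y Num) = n" "\<forall>v\<in>frees_t a. \<rho>' v = \<rho> v"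
    then have "fv \<rho>' a = fv \<rho> a" by (auto intro: fv_agree[of "frees_t a"])
    then show "nv \<rho>' (snoc_trm \<^bold>\<cdot> Var y Num \<^bold>\<cdot> (a \<^bold>\<cdot> Var x Num)) = snoc n (fv \<rho> a m)"
      using 1 assms by (simp add: nv_snoc nv_app[of a])
  qed (use assms in auto)
  then show ?thesis using assms unfolding prefix_code_def pc_def by (simp add: nv_rec typ_of_Lam0 nv_zero)
qed

lemma fv_app11: "snd (rfun r1 r1) (mval \<rho> Y) F \<Longrightarrow> typ_of [] x = Some ty1 \<Longrightarrow> ok \<rho> \<Longrightarrow> fv \<rho> (Y \<^bold>\<cdot> x) = F (fv \<rho> x)"
  using r1_unique[OF appD[OF _ r1_fv]] by (simp add: fv_def)

definition pos :: "('n \<Rightarrow> 'n) \<Rightarrow> bool" where "pos X \<longleftrightarrow> (\<exists>n. 2 / P2 n < qv (X n))"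
definition cst :: "'n \<Rightarrow> 'n \<Rightarrow> 'n" where "cst q = (\<lambda>n. q)"
definition zr where "zr = cst (pair 0 (pair 0 0))"
definition on where "on = cst (pair 0 (pair 1 0))"
abbreviation real :: "('n \<Rightarrow> 'n) \<Rightarrow> bool" where "real X \<equiv> rl r1 X \<and> isr X"
definition isrf :: "(('n \<Rightarrow> 'n) \<Rightarrow> 'n \<Rightarrow> 'n) \<Rightarrow> bool" where
  "isrf F \<longleftrightarrow> (\<forall>X. real X \<longrightarrow> isr (F X)) \<and> (\<forall>X. real X \<longrightarrow> (\<forall>Y. real Y \<longrightarrow> eqr X Y \<longrightarrow> eqr (F X) (F Y)))"
text \<open>The index \<open>n + 1\<close> stems from \<open>minus_R\<close>, which looks one place
  ahead so that a difference of reals converges at the required rate.\<close>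

definition near :: "('n \<Rightarrow> 'n) \<Rightarrow> ('n \<Rightarrow> 'n) \<Rightarrow> 'n \<Rightarrow> bool" where
  "near X Y r \<longleftrightarrow> ltr (\<lambda>n. qabs (qminus (X (n + 1)) (Y (n + 1)))) (cst r)"
definition opn :: "(('n \<Rightarrow> 'n) \<Rightarrow> 'n \<Rightarrow> 'n) \<Rightarrow> bool" where
  "opn F \<longleftrightarrow> isrf F \<and> (\<forall>X. real X \<longrightarrow> pos (F X) \<longrightarrow>
     (\<exists>r. qv (pair 0 (pair 0 0)) < qv r \<and> (\<forall>Y. real Y \<longrightarrow> near X Y r \<longrightarrow> pos (F Y))))"

lemma ltr_zr: "ltr zr X = pos X"
  by (simp add: ltr_def pos_def zr_def cst_def qv_0)

lemma msat_AllR: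
  assumes "\<And>x. wff [] (F (Var x ty1))" "\<And>x. S \<subseteq> frees (F (Var x ty1))" "ok \<rho>"
    and body: "\<And>x X \<rho>'. ok \<rho>' \<Longrightarrow> fv \<rho>' (Var x ty1) = X \<Longrightarrow> real X \<Longrightarrow> \<forall>v\<in>S. \<rho>' v = \<rho> v
      \<Longrightarrow> msat \<rho>' (F (Var x ty1)) = P X"
  shows "msat \<rho> (AllR F) = (\<forall>X. real X \<longrightarrow> P X)"
proof -
  have "msat \<rho> (AllR F) = (\<forall>X. rl r1 X \<longrightarrow> isr X \<longrightarrow> P X)" unfolding AllR_def
  proof (rule msat_All1[where S = S])
    fix x X \<rho>' assume *: "ok \<rho>'" "fv \<rho>' (Var x ty1) = X" "rl r1 X" "\<forall>v\<in>S. \<rho>' v = \<rho> v"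
    show "msat \<rho>' (is_real (Var x ty1) \<^bold>\<longrightarrow> F (Var x ty1)) = (isr X \<longrightarrow> P X)"
      using body[OF *(1,2) _ *(4)] * by (auto simp: msat_is_real)
  next
    fix x show "S \<subseteq> frees (is_real (Var x ty1) \<^bold>\<longrightarrow> F (Var x ty1))" using assms(2)[of x] by auto
  qed (use assms in auto)
  then show ?thesis by blast
qed

end

lemma wff_AllR: "(\<And>x. wff [] (F (Var x ty1))) \<Longrightarrow> wff [] (AllR F)"
  unfolding AllR_def by (rule wff_binders) simp

lemma frees_AllR: "(\<And>x. S \<subseteq> frees (F (Var x ty1))) \<Longrightarrow> S \<subseteq> frees (AllR F)"
  unfolding AllR_def by (rule frees_binders) (simp add: le_supI2)

lemma wff_sets [simp]:
  "typ_of [] Y = Some ty2 \<Longrightarrow> wff [] (is_real_fun Y)"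
  "typ_of [] Y = Some ty2 \<Longrightarrow> typ_of [] x = Some ty1 \<Longrightarrow> wff [] (x \<^bold>\<in> Y)"
  "typ_of [] Y = Some ty2 \<Longrightarrow> typ_of [] x = Some ty1 \<Longrightarrow> wff [] (x \<^bold>\<notin> Y)"
  unfolding is_real_fun_def mem_R_def nmem_R_def by (auto intro!: wff_AllR)

lemma frees_mem: "frees_t x \<union> frees_t Y \<subseteq> frees (x \<^bold>\<in> Y)" "frees_t x \<union> frees_t Y \<subseteq> frees (x \<^bold>\<notin> Y)"
  unfolding mem_R_def nmem_R_def frees_props using frees_real_rels(3)[of "real_of_Q qzero" "Y \<^bold>\<cdot> x"] by auto

lemma frees_is_real_fun: "frees_t Y \<subseteq> frees (is_real_fun Y)"
proof -
  have "frees_t Y \<subseteq> frees (\<^bold>\<forall>\<^sup>Rx. is_real (Y \<^bold>\<cdot> x))"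
    by (rule frees_AllR) (use frees_real_rels(1)[of "Y \<^bold>\<cdot> _"] in auto)
  then show ?thesis unfolding is_real_fun_def by auto
qed

lemma wff_open_set [simp]: "typ_of [] Y = Some ty2 \<Longrightarrow> wff [] (open_set Y)"
  unfolding open_set_def by (auto intro!: wff_AllR wff_binders)

lemma frees_open_set: "frees_t Y \<subseteq> frees (open_set Y)"
  unfolding open_set_def using frees_is_real_fun[of Y] by auto

context nmodel
begin

lemma msat_mem:
  assumes "snd (rfun r1 r1) (mval \<rho> Y) F" "typ_of [] Y = Some ty2" "typ_of [] x = Some ty1" "ok \<rho>"
  shows "msat \<rho> (x \<^bold>\<in> Y) = pos (F (fv \<rho> x))" "msat \<rho> (x \<^bold>\<notin> Y) = (\<not> pos (F (fv \<rho> x)))"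
proof -
  show "msat \<rho> (x \<^bold>\<in> Y) = pos (F (fv \<rho> x))"
    using assms ltr_zr by (simp add: mem_R_def msat_lt_R fv_app11[OF assms(1)] fv_real_of_Q nv_pair nv_zero zr_def cst_def)
  then show "msat \<rho> (x \<^bold>\<notin> Y) = (\<not> pos (F (fv \<rho> x)))" by (simp add: nmem_R_def)
qed

lemma mval_agree: "\<forall>v\<in>S. \<rho>' v = \<rho> v \<Longrightarrow> frees_t t \<subseteq> S \<Longrightarrow> mval \<rho>' t = mval \<rho> t"
  by (rule val_agree)

lemma msat_is_real_fun:
  assumes Y: "snd (rfun r1 r1) (mval \<rho> Y) F" "typ_of [] Y = Some ty2" "ok \<rho>"
  shows "msat \<rho> (is_real_fun Y) = isrf F"
proof -
  have 1: "msat \<rho> (\<^bold>\<forall>\<^sup>Rx. is_real (Y \<^bold>\<cdot> x)) = (\<forall>X. real X \<longrightarrow> isr (F X))"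
  proof (rule msat_AllR[where S = "frees_t Y"])
    fix x show "frees_t Y \<subseteq> frees (is_real (Y \<^bold>\<cdot> Var x ty1))" using frees_real_rels(1)[of "Y \<^bold>\<cdot> _"] by auto
  next
    fix x X \<rho>' assume *: "ok \<rho>'" "fv \<rho>' (Var x ty1) = X" "real X" "\<forall>v\<in>frees_t Y. \<rho>' v = \<rho> v"
    then have "snd (rfun r1 r1) (mval \<rho>' Y) F" using Y by (simp add: mval_agree)
    then show "msat \<rho>' (is_real (Y \<^bold>\<cdot> Var x ty1)) = isr (F X)" using * Y by (simp add: msat_is_real fv_app11)
  qed (use Y in auto)
  let ?E = "\<lambda>x y. x =\<^sub>R y \<^bold>\<longrightarrow> Y \<^bold>\<cdot> x =\<^sub>R Y \<^bold>\<cdot> y"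
  have fr: "frees_t x \<union> frees_t Y \<union> frees_t y \<subseteq> frees (?E x y)" for x y
    using frees_real_rels(2)[of "Y \<^bold>\<cdot> x" "Y \<^bold>\<cdot> y"] by auto
  have 2: "msat \<rho> (\<^bold>\<forall>\<^sup>Rx. \<^bold>\<forall>\<^sup>Ry. ?E x y) =
    (\<forall>X. real X \<longrightarrow> (\<forall>Y. real Y \<longrightarrow> eqr X Y \<longrightarrow> eqr (F X) (F Y)))"
  proof (rule msat_AllR[where S = "frees_t Y"])
    fix x X \<rho>1 assume *: "ok \<rho>1" "fv \<rho>1 (Var x ty1) = X" "real X" "\<forall>v\<in>frees_t Y. \<rho>1 v = \<rho> v"
    show "msat \<rho>1 (\<^bold>\<forall>\<^sup>Ry. ?E (Var x ty1) y) = (\<forall>Y. real Y \<longrightarrow> eqr X Y \<longrightarrow> eqr (F X) (F Y))"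
    proof (rule msat_AllR[where S = "insert (x, ty1) (frees_t Y)"])
      fix y Z \<rho>2 assume **: "ok \<rho>2" "fv \<rho>2 (Var y ty1) = Z" "real Z" "\<forall>v\<in>insert (x, ty1) (frees_t Y). \<rho>2 v = \<rho>1 v"
      then have s: "snd (rfun r1 r1) (mval \<rho>2 Y) F" "fv \<rho>2 (Var x ty1) = X"
        using Y * mval_agree[of "frees_t Y" \<rho>2 \<rho> Y] by (auto simp: fv_def)
      then show "msat \<rho>2 (?E (Var x ty1) (Var y ty1)) = (eqr X Z \<longrightarrow> eqr (F X) (F Z))"
        using * ** Y by (simp add: msat_eq_R fv_app11)
    next
      fix y show "insert (x, ty1) (frees_t Y) \<subseteq> frees (?E (Var x ty1) (Var y ty1))" using fr[of "Var x ty1" "Var y ty1"] by auto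
    qed (use Y * in auto)
  next
    fix x show "frees_t Y \<subseteq> frees (\<^bold>\<forall>\<^sup>Ry. ?E (Var x ty1) y)" by (rule frees_AllR) (use fr in blast)
  qed (use Y in \<open>auto intro!: wff_AllR\<close>)
  show ?thesis unfolding is_real_fun_def isrf_def msat_props 1 2 ..
qed

lemma msat_open_set:
  assumes Y: "snd (rfun r1 r1) (mval \<rho> Y) F" "typ_of [] Y = Some ty2" "ok \<rho>"
  shows "msat \<rho> (open_set Y) = opn F"
proof -
  let ?E = "\<lambda>x r y. abs_R (x -\<^sub>R y) <\<^sub>R real_of_Q r \<^bold>\<longrightarrow> y \<^bold>\<in> Y"
  let ?H = "\<lambda>x r. qzero <\<^sub>Q r \<^bold>\<and> (\<^bold>\<forall>\<^sup>Ry. ?E x r y)"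
  have fE: "{(x, ty1), (r, Num), (y, ty1)} \<union> frees_t Y \<subseteq> frees (?E (Var x ty1) (Var r Num) (Var y ty1))" for x r y
    using frees_real_rels(3)[of "abs_R (Var x ty1 -\<^sub>R Var y ty1)" "real_of_Q (Var r Num)"] frees_mem(1)[of "Var y ty1" Y]
      frees_real_ops(1)[of "Var r Num"] frees_real_ops(2)[of "Var x ty1" "Var y ty1"]
      frees_real_ops(3)[of "Var x ty1 -\<^sub>R Var y ty1"] by simp blast
  have wE: "wff [] (?E (Var x ty1) (Var r Num) (Var y ty1))" for x r y using Y by simp
  have "msat \<rho> (\<^bold>\<forall>\<^sup>Rx. x \<^bold>\<in> Y \<^bold>\<longrightarrow> (\<^bold>\<exists>\<^sup>0r. ?H x r)) = (\<forall>X. real X \<longrightarrow> pos (F X) \<longrightarrow>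
     (\<exists>r. qv (pair 0 (pair 0 0)) < qv r \<and> (\<forall>Y. real Y \<longrightarrow> near X Y r \<longrightarrow> pos (F Y))))"
  proof (rule msat_AllR[where S = "frees_t Y"])
    fix x X \<rho>1 assume 1: "ok \<rho>1" "fv \<rho>1 (Var x ty1) = X" "real X" "\<forall>v\<in>frees_t Y. \<rho>1 v = \<rho> v"
    then have Y1: "snd (rfun r1 r1) (mval \<rho>1 Y) F" using Y by (simp add: mval_agree)
    have "msat \<rho>1 (\<^bold>\<exists>\<^sup>0r. ?H (Var x ty1) r) =
      (\<exists>r. qv (pair 0 (pair 0 0)) < qv r \<and> (\<forall>Y. real Y \<longrightarrow> near X Y r \<longrightarrow> pos (F Y)))"
    proof (rule msat_Ex0[where S = "insert (x, ty1) (frees_t Y)"])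
      fix r q \<rho>2 assume 2: "ok \<rho>2" "nv \<rho>2 (Var r Num) = q" "\<forall>v\<in>insert (x, ty1) (frees_t Y). \<rho>2 v = \<rho>1 v"
      have "msat \<rho>2 (\<^bold>\<forall>\<^sup>Ry. ?E (Var x ty1) (Var r Num) y) = (\<forall>Y. real Y \<longrightarrow> near X Y q \<longrightarrow> pos (F Y))"
      proof (rule msat_AllR[where S = "insert (r, Num) (insert (x, ty1) (frees_t Y))"])
        fix y Z \<rho>3 assume 3: "ok \<rho>3" "fv \<rho>3 (Var y ty1) = Z" "real Z"
          "\<forall>v\<in>insert (r, Num) (insert (x, ty1) (frees_t Y)). \<rho>3 v = \<rho>2 v"
        then have s: "snd (rfun r1 r1) (mval \<rho>3 Y) F" "fv \<rho>3 (Var x ty1) = X" "nv \<rho>3 (Var r Num) = q"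
          using Y1 1 2 mval_agree[of "frees_t Y" \<rho>3 \<rho>1 Y] by (auto simp: fv_def nv_Var)
        then show "msat \<rho>3 (?E (Var x ty1) (Var r Num) (Var y ty1)) = (near X Z q \<longrightarrow> pos (F Z))"
          using 3 Y by (simp add: msat_lt_R fv_abs_R fv_minus_R fv_real_of_Q msat_mem near_def cst_def)
      next
        fix y show "insert (r, Num) (insert (x, ty1) (frees_t Y)) \<subseteq> frees (?E (Var x ty1) (Var r Num) (Var y ty1))"
          using fE[of x r y] by blast
      qed (use wE 2 in auto)
      then show "msat \<rho>2 (?H (Var x ty1) (Var r Num)) =
          (qv (pair 0 (pair 0 0)) < qv q \<and> (\<forall>Y. real Y \<longrightarrow> near X Y q \<longrightarrow> pos (F Y)))"
        using 2 by (simp add: msat_lt_Q nv_pair nv_zero)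
    next
      fix r show "insert (x, ty1) (frees_t Y) \<subseteq> frees (?H (Var x ty1) (Var r Num))"
        unfolding frees_props by (rule le_supI2, rule frees_AllR) (use fE in blast)
    qed (use wE 1 in \<open>auto intro!: wff_AllR\<close>)
    then show "msat \<rho>1 (Var x ty1 \<^bold>\<in> Y \<^bold>\<longrightarrow> (\<^bold>\<exists>\<^sup>0r. ?H (Var x ty1) r)) = (pos (F X) \<longrightarrow>
      (\<exists>r. qv (pair 0 (pair 0 0)) < qv r \<and> (\<forall>Y. real Y \<longrightarrow> near X Y r \<longrightarrow> pos (F Y))))"
      using 1 Y by (simp add: msat_mem[OF Y1])
  next
    fix x show "frees_t Y \<subseteq> frees (Var x ty1 \<^bold>\<in> Y \<^bold>\<longrightarrow> (\<^bold>\<exists>\<^sup>0r. ?H (Var x ty1) r))"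
      using frees_mem(1)[of "Var x ty1" Y] by auto
  qed (use Y wE in \<open>auto intro!: wff_AllR wff_binders\<close>)
  then show ?thesis unfolding open_set_def opn_def msat_props msat_is_real_fun[OF Y] by simp
qed

text \<open>At higher types an element may represent several HOL functions; by \<open>body\<close>
  the truth value is the same for each of them.\<close>

lemma msat_Forall_sort:
  assumes A: "good A" "fst A = \<tau>" and "\<And>x. wff [] (F (Var x \<tau>))" "\<And>x. S \<subseteq> frees (F (Var x \<tau>))" "ok \<rho>"
    and body: "\<And>x X \<rho>'. ok \<rho>' \<Longrightarrow> snd A (\<rho>' (x, \<tau>)) X \<Longrightarrow> rl A X \<Longrightarrow> \<forall>v\<in>S. \<rho>' v = \<rho> v
      \<Longrightarrow> msat \<rho>' (F (Var x \<tau>)) = P X"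
  shows "msat \<rho> (Forall \<tau> F) = (\<forall>X. rl A X \<longrightarrow> P X)"
proof -
  have "msat \<rho> (Forall \<tau> F) = (\<forall>a\<in>D \<tau>. \<forall>X. snd A a X \<longrightarrow> P X)"
  proof (rule sat_Forall[where S = S])
    fix x a \<rho>' assume *: "a \<in> D \<tau>" "ok \<rho>'" "\<rho>' (x, \<tau>) = a" "\<forall>v\<in>S. \<rho>' v = \<rho> v"
    have "msat \<rho>' (F (Var x \<tau>)) = P X" if "snd A a X" for X by (rule body) (use * that in \<open>auto simp: rl_def\<close>)
    then show "msat \<rho>' (F (Var x \<tau>)) = (\<forall>X. snd A a X \<longrightarrow> P X)" using good_total[of A a] A * by auto
  qed (rule assms)+
  also have "\<dots> = (\<forall>X. rl A X \<longrightarrow> P X)" using good_dom[OF A(1)] A(2) unfolding rl_def by blast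
  finally show ?thesis .
qed

definition HBCh :: bool where
  "HBCh \<longleftrightarrow> (\<forall>Dc. rl (rfun r1 r1) Dc \<longrightarrow> (\<forall>U. rl (rfun r0 (rfun r1 r1)) U \<longrightarrow>
     opn Dc \<and> (\<forall>X. real X \<longrightarrow> \<not> pos (Dc X) \<longrightarrow> \<not> ltr X zr \<and> \<not> ltr on X) \<and> (\<forall>n. opn (U n)) \<and>
     (\<forall>X. real X \<longrightarrow> \<not> pos (Dc X) \<longrightarrow> (\<exists>n. pos (U n X))) \<longrightarrow>
     (\<exists>n0. \<forall>X. real X \<longrightarrow> \<not> pos (Dc X) \<longrightarrow> (\<exists>n. (n < n0 \<or> n = n0) \<and> pos (U n X)))))"

lemma msat_HBC_parts:
  assumes d: "snd (rfun r1 r1) (mval \<rho> d) Dc" "typ_of [] d = Some ty2"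
    and u: "snd (rfun r0 (rfun r1 r1)) (mval \<rho> u) U" "typ_of [] u = Some (Num \<^bold>\<rightarrow> ty2)" and ok: "ok \<rho>"
  shows "msat \<rho> (\<^bold>\<forall>\<^sup>Rx. x \<^bold>\<notin> d \<^bold>\<longrightarrow> real_of_Q qzero \<le>\<^sub>R x \<^bold>\<and> x \<le>\<^sub>R real_of_Q qone) =
      (\<forall>X. real X \<longrightarrow> \<not> pos (Dc X) \<longrightarrow> \<not> ltr X zr \<and> \<not> ltr on X)" (is ?A)
    and "msat \<rho> (\<^bold>\<forall>\<^sup>0n. open_set (u \<^bold>\<cdot> n)) = (\<forall>n. opn (U n))" (is ?B)
    and "msat \<rho> (\<^bold>\<forall>\<^sup>Rx. x \<^bold>\<notin> d \<^bold>\<longrightarrow> (\<^bold>\<exists>\<^sup>0n. x \<^bold>\<in> u \<^bold>\<cdot> n)) = (\<forall>X. real X \<longrightarrow> \<not> pos (Dc X) \<longrightarrow> (\<exists>n. pos (U n X)))" (is ?C)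
    and "msat \<rho> (\<^bold>\<exists>\<^sup>0n0. \<^bold>\<forall>\<^sup>Rx. x \<^bold>\<notin> d \<^bold>\<longrightarrow> (\<^bold>\<exists>\<^sup>0n. (n \<^bold>< n0 \<^bold>\<or> n \<^bold>= n0) \<^bold>\<and> x \<^bold>\<in> u \<^bold>\<cdot> n)) =
      (\<exists>n0. \<forall>X. real X \<longrightarrow> \<not> pos (Dc X) \<longrightarrow> (\<exists>n. (n < n0 \<or> n = n0) \<and> pos (U n X)))" (is ?E)
proof -
  let ?S = "frees_t d \<union> frees_t u"
  have ag: "snd (rfun r1 r1) (mval \<rho>' d) Dc" "snd (rfun r0 (rfun r1 r1)) (mval \<rho>' u) U" if "\<forall>v\<in>?S. \<rho>' v = \<rho> v" for \<rho>'
    using d u mval_agree[OF that, of d] mval_agree[OF that, of u] by auto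
  have un: "snd (rfun r1 r1) (mval \<rho>' (u \<^bold>\<cdot> t)) (U (nv \<rho>' t))"
    if "\<forall>v\<in>?S. \<rho>' v = \<rho> v" "typ_of [] t = Some Num" "ok \<rho>'" for \<rho>' t
    using appD[OF ag(2)[OF that(1)] r0_nv[OF that(2,3)]] by simp
  have fm: "frees_t d \<subseteq> frees (x \<^bold>\<notin> d)" "frees_t x \<subseteq> frees (x \<^bold>\<notin> d)" for x using frees_mem(2)[of x d] by auto
  have fu: "frees_t x \<union> frees_t u \<union> frees_t n \<subseteq> frees (x \<^bold>\<in> u \<^bold>\<cdot> n)" for x n using frees_mem(1)[of x "u \<^bold>\<cdot> n"] by auto
  show ?A
  proof (rule msat_AllR[where S = "frees_t d"])
    fix x X \<rho>' assume *: "ok \<rho>'" "fv \<rho>' (Var x ty1) = X" "real X" "\<forall>v\<in>frees_t d. \<rho>' v = \<rho> v"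
    then have "snd (rfun r1 r1) (mval \<rho>' d) Dc" using d by (simp add: mval_agree)
    then show "msat \<rho>' (Var x ty1 \<^bold>\<notin> d \<^bold>\<longrightarrow> real_of_Q qzero \<le>\<^sub>R Var x ty1 \<^bold>\<and> Var x ty1 \<le>\<^sub>R real_of_Q qone) =
       (\<not> pos (Dc X) \<longrightarrow> \<not> ltr X zr \<and> \<not> ltr on X)"
      using * d by (simp add: msat_mem msat_le_R fv_real_of_Q nv_pair nv_zero nv_suc zr_def on_def cst_def)
  next
    fix x show "frees_t d \<subseteq> frees (Var x ty1 \<^bold>\<notin> d \<^bold>\<longrightarrow> real_of_Q qzero \<le>\<^sub>R Var x ty1 \<^bold>\<and> Var x ty1 \<le>\<^sub>R real_of_Q qone)"
      using fm(1)[of "Var x ty1"] by auto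
  qed (use d ok in auto)
  show ?B
  proof (rule msat_All0[where S = "frees_t u"])
    fix x n \<rho>' assume *: "ok \<rho>'" "nv \<rho>' (Var x Num) = n" "\<forall>v\<in>frees_t u. \<rho>' v = \<rho> v"
    then have "snd (rfun r0 (rfun r1 r1)) (mval \<rho>' u) U" using u by (simp add: mval_agree)
    then have "snd (rfun r1 r1) (mval \<rho>' (u \<^bold>\<cdot> Var x Num)) (U n)" using appD r0_nv[of "Var x Num" \<rho>'] * by fastforce
    then show "msat \<rho>' (open_set (u \<^bold>\<cdot> Var x Num)) = opn (U n)" using msat_open_set[of \<rho>' "u \<^bold>\<cdot> Var x Num"] * u by simp
  next
    fix x show "frees_t u \<subseteq> frees (open_set (u \<^bold>\<cdot> Var x Num))" using frees_open_set[of "u \<^bold>\<cdot> Var x Num"] by auto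
  qed (use u ok in auto)
  show ?C
  proof (rule msat_AllR[where S = ?S])
    fix x X \<rho>1 assume 1: "ok \<rho>1" "fv \<rho>1 (Var x ty1) = X" "real X" "\<forall>v\<in>?S. \<rho>1 v = \<rho> v"
    have "msat \<rho>1 (\<^bold>\<exists>\<^sup>0n. Var x ty1 \<^bold>\<in> u \<^bold>\<cdot> n) = (\<exists>n. pos (U n X))"
    proof (rule msat_Ex0[where S = "insert (x, ty1) ?S - frees_t d \<union> insert (x, ty1) (frees_t u)"])
      fix y n \<rho>2 assume 2: "ok \<rho>2" "nv \<rho>2 (Var y Num) = n"
        "\<forall>v\<in>insert (x, ty1) ?S - frees_t d \<union> insert (x, ty1) (frees_t u). \<rho>2 v = \<rho>1 v"
      then have "mval \<rho>2 u = mval \<rho>1 u" "fv \<rho>2 (Var x ty1) = X" using 1 by (auto intro: val_cong simp: fv_def)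
      then have "snd (rfun r1 r1) (mval \<rho>2 (u \<^bold>\<cdot> Var y Num)) (U n)"
        using appD[OF ag(2)[OF 1(4)] r0_nv[of "Var y Num" \<rho>2]] 2 by simp
      then show "msat \<rho>2 (Var x ty1 \<^bold>\<in> u \<^bold>\<cdot> Var y Num) = pos (U n X)"
        using msat_mem(1)[of \<rho>2 "u \<^bold>\<cdot> Var y Num"] u 2 \<open>fv \<rho>2 (Var x ty1) = X\<close> by simp
    next
      fix y show "insert (x, ty1) ?S - frees_t d \<union> insert (x, ty1) (frees_t u) \<subseteq> frees (Var x ty1 \<^bold>\<in> u \<^bold>\<cdot> Var y Num)"
        using fu[of "Var x ty1" "Var y Num"] by auto
    qed (use u 1 in auto)
    then show "msat \<rho>1 (Var x ty1 \<^bold>\<notin> d \<^bold>\<longrightarrow> (\<^bold>\<exists>\<^sup>0n. Var x ty1 \<^bold>\<in> u \<^bold>\<cdot> n)) = (\<not> pos (Dc X) \<longrightarrow> (\<exists>n. pos (U n X)))"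
      using msat_mem(2)[OF ag(1)[OF 1(4)] d(2), of "Var x ty1"] 1 by simp
  next
    fix x
    have "frees_t u \<subseteq> frees (\<^bold>\<exists>\<^sup>0n. Var x ty1 \<^bold>\<in> u \<^bold>\<cdot> n)" by (rule frees_binders) (use fu in blast)
    then show "?S \<subseteq> frees (Var x ty1 \<^bold>\<notin> d \<^bold>\<longrightarrow> (\<^bold>\<exists>\<^sup>0n. Var x ty1 \<^bold>\<in> u \<^bold>\<cdot> n))" using fm(1)[of "Var x ty1"] by auto
  qed (use d u ok in \<open>auto intro!: wff_binders\<close>)
  let ?G = "\<lambda>x n0 n. (n \<^bold>< n0 \<^bold>\<or> n \<^bold>= n0) \<^bold>\<and> x \<^bold>\<in> u \<^bold>\<cdot> n"
  let ?H = "\<lambda>n0 x. x \<^bold>\<notin> d \<^bold>\<longrightarrow> (\<^bold>\<exists>\<^sup>0n. ?G x n0 n)"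
  have wG: "wff [] (?G (Var x ty1) (Var m Num) (Var n Num))" for x m n using u by simp
  have fG: "{(x, ty1), (m, Num)} \<union> frees_t u \<subseteq> frees (?G (Var x ty1) (Var m Num) (Var n Num))" for x m n
    using fu[of "Var x ty1" "Var n Num"] by auto
  have fX: "{(x, ty1), (m, Num)} \<union> frees_t u \<subseteq> frees (\<^bold>\<exists>\<^sup>0n. ?G (Var x ty1) (Var m Num) n)" for x m
    by (rule frees_binders) (use fG in blast)
  have fH: "insert (m, Num) ?S \<subseteq> frees (?H (Var m Num) (Var x ty1))" for m x
    using fX[of x m] fm(1)[of "Var x ty1"] by auto
  show ?E
  proof (rule msat_Ex0[where S = ?S])
    fix m n0 \<rho>1 assume 1: "ok \<rho>1" "nv \<rho>1 (Var m Num) = n0" "\<forall>v\<in>?S. \<rho>1 v = \<rho> v"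
    show "msat \<rho>1 (\<^bold>\<forall>\<^sup>Rx. ?H (Var m Num) x) = (\<forall>X. real X \<longrightarrow> \<not> pos (Dc X) \<longrightarrow> (\<exists>n. (n < n0 \<or> n = n0) \<and> pos (U n X)))"
    proof (rule msat_AllR[where S = "insert (m, Num) ?S"])
      fix x X \<rho>2 assume 2: "ok \<rho>2" "fv \<rho>2 (Var x ty1) = X" "real X" "\<forall>v\<in>insert (m, Num) ?S. \<rho>2 v = \<rho>1 v"
      then have a2: "\<forall>v\<in>?S. \<rho>2 v = \<rho> v" using 1 by auto
      have "msat \<rho>2 (\<^bold>\<exists>\<^sup>0n. ?G (Var x ty1) (Var m Num) n) = (\<exists>n. (n < n0 \<or> n = n0) \<and> pos (U n X))"
      proof (rule msat_Ex0[where S = "{(x, ty1), (m, Num)} \<union> frees_t u"])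
        fix y n \<rho>3 assume 3: "ok \<rho>3" "nv \<rho>3 (Var y Num) = n" "\<forall>v\<in>{(x, ty1), (m, Num)} \<union> frees_t u. \<rho>3 v = \<rho>2 v"
        then have e: "mval \<rho>3 u = mval \<rho>2 u" "fv \<rho>3 (Var x ty1) = X" "nv \<rho>3 (Var m Num) = n0"
          using 1 2 by (auto intro: val_cong simp: fv_def nv_Var)
        then have "snd (rfun r1 r1) (mval \<rho>3 (u \<^bold>\<cdot> Var y Num)) (U n)"
          using appD[OF ag(2)[OF a2] r0_nv[of "Var y Num" \<rho>3]] 3 by simp
        then show "msat \<rho>3 (?G (Var x ty1) (Var m Num) (Var y Num)) = ((n < n0 \<or> n = n0) \<and> pos (U n X))"
          using msat_mem(1)[of \<rho>3 "u \<^bold>\<cdot> Var y Num"] u 3 e by (simp add: msat_Less msat_Eq)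
      qed (use wG fG 2 in auto)
      then show "msat \<rho>2 (?H (Var m Num) (Var x ty1)) = (\<not> pos (Dc X) \<longrightarrow> (\<exists>n. (n < n0 \<or> n = n0) \<and> pos (U n X)))"
        using msat_mem(2)[OF ag(1)[OF a2] d(2), of "Var x ty1"] 2 by simp
    qed (use wG fH d 1 in \<open>auto intro!: wff_binders\<close>)
  next
    fix m show "?S \<subseteq> frees (\<^bold>\<forall>\<^sup>Rx. ?H (Var m Num) x)" by (rule frees_AllR) (use fH in blast)
  qed (use wG d ok in \<open>auto intro!: wff_binders wff_AllR\<close>)
qed

end

lemma wff_HBC: "wff [] HBC_s"
  unfolding HBC_s_def by (auto intro!: wff_Forall wff_binders wff_AllR)

context nmodel
begin

lemma msat_HBC: "ok \<rho> \<Longrightarrow> msat \<rho> HBC_s = HBCh"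
proof -
  let ?F = "\<lambda>d u. open_set d
       \<^bold>\<and> (\<^bold>\<forall>\<^sup>Rx. x \<^bold>\<notin> d \<^bold>\<longrightarrow> real_of_Q qzero \<le>\<^sub>R x \<^bold>\<and> x \<le>\<^sub>R real_of_Q qone)
       \<^bold>\<and> (\<^bold>\<forall>\<^sup>0n. open_set (u \<^bold>\<cdot> n))
       \<^bold>\<and> (\<^bold>\<forall>\<^sup>Rx. x \<^bold>\<notin> d \<^bold>\<longrightarrow> (\<^bold>\<exists>\<^sup>0n. x \<^bold>\<in> u \<^bold>\<cdot> n))
       \<^bold>\<longrightarrow> (\<^bold>\<exists>\<^sup>0n0. \<^bold>\<forall>\<^sup>Rx. x \<^bold>\<notin> d \<^bold>\<longrightarrow> (\<^bold>\<exists>\<^sup>0n. (n \<^bold>< n0 \<^bold>\<or> n \<^bold>= n0) \<^bold>\<and> x \<^bold>\<in> u \<^bold>\<cdot> n))"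
  have w: "wff [] (?F (Var x ty2) (Var y (Num \<^bold>\<rightarrow> ty2)))" for x y
    by (auto intro!: wff_binders wff_AllR)
  have f: "{(x, ty2)} \<subseteq> frees (?F (Var x ty2) y)" for x y using frees_open_set[of "Var x ty2"] by auto
  assume "ok \<rho>"
  show ?thesis unfolding HBC_s_def HBCh_def
  proof (rule msat_Forall_sort[where A = "rfun r1 r1" and S = "{}"])
    fix x Dc \<rho>1 assume 1: "ok \<rho>1" "snd (rfun r1 r1) (\<rho>1 (x, ty2)) Dc"
    show "msat \<rho>1 (Forall (Num \<^bold>\<rightarrow> ty2) (\<lambda>u. ?F (Var x ty2) u)) =
      (\<forall>U. rl (rfun r0 (rfun r1 r1)) U \<longrightarrow>
     opn Dc \<and> (\<forall>X. real X \<longrightarrow> \<not> pos (Dc X) \<longrightarrow> \<not> ltr X zr \<and> \<not> ltr on X) \<and> (\<forall>n. opn (U n)) \<and>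
     (\<forall>X. real X \<longrightarrow> \<not> pos (Dc X) \<longrightarrow> (\<exists>n. pos (U n X))) \<longrightarrow>
     (\<exists>n0. \<forall>X. real X \<longrightarrow> \<not> pos (Dc X) \<longrightarrow> (\<exists>n. (n < n0 \<or> n = n0) \<and> pos (U n X))))"
    proof (rule msat_Forall_sort[where A = "rfun r0 (rfun r1 r1)" and S = "{(x, ty2)}"])
      fix y U \<rho>2 assume 2: "ok \<rho>2" "snd (rfun r0 (rfun r1 r1)) (\<rho>2 (y, Num \<^bold>\<rightarrow> ty2)) U" "\<forall>v\<in>{(x, ty2)}. \<rho>2 v = \<rho>1 v"
      have d: "snd (rfun r1 r1) (mval \<rho>2 (Var x ty2)) Dc" and u: "snd (rfun r0 (rfun r1 r1)) (mval \<rho>2 (Var y (Num \<^bold>\<rightarrow> ty2))) U"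
        using 1 2 by simp_all
      note parts = msat_HBC_parts[OF d _ u _ 2(1)]
      show "msat \<rho>2 (?F (Var x ty2) (Var y (Num \<^bold>\<rightarrow> ty2))) = (opn Dc \<and> (\<forall>X. real X \<longrightarrow> \<not> pos (Dc X) \<longrightarrow> \<not> ltr X zr \<and> \<not> ltr on X) \<and> (\<forall>n. opn (U n)) \<and>
     (\<forall>X. real X \<longrightarrow> \<not> pos (Dc X) \<longrightarrow> (\<exists>n. pos (U n X))) \<longrightarrow>
     (\<exists>n0. \<forall>X. real X \<longrightarrow> \<not> pos (Dc X) \<longrightarrow> (\<exists>n. (n < n0 \<or> n = n0) \<and> pos (U n X))))"
        using parts msat_open_set[OF d _ 2(1)] by simp
    qed (use w f 1 in auto)
  qed (use w \<open>ok \<rho>\<close> in \<open>auto intro!: wff_Forall\<close>)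
qed

subsection \<open>Trees\<close>

definition bin :: "('n \<Rightarrow> 'n) \<Rightarrow> bool" where "bin f \<longleftrightarrow> (\<forall>n. f n = 0 \<or> f n = 1)"
definition tree :: "('n \<Rightarrow> 'n) \<Rightarrow> bool" where
  "tree T \<longleftrightarrow> bin T \<and> (\<forall>s t. (\<exists>k. s = cut k t) \<and> T t = 1 \<longrightarrow> T s = 1)"
definition infin :: "('n \<Rightarrow> 'n) \<Rightarrow> bool" where "infin T \<longleftrightarrow> (\<forall>n. \<exists>s. len s = n \<and> T s = 1)"
definition path :: "('n \<Rightarrow> 'n) \<Rightarrow> ('n \<Rightarrow> 'n) \<Rightarrow> bool" where
  "path a T \<longleftrightarrow> bin a \<and> (\<forall>n. T (pc a n) = 1)"
definition WKLh :: bool where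
  "WKLh \<longleftrightarrow> (\<forall>T. rl r1 T \<longrightarrow> tree T \<and> infin T \<longrightarrow> (\<exists>a. rl r1 a \<and> path a T))"

end

lemma wff_trees [simp]:
  "typ_of [] a = Some ty1 \<Longrightarrow> wff [] (binary a)"
  "typ_of [] s = Some Num \<Longrightarrow> typ_of [] t = Some Num \<Longrightarrow> wff [] (s \<^bold>\<sqsubseteq> t)"
  "typ_of [] T = Some ty1 \<Longrightarrow> wff [] (is_tree T)"
  "typ_of [] T = Some ty1 \<Longrightarrow> wff [] (is_infinite T)"
  "typ_of [] T = Some ty1 \<Longrightarrow> typ_of [] a = Some ty1 \<Longrightarrow> wff [] (is_path a T)"
  unfolding binary_def initial_segment_def is_tree_def is_infinite_def is_path_def
  by (auto intro!: wff_binders)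

context nmodel
begin

lemma msat_binary:
  assumes "typ_of [] a = Some ty1" "ok \<rho>" shows "msat \<rho> (binary a) = bin (fv \<rho> a)"
  unfolding binary_def bin_def
proof (rule msat_All0[where S = "frees_t a"])
  fix x n \<rho>' assume *: "ok \<rho>'" "nv \<rho>' (Var x Num) = n" "\<forall>v\<in>frees_t a. \<rho>' v = \<rho> v"
  then have "fv \<rho>' a = fv \<rho> a" by (auto intro: fv_agree[of "frees_t a"])
  then show "msat \<rho>' (a \<^bold>\<cdot> Var x Num \<^bold>= \<^bold>0 \<^bold>\<or> a \<^bold>\<cdot> Var x Num \<^bold>= \<^bold>1) = (fv \<rho> a n = 0 \<or> fv \<rho> a n = 1)"
    using * assms by (simp add: msat_Eq nv_app[of a] nv_zero nv_suc)
qed (use assms in auto)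

lemma msat_initial_segment:
  assumes "typ_of [] s = Some Num" "typ_of [] t = Some Num" "ok \<rho>"
  shows "msat \<rho> (s \<^bold>\<sqsubseteq> t) = (\<exists>k. nv \<rho> s = cut k (nv \<rho> t))"
  unfolding initial_segment_def
proof (rule msat_Ex0[where S = "frees_t s \<union> frees_t t"])
  fix x n \<rho>' assume *: "ok \<rho>'" "nv \<rho>' (Var x Num) = n" "\<forall>v\<in>frees_t s \<union> frees_t t. \<rho>' v = \<rho> v"
  then have "nv \<rho>' s = nv \<rho> s" "nv \<rho>' t = nv \<rho> t" by (auto intro: nv_agree[of "frees_t s \<union> frees_t t"])
  then show "msat \<rho>' (s \<^bold>= cut_trm \<^bold>\<cdot> Var x Num \<^bold>\<cdot> t) = (nv \<rho> s = cut n (nv \<rho> t))"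
    using * assms by (simp add: msat_Eq nv_cut)
qed (use assms in auto)

lemma msat_is_tree:
  assumes "typ_of [] T = Some ty1" "ok \<rho>" shows "msat \<rho> (is_tree T) = tree (fv \<rho> T)"
proof -
  let ?F = "\<lambda>s t. s \<^bold>\<sqsubseteq> t \<^bold>\<and> T \<^bold>\<cdot> t \<^bold>= \<^bold>1 \<^bold>\<longrightarrow> T \<^bold>\<cdot> s \<^bold>= \<^bold>1"
  have "msat \<rho> (\<^bold>\<forall>\<^sup>0s. \<^bold>\<forall>\<^sup>0t. ?F s t) = (\<forall>s t. (\<exists>k. s = cut k t) \<and> fv \<rho> T t = 1 \<longrightarrow> fv \<rho> T s = 1)"
  proof (rule msat_All0[where S = "frees_t T"])
    fix x s \<rho>1 assume 1: "ok \<rho>1" "nv \<rho>1 (Var x Num) = s" "\<forall>v\<in>frees_t T. \<rho>1 v = \<rho> v"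
    show "msat \<rho>1 (\<^bold>\<forall>\<^sup>0t. ?F (Var x Num) t) = (\<forall>t. (\<exists>k. s = cut k t) \<and> fv \<rho> T t = 1 \<longrightarrow> fv \<rho> T s = 1)"
    proof (rule msat_All0[where S = "insert (x, Num) (frees_t T)"])
      fix y t \<rho>2 assume 2: "ok \<rho>2" "nv \<rho>2 (Var y Num) = t" "\<forall>v\<in>insert (x, Num) (frees_t T). \<rho>2 v = \<rho>1 v"
      then have "fv \<rho>2 T = fv \<rho> T" "nv \<rho>2 (Var x Num) = s" using 1 by (auto intro: fv_agree[of "frees_t T"] simp: nv_Var)
      then show "msat \<rho>2 (?F (Var x Num) (Var y Num)) = ((\<exists>k. s = cut k t) \<and> fv \<rho> T t = 1 \<longrightarrow> fv \<rho> T s = 1)"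
        using 1 2 assms by (simp add: msat_Eq msat_initial_segment nv_app[of T] nv_zero nv_suc)
    qed (use assms 1 in auto)
  qed (use assms in \<open>auto intro!: wff_binders frees_binders\<close>)
  then show ?thesis unfolding is_tree_def tree_def msat_props msat_binary[OF assms] by simp
qed

lemma msat_is_infinite:
  assumes "typ_of [] T = Some ty1" "ok \<rho>" shows "msat \<rho> (is_infinite T) = infin (fv \<rho> T)"
  unfolding is_infinite_def infin_def
proof (rule msat_All0[where S = "frees_t T"])
  fix x n \<rho>1 assume 1: "ok \<rho>1" "nv \<rho>1 (Var x Num) = n" "\<forall>v\<in>frees_t T. \<rho>1 v = \<rho> v"
  show "msat \<rho>1 (\<^bold>\<exists>\<^sup>0s. length_trm \<^bold>\<cdot> s \<^bold>= Var x Num \<^bold>\<and> T \<^bold>\<cdot> s \<^bold>= \<^bold>1) = (\<exists>s. len s = n \<and> fv \<rho> T s = 1)"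
  proof (rule msat_Ex0[where S = "insert (x, Num) (frees_t T)"])
    fix y t \<rho>2 assume 2: "ok \<rho>2" "nv \<rho>2 (Var y Num) = t" "\<forall>v\<in>insert (x, Num) (frees_t T). \<rho>2 v = \<rho>1 v"
    then have "fv \<rho>2 T = fv \<rho> T" "nv \<rho>2 (Var x Num) = n" using 1 by (auto intro: fv_agree[of "frees_t T"] simp: nv_Var)
    then show "msat \<rho>2 (length_trm \<^bold>\<cdot> Var y Num \<^bold>= Var x Num \<^bold>\<and> T \<^bold>\<cdot> Var y Num \<^bold>= \<^bold>1) = (len t = n \<and> fv \<rho> T t = 1)"
      using 1 2 assms by (simp add: msat_Eq nv_app[of T] nv_zero nv_suc nv_length)
  qed (use assms 1 in auto)
qed (use assms in \<open>auto intro!: wff_binders frees_binders\<close>)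

lemma msat_is_path:
  assumes "typ_of [] T = Some ty1" "typ_of [] a = Some ty1" "ok \<rho>"
  shows "msat \<rho> (is_path a T) = path (fv \<rho> a) (fv \<rho> T)"
proof -
  have "msat \<rho> (\<^bold>\<forall>\<^sup>0n. T \<^bold>\<cdot> prefix_code a n \<^bold>= \<^bold>1) = (\<forall>n. fv \<rho> T (pc (fv \<rho> a) n) = 1)"
  proof (rule msat_All0[where S = "frees_t T \<union> frees_t a"])
    fix x n \<rho>' assume *: "ok \<rho>'" "nv \<rho>' (Var x Num) = n" "\<forall>v\<in>frees_t T \<union> frees_t a. \<rho>' v = \<rho> v"
    then have "fv \<rho>' T = fv \<rho> T" "fv \<rho>' a = fv \<rho> a" by (auto intro: fv_agree[of "frees_t T \<union> frees_t a"])
    then show "msat \<rho>' (T \<^bold>\<cdot> prefix_code a (Var x Num) \<^bold>= \<^bold>1) = (fv \<rho> T (pc (fv \<rho> a) n) = 1)"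
      using * assms by (simp add: msat_Eq nv_app[of T] nv_prefix_code nv_zero nv_suc)
  next
    fix x show "frees_t T \<union> frees_t a \<subseteq> frees (T \<^bold>\<cdot> prefix_code a (Var x Num) \<^bold>= \<^bold>1)"
      using frees_prefix_code[OF assms(2), of "Var x Num"] by auto
  qed (use assms in auto)
  then show ?thesis unfolding is_path_def path_def msat_props msat_binary[OF assms(2,3)] by simp
qed

end

lemma wff_WKL: "wff [] WKL"
  unfolding WKL_def by (auto intro!: wff_binders)

context nmodel
begin

lemma msat_WKL:
  assumes "ok \<rho>" shows "msat \<rho> WKL = WKLh"
  unfolding WKL_def WKLh_def
proof (rule msat_All1[where S = "{}"])
  fix x T \<rho>1 assume 1: "ok \<rho>1" "fv \<rho>1 (Var x ty1) = T"
  have "msat \<rho>1 (\<^bold>\<exists>\<^sup>1a. is_path a (Var x ty1)) = (\<exists>a. rl r1 a \<and> path a T)"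
  proof (rule msat_Ex1[where S = "{(x, ty1)}"])
    fix y a \<rho>2 assume 2: "ok \<rho>2" "fv \<rho>2 (Var y ty1) = a" "\<forall>v\<in>{(x, ty1)}. \<rho>2 v = \<rho>1 v"
    then have "fv \<rho>2 (Var x ty1) = T" using 1 by (auto simp: fv_def)
    then show "msat \<rho>2 (is_path (Var y ty1) (Var x ty1)) = path a T" using 2 by (simp add: msat_is_path)
  next
    fix y
    have "{(x, ty1)} \<subseteq> frees (\<^bold>\<forall>\<^sup>0n. Var x ty1 \<^bold>\<cdot> prefix_code (Var y ty1) n \<^bold>= \<^bold>1)" by (rule frees_binders) auto
    then show "{(x, ty1)} \<subseteq> frees (is_path (Var y ty1) (Var x ty1))" by (auto simp: is_path_def)
  qed (use 1 in auto)
  then show "msat \<rho>1 (is_tree (Var x ty1) \<^bold>\<and> is_infinite (Var x ty1) \<^bold>\<longrightarrow> (\<^bold>\<exists>\<^sup>1a. is_path a (Var x ty1))) =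
      (tree T \<and> infin T \<longrightarrow> (\<exists>a. rl r1 a \<and> path a T))"
    using 1 by (simp add: msat_is_tree msat_is_infinite)
qed (use assms in \<open>auto intro!: wff_binders\<close>)

section \<open>Real numbers in a model\<close>

lemma pd_qless: "dfn G r0 p \<Longrightarrow> dfn G r0 q \<Longrightarrow> pd G (\<lambda>c. qv (p c) < qv (q c))"
  unfolding qv_less[symmetric] by (rule pd_less dfn_terms dfn_ops | assumption)+

lemma pd_qle: "dfn G r0 p \<Longrightarrow> dfn G r0 q \<Longrightarrow> pd G (\<lambda>c. qv (p c) \<le> qv (q c))"
  unfolding not_less[symmetric] by (rule pd_not pd_qless)+

lemmas pd_q = pd_qless pd_qle
lemmas dfn_all = pd_q dfn_terms dfn_qdiff dfn_base dfn_good

lemma p2_add: "p2 (m + n) = p2 m * p2 n"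
  by (rule num_induct[where n = n], (rule dfn_all)+) (simp_all add: p2_Suc add.assoc[symmetric] distrib_left)

lemma p2_gt: "n < p2 n"
proof (rule num_induct[where n = n], (rule dfn_all)+)
  fix n assume "n < p2 n"
  moreover have "1 \<le> p2 n" by (simp add: mnat_ge_1)
  ultimately show "n + 1 < p2 (n + 1)" unfolding p2_Suc by (rule add_less_le_mono)
qed simp

definition ip :: "'n \<Rightarrow> 'n mint fract" where "ip n = 1 / P2 n"

lemma ip_pos [simp]: "0 < ip n" and ip_0 [simp]: "ip 0 = 1" and ip_Suc: "ip (n + 1) = ip n / 2"
  and ip_add: "ip (m + n) = ip m * ip n"
  by (simp_all add: ip_def P2_Suc) (simp add: P2_def p2_add)

lemma ip_le_1: "ip n \<le> 1"
proof -
  have "fr 1 \<le> fr (p2 n)" using p2_pos[of n] unfolding fr_simps(5) mnat_ge_1 .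
  then show ?thesis by (simp add: ip_def P2_def divide_le_eq)
qed

lemma ip_mono: "m \<le> n \<Longrightarrow> ip n \<le> ip m"
  using ip_add[of m "n - m"] ip_le_1[of "n - m"] ip_pos[of m] by (simp add: mult_left_le)

lemma ip_small: "0 < x \<Longrightarrow> \<exists>n. ip n < x"
proof -
  assume x: "0 < x"
  obtain n where "1 / x < fr n" using fr_archimedean by blast
  also have "\<dots> < P2 n" using p2_gt[of n] by (simp add: P2_def)
  finally show ?thesis using x by (intro exI[of _ n]) (simp add: ip_def field_simps)
qed

lemma isr_ip: "isr X \<longleftrightarrow> (\<forall>n i. \<bar>qv (X n) - qv (X (n + i))\<bar> < ip n)"
  and eqr_ip: "eqr X Y \<longleftrightarrow> (\<forall>n. \<bar>qv (X n) - qv (Y n)\<bar> \<le> 2 * ip n)"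
  and ltr_ip: "ltr X Y \<longleftrightarrow> (\<exists>n. 2 * ip n < qv (Y n) - qv (X n))"
  and pos_ip: "pos X \<longleftrightarrow> (\<exists>n. 2 * ip n < qv (X n))"
  by (simp_all add: isr_def eqr_def ltr_def pos_def ip_def)

lemma isr_diff: "isr X \<Longrightarrow> m \<le> n \<Longrightarrow> \<bar>qv (X m) - qv (X n)\<bar> < ip m"
  unfolding isr_ip by (metis le_add_diff_inverse)

lemma isr_diff2: "isr X \<Longrightarrow> \<bar>qv (X m) - qv (X n)\<bar> < ip m + ip n"
proof (cases "m \<le> n")
  case True
  assume "isr X"
  then show ?thesis using isr_diff[OF _ True, of X] ip_pos[of n] by linarith
next
  case False
  assume "isr X"
  then have "\<bar>qv (X n) - qv (X m)\<bar> < ip n" using False by (intro isr_diff) auto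
  then show ?thesis using ip_pos[of m] by (simp only: abs_minus_commute[of "qv (X m)"])
qed

lemma pos_eqr:
  assumes "pos X" "isr X" "eqr X Y"
  shows "pos Y"
proof -
  obtain n where n: "2 * ip n < qv (X n)" using assms(1) pos_ip by blast
  \<comment> \<open>Two places further, the drift of \<open>X\<close> costs less than
    \<open>ip n\<close> and the distance to \<open>Y\<close> at most \<open>ip n / 2\<close>; what
    remains of \<open>2 * ip n\<close> exceeds \<open>ip n / 2\<close>, which is
    \<open>2 * ip ?m\<close>.\<close>
  let ?m = "n + 1 + 1"
  have "\<bar>qv (X n) - qv (X ?m)\<bar> < ip n" using assms(2) by (intro isr_diff) (simp_all add: add.assoc)
  moreover have "\<bar>qv (X ?m) - qv (Y ?m)\<bar> \<le> 2 * ip ?m" using assms(3) eqr_ip by blast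
  moreover have "ip ?m = ip n / 4" by (simp add: ip_Suc)
  ultimately have "2 * ip ?m < qv (Y ?m)" using n by linarith
  then show ?thesis unfolding pos_ip by blast
qed

lemma eqr_sym: "eqr X Y \<Longrightarrow> eqr Y X"
  by (simp add: eqr_def abs_minus_commute)

lemma near_ip: "near X Y r \<longleftrightarrow> (\<exists>n. 2 * ip n < qv r - \<bar>qv (X (n + 1)) - qv (Y (n + 1))\<bar>)"
  by (simp add: near_def ltr_ip cst_def qv_qabs qv_qminus)

lemma near_close:
  assumes X: "isr X" and Y: "isr Y" and 1: "near X Y r"
  shows "\<exists>j. \<forall>m\<ge>j. \<bar>qv (X m) - qv (Y m)\<bar> < qv r"
proof -
  obtain j where j: "2 * ip j < qv r - \<bar>qv (X (j + 1)) - qv (Y (j + 1))\<bar>" using 1 near_ip by blast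
  have "\<bar>qv (X m) - qv (Y m)\<bar> < qv r" if "j + 1 \<le> m" for m
    using isr_diff[OF X that] isr_diff[OF Y that] j ip_Suc[of j] ip_pos[of j] by linarith
  then show ?thesis by blast
qed

lemma near_aux: "a \<le> b + c + d \<Longrightarrow> b < i + k / 2 \<Longrightarrow> d < i + k / 2 \<Longrightarrow> 4 * k < R - c - 2 * i \<Longrightarrow> 0 < k \<Longrightarrow>
    2 * k < R - (a :: 'a::linordered_field)"
  by linarith

lemma close_near:
  assumes X: "isr X" and Y: "isr Y" and m: "\<bar>qv (X m) - qv (Y m)\<bar> + 2 * ip m < qv r"
  shows "near X Y r"
proof -
  \<comment> \<open>Passing from \<open>m\<close> to \<open>j + 1\<close> can add
    \<open>2 * ip m + ip j\<close> to the distance, and \<open>near\<close> asks for a margin of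
    \<open>2 * ip j\<close>; beyond \<open>2 * ip m\<close>, a reserve of \<open>4 * ip j\<close> is
    ample.\<close>
  obtain j where "ip j < (qv r - \<bar>qv (X m) - qv (Y m)\<bar> - 2 * ip m) / 4"
    using ip_small[of "(qv r - \<bar>qv (X m) - qv (Y m)\<bar> - 2 * ip m) / 4"] m by auto
  then have j: "4 * ip j < qv r - \<bar>qv (X m) - qv (Y m)\<bar> - 2 * ip m"
    by (simp add: less_divide_eq mult.commute)
  have "\<bar>qv (X (j + 1)) - qv (Y (j + 1))\<bar> \<le>
      \<bar>qv (X m) - qv (X (j + 1))\<bar> + \<bar>qv (X m) - qv (Y m)\<bar> + \<bar>qv (Y m) - qv (Y (j + 1))\<bar>" by linarith
  from this isr_diff2[OF X, of m "j + 1"] isr_diff2[OF Y, of m "j + 1"] j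
  have "2 * ip j < qv r - \<bar>qv (X (j + 1)) - qv (Y (j + 1))\<bar>"
    unfolding ip_Suc abs_minus_commute[of "qv (Y (j + 1))"]
    by (rule near_aux) simp
  then show ?thesis unfolding near_ip by blast
qed

text \<open>A 1-Lipschitz function applied termwise keeps the rate of convergence and the equality
  of reals. If its value at index \<open>n\<close> exceeds \<open>2 * ip n\<close>, it stays
  positive within radius \<open>ip n / 4\<close>.\<close>

lemma lipschitz_opn:
  assumes \<phi>: "\<And>X n. qv (F X n) = \<phi> (qv (X n))" and lip: "\<And>x y. \<bar>\<phi> x - \<phi> y\<bar> \<le> \<bar>x - y\<bar>"
  shows "opn F"
proof -
  have F: "isr (F X)" if "isr X" for X
    using that lip unfolding isr_ip \<phi> by (meson le_less_trans)
  have "isrf F" unfolding isrf_def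
    using F lip unfolding eqr_ip \<phi> by (meson order_trans)
  moreover have "\<exists>r. qv (pair 0 (pair 0 0)) < qv r \<and> (\<forall>Y. real Y \<longrightarrow> near X Y r \<longrightarrow> pos (F Y))"
    if X: "real X" and p: "pos (F X)" for X
  proof -
    obtain n where n: "2 * ip n < \<phi> (qv (X n))" using p unfolding pos_ip \<phi> by blast
    let ?r = "qpow 1 (n + 1 + 1)"
    have r: "qv ?r = ip n / 4" using ip_Suc[of "n + 1"] ip_Suc[of n] by (simp add: qv_qpow ip_def)
    have "pos (F Y)" if Y: "real Y" and nr: "near X Y ?r" for Y
    proof -
      obtain j where j: "\<forall>m\<ge>j. \<bar>qv (X m) - qv (Y m)\<bar> < qv ?r" using near_close nr X Y by blast
      let ?m = "n + 1 + 1 + j"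
      have "\<bar>qv (X ?m) - qv (Y ?m)\<bar> < ip n / 4" using j r by simp
      moreover have "n \<le> ?m" by (simp add: add.assoc)
      then have "\<bar>qv (X n) - qv (X ?m)\<bar> < ip n" using X isr_diff by blast
      moreover have "ip ?m \<le> ip n / 4" using ip_mono[of "n + 1 + 1" ?m] by (simp add: ip_Suc)
      ultimately have "2 * ip ?m < \<phi> (qv (Y ?m))"
        using n lip[of "qv (X n)" "qv (X ?m)"] lip[of "qv (X ?m)" "qv (Y ?m)"] by linarith
      then show ?thesis unfolding pos_ip \<phi> by blast
    qed
    moreover have "0 < qv ?r" unfolding r by simp
    ultimately show ?thesis by (intro exI[of _ ?r]) (simp add: qv_0)
  qed
  ultimately show ?thesis unfolding opn_def by blast
qed

subsection \<open>Binary strings\<close>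

lemma Suc_neq_0 [simp]: "(a::'n) + 1 \<noteq> 0"
  by (simp add: mnat_pos)

lemma two_cases: "b \<le> (1::'n) \<Longrightarrow> b = 0 \<or> b = 1"
  using less_succ[of b 0] by (auto simp: le_less)

lemma hf_double: "hf (k + k) = k \<and> hf (k + k + 1) = k"
proof (rule num_induct[where n = k], (rule dfn_all)+)
  show "hf (0 + 0) = 0 \<and> hf (0 + 0 + 1) = 0" using hf_Suc[of 0] by simp
  fix n assume n: "hf (n + n) = n \<and> hf (n + n + 1) = n"
  have e: "n + 1 + (n + 1) = n + n + 1 + 1" by (simp add: ac_simps)
  have "hf (n + n + 1 + 1) = n + n + 1 - n" using n by (simp only: hf_Suc[of "n + n + 1"])
  then have 1: "hf (n + n + 1 + 1) = n + 1" by (simp add: add.assoc)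
  have "hf (n + n + 1 + 1 + 1) = n + n + 1 + 1 - (n + 1)" using 1 by (simp only: hf_Suc[of "n + n + 1 + 1"])
  also have "\<dots> = n + 1" unfolding e[symmetric] by (rule add_diff_cancel_left')
  finally show "hf (n + 1 + (n + 1)) = n + 1 \<and> hf (n + 1 + (n + 1) + 1) = n + 1" using 1 by (simp add: e)
qed

lemma even_odd: "\<exists>k. n = k + k \<or> n = k + k + (1::'n)"
proof -
  \<comment> \<open>With \<open>hf n\<close> as explicit witness the statement is decidable, as the
    induction requires.\<close>
  have "n = hf n + hf n \<or> n = hf n + hf n + 1"
  proof (rule num_induct[where n = n], (rule dfn_all)+)
    fix n assume "n = hf n + hf n \<or> n = hf n + hf n + 1"
    then obtain k where "n = k + k \<or> n = k + k + 1" by blast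
    then consider "n + 1 = k + k + 1" | "n + 1 = (k + 1) + (k + 1)" by (auto simp: ac_simps)
    then show "n + 1 = hf (n + 1) + hf (n + 1) \<or> n + 1 = hf (n + 1) + hf (n + 1) + 1"
      by cases (metis hf_double, metis hf_double)
  qed simp
  then show ?thesis by blast
qed

text \<open>The string without its last bit; the empty string is its own parent. \<open>lst\<close>
  reads the bit that is removed.\<close>

definition par where "par s = hf (s - 1)"
definition lst where "lst s = (s - 1) - (par s + par s)"

lemma par_snoc [simp]: "b \<le> 1 \<Longrightarrow> par (snoc r b) = r" and lst_snoc [simp]: "b \<le> 1 \<Longrightarrow> lst (snoc r b) = b"
proof -
  assume b: "b \<le> 1"
  have "snoc r b - 1 = r + r + b" unfolding snoc_def by (metis add.assoc add.commute add_diff_cancel_left')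
  then show "par (snoc r b) = r" "lst (snoc r b) = b"
    using hf_double[of r] two_cases[OF b] unfolding lst_def par_def by auto
qed

lemma snoc_pos [simp]: "snoc r b \<noteq> 0" "0 < snoc r b"
proof -
  have "snoc r b = (r + r + b) + 1" by (simp only: snoc_def add.assoc add.commute add.left_commute)
  then show "0 < snoc r b" by simp
  then show "snoc r b \<noteq> 0" by simp
qed

lemma string_cases: "s = 0 \<or> (\<exists>r b. b \<le> 1 \<and> s = snoc r b)"
proof -
  have "\<exists>r b. b \<le> 1 \<and> s = snoc r b" if "s = m + 1" for m
  proof -
    obtain k where "m = k + k \<or> m = k + k + 1" using even_odd by blast
    then show ?thesis using that unfolding snoc_def by (metis add.right_neutral order_refl zero_least)
  qed
  then show ?thesis using num_cases[of s] by blast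
qed

lemma snoc_gt: "r < snoc r b"
proof -
  have "snoc r b = r + ((r + b) + 1)" by (simp only: snoc_def add.assoc add.commute add.left_commute)
  then show ?thesis using less_add_same_cancel1[of r "(r + b) + 1"] by simp
qed

lemma num_less_induct:
  assumes P: "dec P" and step: "\<And>n. (\<And>k. k < n \<Longrightarrow> P k) \<Longrightarrow> P n"
  shows "P n"
proof (rule ccontr)
  assume "\<not> P n"
  then obtain m where "\<not> P m" "\<forall>k<m. \<not> \<not> P k" using num_least[OF pd_not[OF P]] by metis
  then show False using step by blast
qed

text \<open>Appending a bit increases the code (\<open>snoc_gt\<close>), so course-of-values
  induction on codes is structural induction on strings.\<close>

lemma string_induct:
  assumes P: "dec P" and 0: "P 0" and snoc: "\<And>r b. b \<le> 1 \<Longrightarrow> P r \<Longrightarrow> P (snoc r b)"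
  shows "P s"
proof (rule num_less_induct[OF P])
  fix s assume "\<And>k. k < s \<Longrightarrow> P k"
  then show "P s" using string_cases[of s] 0 snoc snoc_gt by metis
qed

lemma cut_par: "cut (k + 1) s = par (cut k s)"
  by (simp add: cut_Suc par_def)

lemma par_0 [simp]: "par 0 = 0"
  by (simp add: par_def)

lemma cut_0_right [simp]: "cut k 0 = 0"
  by (rule num_induct[where n = k], (rule dfn_all)+) (simp_all add: cut_par)

lemma cut_par': "cut k (par s) = cut (k + 1) s"
proof (rule num_induct[where n = k], (unfold par_def)[1], (rule dfn_all)+)
  show "cut 0 (par s) = cut (0 + 1) s" by (simp add: cut_Suc[of 0, simplified] par_def)
  fix n assume "cut n (par s) = cut (n + 1) s"
  then show "cut (n + 1) (par s) = cut (n + 1 + 1) s" by (simp add: cut_par)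
qed

lemma cut_snoc [simp]: "b \<le> 1 \<Longrightarrow> cut (k + 1) (snoc r b) = cut k r"
  by (simp add: cut_par'[symmetric])

lemma cut_cut: "cut j (cut k t) = cut (j + k) t"
proof (rule num_induct[where n = j], (rule dfn_all)+)
  fix n assume "cut n (cut k t) = cut (n + k) t"
  moreover have "n + 1 + k = n + k + 1" by (simp add: ac_simps)
  ultimately show "cut (n + 1) (cut k t) = cut (n + 1 + k) t" by (simp add: cut_par)
qed simp

text \<open>Each cut lowers the code of a nonempty string by at least one, so \<open>s\<close> cuts
  empty \<open>s\<close>. This is why the code can bound the number of cuts, both in the length and
  in conditions on all initial segments.\<close>

lemma cut_bound: "cut k s + k \<le> s \<or> cut k s = 0"
proof (rule num_induct[where n = k], (rule dfn_all)+)
  fix n assume IH: "cut n s + n \<le> s \<or> cut n s = 0"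
  show "cut (n + 1) s + (n + 1) \<le> s \<or> cut (n + 1) s = 0"
  proof (cases "cut n s = 0")
    case False
    then obtain r b where r: "b \<le> 1" "cut n s = snoc r b" using string_cases by blast
    have "r + 1 \<le> snoc r b" using snoc_gt Suc_le_mnat by blast
    then have "r + 1 + n \<le> s" using IH False r by (metis add_right_mono order_trans)
    moreover have "cut (n + 1) s = r" using r by (simp add: cut_par)
    moreover have "r + 1 + n = r + (n + 1)" by (simp only: ac_simps)
    ultimately show ?thesis by simp
  qed (simp add: cut_par)
qed simp

lemma cut_ge: "s \<le> k \<Longrightarrow> cut k s = 0"
  using cut_bound[of k s] by (metis add_le_same_cancel2 le_0 order_trans)

lemma dfn_cnt: "dfn G r0 a \<Longrightarrow> dfn G r0 b \<Longrightarrow> dfn G r0 (\<lambda>c. cnt (a c) (b c))"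
  by (rule dfn_app2[OF rl_cnt good_r0 good_r0 good_r0])

lemma cnt_ge: "cnt s (s + d) = cnt s s"
proof (rule num_induct[where n = d], (rule dfn_cnt dfn_all)+)
  fix n assume "cnt s (s + n) = cnt s s"
  moreover have "cnt s (s + n + 1) = cnt s (s + n) + 0" by (simp add: cnt_Suc cut_ge sg_def)
  ultimately show "cnt s (s + (n + 1)) = cnt s s" by (simp add: add.assoc)
qed simp

lemma len_0 [simp]: "len 0 = 0"
  by (simp add: len_cnt)

lemma len_snoc [simp]:
  assumes b: "b \<le> 1" shows "len (snoc r b) = len r + 1"
proof -
  have c: "cnt (snoc r b) (m + 1) = cnt r m + 1" for m
  proof (rule num_induct[where n = m], (rule dfn_cnt dfn_all)+)
    show "cnt (snoc r b) (0 + 1) = cnt r 0 + 1" using cnt_Suc[of _ 0] by (simp add: sg_def)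
    fix n assume "cnt (snoc r b) (n + 1) = cnt r n + 1"
    then have "cnt (snoc r b) (n + 1 + 1) = cnt r n + 1 + sg (cut n r)" using b by (simp add: cnt_Suc[of _ "n + 1"])
    then show "cnt (snoc r b) (n + 1 + 1) = cnt r (n + 1) + 1" unfolding cnt_Suc[of r] by (simp only: ac_simps)
  qed
  have "snoc r b = (r + (r + b)) + 1" by (simp only: snoc_def add.assoc add.commute add.left_commute)
  then show ?thesis using c[of "r + (r + b)"] cnt_ge[of r "r + b"] by (simp add: len_cnt)
qed

lemma len_eq_0: "len s = 0 \<longleftrightarrow> s = 0"
  using string_cases[of s] by auto

lemma len_le: "len s \<le> s"
proof (rule string_induct[where s = s], (rule dfn_all)+)
  fix r b :: 'n assume "b \<le> 1" "len r \<le> r"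
  then have "len (snoc r b) < snoc r b + 1" using snoc_gt[of r b] by (auto intro: le_less_trans)
  then show "len (snoc r b) \<le> snoc r b" using \<open>b \<le> 1\<close> by (simp only: less_succ)
qed simp

text \<open>Turns a search over all strings of one length into a bounded one.\<close>

lemma len_bound: "s + 1 < p2 (len s + 1)"
proof (rule string_induct[where s = s], (rule dfn_all)+)
  show "0 + 1 < p2 (len 0 + 1)" using p2_Suc[of 0] by (simp add: less_add_one)
  fix r b :: 'n assume b: "b \<le> 1" and r: "r + 1 < p2 (len r + 1)"

  from r have "r + 1 + 1 \<le> p2 (len r + 1)" using Suc_le_mnat[of "r + 1" "p2 (len r + 1)"] by blast
  from add_mono[OF this this] have "(r + 1 + 1) + (r + 1 + 1) \<le> p2 (len r + 1 + 1)" unfolding p2_Suc[of "len r + 1"] .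
  moreover have "snoc r b + 1 < (r + 1 + 1) + (r + 1 + 1)"
    using b unfolding snoc_def to_fr fr_simps(1-4) by linarith
  ultimately show "snoc r b + 1 < p2 (len (snoc r b) + 1)" using b by simp
qed

lemma len_cut_le: "len (cut k s) \<le> len s"
proof (rule num_induct[where n = k], (rule dfn_all)+)
  fix n assume IH: "len (cut n s) \<le> len s"
  have "len (par t) \<le> len t" for t using string_cases[of t] by auto
  then show "len (cut (n + 1) s) \<le> len s" using IH unfolding cut_par by (rule order_trans)
qed simp

lemma len_cut: "k \<le> len s \<longrightarrow> len (cut k s) + k = len s"
proof (rule num_induct[where n = k], (rule dfn_all)+)
  fix n assume IH: "n \<le> len s \<longrightarrow> len (cut n s) + n = len s"
  show "n + 1 \<le> len s \<longrightarrow> len (cut (n + 1) s) + (n + 1) = len s"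
  proof
    assume n: "n + 1 \<le> len s"
    then have e: "len (cut n s) + n = len s" using IH by (auto simp: Suc_le_mnat)
    then have "cut n s \<noteq> 0" using n by (auto simp: Suc_le_mnat)
    then obtain r b where "b \<le> 1" "cut n s = snoc r b" using string_cases by blast
    moreover from this have "cut (n + 1) s = r" "len r + 1 + n = len s" using e by (simp_all add: cut_par)
    moreover have "len r + (n + 1) = len r + 1 + n" by (simp only: ac_simps)
    ultimately show "len (cut (n + 1) s) + (n + 1) = len s" by simp
  qed
qed simp

lemma pc_0 [simp]: "rl r1 a \<Longrightarrow> pc a 0 = 0" and pc_Suc: "rl r1 a \<Longrightarrow> pc a (n + 1) = snoc (pc a n) (a n)"
  and rl_pc: "rl r1 a \<Longrightarrow> rl r1 (pc a)"
proof -
  have f: "rl (rfun r0 r1) (\<lambda>k r. snoc r (a k))" if "rl r1 a"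
    by (rule rl_lam2) (rule dfn_app1[OF that] dfn_all)+
  show "rl r1 a \<Longrightarrow> pc a (n + 1) = snoc (pc a n) (a n)" unfolding pc_def using prc_Suc[OF f] .
  show "rl r1 (pc a)" if "rl r1 a" unfolding pc_def by (rule rl_lam) (rule dfn_prc dfn_const[OF _ f[OF that]] dfn_all)+
  show "rl r1 a \<Longrightarrow> pc a 0 = 0" unfolding pc_def using prc_0[OF f] .
qed

section \<open>The covering theorem implies weak Koenig's lemma\<close>

lemma dfn_lst: "dfn G r0 s \<Longrightarrow> dfn G r0 (\<lambda>c. lst (s c))"
  unfolding par_def lst_def by (rule dfn_all | assumption)+

lemma diff_Suc_Suc: "m + 1 \<le> (n::'n) \<Longrightarrow> n - m = (n - (m + 1)) + 1"
proof -
  assume "m + 1 \<le> n"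
  then obtain d where d: "n = (m + 1) + d" using le_add_diff_inverse by metis
  then have "n = m + (d + 1)" by (simp only: ac_simps)
  then have "n - m = d + 1" by (simp only: add_diff_cancel_left')
  moreover have "n - (m + 1) = d" unfolding d by (rule add_diff_cancel_left')
  ultimately show ?thesis by simp
qed

text \<open>The digits of a string, read in base 4: strings of length \<open>n\<close> get centers \<open>3 B / 4 ^ n\<close>, so the
  balls of radius \<open>4 ^ - n\<close> about them are disjoint, and each contains the two balls of the next level.\<close>

definition Bs where "Bs s m = prc (\<lambda>k r. 4 * r + lst (cut (len s - (k + 1)) s)) 0 m"
definition B where "B s = Bs s (len s)"

lemma rl_Bs_step: "rl (rfun r0 r1) (\<lambda>k r. 4 * r + lst (cut (len s - (k + 1)) s))"
  by (rule rl_lam2) (rule dfn_lst dfn_all)+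

lemma rl_B: "rl r1 B" and rl_Bs: "rl (rfun r0 r1) Bs"
  unfolding B_def Bs_def by (rule rl_lam rl_lam2; (rule dfn_prc dfn_lam dfn_lst dfn_all)+)+

lemma Bs_0: "Bs s 0 = 0" and Bs_Suc: "Bs s (m + 1) = 4 * Bs s m + lst (cut (len s - (m + 1)) s)"
  unfolding Bs_def by (simp_all only: prc_0[OF rl_Bs_step] prc_Suc[OF rl_Bs_step])

lemma B_0 [simp]: "B 0 = 0"
  by (simp add: B_def Bs_0)

lemma B_snoc [simp]:
  assumes b: "b \<le> 1" shows "B (snoc r b) = 4 * B r + b"
proof -
  have "m \<le> len r \<longrightarrow> Bs (snoc r b) m = Bs r m" for m
  proof (rule num_induct[where n = m], (rule dfn_app2[OF rl_Bs good_r0 good_r0 good_r0] dfn_all)+)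
    fix m assume IH: "m \<le> len r \<longrightarrow> Bs (snoc r b) m = Bs r m"
    show "m + 1 \<le> len r \<longrightarrow> Bs (snoc r b) (m + 1) = Bs r (m + 1)"
    proof
      assume m: "m + 1 \<le> len r"
      then have "Bs (snoc r b) m = Bs r m" using IH by (auto simp: Suc_le_mnat)
      moreover have "cut (len (snoc r b) - (m + 1)) (snoc r b) = cut (len r - (m + 1)) r"
        using b diff_Suc_Suc[OF m] by simp
      ultimately show "Bs (snoc r b) (m + 1) = Bs r (m + 1)" unfolding Bs_Suc by simp
    qed
  qed (simp add: Bs_0)
  then have "Bs (snoc r b) (len r) = B r" by (simp add: B_def)
  moreover have "Bs (snoc r b) (len r + 1) = 4 * Bs (snoc r b) (len r) + b" unfolding Bs_Suc using b by simp
  ultimately show ?thesis using b by (simp add: B_def)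
qed

lemmas dfn_B = dfn_app1[OF rl_B good_r0 good_r0]

text \<open>This is 4 to the power \<open>- n\<close>, the radius belonging to level
  \<open>n\<close>. Below, \<open>cc s\<close> codes the center of \<open>s\<close>, and
  \<open>dst s q\<close> the distance of \<open>q\<close> from it.\<close>

definition w where "w n = ip (n + n)"
definition cc where "cc s = qdiff (3 * B s) 0 (p2 (len s + len s) - 1)"
definition ctr where "ctr s = qv (cc s)"
definition dst where "dst s q = qabs (qminus q (cc s))"

lemma ctr: "ctr s = 3 * fr (B s) * w (len s)"
proof -
  have "1 \<le> p2 (len s + len s)" by (simp add: mnat_ge_1)
  then show ?thesis by (simp add: ctr_def cc_def qv_qdiff fr_minus w_def ip_def P2_def)
qed

lemma w_Suc: "w (n + 1) = w n / 4" and w_0 [simp]: "w 0 = 1" and w_pos [simp]: "0 < w n"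
proof -
  have "n + 1 + (n + 1) = n + n + 1 + 1" by (simp add: ac_simps)
  then show "w (n + 1) = w n / 4" by (simp add: w_def ip_Suc)
qed (simp_all add: w_def)

lemma w_le_1: "w n \<le> 1"
  by (simp add: w_def ip_le_1)

lemma ctr_0 [simp]: "ctr 0 = 0" and ctr_snoc: "b \<le> 1 \<Longrightarrow> ctr (snoc r b) = ctr r + 3 / 4 * (fr b * w (len r))"
  by (simp_all add: ctr w_Suc) (simp add: field_simps)

lemma fr_bit: "b \<le> 1 \<Longrightarrow> 0 \<le> fr b \<and> fr b \<le> (1 :: 'n mint fract)"
  using fr_simps(5)[of b 1] by simp

lemma w_bit: "b \<le> 1 \<Longrightarrow> 0 \<le> fr b * w n \<and> fr b * w n \<le> w n"
  using fr_bit[of b] w_pos[of n] by (simp add: mult_left_le_one_le less_imp_le)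

lemma dfn_cc: "dfn G r0 s \<Longrightarrow> dfn G r0 (\<lambda>c. cc (s c))"
  unfolding cc_def by (rule dfn_qdiff dfn_B dfn_terms dfn_ops dfn_num | assumption)+

lemma dfn_dst: "dfn G r0 s \<Longrightarrow> dfn G r0 q \<Longrightarrow> dfn G r0 (\<lambda>c. dst (s c) (q c))"
  unfolding dst_def by (rule dfn_cc dfn_terms | assumption)+

lemma qv_dst: "qv (dst s q) = \<bar>qv q - ctr s\<bar>"
  by (simp add: dst_def qv_qabs qv_qminus ctr_def)

lemma qv_w: "qv (qpow 1 (n + n)) = w n"
  by (simp add: qv_qpow w_def ip_def)

lemma ctr_bounds: "0 \<le> ctr s \<and> ctr s \<le> 1"
proof -
  \<comment> \<open>The bound \<open>1 - w (len s)\<close> is what the induction needs: a bit 1 adds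
    three quarters of \<open>w\<close>, exactly the amount by which \<open>w\<close>
    shrinks.\<close>
  have "qv (cc s) \<le> qv (qminus (qdiff 1 0 0) (qpow 1 (len s + len s)))"
  proof (rule string_induct[where s = s], (rule dfn_cc dfn_all)+, unfold qv_qminus qv_w ctr_def[symmetric])
    fix r b :: 'n assume b: "b \<le> 1" and "ctr r \<le> qv (qdiff 1 0 0) - w (len r)"
    then show "ctr (snoc r b) \<le> qv (qdiff 1 0 0) - w (len (snoc r b))"
      using w_bit[OF b, of "len r"] unfolding ctr_snoc[OF b] len_snoc[OF b] w_Suc by linarith
  qed (simp add: qv_qdiff)
  then have "ctr s \<le> 1 - w (len s)" by (simp add: qv_qminus qv_w qv_qdiff ctr_def)
  then have "ctr s \<le> 1" using w_pos[of "len s"] by linarith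
  moreover have "0 \<le> ctr s" unfolding ctr by (intro mult_nonneg_nonneg less_imp_le[OF w_pos]) simp_all
  ultimately show ?thesis by simp
qed

text \<open>The interval of length \<open>w (len s)\<close> to the right of a center contains those
  of both children, which start at offset 0 or at three quarters of it and have a quarter of its
  length.\<close>

lemma ctr_cut: "ctr (cut j s) \<le> ctr s \<and> ctr s \<le> ctr (cut j s) + w (len (cut j s))"
proof -
  have "qv (cc (cut j s)) \<le> qv (cc s) \<and> qv (qminus (cc s) (cc (cut j s))) \<le> qv (qpow 1 (len (cut j s) + len (cut j s)))"
  proof (rule num_induct[where n = j], (rule dfn_cc dfn_all)+, unfold qv_qminus qv_w ctr_def[symmetric])
    fix j assume IH: "ctr (cut j s) \<le> ctr s \<and> ctr s - ctr (cut j s) \<le> w (len (cut j s))"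
    show "ctr (cut (j + 1) s) \<le> ctr s \<and> ctr s - ctr (cut (j + 1) s) \<le> w (len (cut (j + 1) s))"
    proof (cases "cut j s = 0")
      case False
      then obtain r b where r: "b \<le> 1" "cut j s = snoc r b" using string_cases by blast
      then have "cut (j + 1) s = r" by (simp add: cut_par)
      then show ?thesis using IH w_bit[OF r(1), of "len r"]
        unfolding r(2) ctr_snoc[OF r(1)] len_snoc[OF r(1)] w_Suc by (simp only:) linarith
    qed (use IH in \<open>simp add: cut_par\<close>)
  qed (simp add: less_imp_le)
  then show ?thesis by (simp add: qv_qminus qv_w ctr_def)
qed

lemma fr_Suc_le: "(a::'n) + 1 \<le> b \<Longrightarrow> fr a + 1 \<le> fr b"
  by (metis fr_simps(2,3,5))

lemma B_inj:
  assumes "len t = len s" "B t = B s" shows "t = s"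
proof -
  \<comment> \<open>\<open>len_bound\<close> supplies the bound on \<open>t\<close> that makes the
    statement decidable. The digits are recovered because \<open>4 * B q + c\<close> determines
    \<open>B q\<close> and \<open>c\<close> when \<open>c \<le> 1\<close>.\<close>
  have "\<forall>t<p2 (len s + 1). len t = len s \<and> B t = B s \<longrightarrow> t = s"
  proof (rule string_induct[where s = s], (rule pd_bdd dfn_B dfn_all)+)
    show "\<forall>t<p2 (len 0 + 1). len t = len 0 \<and> B t = B 0 \<longrightarrow> t = 0" by (simp add: len_eq_0)
    fix r b :: 'n assume b: "b \<le> 1" and IH: "\<forall>t<p2 (len r + 1). len t = len r \<and> B t = B r \<longrightarrow> t = r"
    show "\<forall>t<p2 (len (snoc r b) + 1). len t = len (snoc r b) \<and> B t = B (snoc r b) \<longrightarrow> t = snoc r b"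
    proof (intro allI impI)
      fix t assume "len t = len (snoc r b) \<and> B t = B (snoc r b)"
      moreover from this have "t \<noteq> 0" using b by auto
      then obtain q c where q: "c \<le> 1" "t = snoc q c" using string_cases by blast
      ultimately have e: "len q = len r" "4 * B q + c = 4 * B r + b" using b by auto
      have "fr (4 * B q + c) = fr (4 * B r + b)" using e by simp
      then have f: "4 * fr (B q) + fr c = 4 * fr (B r) + fr b" by simp
      have "B q = B r"
      proof (rule ccontr)
        assume "B q \<noteq> B r"
        then consider "B q + 1 \<le> B r" | "B r + 1 \<le> B q" unfolding Suc_le_mnat by (meson linorder_neqE)
        then have "fr (B q) + 1 \<le> fr (B r) \<or> fr (B r) + 1 \<le> fr (B q)"
          by cases (simp_all add: fr_Suc_le)
        then show False using f fr_bit[OF b] fr_bit[OF q(1)] by auto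
      qed
      then have "b = c" using e by simp
      moreover have "q < p2 (len r + 1)" using len_bound[of q] e less_add_one[of q] by (metis less_trans)
      ultimately show "t = snoc r b" using IH e \<open>B q = B r\<close> q by blast
    qed
  qed
  moreover have "t < p2 (len s + 1)" using len_bound[of t] assms(1) less_add_one[of t] by (metis less_trans)
  ultimately show ?thesis using assms by blast
qed

text \<open>Centers on one level are integer multiples of \<open>3 * w (len s)\<close>, and by
  \<open>B_inj\<close> different strings have different multiples.\<close>

lemma ctr_separated:
  assumes l: "len t = len s" and d: "\<bar>ctr t - ctr s\<bar> < 3 * w (len s)"
  shows "t = s"
proof (rule B_inj[OF l], rule ccontr)
  assume "B t \<noteq> B s"
  then consider "B t + 1 \<le> B s" | "B s + 1 \<le> B t" unfolding Suc_le_mnat by (meson linorder_neqE)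
  then have "1 \<le> \<bar>fr (B t) - fr (B s)\<bar>"
  proof cases
    case 1
    then show ?thesis using fr_Suc_le[OF 1] by simp
  next
    case 2
    then show ?thesis using fr_Suc_le[OF 2] by simp
  qed
  from mult_left_mono[OF this, of "3 * w (len s)"]
  have "3 * w (len s) \<le> 3 * w (len s) * \<bar>fr (B t) - fr (B s)\<bar>"
    using w_pos[of "len s"] by simp
  also have "\<dots> = \<bar>3 * w (len s) * (fr (B t) - fr (B s))\<bar>" using w_pos[of "len s"] by (simp add: abs_mult abs_of_pos)
  also have "3 * w (len s) * (fr (B t) - fr (B s)) = ctr t - ctr s" by (simp add: ctr l algebra_simps)
  finally show False using d by simp
qed

lemma qv_surj: "\<exists>q. qv q = x"
proof -
  obtain a b d where d: "0 < d" "x = (fr a - fr b) / fr d" using fract_cases by blast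
  then have "fr (d - 1) + 1 = fr d" by (simp add: fr_minus mnat_ge_1)
  then show ?thesis using d by (intro exI[of _ "qdiff a b (d - 1)"]) (simp add: qv_qdiff)
qed

text \<open>The distance of \<open>q\<close> to the centers of the strings below \<open>b\<close> on level \<open>n\<close> of \<open>T\<close>, cut off at 5.\<close>

definition M where "M T n q b =
  prc (\<lambda>s r. if len s = n \<and> T s = 1 \<and> qv (dst s q) < qv r then dst s q else r) (qdiff 5 0 0) b"

section \<open>Distance to one level of a tree, and the open sets it defines\<close>

context
  fixes T :: "'n \<Rightarrow> 'n"
  assumes T: "rl r1 T"
begin

lemma rl_M_step: "rl (rfun r0 r1) (\<lambda>s r. if len s = n \<and> T s = 1 \<and> qv (dst s q) < qv r then dst s q else r)"
  by (rule rl_lam2) (rule dfn_dst dfn_app1[OF T good_r0 good_r0] dfn_all)+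

lemma dfn_M: "gctx G \<Longrightarrow> dfn G r0 n \<Longrightarrow> dfn G r0 q \<Longrightarrow> dfn G r0 b \<Longrightarrow> dfn G r0 (\<lambda>c. M T (n c) (q c) (b c))"
  unfolding M_def
  by (rule dfn_prc dfn_lam dfn_dst dfn_app1[OF T good_r0 good_r0] dfn_qdiff dfn_num dfn_if pd_conj pd_eq pd_q
      dfn_terms dfn_fst dfn_snd dfn_good | assumption)+

lemma M_0: "M T n q 0 = qdiff 5 0 0"
  and M_Suc: "M T n q (b + 1) = (if len b = n \<and> T b = 1 \<and> qv (dst b q) < qv (M T n q b) then dst b q else M T n q b)"
  unfolding M_def by (simp_all only: prc_0[OF rl_M_step] prc_Suc[OF rl_M_step])

lemma M_le_5: "qv (M T n q b) \<le> 5"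
proof -
  have "qv (M T n q b) \<le> qv (qdiff 5 0 0)"
    by (rule num_induct[where n = b], (rule dfn_M dfn_all)+) (auto simp: M_0 M_Suc)
  then show ?thesis by (simp add: qv_qdiff)
qed

lemma M_le: "s < b \<Longrightarrow> len s = n \<Longrightarrow> T s = 1 \<Longrightarrow> qv (M T n q b) \<le> \<bar>qv q - ctr s\<bar>"
proof -
  assume s: "s < b" "len s = n" "T s = 1"
  have "s < b \<longrightarrow> qv (M T n q b) \<le> qv (dst s q)"
    by (rule num_induct[where n = b], (rule dfn_M dfn_all)+) (use s in \<open>auto simp: M_0 M_Suc less_succ le_less\<close>)
  then show ?thesis using s by (simp add: qv_dst)
qed

lemma M_attained:
  assumes "qv (M T n q b) < 5"
  shows "\<exists>s<b. len s = n \<and> T s = 1 \<and> \<bar>qv q - ctr s\<bar> \<le> qv (M T n q b)"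
proof (rule ccontr)
  let ?t = "M T n q b"
  assume nex: "\<not> ?thesis"
  \<comment> \<open>Otherwise the running minimum could never come down to its own final
    value.\<close>
  have "a \<le> b \<longrightarrow> qv ?t < qv (M T n q a)" for a
  proof (rule num_induct[where n = a], (rule dfn_M dfn_all)+)
    show "0 \<le> b \<longrightarrow> qv ?t < qv (M T n q 0)" using assms by (simp add: M_0 qv_qdiff)
    fix a assume "a \<le> b \<longrightarrow> qv ?t < qv (M T n q a)"
    then show "a + 1 \<le> b \<longrightarrow> qv ?t < qv (M T n q (a + 1))"
      using nex by (auto simp: M_Suc Suc_le_mnat qv_dst not_le)
  qed
  then show False by blast
qed

text \<open>A minimum of distances is 1-Lipschitz, and so is its cut-off at 5; this is the
  hypothesis of \<open>lipschitz_opn\<close>.\<close>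

lemma M_lipschitz: "\<bar>qv (M T n q b) - qv (M T n q' b)\<bar> \<le> \<bar>qv q - qv q'\<bar>"
proof -
  have 1: "qv (M T n q b) \<le> qv (M T n q' b) + \<bar>qv q - qv q'\<bar>" for q q'
  proof (cases "qv (M T n q' b) < 5")
    case True
    then obtain s where s: "s < b" "len s = n" "T s = 1" "\<bar>qv q' - ctr s\<bar> \<le> qv (M T n q' b)" using M_attained by blast
    have "\<bar>qv q - ctr s\<bar> \<le> \<bar>qv q' - ctr s\<bar> + \<bar>qv q - qv q'\<bar>" by linarith
    then show ?thesis using M_le[OF s(1-3), of q] s(4) by linarith
  next
    case False
    then show ?thesis using M_le_5[of n q b] abs_ge_zero[of "qv q - qv q'"] by linarith
  qed
  show ?thesis using 1[of q q'] 1[of q' q] by (simp add: abs_minus_commute abs_le_iff)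
qed

text \<open>By \<open>len_bound\<close>, \<open>p2 (n + 1)\<close> lies above all codes of strings
  of length \<open>n\<close>, so the whole level is taken into account.\<close>

definition Ut :: "'n \<Rightarrow> ('n \<Rightarrow> 'n) \<Rightarrow> 'n \<Rightarrow> 'n" where
  "Ut n X m = qminus (M T n (X m) (p2 (n + 1))) (qpow 1 (n + n))"

lemma rl_Ut: "rl (rfun r0 (rfun r1 r1)) Ut"
  unfolding Ut_def by (rule rl_lam) (rule dfn_lam dfn_M dfn_all)+

lemma qv_Ut: "qv (Ut n X m) = qv (M T n (X m) (p2 (n + 1))) - w n"
  by (simp add: Ut_def qv_qminus qv_w)

lemma opn_Ut: "opn (Ut n)"
proof -
  \<comment> \<open>The function on the field is evaluated at an arbitrary code of its argument; by
    \<open>M_lipschitz\<close> the result depends only on the value of the code.\<close>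
  define \<phi> where "\<phi> x = qv (M T n (SOME q. qv q = x) (p2 (n + 1))) - w n" for x
  have s: "qv (SOME q. qv q = x) = x" for x using someI_ex[OF qv_surj] .
  show ?thesis
  proof (rule lipschitz_opn[where \<phi> = \<phi>])
    show "qv (Ut n X m) = \<phi> (qv (X m))" for X m
      using M_lipschitz[of n "X m" _ "SOME q. qv q = qv (X m)"] unfolding qv_Ut \<phi>_def s by simp
    show "\<bar>\<phi> x - \<phi> y\<bar> \<le> \<bar>x - y\<bar>" for x y
      using M_lipschitz[of n "SOME q. qv q = x" _ "SOME q. qv q = y"] unfolding \<phi>_def s by simp
  qed
qed

end

text \<open>The complement of the unit interval, as the set where the distance from 1/2 exceeds 1/2;
  \<open>qdiff 1 0 1\<close> codes 1/2.\<close>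

definition Dunit :: "('n \<Rightarrow> 'n) \<Rightarrow> 'n \<Rightarrow> 'n" where
  "Dunit X m = qminus (qabs (qminus (X m) (qdiff 1 0 1))) (qdiff 1 0 1)"

lemma rl_Dunit: "rl (rfun r1 r1) Dunit"
  unfolding Dunit_def by (rule rl_lam) (rule dfn_lam dfn_all)+

lemma qv_Dunit: "qv (Dunit X m) = \<bar>qv (X m) - 1 / 2\<bar> - 1 / 2"
  by (simp add: Dunit_def qv_qminus qv_qabs qv_qdiff)

lemma opn_Dunit: "opn Dunit"
proof (rule lipschitz_opn[where \<phi> = "\<lambda>x. \<bar>x - 1 / 2\<bar> - 1 / 2"], rule qv_Dunit)
  show "\<bar>\<bar>x - 1 / 2\<bar> - 1 / 2 - (\<bar>y - 1 / 2\<bar> - 1 / 2)\<bar> \<le> \<bar>x - y\<bar>" for x y :: "'n mint fract"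
    using abs_triangle_ineq3[of "x - 1 / 2" "y - 1 / 2"] by simp
qed

lemma ip_numerals: "ip 4 = 1 / 16" "ip 5 = 1 / 32"
  using ip_Suc[of 0] ip_Suc[of 1] ip_Suc[of 2] ip_Suc[of 3] ip_Suc[of 4] by simp_all

text \<open>A point outside all the sets \<open>Ut n\<close> stays close to one string of the tree at each level, and these
  strings form a path.\<close>

lemma path_of_point:
  assumes T: "rl r1 T" and X: "real X" and npos: "\<And>n. \<not> pos (Ut T n X)"
  shows "\<exists>a. rl r1 a \<and> path a T"
proof -
  \<comment> \<open>At this index the slack \<open>2 * ip\<close> in the negation of
    \<open>pos\<close> is \<open>w n / 16\<close>, so the nearest center is at distance at most
    \<open>17 / 16 * w n\<close>. This is the origin of the number 17.\<close>
  let ?m = "\<lambda>n. n + n + 5"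
  have q: "qv (qpow 17 (n + n + 4)) = 17 / 16 * w n" for n
  proof -
    have "qv (qpow 17 (n + n + 4)) = 17 * ip (n + n + 4)" by (simp add: qv_qpow ip_def)
    then show ?thesis by (simp add: ip_add[of "n + n"] w_def ip_numerals)
  qed
  have ex: "\<exists>s. len s = n \<and> T s = 1 \<and> qv (dst s (X (?m n))) \<le> qv (qpow 17 (n + n + 4))" for n
  proof -
    have "qv (M T n (X (?m n)) (p2 (n + 1))) \<le> w n + 2 * ip (?m n)"
      using npos[of n] unfolding pos_ip qv_Ut[OF T] by (simp add: not_less algebra_simps)
    moreover have "2 * ip (?m n) = w n / 16" by (simp add: ip_add w_def ip_numerals)
    ultimately have *: "qv (M T n (X (?m n)) (p2 (n + 1))) \<le> 17 / 16 * w n" by simp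
    \<comment> \<open>Below the cut-off, the minimum is attained by a string of the tree.\<close>
    then have "qv (M T n (X (?m n)) (p2 (n + 1))) < 5" using w_le_1[of n] by simp
    from M_attained[OF T this] obtain s where "len s = n" "T s = 1"
      "\<bar>qv (X (?m n)) - ctr s\<bar> \<le> qv (M T n (X (?m n)) (p2 (n + 1)))" by blast
    then show ?thesis using * unfolding q qv_dst by (intro exI[of _ s]) simp
  qed
  have "pd (ccons r0 (ccons r0 cnil)) (\<lambda>c. len (fst c) = fst (snd c) \<and> T (fst c) = 1 \<and>
      qv (dst (fst c) (X (?m (fst (snd c))))) \<le> qv (qpow 17 (fst (snd c) + fst (snd c) + 4)))"
    by (rule dfn_dst dfn_app1[OF T good_r0 good_r0] dfn_app1[OF conjunct1[OF X] good_r0 good_r0] dfn_all)+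
  from choice_00[OF this] ex obtain h where h: "rl r1 h" "\<And>n. len (h n) = n" "\<And>n. T (h n) = 1"
    and d: "\<And>n. qv (dst (h n) (X (?m n))) \<le> qv (qpow 17 (n + n + 4))" by blast
  have nz: "h (n + 1) \<noteq> 0" for n using h(2)[of "n + 1"] by auto
  have par: "par (h (n + 1)) = h n" for n
  proof -
    obtain t b where t: "b \<le> 1" "h (n + 1) = snoc t b" using string_cases nz by blast
    then have l: "len t = n" using h(2)[of "n + 1"] by simp
    \<comment> \<open>The two approximation errors, the drift of \<open>X\<close> between the two
      indices and the offset of the child together stay below \<open>2.2 * w n\<close>, within the
      separation of \<open>3 * w n\<close>.\<close>
    have "t = h n"
    proof (rule ctr_separated)
      have 1: "\<bar>qv (X (?m n)) - ctr (h n)\<bar> \<le> 17 / 16 * w n" using d[of n] q by (simp add: qv_dst)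
      have 2: "\<bar>qv (X (?m (n + 1))) - ctr (snoc t b)\<bar> \<le> 17 / 64 * w n" using d[of "n + 1"] q[of "n + 1"] t by (simp add: qv_dst w_Suc)
      have "?m n \<le> ?m (n + 1)" by (intro add_mono) auto
      then have "\<bar>qv (X (?m n)) - qv (X (?m (n + 1)))\<bar> < ip (?m n)" using X by (intro isr_diff) auto
      then have 3: "\<bar>qv (X (?m n)) - qv (X (?m (n + 1)))\<bar> < w n / 32" by (simp add: ip_add[of "n + n"] w_def ip_numerals)
      have 4: "ctr (snoc t b) = ctr t + 3 / 4 * (fr b * w n)" using t l by (simp add: ctr_snoc)
      show "\<bar>ctr t - ctr (h n)\<bar> < 3 * w (len (h n))"
        using 1 2 3 4 w_bit[OF t(1), of n] w_pos[of n] unfolding h(2) by linarith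
    qed (simp add: l h)
    then show ?thesis using t by simp
  qed
  let ?a = "\<lambda>n. lst (h (n + 1))"
  have a: "rl r1 ?a" by (rule rl_lam) (rule dfn_lst dfn_app1[OF h(1) good_r0 good_r0] dfn_all)+
  have "pc ?a n = h n" for n
  proof (rule num_induct[where n = n], (rule dfn_app1[OF h(1) good_r0 good_r0] dfn_app1[OF rl_pc[OF a] good_r0 good_r0] dfn_all)+)
    show "pc ?a 0 = h 0" using h(2)[of 0] pc_0[OF a] len_eq_0 by simp
    fix n assume "pc ?a n = h n"
    then have "pc ?a (n + 1) = snoc (par (h (n + 1))) (lst (h (n + 1)))" using pc_Suc[OF a] par by simp
    also have "\<dots> = h (n + 1)" using string_cases[of "h (n + 1)"] nz by auto
    finally show "pc ?a (n + 1) = h (n + 1)" .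
  qed
  moreover have "bin ?a" unfolding bin_def using string_cases[of "h (_ + 1)"] nz two_cases by (metis lst_snoc)
  ultimately show ?thesis using a h(3) unfolding path_def by auto
qed

theorem HBCh_WKLh: "HBCh \<Longrightarrow> WKLh"
  unfolding WKLh_def
proof (intro allI impI)
  assume HBC: HBCh
  fix T assume T: "rl r1 T" and tr: "tree T \<and> infin T"
  show "\<exists>a. rl r1 a \<and> path a T"
  proof (rule ccontr)
    assume np: "\<not> ?thesis"
    have "\<exists>n. pos (Ut T n X)" if "real X" for X using path_of_point[OF T that] np by blast
    moreover have "\<not> ltr X zr \<and> \<not> ltr on X" if "\<not> pos (Dunit X)" for X
    proof -
      have "\<bar>qv (X n) - 1 / 2\<bar> - 1 / 2 \<le> 2 * ip n" for n using that unfolding pos_ip qv_Dunit by (auto simp: not_less)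
      moreover have "- x \<le> \<bar>x - 1 / 2\<bar> - 1 / 2" "x - 1 \<le> \<bar>x - 1 / 2\<bar> - 1 / 2" for x :: "'n mint fract"
        by (simp_all add: abs_if)
      ultimately have "- qv (X n) \<le> 2 * ip n" "qv (X n) - 1 \<le> 2 * ip n" for n by (meson order_trans)+
      then show ?thesis unfolding ltr_ip zr_def on_def cst_def qv_0 qv_1 by (auto simp: not_less)
    qed
    ultimately obtain n0 where n0: "\<And>X. real X \<Longrightarrow> \<not> pos (Dunit X) \<Longrightarrow> \<exists>n. (n < n0 \<or> n = n0) \<and> pos (Ut T n X)"
      using HBC[unfolded HBCh_def, rule_format, OF rl_Dunit rl_Ut[OF T]] opn_Dunit opn_Ut[OF T] by blast
    obtain s where s: "len s = n0" "T s = 1" using tr by (auto simp: infin_def)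
    \<comment> \<open>For every \<open>n \<le> n0\<close>, the center of a string of length
      \<open>n0\<close> lies within \<open>w n\<close> of the center of its prefix of length
      \<open>n\<close>, so it avoids each of these sets \<open>Ut T n\<close>.\<close>
    let ?X = "\<lambda>k::'n. cc s"
    have "real ?X" by (auto simp: isr_ip intro!: rl_lam dfn_num dfn_good)
    moreover have "\<bar>ctr s - 1 / 2\<bar> \<le> 1 / 2" unfolding abs_le_iff using ctr_bounds[of s] by linarith
    then have "\<bar>ctr s - 1 / 2\<bar> - 1 / 2 \<le> 2 * ip n" for n using ip_pos[of n] by linarith
    then have "\<not> pos (Dunit ?X)" unfolding pos_ip qv_Dunit ctr_def[symmetric] by (simp add: not_less)
    ultimately obtain n where n: "n \<le> n0" "pos (Ut T n ?X)" using n0 by (auto simp: le_less)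
    let ?t = "cut (n0 - n) s"
    have "n0 - n \<le> n0" using n(1) by (metis le_add_diff_inverse add.commute le_add1 zero_least add_increasing2 order_refl)
    then have "len ?t + (n0 - n) = n + (n0 - n)" using len_cut[of "n0 - n" s] s n(1) by simp
    then have l: "len ?t = n" by simp
    moreover have "T ?t = 1" using tr s unfolding tree_def by blast
    moreover have "?t < p2 (n + 1)" using len_bound[of ?t] l less_add_one[of ?t] by (metis less_trans)
    ultimately have "qv (M T n (cc s) (p2 (n + 1))) \<le> \<bar>ctr s - ctr ?t\<bar>"
      using M_le[OF T, of ?t "p2 (n + 1)" n "cc s"] by (simp add: ctr_def)
    also have "\<dots> \<le> w n" using ctr_cut[of "n0 - n" s] l by simp
    finally have "qv (M T n (cc s) (p2 (n + 1))) \<le> w n" .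
    moreover obtain m where "2 * ip m < qv (M T n (cc s) (p2 (n + 1))) - w n"
      using n(2) unfolding pos_ip qv_Ut[OF T] by blast
    ultimately show False using ip_pos[of m] by linarith
  qed
qed

section \<open>Weak Koenig's lemma implies the covering theorem\<close>

lemma minus_le [simp]: "(a::'n) - b \<le> a"
  by (cases "b \<le> a") (metis le_add1 le_add_diff_inverse add.commute le_add_same_cancel1 zero_least, metis minus_0_iff linear zero_least)

lemma nfst_le: "nfst z \<le> z"
  by (simp add: nfst_def)

lemma dfn_app3: "rl (rfun A (rfun A' (rfun C E))) h \<Longrightarrow> good A \<Longrightarrow> good A' \<Longrightarrow> good C \<Longrightarrow> good E \<Longrightarrow>
    dfn G A x \<Longrightarrow> dfn G A' y \<Longrightarrow> dfn G C z \<Longrightarrow> dfn G E (\<lambda>c. h (x c) (y c) (z c))"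
  by (rule dfn_app[where x = z], rule dfn_app2[where h = h]) auto

abbreviation dec2 :: "('n \<Rightarrow> 'n \<Rightarrow> bool) \<Rightarrow> bool" where
  "dec2 P \<equiv> pd (ccons r0 (ccons r0 cnil)) (\<lambda>c. P (fst (snd c)) (fst c))"

lemma dec2_app: "dec2 P \<Longrightarrow> dfn G r0 x \<Longrightarrow> dfn G r0 y \<Longrightarrow> pd G (\<lambda>c. P (x c) (y c))"
  unfolding pd_def by (rule dfn_app2[where h = "\<lambda>m n. if P m n then 0 else 1"], rule rl_lam2) auto

subsection \<open>Separation\<close>

context
  fixes a :: "'n \<Rightarrow> 'n"
  assumes a: "rl r1 a" and bin: "bin a"
begin

lemma bin_le_1: "a k \<le> 1"
  using bin unfolding bin_def by (metis order_refl zero_least)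

lemma len_pc: "len (pc a n) = n"
  by (rule num_induct[where n = n], (rule dfn_app1[OF rl_pc[OF a] good_r0 good_r0] dfn_all)+)
    (simp_all add: a pc_Suc bin_le_1)

lemma cut_pc: "cut k (pc a (m + k)) = pc a m"
proof (rule num_induct[where n = k], (rule dfn_app1[OF rl_pc[OF a] good_r0 good_r0] dfn_all)+)
  fix k assume "cut k (pc a (m + k)) = pc a m"
  moreover have "m + (k + 1) = m + k + 1" by (simp only: ac_simps)
  ultimately show "cut (k + 1) (pc a (m + (k + 1))) = pc a m" by (simp add: a pc_Suc bin_le_1)
qed simp

end

text \<open>\<open>r\<close> is an initial segment, and its last bit has position
  \<open>len r - 1\<close>. That bit must not contradict an event of \<open>P\<close> (asking for 1)
  or of \<open>Q\<close> (asking for 0) from before stage \<open>n\<close>; the empty string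
  passes.\<close>

definition agrees where
  "agrees P Q r n \<longleftrightarrow> r = 0 \<or> (\<forall>s<n. (P (len r - 1) s \<longrightarrow> lst r = 1) \<and> (Q (len r - 1) s \<longrightarrow> lst r = 0))"

text \<open>Separation of disjoint existential predicates by weak Koenig's lemma: a string stays in
  the tree as long as no event with a stage below its own length refutes it.\<close>

lemma separation:
  assumes WKL: WKLh and P: "dec2 P" and Q: "dec2 Q" and disj: "\<And>j s t. P j s \<Longrightarrow> Q j t \<Longrightarrow> False"
  obtains b where "rl r1 b" "bin b" "\<And>j s. P j s \<Longrightarrow> b j = 1" "\<And>j s. Q j s \<Longrightarrow> b j = 0"
proof -
  \<comment> \<open>Cuts by more than \<open>\<sigma>\<close> bits give the empty string, so
    bounding \<open>k\<close> by the code loses no initial segment.\<close>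
  define T where "T \<sigma> = (if \<forall>k\<le>\<sigma>. agrees P Q (cut k \<sigma>) (len \<sigma>) then 1 else (0::'n))" for \<sigma>
  have T: "rl r1 T" unfolding T_def agrees_def
    by (rule rl_lam, (rule pd_bdd dec2_app[OF P] dec2_app[OF Q] dfn_lst dfn_all)+)
  have T1: "T \<sigma> = 1 \<longleftrightarrow> (\<forall>k\<le>\<sigma>. agrees P Q (cut k \<sigma>) (len \<sigma>))" for \<sigma> by (simp add: T_def)
  have mono: "agrees P Q r m" if "agrees P Q r n" "m \<le> n" for r m n
    using that unfolding agrees_def by (meson less_le_trans)
  have "tree T" unfolding tree_def
  proof (intro conjI allI impI)
    show "bin T" by (simp add: bin_def T_def)
    fix s t assume "(\<exists>k. s = cut k t) \<and> T t = 1"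
    then obtain j where j: "s = cut j t" "\<And>k. k \<le> t \<Longrightarrow> agrees P Q (cut k t) (len t)" using T1 by blast
    have "agrees P Q (cut k s) (len s)" for k
    proof (cases "k + j \<le> t")
      case True
      then show ?thesis using mono[OF j(2)[OF True] len_cut_le[of j t]] by (simp add: cut_cut j(1))
    next
      case False
      then have "cut k s = 0" using cut_ge[of t "k + j"] j by (simp add: cut_cut)
      then show ?thesis by (simp add: agrees_def)
    qed
    then show "T s = 1" using T1 by blast
  qed
  moreover have "infin T" unfolding infin_def
  proof
    fix n
    \<comment> \<open>Below a fixed stage \<open>n\<close> the events are decidable, which yields a
      string of length \<open>n\<close> in the tree outright.\<close>
    let ?a = "\<lambda>j. if \<exists>s<n. P j s then 1 else 0"
    have a: "rl r1 ?a" by (rule rl_lam, (rule pd_bdd dec2_app[OF P] dfn_all)+)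
    have b: "bin ?a" by (simp add: bin_def)
    have "agrees P Q (cut k (pc ?a n)) n" for k
    proof (cases "k < n")
      case True
      then obtain d where d: "n = d + k" by (metis le_add_diff_inverse add.commute less_imp_le)
      then have "d \<noteq> 0" using True by auto
      then obtain m where m: "d = m + 1" using num_cases by blast
      then have "cut k (pc ?a n) = snoc (pc ?a m) (?a m)" using cut_pc[OF a b] d pc_Suc[OF a] by simp
      moreover have "len (cut k (pc ?a n)) = m + 1" using cut_pc[OF a b] d m len_pc[OF a b] by simp
      ultimately show ?thesis unfolding agrees_def using lst_snoc[OF bin_le_1[OF a b], of "pc ?a m" m] disj by simp blast
    next
      case False
      then obtain d where "k = d + n" by (metis le_add_diff_inverse add.commute not_less)
      then have "cut k (pc ?a n) = 0" using cut_pc[OF a b, of n 0] cut_cut[of d n "pc ?a n"] pc_0[OF a] by simp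
      then show ?thesis by (simp add: agrees_def)
    qed
    then show "\<exists>s. len s = n \<and> T s = 1" unfolding T1 by (intro exI[of _ "pc ?a n"]) (simp add: len_pc[OF a b])
  qed
  ultimately obtain b where b: "rl r1 b" "bin b" and p: "\<And>n. T (pc b n) = 1"
    using WKL T unfolding WKLh_def path_def by blast
  \<comment> \<open>A prefix of length \<open>j + 1 + s\<close> tests bit \<open>j\<close> against
    all stages below its own length; letting it grow covers every stage.\<close>
  have ag: "agrees P Q (pc b (j + 1)) (j + 1 + s)" for j s
  proof -
    have "s \<le> pc b (j + 1 + s)" using len_le[of "pc b (j + 1 + s)"] len_pc[OF b, of "j + 1 + s"]
      by (metis add.commute le_add_same_cancel1 order_trans zero_least)
    then show ?thesis using p[of "j + 1 + s"] cut_pc[OF b, of s "j + 1"] len_pc[OF b] T1 by metis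
  qed
  have nz: "pc b (j + 1) \<noteq> 0" for j by (simp add: pc_Suc b)
  have l: "lst (pc b (j + 1)) = b j" "len (pc b (j + 1)) - 1 = j" for j
    by (simp_all add: pc_Suc[OF b(1)] bin_le_1[OF b] len_pc[OF b])
  have s: "s < j + 1 + (s + 1)" for s j :: 'n
  proof -
    have "s < s + 1" by (rule less_add_one)
    also have "s + 1 \<le> j + 1 + (s + 1)" by simp
    finally show ?thesis .
  qed
  have "(P j s \<longrightarrow> b j = 1) \<and> (Q j s \<longrightarrow> b j = 0)" for j s
    using ag[of j "s + 1"] nz s[of s j] unfolding agrees_def l by blast
  then show thesis using that b by blast
qed

subsection \<open>Comprehension from an unbounded functional\<close>

text \<open>Comprehension for existential predicates; \<open>cluster\<close> applies it twice to
  decide whether something happens for arbitrarily large numbers.\<close>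

definition CA :: bool where
  "CA \<longleftrightarrow> (\<forall>P. dec2 P \<longrightarrow> (\<exists>b. rl r1 b \<and> (\<forall>i. b i = 0 \<longleftrightarrow> (\<exists>s. P i s))))"

lemma comprehension: "CA \<Longrightarrow> dec2 P \<Longrightarrow> \<exists>b. rl r1 b \<and> (\<forall>i. b i = 0 \<longleftrightarrow> (\<exists>s. P i s))"
  unfolding CA_def by blast

lemma ternary_cases: "(d::'n) \<le> 2 \<Longrightarrow> d = 0 \<or> d = 1 \<or> d = 2"
proof -
  assume "d \<le> 2"
  then consider "d = 2" | "d < 1 + 1" unfolding one_add_one le_less by blast
  then show ?thesis unfolding less_succ using two_cases by cases blast+
qed

text \<open>If the event \<open>P i\<close> first occurs at stage \<open>s\<close>, then \<open>e i\<close> equals \<open>g s\<close>, so \<open>\<Psi> (e i)\<close> bounds the stage.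
  Separation finds such an \<open>e\<close> without deciding whether the event occurs; two bits code a ternary digit.\<close>

lemma unbounded_CA:
  assumes WKL: WKLh and g: "rl (rfun r0 r1) g" "\<And>n k. g n k \<le> 2"
    and \<Psi>: "rl (rfun r1 r0) \<Psi>" "\<And>n. n \<le> \<Psi> (g n)"
  shows CA
  unfolding CA_def
proof (intro allI impI)
  fix P assume P: "dec2 P"
  \<comment> \<open>Only the first stage counts. At most one \<open>s\<close> then speaks for each
    \<open>i\<close>, which makes the two predicates to be separated disjoint.\<close>
  define F where "F i s \<longleftrightarrow> P i s \<and> (\<forall>t<s. \<not> P i t)" for i s
  \<comment> \<open>\<open>j\<close> codes \<open>i\<close>, a position \<open>k\<close> and a
    threshold \<open>v\<close>; digit \<open>k\<close> of \<open>g s\<close> is compared with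
    \<open>v\<close>. A digit up to 2 is the number of those thresholds among 0 and 1 that it
    exceeds.\<close>
  define Q where "Q j s \<longleftrightarrow> nsnd (nsnd j) < g s (nfst (nsnd j))" for j s
  have F: "dec2 F" unfolding F_def by (rule pd_bdd dec2_app[OF P] dfn_all)+
  have Q: "dec2 Q" unfolding Q_def by (rule dfn_app2[OF g(1) good_r0 good_r0 good_r0] dfn_all)+
  have uniq: "s = t" if "F i s" "F i t" for i s t using that unfolding F_def by (meson linorder_neqE)
  obtain b where b: "rl r1 b" "bin b" and b1: "\<And>j s. F (nfst j) s \<and> Q j s \<Longrightarrow> b j = 1"
      and b0: "\<And>j s. F (nfst j) s \<and> \<not> Q j s \<Longrightarrow> b j = 0"
  proof (rule separation[OF WKL, of "\<lambda>j s. F (nfst j) s \<and> Q j s" "\<lambda>j s. F (nfst j) s \<and> \<not> Q j s"])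
    show "dec2 (\<lambda>j s. F (nfst j) s \<and> Q j s)" "dec2 (\<lambda>j s. F (nfst j) s \<and> \<not> Q j s)"
      by (rule dec2_app[OF F] dec2_app[OF Q] dfn_all)+
  qed (use uniq in blast)+
  define e where "e i k = b (pair i (pair k 0)) + b (pair i (pair k 1))" for i k
  have e: "rl (rfun r0 r1) e" unfolding e_def
    by (rule rl_lam2) (rule dfn_app1[OF b(1) good_r0 good_r0] dfn_all)+
  have eg: "e i = g s" if "F i s" for i s
  proof
    fix k
    have d: "b (pair i (pair k v)) = (if v < g s k then 1 else 0)" for v
      using b1[of "pair i (pair k v)" s] b0[of "pair i (pair k v)" s] that by (auto simp: Q_def)
    show "e i k = g s k" using ternary_cases[OF g(2), of s k] unfolding e_def d by (elim disjE) simp_all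
  qed
  have "rl r1 (\<lambda>i. if \<exists>s\<le>\<Psi> (e i). P i s then 0 else 1)"
    by (rule rl_lam) (rule dec2_app[OF P] pd_bdd dfn_app1[OF \<Psi>(1)] dfn_app1[OF e] dfn_all)+
  moreover have "(\<exists>s\<le>\<Psi> (e i). P i s) \<longleftrightarrow> (\<exists>s. P i s)" for i
  proof
    assume "\<exists>s. P i s"
    then obtain s where "P i s" by blast
    moreover have "dec (P i)" by (rule dec2_app[OF P] dfn_all)+
    ultimately obtain t where "P i t" "\<forall>k<t. \<not> P i k" using num_least[of "P i" s] by blast
    then have "F i t" by (simp add: F_def)
    then show "\<exists>s\<le>\<Psi> (e i). P i s" using \<Psi>(2)[of t] eg \<open>P i t\<close> by auto
  qed blast
  ultimately show "\<exists>b. rl r1 b \<and> (\<forall>i. b i = 0 \<longleftrightarrow> (\<exists>s. P i s))"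
    by (intro exI[of _ "\<lambda>i. if \<exists>s\<le>\<Psi> (e i). P i s then 0 else 1"]) auto
qed

text \<open>Koenig's argument: follow the prefixes that recur for arbitrarily large indices.
  Recurrence has two number quantifiers, hence two uses of comprehension.\<close>

lemma cluster:
  assumes CA and g: "rl (rfun r0 r1) g" "\<And>n k. g n k \<le> 2"
  obtains h \<nu> where "rl r1 h" "rl r1 \<nu>" "\<And>j. j \<le> \<nu> j" "\<And>j k. k < j \<Longrightarrow> g (\<nu> j) k = h k"
proof -
  \<comment> \<open>\<open>c n j\<close> codes the first \<open>j\<close> digits of
    \<open>g n\<close> by iterated pairing.\<close>
  define c where "c n j = prc (\<lambda>k r. pair r (g n k)) 0 j" for n j
  note dg = dfn_app2[OF g(1) good_r0 good_r0 good_r0]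
  have f: "rl (rfun r0 r1) (\<lambda>k r. pair r (g n k))" for n
    by (rule rl_lam2) (rule dg dfn_all)+
  have c0: "c n 0 = 0" and cS: "c n (j + 1) = pair (c n j) (g n j)" for n j
    unfolding c_def by (simp_all only: prc_0[OF f] prc_Suc[OF f])
  have "rl (rfun r0 r1) c" unfolding c_def by (rule rl_lam2) (rule dfn_lam dg dfn_all)+
  note dc = dfn_app2[OF this good_r0 good_r0 good_r0]
  have "dec2 (\<lambda>i n. nsnd (nsnd i) \<le> n \<and> c n (nfst (nsnd i)) = nfst i)" by (rule dc dfn_all)+
  from comprehension[OF \<open>CA\<close> this] obtain b1 where b1: "rl r1 b1"
      "\<And>i. b1 i = 0 \<longleftrightarrow> (\<exists>n. nsnd (nsnd i) \<le> n \<and> c n (nfst (nsnd i)) = nfst i)"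
    by blast
  have "dec2 (\<lambda>i m. b1 (pair (nfst i) (pair (nsnd i) m)) \<noteq> 0)"
    by (rule dfn_app1[OF b1(1) good_r0 good_r0] dfn_all)+
  from comprehension[OF \<open>CA\<close> this] obtain b2 where b2: "rl r1 b2"
      "\<And>i. b2 i = 0 \<longleftrightarrow> (\<exists>m. b1 (pair (nfst i) (pair (nsnd i) m)) \<noteq> 0)"
    by blast
  note db = dfn_app1[OF b2(1) good_r0 good_r0]
  \<comment> \<open>A nonzero value of \<open>b2\<close> says that the prefix coded by
    \<open>\<sigma>\<close> recurs for arbitrarily large \<open>n\<close>.\<close>
  have b: "b2 (pair \<sigma> j) \<noteq> 0 \<longleftrightarrow> (\<forall>m. \<exists>n\<ge>m. c n j = \<sigma>)" for \<sigma> j by (simp add: b1 b2)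
  define d where "d j r = (if b2 (pair (pair r 0) (j + 1)) \<noteq> 0 then 0 else
    if b2 (pair (pair r 1) (j + 1)) \<noteq> 0 then 1 else (2::'n))" for j r
  have "rl (rfun r0 r1) d" unfolding d_def by (rule rl_lam2) (rule db dfn_all)+
  note dd = dfn_app2[OF this good_r0 good_r0 good_r0]
  define S where "S j = prc (\<lambda>j r. pair r (d j r)) 0 j" for j
  have f: "rl (rfun r0 r1) (\<lambda>j r. pair r (d j r))" by (rule rl_lam2) (rule dd dfn_all)+
  have S0: "S 0 = 0" and SS: "S (j + 1) = pair (S j) (d j (S j))" for j
    unfolding S_def by (simp_all only: prc_0[OF f] prc_Suc[OF f])
  have "rl r1 S" unfolding S_def by (rule rl_lam) (rule dfn_lam dd dfn_all)+
  note dS = dfn_app1[OF this good_r0 good_r0]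
  have inf: "b2 (pair (S j) j) \<noteq> 0" for j
  proof (rule num_induct[where n = j], (rule db dS dfn_all)+)
    show "b2 (pair (S 0) 0) \<noteq> 0" unfolding b by (auto simp: S0 c0)
    fix j assume "b2 (pair (S j) j) \<noteq> 0"
    then have j: "\<And>m. \<exists>n\<ge>m. c n j = S j" unfolding b by blast
    show "b2 (pair (S (j + 1)) (j + 1)) \<noteq> 0"
    proof (rule ccontr)
      assume *: "\<not> ?thesis"
      then have "b2 (pair (pair (S j) v) (j + 1)) = 0" if "v = 0 \<or> v = 1 \<or> v = 2" for v
        using that unfolding SS d_def by (auto split: if_splits)
      then have "\<exists>m. \<forall>n\<ge>m. c n (j + 1) \<noteq> pair (S j) v" if "v = 0 \<or> v = 1 \<or> v = 2" for v
        using that b[of "pair (S j) v" "j + 1"] by metis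
      then obtain m0 m1 m2 where m: "\<forall>n\<ge>m0. c n (j + 1) \<noteq> pair (S j) 0" "\<forall>n\<ge>m1. c n (j + 1) \<noteq> pair (S j) 1"
          "\<forall>n\<ge>m2. c n (j + 1) \<noteq> pair (S j) 2" by metis
      \<comment> \<open>Beyond all three bounds the prefix recurs once more, and its next digit
        contradicts one of them.\<close>
      obtain n where n: "max m0 (max m1 m2) \<le> n" "c n j = S j" using j by blast
      then have "c n (j + 1) = pair (S j) (g n j)" by (simp add: cS)
      then show False using ternary_cases[OF g(2), of n j] m n(1) by auto
    qed
  qed
  have "dec2 (\<lambda>j n. j \<le> n \<and> c n j = S j)" by (rule dc dS dfn_all)+
  moreover have "\<exists>n\<ge>j. c n j = S j" for j using inf[of j] unfolding b by blast
  ultimately obtain \<nu> where \<nu>: "rl r1 \<nu>" "\<And>j. j \<le> \<nu> j" "\<And>j. c (\<nu> j) j = S j"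
    using choice_00[of "\<lambda>j n. j \<le> n \<and> c n j = S j"] by blast
  define h where "h j = nsnd (S (j + 1))" for j
  have h: "rl r1 h" unfolding h_def by (rule rl_lam) (rule dS dfn_all)+
  have "c n j = S j \<longrightarrow> (\<forall>k<j. g n k = h k)" for n j
  proof (rule num_induct[where n = j], (rule pd_bdd dc dS dg dfn_app1[OF h] dfn_all)+)
    fix j assume IH: "c n j = S j \<longrightarrow> (\<forall>k<j. g n k = h k)"
    show "c n (j + 1) = S (j + 1) \<longrightarrow> (\<forall>k<j + 1. g n k = h k)"
    proof
      assume "c n (j + 1) = S (j + 1)"
      then have "pair (c n j) (g n j) = pair (S j) (d j (S j))" unfolding cS SS .
      then have "c n j = S j" "g n j = h j" unfolding h_def SS by (metis nfst_pair, metis nsnd_pair)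
      then show "\<forall>k<j + 1. g n k = h k" using IH by (auto simp: less_succ le_less)
    qed
  qed simp
  then show thesis using that[OF h \<nu>(1,2)] \<nu>(3) by blast
qed

text \<open>Grilliot's trick: \<open>f p\<close> is \<open>g (\<nu> s)\<close> when \<open>s\<close> is the first zero of \<open>p\<close>, whence \<open>\<Psi> (f p)\<close> bounds
  the search for a zero.\<close>

lemma grilliot:
  assumes g: "rl (rfun r0 r1) g" and \<Psi>: "rl (rfun r1 r0) \<Psi>" "\<And>n. n \<le> \<Psi> (g n)"
    and \<nu>: "rl r1 \<nu>" "\<And>j. j \<le> \<nu> j" "\<And>j k. k < j \<Longrightarrow> g (\<nu> j) k = h k"
  obtains E where "rl (rfun r1 r0) E" "\<And>p. rl r1 p \<Longrightarrow> E p = 0 \<longleftrightarrow> (\<exists>s. p s = 0)"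
proof -
  \<comment> \<open>\<open>L p k\<close> is the smaller of \<open>k\<close> and the first zero of
    \<open>p\<close>. So \<open>f p\<close> follows \<open>h\<close> as long as no zero has shown
    up, and \<open>g (\<nu> s)\<close> from the first zero \<open>s\<close> on; the two agree before
    \<open>s\<close>.\<close>
  define L where "L p k = prc (\<lambda>s r. if r = s \<and> p s \<noteq> 0 then s + 1 else r) 0 k" for p :: "'n \<Rightarrow> 'n" and k
  define f where "f p k = g (\<nu> (L p (k + 1))) k" for p k
  have st: "rl (rfun r0 r1) (\<lambda>s r. if r = s \<and> p s \<noteq> 0 then s + 1 else r)" if "rl r1 p" for p
    by (rule rl_lam2) (rule dfn_app1[OF that] dfn_all)+
  have L: "rl (rfun r1 r1) L" unfolding L_def by (rule rl_lam2) (rule dfn_lam dfn_all)+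
  have f: "rl (rfun r1 r1) f" unfolding f_def
    by (rule rl_lam2) (rule dfn_app2[OF g] dfn_app1[OF \<nu>(1)] dfn_app2[OF L] dfn_all)+
  have fz: "f p = g (\<nu> s)" if p: "rl r1 p" and s: "p s = 0" "\<forall>t<s. p t \<noteq> 0" for p s
  proof
    fix k
    have "L p k = (if k \<le> s then k else s)" for k
    proof (rule num_induct[where n = k], (rule dfn_app2[OF L] dfn_app1[OF p] dfn_const[OF good_rfun[OF good_r0 good_r0] p] dfn_all)+)
      fix k assume "L p k = (if k \<le> s then k else s)"
      moreover have "L p (k + 1) = (if L p k = k \<and> p k \<noteq> 0 then k + 1 else L p k)"
        unfolding L_def by (simp only: prc_Suc[OF st[OF p]])
      ultimately show "L p (k + 1) = (if k + 1 \<le> s then k + 1 else s)" using s by (auto simp: Suc_le_mnat not_le)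
    qed (simp add: L_def prc_0[OF st[OF p]])
    then show "f p k = g (\<nu> s) k" using \<nu>(3)[of k "k + 1"] \<nu>(3)[of k s] by (auto simp: f_def Suc_le_mnat less_add_one)
  qed
  have "rl (rfun r1 r0) (\<lambda>p. if \<exists>s\<le>\<Psi> (f p). p s = 0 then 0 else 1)"
    by (rule rl_lam) (rule pd_bdd dfn_app1[OF \<Psi>(1)] dfn_app1[OF f] dfn_all)+
  moreover have "(\<exists>s\<le>\<Psi> (f p). p s = 0) \<longleftrightarrow> (\<exists>s. p s = 0)" if p: "rl r1 p" for p
  proof
    assume "\<exists>s. p s = 0"
    then obtain s0 where "p s0 = 0" by blast
    moreover have "dec (\<lambda>s. p s = 0)" by (rule dfn_app1[OF p] dfn_all)+
    ultimately obtain s where s: "p s = 0" "\<forall>t<s. p t \<noteq> 0" using num_least[of "\<lambda>s. p s = 0" s0] by blast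
    then have "s \<le> \<Psi> (f p)" using fz[OF p] \<Psi>(2)[of "\<nu> s"] \<nu>(2)[of s] by auto
    then show "\<exists>s\<le>\<Psi> (f p). p s = 0" using s by blast
  qed blast
  ultimately show thesis using that by (auto split: if_splits)
qed

subsection \<open>Ternary expansions\<close>

text \<open>Clipping lets every sequence of numbers count as an expansion, so that quantifiers over
  expansions run over all of type 1.\<close>

definition cl :: "'n \<Rightarrow> 'n" where "cl d = (if d \<le> 2 then d else 2)"
definition At where "At e k = prc (\<lambda>j r. r + r + cl (e j)) 0 k"
text \<open>Digit \<open>e j\<close> has weight 1 / 2 ^ (j + 2), so the values lie between 0 and 1.
  Three digits in base 2 make the representation redundant.\<close>

definition rr :: "('n \<Rightarrow> 'n) \<Rightarrow> 'n \<Rightarrow> 'n" where "rr e k = qdiff (At e k) 0 (2 * p2 k - 1)"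

lemma cl_le [simp]: "cl d \<le> 2" and cl_id [simp]: "d \<le> 2 \<Longrightarrow> cl d = d"
  by (simp_all add: cl_def)

lemma dfn_cl: "dfn G r0 d \<Longrightarrow> dfn G r0 (\<lambda>c. cl (d c))"
  unfolding cl_def by (rule dfn_all | assumption)+

lemma rl_At: "rl (rfun r1 r1) At" and rl_rr: "rl (rfun r1 r1) rr"
  unfolding At_def rr_def by (rule rl_lam2; (rule dfn_lam dfn_cl dfn_all)+)+

lemma rl_At_step: "rl r1 e \<Longrightarrow> rl (rfun r0 r1) (\<lambda>j r. r + r + cl (e j))"
proof -
  assume "rl r1 e"
  show ?thesis by (rule rl_lam2) (rule dfn_cl dfn_app1[OF \<open>rl r1 e\<close>] dfn_all)+
qed

lemma At_0: "rl r1 e \<Longrightarrow> At e 0 = 0"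
  and At_Suc: "rl r1 e \<Longrightarrow> At e (k + 1) = At e k + At e k + cl (e k)"
  unfolding At_def by (simp_all only: prc_0[OF rl_At_step] prc_Suc[OF rl_At_step])

lemma qv_rr: "qv (rr e k) = fr (At e k) * ip k / 2"
proof -
  have "1 \<le> 2 * p2 k" unfolding mnat_ge_1 by (simp add: mult_2 add_pos_pos)
  then show ?thesis by (simp add: rr_def qv_qdiff fr_minus ip_def P2_def)
qed

lemma qv_rr_Suc: "rl r1 e \<Longrightarrow> qv (rr e (k + 1)) = qv (rr e k) + fr (cl (e k)) * ip k / 4"
  by (simp only: qv_rr At_Suc ip_Suc fr_simps) (simp add: field_simps)

lemma fr_cl: "0 \<le> fr (cl d) \<and> fr (cl d) \<le> (2 :: 'n mint fract)"
  using fr_simps(5)[of "cl d" 2] by simp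

lemma real_rr:
  assumes e: "rl r1 e" shows "real (rr e)"
proof -
  note d = dfn_app2[OF rl_rr] dfn_const[OF good_rfun[OF good_r0 good_r0] e]
  \<comment> \<open>The increment at position \<open>k\<close> is at most \<open>ip k / 2\<close>,
    which is \<open>ip k - ip (k + 1)\<close>; the telescoped bound yields the strict inequality
    that \<open>isr\<close> demands.\<close>
  have "qv (rr e n) \<le> qv (rr e (n + i)) \<and> qv (qminus (rr e (n + i)) (rr e n)) \<le> qv (qminus (qpow 1 n) (qpow 1 (n + i)))" for n i
  proof (rule num_induct[where n = i], (rule d dfn_all)+)
    fix i assume "qv (rr e n) \<le> qv (rr e (n + i)) \<and> qv (qminus (rr e (n + i)) (rr e n)) \<le> qv (qminus (qpow 1 n) (qpow 1 (n + i)))"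
    moreover have "0 \<le> fr (cl (e (n + i))) * ip (n + i) \<and> fr (cl (e (n + i))) * ip (n + i) \<le> 2 * ip (n + i)"
      using fr_cl[of "e (n + i)"] ip_pos[of "n + i"]
      by (intro conjI mult_nonneg_nonneg mult_right_mono) (simp_all add: less_imp_le)
    moreover have "n + (i + 1) = n + i + 1" by (simp only: ac_simps)
    ultimately show "qv (rr e n) \<le> qv (rr e (n + (i + 1))) \<and>
        qv (qminus (rr e (n + (i + 1))) (rr e n)) \<le> qv (qminus (qpow 1 n) (qpow 1 (n + (i + 1))))"
      by (simp add: qv_qminus qv_qpow qv_rr_Suc[OF e] ip_Suc[unfolded ip_def] ip_def)
  qed (simp add: qv_qminus)
  then have "\<bar>qv (rr e n) - qv (rr e (n + i))\<bar> \<le> ip n - ip (n + i)" for n i by (simp add: qv_qminus qv_qpow ip_def abs_minus_commute[of "qv (rr e n)"])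
  then have "\<bar>qv (rr e n) - qv (rr e (n + i))\<bar> < ip n" for n i
    using ip_pos[of "n + i"] by (meson le_less_trans diff_less_eq less_add_same_cancel1)
  then show ?thesis unfolding isr_ip using rl_app[OF rl_rr e] by blast
qed

lemma rr_agree:
  assumes "rl r1 e" "rl r1 e'" "\<And>k. k < j \<Longrightarrow> cl (e k) = cl (e' k)"
  shows "rr e j = rr e' j"
proof -
  note d = dfn_app2[OF rl_At] assms(1,2)[THEN dfn_const[OF good_rfun[OF good_r0 good_r0]]]
  have "k \<le> j \<longrightarrow> At e k = At e' k" for k
    by (rule num_induct[where n = k], (rule d dfn_all)+)
      (use assms in \<open>auto simp: At_0 At_Suc Suc_le_mnat less_imp_le\<close>)
  then show ?thesis by (simp add: rr_def)
qed

lemma eqr_close: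
  assumes X: "isr X" and Y: "isr Y" and c: "\<And>m. \<bar>qv (X m) - qv (Y m)\<bar> \<le> 3 * ip m"
  shows "eqr X Y"
  unfolding eqr_ip
proof (rule allI, rule ccontr)
  fix n assume "\<not> \<bar>qv (X n) - qv (Y n)\<bar> \<le> 2 * ip n"
  \<comment> \<open>Comparison at a far index \<open>m\<close> costs \<open>2 * ip n\<close> for the
    drifts at \<open>n\<close> and \<open>5 * ip m\<close> for everything else, which is to be
    smaller than the supposed excess.\<close>
  then have "0 < (\<bar>qv (X n) - qv (Y n)\<bar> - 2 * ip n) / 5" by simp
  then obtain m where "ip m < (\<bar>qv (X n) - qv (Y n)\<bar> - 2 * ip n) / 5" using ip_small by blast
  then have "5 * ip m < \<bar>qv (X n) - qv (Y n)\<bar> - 2 * ip n" by (simp add: less_divide_eq mult.commute)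
  moreover have "\<bar>qv (X n) - qv (Y n)\<bar> \<le> \<bar>qv (X n) - qv (X m)\<bar> + \<bar>qv (X m) - qv (Y m)\<bar> + \<bar>qv (Y m) - qv (Y n)\<bar>"
    by linarith
  ultimately show False using isr_diff2[OF X, of n m] isr_diff2[OF Y, of m n] c[of m] by linarith
qed

text \<open>Digits are read off approximations with an error of at most 1/32 of the current interval; the
  three subintervals overlap by half.\<close>

definition dgt :: "('n \<Rightarrow> 'n) \<Rightarrow> 'n \<Rightarrow> 'n \<Rightarrow> 'n" where
  "dgt X k r = (if qv (X (k + 5)) < qv (qdiff (4 * r + 3) 0 (8 * p2 k - 1)) then 0 else
    if qv (X (k + 5)) < qv (qdiff (4 * r + 5) 0 (8 * p2 k - 1)) then 1 else 2)"

lemma expansion: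
  assumes X: "real X" and lo: "\<not> ltr X zr" and hi: "\<not> ltr on X"
  obtains e where "rl r1 e" "eqr X (rr e)"
proof -
  have "rl (rfun r0 r1) (dgt X)" unfolding dgt_def
    by (rule rl_lam2) (rule dfn_app1[OF conjunct1[OF X]] dfn_all)+
  note dd = dfn_app2[OF this]
  \<comment> \<open>Numerators and digits are produced together, because a digit depends on the
    earlier digits through their numerator.\<close>
  define S where "S = prc (\<lambda>k r. r + r + dgt X k r) 0"
  have st: "rl (rfun r0 r1) (\<lambda>k r. r + r + dgt X k r)" by (rule rl_lam2) (rule dd dfn_all)+
  have S: "rl r1 S" unfolding S_def by (rule rl_lam) (rule dfn_lam dd dfn_all)+
  define e where "e k = dgt X k (S k)" for k
  have e: "rl r1 e" unfolding e_def by (rule rl_lam) (rule dd dfn_app1[OF S] dfn_all)+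
  have cl: "cl (e k) = e k" for k
  proof -
    have "(1::'n) \<le> 2" using less_add_one[of "1::'n"] by simp
    then show ?thesis by (simp add: e_def dgt_def)
  qed
  have SA: "S k = At e k" for k
  proof (rule num_induct[where n = k], (rule dfn_app1[OF S] dfn_app2[OF rl_At] dfn_const[OF good_rfun[OF good_r0 good_r0] e] dfn_all)+)
    show "S 0 = At e 0" by (simp add: S_def prc_0[OF st] At_0 e)
    fix k assume k: "S k = At e k"
    have "S (k + 1) = S k + S k + e k" unfolding e_def S_def by (simp only: prc_Suc[OF st])
    then show "S (k + 1) = At e (k + 1)" by (simp add: At_Suc e cl k)
  qed
  \<comment> \<open>The thresholds of \<open>dgt\<close> sit at 3/8 and 5/8 of the current interval:
    the midpoints of the two overlaps, an eighth away from their ends, which tolerates the error of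
    1/32.\<close>
  have q: "qv (qdiff (4 * At e k + t) 0 (8 * p2 k - 1)) = qv (rr e k) + fr t * ip k / 8" for k t
  proof -
    have "(0::'n) < 8 * p2 k" by (intro mult_pos_pos) simp_all
    then have "1 \<le> 8 * p2 k" by (simp only: mnat_ge_1)
    then show ?thesis by (simp add: qv_qdiff fr_minus qv_rr ip_def P2_def add_divide_distrib)
  qed
  \<comment> \<open>\<open>X\<close> stays in the current interval of length \<open>ip k\<close>. As
    an inequality between reals this holds up to \<open>2 * ip m\<close> at each index
    \<open>m\<close>, so \<open>m\<close> is kept fixed during the induction on
    \<open>k\<close>.\<close>
  have inv: "qv (rr e k) - 2 * ip m \<le> qv (X m) \<and> qv (X m) \<le> qv (rr e k) + ip k + 2 * ip m" for m k
  proof -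
    have "qv (qminus (rr e k) (qpow 2 m)) \<le> qv (X m) \<and> qv (qminus (X m) (qpow 1 k)) \<le> qv (qminus (rr e k) (qminus (qpow 0 0) (qpow 2 m)))"
    proof (rule num_induct[where n = k], (rule dfn_app2[OF rl_rr] dfn_const[OF good_rfun[OF good_r0 good_r0] e] dfn_all)+,
        unfold qv_qminus qv_qpow)
      have r0: "qv (rr e 0) = 0" by (simp add: qv_rr At_0 e)
      have "- (2 * ip m) \<le> qv (X m)" "qv (X m) \<le> 1 + 2 * ip m"
        using lo hi by (auto simp: ltr_ip zr_def on_def cst_def qv_0 qv_1 not_less algebra_simps minus_le_iff)
      then show "qv (rr e 0) - fr 2 / P2 m \<le> qv (X m) \<and> qv (X m) - fr 1 / P2 0 \<le> qv (rr e 0) - (fr 0 / P2 0 - fr 2 / P2 m)"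
        by (simp add: r0 ip_def)
    next
      fix k assume "qv (rr e k) - fr 2 / P2 m \<le> qv (X m) \<and> qv (X m) - fr 1 / P2 k \<le> qv (rr e k) - (fr 0 / P2 0 - fr 2 / P2 m)"
      then have IH: "qv (rr e k) - 2 * ip m \<le> qv (X m)" "qv (X m) \<le> qv (rr e k) + ip k + 2 * ip m"
        by (simp_all add: ip_def)
      have "\<bar>qv (X (k + 5)) - qv (X m)\<bar> < ip (k + 5) + ip m" using X isr_diff2 by blast
      then have d: "qv (X (k + 5)) - qv (X m) < ip k / 32 + ip m" "qv (X m) - qv (X (k + 5)) < ip k / 32 + ip m"
        by (auto simp: ip_add ip_numerals abs_less_iff)
      note pos = ip_pos[of k] ip_pos[of m]
      have "qv (rr e (k + 1)) - 2 * ip m \<le> qv (X m) \<and> qv (X m) \<le> qv (rr e (k + 1)) + ip k / 2 + 2 * ip m"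
      proof -
        consider "e k = 0" "qv (X (k + 5)) < qv (rr e k) + 3 * ip k / 8"
          | "e k = 1" "qv (rr e k) + 3 * ip k / 8 \<le> qv (X (k + 5))" "qv (X (k + 5)) < qv (rr e k) + 5 * ip k / 8"
          | "e k = 2" "qv (rr e k) + 5 * ip k / 8 \<le> qv (X (k + 5))"
          using e_def[of k] unfolding dgt_def SA q by (force simp: not_less split: if_splits)
        then show ?thesis
        proof cases
          case 1
          then show ?thesis using IH d pos unfolding qv_rr_Suc[OF e] cl by simp
        next
          case 2
          then show ?thesis using IH d pos unfolding qv_rr_Suc[OF e] cl by simp
        next
          case 3
          then show ?thesis using IH d pos unfolding qv_rr_Suc[OF e] cl by simp
        qed
      qed
      then show "qv (rr e (k + 1)) - fr 2 / P2 m \<le> qv (X m) \<and> qv (X m) - fr 1 / P2 (k + 1) \<le> qv (rr e (k + 1)) - (fr 0 / P2 0 - fr 2 / P2 m)"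
        by (simp add: ip_def P2_Suc)
    qed
    then show ?thesis by (simp add: qv_qminus qv_qpow ip_def)
  qed
  have "\<bar>qv (X m) - qv (rr e m)\<bar> \<le> 3 * ip m" for m
    using inv[of m m] ip_pos[of m] by (simp add: abs_le_iff)
  then show thesis using that[OF e] eqr_close X real_rr[OF e] by blast
qed

subsection \<open>The covering theorem\<close>

text \<open>Being a real is a universal condition, so a statement about all reals is no premise for
  quantifier-free choice. Expansions range over all of type 1, and positivity is existential with a
  witness that can be chosen along with the index.\<close>

lemma HB_expansions:
  assumes WKL: WKLh and V: "rl (rfun r0 (rfun r1 r1)) V" "\<And>n. opn (V n)"
    and cov: "\<And>e. rl r1 e \<Longrightarrow> \<exists>n. pos (V n (rr e))"
  shows "\<exists>n0. \<forall>e. rl r1 e \<longrightarrow> (\<exists>n\<le>n0. pos (V n (rr e)))"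
proof (rule ccontr)
  assume nc: "\<not> ?thesis"
  note dV = dfn_app3[OF V(1)] dfn_app1[OF rl_rr]
  let ?P = "\<lambda>e w. qv (qpow 2 (nsnd w)) < qv (V (nfst w) (rr e) (nsnd w))"
  have pos: "pos X \<longleftrightarrow> (\<exists>m. qv (qpow 2 m) < qv (X m))" for X by (simp add: pos_def qv_qpow)
  have "pd (ccons r0 (ccons r1 cnil)) (\<lambda>c. ?P (fst (snd c)) (fst c))" by (rule dV dfn_all)+
  moreover have "\<exists>w. ?P e w" if "rl r1 e" for e
    using cov[OF that] unfolding pos by (metis nfst_pair nsnd_pair)
  ultimately obtain \<Phi> where \<Phi>: "rl (rfun r1 r0) \<Phi>" "\<And>e. rl r1 e \<Longrightarrow> ?P e (\<Phi> e)"
    using choice_10[of ?P] by blast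
  have cl: "rl r1 (\<lambda>k. cl (f k))" if "rl r1 f" for f
    by (rule rl_lam) (rule dfn_cl dfn_app1[OF that] dfn_all)+
  have rr_cl: "rr (\<lambda>k. cl (f k)) = rr f" if "rl r1 f" for f
    by (rule ext, rule rr_agree[OF cl[OF that] that]) simp
  have clip: "rl (rfun r0 r1) (\<lambda>n k. cl (G n k))" if "rl (rfun r0 r1) G" for G
    by (rule rl_lam2) (rule dfn_cl dfn_app2[OF that] dfn_all)+
  have rl_n: "rl r1 (g n)" if "rl (rfun r0 r1) g" for g n using rl_app[OF that rl_0] .
  \<comment> \<open>A bound on \<open>\<Phi>\<close> over clipped sequences would bound the index
    for every expansion, since clipping does not change \<open>rr\<close>; that would be a finite
    subcover.\<close>
  have "\<exists>e. rl r1 e \<and> n \<le> \<Phi> (\<lambda>k. cl (e k))" for n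
  proof (rule ccontr)
    assume "\<not> ?thesis"
    then have "nfst (\<Phi> (\<lambda>k. cl (e k))) \<le> n" if "rl r1 e" for e
      using that nfst_le[of "\<Phi> (\<lambda>k. cl (e k))"] by (meson linear order_trans)
    moreover have "\<exists>m. qv (qpow 2 m) < qv (V (nfst (\<Phi> (\<lambda>k. cl (e k)))) (rr e) m)" if "rl r1 e" for e
      using \<Phi>(2)[OF cl[OF that]] unfolding rr_cl[OF that] by blast
    ultimately show False using nc unfolding pos by blast
  qed
  moreover have "pd (ccons r1 (ccons r0 cnil)) (\<lambda>c. fst (snd c) \<le> \<Phi> (\<lambda>k. cl (fst c k)))"
    by (rule dfn_app1[OF \<Phi>(1)] dfn_lam dfn_cl dfn_all)+
  ultimately obtain G where G: "rl (rfun r0 r1) G" "\<And>n. n \<le> \<Phi> (\<lambda>k. cl (G n k))"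
    using choice_01[of "\<lambda>n e. n \<le> \<Phi> (\<lambda>k. cl (e k))"] by blast
  then have CA using unbounded_CA[OF WKL clip _ \<Phi>(1)] cl_le by blast
  obtain h \<nu> where "rl r1 h" and h: "rl r1 \<nu>" "\<And>j. j \<le> \<nu> j" "\<And>j k. k < j \<Longrightarrow> cl (G (\<nu> j) k) = h k"
    by (rule cluster[OF \<open>CA\<close> clip[OF G(1)] cl_le]) blast
  obtain E where E: "rl (rfun r1 r0) E" "\<And>p. rl r1 p \<Longrightarrow> E p = 0 \<longleftrightarrow> (\<exists>s. p s = 0)"
    by (rule grilliot[OF clip[OF G(1)] \<Phi>(1) G(2) h], assumption, rule that)
  \<comment> \<open>Membership in a set is the existence of a zero of \<open>?p\<close>, which
    \<open>E\<close> decides; this makes the matrix of the next choice quantifier-free.\<close>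
  let ?p = "\<lambda>k e m. if qv (qpow 2 m) < qv (V k (rr e) m) then 0 else 1"
  have posE: "pos (V k (rr e)) \<longleftrightarrow> E (?p k e) = 0" if "rl r1 e" for k e
  proof -
    have "rl r1 (?p k e)"
      by (rule rl_lam) (rule dV dfn_const[OF good_rfun[OF good_r0 good_r0] that] dfn_all)+
    then show ?thesis unfolding pos by (simp add: E(2))
  qed
  have "pd (ccons r1 (ccons r0 cnil)) (\<lambda>c. \<forall>k\<le>fst (snd c). E (?p k (fst c)) \<noteq> 0)"
    by (rule pd_bdd dfn_app1[OF E(1)] dfn_lam dV dfn_all)+
  moreover have "\<exists>e. rl r1 e \<and> (\<forall>k\<le>n. E (?p k e) \<noteq> 0)" for n using nc posE by blast
  ultimately obtain F where F: "rl (rfun r0 r1) F" "\<And>n k. k \<le> n \<Longrightarrow> E (?p k (F n)) \<noteq> 0"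
    using choice_01[of "\<lambda>n e. \<forall>k\<le>n. E (?p k e) \<noteq> 0"] by blast
  then have npos: "\<not> pos (V k (rr (F n)))" if "k \<le> n" for k n using posE[OF rl_n] that by blast
  obtain x \<mu> where x: "rl r1 x" "rl r1 \<mu>" "\<And>j. j \<le> \<mu> j" "\<And>j k. k < j \<Longrightarrow> cl (F (\<mu> j) k) = x k"
    by (rule cluster[OF \<open>CA\<close> clip[OF F(1)] cl_le]) blast
  obtain k where k: "pos (V k (rr x))" using cov x by blast
  obtain r where r: "0 < qv r" "\<And>Y. real Y \<Longrightarrow> near (rr x) Y r \<Longrightarrow> pos (V k Y)"
    using V(2)[of k] k real_rr[OF x(1)] unfolding opn_def qv_0 by blast
  obtain n where n: "ip n < qv r / 2" using ip_small[of "qv r / 2"] r(1) by auto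
  \<comment> \<open>Large in both respects: \<open>n\<close> makes agreement of the first
    \<open>?j\<close> digits close enough for the ball, and \<open>k\<close> makes
    \<open>rr (F (\<mu> ?j))\<close> a point outside \<open>V k\<close>.\<close>
  let ?j = "n + k"
  have xcl: "cl (x i) = x i" for i using x(4)[of i "i + 1"] less_add_one[of i] by (metis cl_le cl_id)
  have "rr x ?j = rr (F (\<mu> ?j)) ?j"
    by (rule rr_agree[OF x(1) rl_n[OF F(1)]]) (simp add: xcl x(4))
  moreover have "ip ?j \<le> ip n" by (rule ip_mono) simp
  ultimately have "near (rr x) (rr (F (\<mu> ?j))) r"
    using n by (intro close_near[where m = ?j] conjunct2[OF real_rr] x(1) rl_n[OF F(1)]) simp_all
  then have "pos (V k (rr (F (\<mu> ?j))))" using r(2) real_rr[OF rl_n[OF F(1)]] by blast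
  moreover have "k \<le> \<mu> ?j" using x(3)[of ?j] by (meson order_trans le_add2 add_increasing zero_least order_refl)
  ultimately show False using npos by blast
qed

theorem WKLh_HBCh: "WKLh \<Longrightarrow> HBCh"
  unfolding HBCh_def
proof (intro allI impI, elim conjE)
  fix Dc U
  assume WKL: WKLh and rls: "rl (rfun r1 r1) Dc" "rl (rfun r0 (rfun r1 r1)) U" and op: "opn Dc" "\<forall>n. opn (U n)"
    and unit: "\<forall>X. real X \<longrightarrow> \<not> pos (Dc X) \<longrightarrow> \<not> ltr X zr \<and> \<not> ltr on X"
    and cov: "\<forall>X. real X \<longrightarrow> \<not> pos (Dc X) \<longrightarrow> (\<exists>n. pos (U n X))"
  \<comment> \<open>The open complement of the closed set is put in front of the cover. The result
    covers every expansion, and a point of the closed set can only be covered by a later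
    member.\<close>
  define V where "V n X m = (if n = 0 then Dc X m else U (n - 1) X m)" for n X m
  have V0: "V 0 = Dc" and VS: "V (n + 1) = U n" for n by (simp_all add: V_def fun_eq_iff)
  have "rl (rfun r0 (rfun r1 r1)) V"
    by (rule rl_lam2, rule dfn_lam) (unfold V_def, (rule dfn_app2[OF rls(1)] dfn_app3[OF rls(2)] dfn_all)+)
  moreover have "opn (V n)" for n using num_cases[of n] op V0 VS by auto
  moreover have "\<exists>n. pos (V n (rr e))" if "rl r1 e" for e
    using cov real_rr[OF that] V0 VS by metis
  ultimately obtain n0 where n0: "\<And>e. rl r1 e \<Longrightarrow> \<exists>n\<le>n0. pos (V n (rr e))"
    using HB_expansions[OF WKL] by blast
  have "\<exists>n. (n < n0 \<or> n = n0) \<and> pos (U n X)" if X: "real X" and nD: "\<not> pos (Dc X)" for X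
  proof -
    obtain e where e: "rl r1 e" "eqr X (rr e)" using expansion[OF X] unit X nD by blast
    \<comment> \<open>Openness includes extensionality, so membership passes from the expansion to
      the given real.\<close>
    have tr: "pos (F X)" if "pos (F (rr e))" "opn F" for F
      using that X e real_rr[OF e(1)] eqr_sym pos_eqr unfolding opn_def isrf_def by blast
    obtain n where n: "n \<le> n0" "pos (V n (rr e))" using n0 e by blast
    then have "n \<noteq> 0" using tr[of Dc] op nD V0 by auto
    then obtain m where m: "n = m + 1" using num_cases by blast
    then have "m < n0" using n(1) by (simp add: Suc_le_mnat)
    moreover have "pos (U m X)" using tr n op m VS by auto
    ultimately show ?thesis by blast
  qed
  then show "\<exists>n0. \<forall>X. real X \<longrightarrow> \<not> pos (Dc X) \<longrightarrow> (\<exists>n. (n < n0 \<or> n = n0) \<and> pos (U n X))" by blast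
qed

end

section \<open>Transport to a fixed type and conclusion\<close>

text \<open>A type class can only be instantiated at a type, so the numbers of a countable countermodel, if
  there is one, are made into a type by copying its operations to \<open>nat\<close>.\<close>

locale mnat_ops =
  fixes z o1 :: 'a and p m d :: "'a \<Rightarrow> 'a \<Rightarrow> 'a" and l :: "'a \<Rightarrow> 'a \<Rightarrow> bool"
  assumes p_assoc: "p (p a b) c = p a (p b c)" and p_comm: "p a b = p b a" and p_z: "p z a = a"
    and m_assoc: "m (m a b) c = m a (m b c)" and m_comm: "m a b = m b a" and m_o: "m o1 a = a"
    and m_z: "m z a = z" and m_distrib: "m a (p b c) = p (m a b) (m a c)" and z_o: "z \<noteq> o1"
    and d_p: "d (p a b) a = b" and d_d: "d (d a b) c = d a (p b c)" and d_z: "d z a = z"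
    and d_inverse: "\<not> l a b \<Longrightarrow> p b (d a b) = a"
    and l_irrefl: "\<not> l a a" and l_trans: "l a b \<Longrightarrow> l b c \<Longrightarrow> l a c" and l_linear: "l a b \<or> a = b \<or> l b a"
    and l_p: "l a b \<Longrightarrow> l (p c a) (p c b)" and l_m: "l a b \<Longrightarrow> l z c \<Longrightarrow> l (m c a) (m c b)"
    and l_z: "\<not> l a z" and l_Suc: "l a (p b o1) \<longleftrightarrow> l a b \<or> a = b"
begin

lemma d_le: "l a b \<or> a = b \<Longrightarrow> d a b = z"
  by (metis d_p d_d d_z d_inverse l_irrefl l_trans p_comm p_z)

lemma m_d: "m a (d b c) = d (m a b) (m a c)"
proof (cases "l b c")
  case True
  then have "l (m a b) (m a c) \<or> m a b = m a c" by (metis l_m l_z l_linear m_z)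
  then show ?thesis using True by (metis d_le m_comm m_z)
next
  case False
  then show ?thesis by (metis d_inverse d_p m_distrib)
qed

lemma m_eq_z: "a \<noteq> z \<Longrightarrow> b \<noteq> z \<Longrightarrow> m a b \<noteq> z"
  by (metis l_linear l_m l_z m_comm m_z)

end

type_synonym 'a ops = "'a \<times> 'a \<times> ('a \<Rightarrow> 'a \<Rightarrow> 'a) \<times> ('a \<Rightarrow> 'a \<Rightarrow> 'a) \<times> ('a \<Rightarrow> 'a \<Rightarrow> 'a) \<times> ('a \<Rightarrow> 'a \<Rightarrow> bool)"

fun mnat_tuple :: "'a ops \<Rightarrow> bool" where
  "mnat_tuple (z, o1, p, m, d, l) = mnat_ops z o1 p m d l"

fun countermodel :: "fm \<Rightarrow> nat ops \<Rightarrow> bool" where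
  "countermodel A (z, o1, p, m, d, l) \<longleftrightarrow> (\<exists>(D :: ty \<Rightarrow> trm set) ap I ls \<rho> num.
     is_model T0 D ap I ls \<and> val_ok D \<rho> \<and> \<not> sat D ap I (=) ls \<rho> [] A \<and> bij_betw num (D Num) UNIV \<and>
     num (I CZero) = z \<and> (\<forall>a\<in>D Num. num (ap (I CSucc) a) = p (num a) o1) \<and>
     (\<forall>a\<in>D Num. \<forall>b\<in>D Num. num (ap (ap (I CPlus) a) b) = p (num a) (num b)) \<and>
     (\<forall>a\<in>D Num. \<forall>b\<in>D Num. num (ap (ap (I CTimes) a) b) = m (num a) (num b)) \<and>
     (\<forall>a\<in>D Num. \<forall>b\<in>D Num. ls a b \<longleftrightarrow> l (num a) (num b)))"

text \<open>A type cannot depend on a countermodel assumed inside a proof. The choice therefore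
  prefers operations that come from a countermodel and otherwise takes any lawful ones;
  \<open>mnat_ops_nat\<close> shows that there are some.\<close>

definition cm_ops :: "nat ops" where
  "cm_ops = (SOME t. mnat_tuple t \<and>
     ((\<exists>t'. mnat_tuple t' \<and> countermodel (WKL \<^bold>\<longleftrightarrow> HBC_s) t') \<longrightarrow> countermodel (WKL \<^bold>\<longleftrightarrow> HBC_s) t))"

lemma mnat_ops_nat: "mnat_ops 0 (1::nat) (+) (*) (-) (<)"
  by unfold_locales (auto simp: algebra_simps)

lemma cm_ops: "mnat_tuple cm_ops"
    "(\<exists>t'. mnat_tuple t' \<and> countermodel (WKL \<^bold>\<longleftrightarrow> HBC_s) t') \<Longrightarrow> countermodel (WKL \<^bold>\<longleftrightarrow> HBC_s) cm_ops"
proof -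
  have "\<exists>t. mnat_tuple t \<and>
     ((\<exists>t'. mnat_tuple t' \<and> countermodel (WKL \<^bold>\<longleftrightarrow> HBC_s) t') \<longrightarrow> countermodel (WKL \<^bold>\<longleftrightarrow> HBC_s) t)"
    using mnat_ops_nat mnat_tuple.simps by metis
  from someI_ex[OF this] show "mnat_tuple cm_ops"
    "(\<exists>t'. mnat_tuple t' \<and> countermodel (WKL \<^bold>\<longleftrightarrow> HBC_s) t') \<Longrightarrow> countermodel (WKL \<^bold>\<longleftrightarrow> HBC_s) cm_ops"
    unfolding cm_ops_def by blast+
qed

definition "cm_z = fst cm_ops"
definition "cm_o = fst (snd cm_ops)"
definition "cm_p = fst (snd (snd cm_ops))"
definition "cm_m = fst (snd (snd (snd cm_ops)))"
definition "cm_d = fst (snd (snd (snd (snd cm_ops))))"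
definition "cm_l = snd (snd (snd (snd (snd cm_ops))))"

lemma cm_ops_eq: "cm_ops = (cm_z, cm_o, cm_p, cm_m, cm_d, cm_l)"
  by (simp add: cm_z_def cm_o_def cm_p_def cm_m_def cm_d_def cm_l_def)

interpretation cm: mnat_ops cm_z cm_o cm_p cm_m cm_d cm_l
  using cm_ops(1) unfolding cm_ops_eq by simp

text \<open>A fresh copy of \<open>nat\<close>, since the operations of \<open>nat\<close> itself
  are not those of the model.\<close>

typedef cnum = "UNIV :: nat set" ..

setup_lifting type_definition_cnum

instantiation cnum :: mnat
begin

lift_definition zero_cnum :: cnum is cm_z .
lift_definition one_cnum :: cnum is cm_o .
lift_definition plus_cnum :: "cnum \<Rightarrow> cnum \<Rightarrow> cnum" is cm_p .
lift_definition times_cnum :: "cnum \<Rightarrow> cnum \<Rightarrow> cnum" is cm_m .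
lift_definition minus_cnum :: "cnum \<Rightarrow> cnum \<Rightarrow> cnum" is cm_d .
lift_definition less_cnum :: "cnum \<Rightarrow> cnum \<Rightarrow> bool" is cm_l .
definition less_eq_cnum :: "cnum \<Rightarrow> cnum \<Rightarrow> bool" where "less_eq_cnum a b \<longleftrightarrow> a < b \<or> a = b"

lemma cnum_facts:
  fixes a b c :: cnum
  shows "a + b + c = a + (b + c)" "a + b = b + a" "0 + a = a" "a * b * c = a * (b * c)" "a * b = b * a"
    "1 * a = a" "0 * a = 0" "a * (b + c) = a * b + a * c" "(0::cnum) \<noteq> 1" "a + b - a = b" "a - b - c = a - (b + c)"
    "0 - a = 0" "\<not> a < b \<Longrightarrow> b + (a - b) = a" "\<not> a < a" "a < b \<Longrightarrow> b < c \<Longrightarrow> a < c" "a < b \<or> a = b \<or> b < a"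
    "a < b \<Longrightarrow> c + a < c + b" "a < b \<Longrightarrow> 0 < c \<Longrightarrow> c * a < c * b" "\<not> a < 0" "a < b + 1 \<longleftrightarrow> a < b \<or> a = b"
    "a * (b - c) = a * b - a * c" "a \<noteq> 0 \<Longrightarrow> b \<noteq> 0 \<Longrightarrow> a * b \<noteq> 0"
  subgoal by transfer (rule cm.p_assoc)
  subgoal by transfer (rule cm.p_comm)
  subgoal by transfer (rule cm.p_z)
  subgoal by transfer (rule cm.m_assoc)
  subgoal by transfer (rule cm.m_comm)
  subgoal by transfer (rule cm.m_o)
  subgoal by transfer (rule cm.m_z)
  subgoal by transfer (rule cm.m_distrib)
  subgoal by transfer (rule cm.z_o)
  subgoal by transfer (rule cm.d_p)
  subgoal by transfer (rule cm.d_d)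
  subgoal by transfer (rule cm.d_z)
  subgoal by transfer (rule cm.d_inverse)
  subgoal by transfer (rule cm.l_irrefl)
  subgoal by transfer (rule cm.l_trans)
  subgoal by transfer (rule cm.l_linear)
  subgoal by transfer (rule cm.l_p)
  subgoal by transfer (rule cm.l_m)
  subgoal by transfer (rule cm.l_z)
  subgoal by transfer (rule cm.l_Suc)
  subgoal by transfer (rule cm.m_d)
  subgoal by transfer (rule cm.m_eq_z)
  done

instance
proof
  note f = cnum_facts and le = less_eq_cnum_def
  fix a b c :: cnum
  show "a + b + c = a + (b + c)" "a + b = b + a" "0 + a = a" "a * b * c = a * (b * c)" "a * b = b * a"
    "1 * a = a" "0 * a = 0" "(0::cnum) \<noteq> 1" "a + b - a = b" "a - b - c = a - (b + c)"
    "0 - a = 0" "a * (b - c) = a * b - a * c"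
    "a * (b + c) = a * b + a * c" by (rule f)+
  show "a * 0 = 0" by (simp only: f(7) f(5)[of a])
  show "(a + b) * c = a * c + b * c" by (simp only: f(8) f(5)[of _ c])
  show "a \<noteq> 0 \<Longrightarrow> b \<noteq> 0 \<Longrightarrow> a * b \<noteq> 0" by (rule f(22))
  show "a < b \<Longrightarrow> 0 < c \<Longrightarrow> c * a < c * b" by (rule f(18))
  show "a < b + 1 \<longleftrightarrow> a \<le> b" unfolding le by (rule f(20))
  show "0 \<le> a" "(0::cnum) < 1" unfolding le using f(16)[of 0 a] f(16)[of 0 1] f(9,19) by blast+
  show "a < b \<longleftrightarrow> a \<le> b \<and> \<not> b \<le> a" "a \<le> a" "a \<le> b \<Longrightarrow> b \<le> a \<Longrightarrow> a = b" "a \<le> b \<or> b \<le> a"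
    unfolding le using f(14)[of a] f(15)[of a b a] f(16)[of a b] by blast+
  show "a \<le> b \<Longrightarrow> b \<le> c \<Longrightarrow> a \<le> c" unfolding le using f(15)[of a b c] by blast
  show "a \<le> b \<Longrightarrow> c + a \<le> c + b" unfolding le using f(17)[of a b c] by blast
  assume "b \<le> a"
  then have "\<not> a < b" unfolding le using f(14)[of a] f(15)[of a b a] by blast
  from f(13)[OF this] show "a - b + b = a" by (simp only: f(2)[of "a - b"])
qed

end

context model
begin

lemma mnat_ops_N:
  fixes h :: "'u \<Rightarrow> 'a"
  assumes bij: "bij_betw h N UNIV"
  defines "u \<equiv> inv_into N h"
  shows "mnat_ops (h Z) (h (Sc Z)) (\<lambda>a b. h (ad (u a) (u b))) (\<lambda>a b. h (ml (u a) (u b)))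
    (\<lambda>a b. h (mn (u a) (u b))) (\<lambda>a b. ls (u a) (u b))"
proof -
  have u [simp]: "u x \<in> N" "h (u x) = x" for x
    using bij unfolding u_def bij_betw_def by (metis UNIV_I inv_into_into, metis UNIV_I f_inv_into_f)
  have [simp]: "u (h a) = a" if "a \<in> N" for a using that bij unfolding u_def bij_betw_def by simp
  have inj: "h a = h b \<longleftrightarrow> a = b" if "a \<in> N" "b \<in> N" for a b
    using that bij unfolding bij_betw_def inj_on_def by blast
  have eq: "a = b \<longleftrightarrow> u a = u b" for a b by (metis u(2))
  show ?thesis
  proof (unfold_locales, simp_all add: inj ad_assoc ad_Zl ml_assoc ml_Zl ml_distrib mn_mn mn_Zl ls_irrefl)
    fix a b c
    show "ad (u a) (u b) = ad (u b) (u a)" "ml (u a) (u b) = ml (u b) (u a)" by (simp_all add: ad_comm ml_comm)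
    show "h (ml (Sc Z) (u a)) = a" by (simp add: ml_Scl ml_Zl ad_Zl)
    show "Z \<noteq> Sc Z" by (metis Sc_neq_Z N_closed(1))
    show "h (mn (ad (u a) (u b)) (u a)) = b" by (simp add: ad_comm[of "u a"] mn_ad)
    show "h (ad (u b) (mn (u a) (u b))) = a" if "\<not> ls (u a) (u b)"
      using that mn_inverse[of "u b" "u a"] ls_linear[of "u a" "u b"] u by metis
    show "ls (u a) (u c)" if "ls (u a) (u b)" "ls (u b) (u c)" using that ls_trans u(1) by blast
    show "ls (u a) (u b) \<or> a = b \<or> ls (u b) (u a)" using ls_linear[of "u a" "u b"] by (simp add: eq[of a b])
    show "ls (ad (u c) (u a)) (ad (u c) (u b))" if "ls (u a) (u b)"
      using that ls_ad[of "u a" "u b" "u c"] by (simp add: ad_comm[of "u c"])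
    show "\<not> ls (u a) Z" by (simp add: ls_Z)
    show "ls (u a) (ad (u b) (Sc Z)) \<longleftrightarrow> ls (u a) (u b) \<or> a = b" by (simp add: ls_Sc ad_Sc ad_Z eq[of a b])
    show "ls (ml (u c) (u a)) (ml (u c) (u b))" if "ls (u a) (u b)" "ls Z (u c)"
    proof -
      have "u c = Sc (pr (u c))" using N_cases[of "u c"] that(2) ls_irrefl[of Z] by auto
      then show ?thesis using that(1) ls_ml[of "u a" "u b" "pr (u c)"] ml_comm[of "u c"] by (metis pr_dom u(1))
    qed
  qed
qed

text \<open>The successor is injective and misses \<open>Z\<close>. Infinity is what makes a
  countable domain of numbers biject with \<open>nat\<close>.\<close>

lemma infinite_N: "infinite N"
proof
  assume fin: "finite N"
  have "inj_on Sc N" using Sc_inj by (simp add: inj_on_def)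
  moreover have "Sc ` N \<subseteq> N - {Z}" using Sc_neq_Z by auto
  ultimately have "card N \<le> card (N - {Z})" using card_inj_on_le fin by blast
  then show False using fin N_closed(1) by (metis card_Diff1_less not_le)
qed

end

theorem theorem3p16:
  shows "RCA0_omega \<union> QF_AC Num ty1 \<^bold>\<turnstile> WKL \<^bold>\<longleftrightarrow> HBC_s"
proof (rule ccontr)
  let ?A = "WKL \<^bold>\<longleftrightarrow> HBC_s"
  assume "\<not> ?thesis"
  moreover have "extensionality_axioms \<subseteq> T0" by (auto simp: RCA0_omega_def)
  moreover have "wff [] ?A" using wff_WKL wff_HBC by simp
  ultimately obtain D :: "ty \<Rightarrow> trm set" and ap I ls \<rho>
    where M: "is_model T0 D ap I ls" and \<rho>: "val_ok D \<rho>" "\<not> sat D ap I (=) ls \<rho> [] ?A"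
    using completeness[of T0 ?A] by blast
  interpret model D ap I ls by unfold_locales (rule M)
  let ?h = "to_nat_on (D Num)" and ?u = "inv_into (D Num) (to_nat_on (D Num))"
  have bij: "bij_betw ?h (D Num) UNIV" using infinite_N by (simp add: to_nat_on_infinite)
  then have u: "?u (?h a) = a" if "a \<in> D Num" for a using that by (simp add: bij_betw_def)
  let ?t = "(?h (I CZero), ?h (ap (I CSucc) (I CZero)), \<lambda>a b. ?h (ad (?u a) (?u b)), \<lambda>a b. ?h (ml (?u a) (?u b)),
    \<lambda>a b. ?h (mn (?u a) (?u b)), \<lambda>a b. ls (?u a) (?u b))"
  have "mnat_tuple ?t" using mnat_ops_N[OF bij] by simp
  moreover have "countermodel ?A ?t"
    unfolding countermodel.simps
    by (rule exI[of _ D], rule exI[of _ ap], rule exI[of _ I], rule exI[of _ ls], rule exI[of _ \<rho>], rule exI[of _ ?h])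
      (use M \<rho> bij u in \<open>auto simp: ad_Sc ad_Z\<close>)
  \<comment> \<open>The model found first only shows that a countermodel exists. The argument
    continues with one whose arithmetic is that of \<open>cm_ops\<close>, and hence of
    \<open>cnum\<close>.\<close>
  ultimately have "countermodel ?A (cm_z, cm_o, cm_p, cm_m, cm_d, cm_l)" using cm_ops(2) unfolding cm_ops_eq by blast
  then obtain D' :: "ty \<Rightarrow> trm set" and ap' I' ls' \<rho>' num where M': "is_model T0 D' ap' I' ls'"
    and \<rho>': "val_ok D' \<rho>'" "\<not> sat D' ap' I' (=) ls' \<rho>' [] ?A" and num: "bij_betw num (D' Num) UNIV"
      "num (I' CZero) = cm_z" "\<forall>a\<in>D' Num. num (ap' (I' CSucc) a) = cm_p (num a) cm_o"
      "\<forall>a\<in>D' Num. \<forall>b\<in>D' Num. num (ap' (ap' (I' CPlus) a) b) = cm_p (num a) (num b)"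
      "\<forall>a\<in>D' Num. \<forall>b\<in>D' Num. num (ap' (ap' (I' CTimes) a) b) = cm_m (num a) (num b)"
      "\<forall>a\<in>D' Num. \<forall>b\<in>D' Num. ls' a b \<longleftrightarrow> cm_l (num a) (num b)" by auto
  interpret C: model D' ap' I' ls' by unfold_locales (rule M')
  have "bij Abs_cnum" by (rule bijI') (auto simp: Abs_cnum_inject, metis Abs_cnum_cases)
  then have "bij_betw (Abs_cnum \<circ> num) (D' Num) UNIV" using num(1) bij_betw_trans by blast
  then interpret C: nmodel D' ap' I' ls' "Abs_cnum \<circ> num"
    by unfold_locales (use num in \<open>simp_all add: zero_cnum_def one_cnum_def plus_cnum_def times_cnum_def less_cnum_def Abs_cnum_inverse\<close>)
  show False using \<rho>' C.msat_WKL C.msat_HBC C.WKLh_HBCh C.HBCh_WKLh by auto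
qed

end
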